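(* Consider SWFPP with i.i.d. horizontal weights of law $\mathrm{Ber}(p)\mathrm{Exp}(\alpha)$ ($0<p\le1$, $\alpha>0$) or $\mathrm{Ber}(p)$ ($0<p<1$). Then $$\mathbb{P}(\xi^*(0)>\xi^*(e_2))=\tfrac13,\qquad \mathbb{P}(\xi^*(0)=\xi^*(e_2))=\tfrac16,\qquad \mathbb{P}(\xi^*(0)<\xi^*(e_2))=\tfrac12.$$
   Context: SWFPP: directed edge-weight FPP on $\mathbb{Z}^2$, zero weights on vertical edges, i.i.d. non-negative weights on horizontal edges; $L(x,y)$ is the minimal weight sum over up-right paths. $\mathrm{Ber}(p)\mathrm{Exp}(\alpha)$ is the law of $BE$ with $B\sim\mathrm{Ber}(p)$, $E\sim\mathrm{Exp}(\alpha)$ independent. Directions $\mathscr U=\{(t,1-t):0<t<1\}$ are ordered by first coordinate ($\xi>\zeta$ iff $\xi\cdot e_1>\zeta\cdot e_1$, i.e. closer to horizontal). $B^{\xi\pm}(x,y)$ denote the north-east Busemann functions: $B^\xi(x,y)=\lim_n(L(x,v_n)-L(y,v_n))$ along $|v_n|\to\infty$, $v_n/|v_n|\to\xi$, with $B^{\xi\pm}$ their one-sided limits in $\xi$ (these exist for all $\xi$ a.s.). The critical angle at $x$ is $\xi^*(x)=\sup\{\xi\in\mathscr U:B^{\xi}(x,x+e_2)=0\}$, equivalently the asymptotic direction of the competition interface between the subtrees through $x+e_1$ and $x+e_2$ of the geodesic tree rooted at $x$. *)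

theory Defs
  imports "HOL-Probability.Probability"
begin

text \<open>Sites of Z^2 are pairs of integers. A weight configuration W assigns to each
site z the weight W z of the horizontal edge from z to z + e1; vertical edges have
weight zero.\<close>

type_synonym site = "int \<times> int"

definition e1 :: site where "e1 = (1, 0)"
definition e2 :: site where "e2 = (0, 1)"

fun path_wt :: "(site \<Rightarrow> real) \<Rightarrow> site \<Rightarrow> bool list \<Rightarrow> real" where
  "path_wt W z [] = 0"
| "path_wt W z (True # s) = W z + path_wt W (fst z + 1, snd z) s"
| "path_wt W z (False # s) = path_wt W (fst z, snd z + 1) s"

definition path_end :: "site \<Rightarrow> bool list \<Rightarrow> site" where
  "path_end z s = (fst z + int (length (filter id s)),
                   snd z + int (length (filter Not s)))"

definition L :: "(site \<Rightarrow> real) \<Rightarrow> site \<Rightarrow> site \<Rightarrow> real" where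
  "L W x y = Inf {path_wt W x s | s. path_end x s = y}"

definition dir_seq :: "real \<Rightarrow> (nat \<Rightarrow> site) \<Rightarrow> bool" where
  "dir_seq t v \<longleftrightarrow>
     filterlim (\<lambda>n. real_of_int (\<bar>fst (v n)\<bar> + \<bar>snd (v n)\<bar>)) at_top sequentially
   \<and> (\<lambda>n. real_of_int (fst (v n)) / real_of_int (\<bar>fst (v n)\<bar> + \<bar>snd (v n)\<bar>)) \<longlonglongrightarrow> t
   \<and> (\<lambda>n. real_of_int (snd (v n)) / real_of_int (\<bar>fst (v n)\<bar> + \<bar>snd (v n)\<bar>)) \<longlonglongrightarrow> 1 - t"

definition busemann_is :: "(site \<Rightarrow> real) \<Rightarrow> real \<Rightarrow> site \<Rightarrow> site \<Rightarrow> real \<Rightarrow> bool" where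
  "busemann_is W t x y b \<longleftrightarrow>
     (\<forall>v. dir_seq t v \<longrightarrow> (\<lambda>n. L W x (v n) - L W y (v n)) \<longlonglongrightarrow> b)"

text \<open>Critical angle at x, identified with the first coordinate of xi*(x).\<close>
definition crit_angle :: "(site \<Rightarrow> real) \<Rightarrow> site \<Rightarrow> real" where
  "crit_angle W x = Sup {t. 0 < t \<and> t < 1 \<and> busemann_is W t x (x + e2) 0}"

definition ber_exp_law :: "real \<Rightarrow> real \<Rightarrow> real measure" where
  "ber_exp_law p \<alpha> =
     distr (measure_pmf (bernoulli_pmf p) \<Otimes>\<^sub>M density lborel (\<lambda>x. ennreal (exponential_density \<alpha> x)))
           borel (\<lambda>(b, e). (if b then 1 else 0) * e)"

definition ber_law :: "real \<Rightarrow> real measure" where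
  "ber_law p = distr (measure_pmf (bernoulli_pmf p)) borel (\<lambda>b. if b then 1 else 0)"

end

theory Submission
  imports Defs
begin

text \<open>
  Increments of \<open>L\<close> across horizontal and vertical edges obey the queueing recursion
  \<open>U' = min (U + V) W\<close>, \<open>V' = max 0 (U + V - W)\<close>. For both weight laws there is a one-parameter
  family of product measures which it leaves invariant; the parameter \<open>a\<close> in \<open>(0, 1)\<close> is the
  probability that a vertical increment is positive. For \<open>a < b\<close> the two stationary fields can be
  built on the same weights by feeding the \<open>b\<close>-field into a further queue, and this multi-type queue
  gives the joint law of the events \<open>V\<^sup>a > 0\<close> and \<open>V\<^sup>b = 0\<close> at two neighbouring sites:
  probability \<open>a (1 - b)\<close> if the \<open>a\<close>-increment sits at the lower site, \<open>a (1 - b) (1 + b - a)\<close> if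
  it sits at the upper one.

  Chebyshev's inequality along the squares sandwiches the increments of \<open>L\<close> towards the slope \<open>c a\<close>
  between stationary increments with parameters slightly below and above \<open>a\<close>. Hence almost surely
  each of the two sites has a threshold \<open>\<theta>\<close> such that its increments towards slope \<open>c a\<close> vanish for
  \<open>a < \<theta>\<close> and stay positive for \<open>a > \<theta>\<close>, and its critical angle is \<open>c \<theta> / (1 + c \<theta>)\<close>. A strict
  inequality between the two thresholds is an increasing union, over dyadic grids, of events whose
  probabilities telescope by the two-site law; the limits are \<open>1/2\<close> and \<open>1/3\<close>.\<close>

section \<open>Independent families and local updates\<close>

text \<open>Existence of Busemann limits is neither assumed nor proved: \<open>crit_angle\<close>
  only asks where the limit is zero, and this is settled by increments that vanish eventually or
  stay above some \<delta> > 0. Exit-point estimates for geodesics are replaced by comparing two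
  stationary heights with different parameters, each a difference of two sums of independent
  variables with known means. A variance bound leaves errors of order \<open>1 / h\<close> at height
  \<open>h\<close>, which do not sum over \<open>h\<close>; at heights \<open>k\<^sup>2\<close> they
  do, and monotonicity of increments in the endpoint covers the heights in between. Independence is
  only used for finite families, so each event is moved into a finite array that contains it. The
  two limits are integrals over (0, 1): differentiating the two-site probabilities in
  \<open>a\<close> and putting \<open>b = a\<close> gives \<open>1 - t\<close> and
  \<open>(1 - t)^2\<close>. The two-site law is available only for \<open>a < b\<close>, hence it
  sees strict inequalities; equality of the angles receives the remaining
  \<open>1 - 1 / 2 - 1 / 3\<close>. The events on critical angles are not shown to be measurable, so
  their probabilities are taken in the completion.\<close>

definition prodlaw :: "'a measure \<Rightarrow> 'i set \<Rightarrow> ('i \<Rightarrow> 'a \<Rightarrow> real) \<Rightarrow> ('i \<Rightarrow> real measure) \<Rightarrow> bool" where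
  "prodlaw P I X \<mu> \<longleftrightarrow> prob_space P \<and> finite I \<and> (\<forall>i. prob_space (\<mu> i) \<and> sets (\<mu> i) = sets borel) \<and>
     (\<forall>i\<in>I. X i \<in> borel_measurable P) \<and>
     distr P (PiM I (\<lambda>_. borel)) (\<lambda>\<omega>. \<lambda>i\<in>I. X i \<omega>) = PiM I \<mu>"

lemma sets_PiM_borel:
  assumes "\<And>i. sets (\<mu> i) = sets (borel :: real measure)"
  shows "sets (PiM I \<mu>) = sets (PiM I (\<lambda>_. borel :: real measure))"
  using assms by (intro sets_PiM_cong) auto

lemma prodlaw_measurable_PiM:
  assumes "prodlaw P I X \<mu>"
  shows "(\<lambda>\<omega>. \<lambda>i\<in>I. X i \<omega>) \<in> measurable P (PiM I (\<lambda>_. borel))"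
  using assms by (intro measurable_restrict) (auto simp: prodlaw_def)

lemma prodlaw_nn_integral:
  assumes X: "prodlaw P I X \<mu>" and h: "h \<in> borel_measurable (PiM I (\<lambda>_. borel :: real measure))"
  shows "(\<integral>\<^sup>+\<omega>. h (\<lambda>i\<in>I. X i \<omega>) \<partial>P) = (\<integral>\<^sup>+f. h f \<partial>PiM I \<mu>)"
proof -
  have "(\<integral>\<^sup>+f. h f \<partial>PiM I \<mu>) = (\<integral>\<^sup>+f. h f \<partial>distr P (PiM I (\<lambda>_. borel)) (\<lambda>\<omega>. \<lambda>i\<in>I. X i \<omega>))"
    using X by (simp add: prodlaw_def)
  also have "\<dots> = (\<integral>\<^sup>+\<omega>. h (\<lambda>i\<in>I. X i \<omega>) \<partial>P)"
    by (rule nn_integral_distr[OF prodlaw_measurable_PiM[OF X]]) (use h in simp)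
  finally show ?thesis by simp
qed

text \<open>Local updates are computed as iterated integrals, so the joint law is tested against
  nonnegative functions of the whole tuple; indicators then give equality of measures.\<close>

lemma prodlawI_nn_integral:
  assumes P: "prob_space P" "finite I" "\<And>i. prob_space (\<mu> i)" "\<And>i. sets (\<mu> i) = sets borel"
    and X: "\<And>i. i \<in> I \<Longrightarrow> X i \<in> borel_measurable P"
    and eq: "\<And>h :: _ \<Rightarrow> ennreal. h \<in> borel_measurable (PiM I (\<lambda>_. borel :: real measure)) \<Longrightarrow>
       (\<integral>\<^sup>+\<omega>. h (\<lambda>i\<in>I. X i \<omega>) \<partial>P) = (\<integral>\<^sup>+f. h f \<partial>PiM I \<mu>)"
  shows "prodlaw P I X \<mu>"
proof -
  have meas: "(\<lambda>\<omega>. \<lambda>i\<in>I. X i \<omega>) \<in> measurable P (PiM I (\<lambda>_. borel))"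
    using X by (intro measurable_restrict) auto
  have "distr P (PiM I (\<lambda>_. borel)) (\<lambda>\<omega>. \<lambda>i\<in>I. X i \<omega>) = PiM I \<mu>"
  proof (rule measure_eqI)
    show s: "sets (distr P (PiM I (\<lambda>_. borel)) (\<lambda>\<omega>. \<lambda>i\<in>I. X i \<omega>)) = sets (PiM I \<mu>)"
      using sets_PiM_borel[of \<mu> I] P by simp
    fix A assume A: "A \<in> sets (distr P (PiM I (\<lambda>_. borel)) (\<lambda>\<omega>. \<lambda>i\<in>I. X i \<omega>))"
    then have A': "A \<in> sets (PiM I (\<lambda>_. borel))" and A'': "A \<in> sets (PiM I \<mu>)" using s by auto
    have ind: "indicator A \<in> borel_measurable (PiM I (\<lambda>_. borel :: real measure))" using A' by simp
    have "emeasure (distr P (PiM I (\<lambda>_. borel)) (\<lambda>\<omega>. \<lambda>i\<in>I. X i \<omega>)) A =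
       (\<integral>\<^sup>+f. indicator A f \<partial>distr P (PiM I (\<lambda>_. borel)) (\<lambda>\<omega>. \<lambda>i\<in>I. X i \<omega>))"
      using A by (rule nn_integral_indicator[symmetric])
    also have "\<dots> = (\<integral>\<^sup>+\<omega>. indicator A (\<lambda>i\<in>I. X i \<omega>) \<partial>P)"
      by (rule nn_integral_distr[OF meas]) (use ind in simp)
    also have "\<dots> = (\<integral>\<^sup>+f. indicator A f \<partial>PiM I \<mu>)" by (rule eq[OF ind])
    also have "\<dots> = emeasure (PiM I \<mu>) A" using A'' by simp
    finally show "emeasure (distr P (PiM I (\<lambda>_. borel)) (\<lambda>\<omega>. \<lambda>i\<in>I. X i \<omega>)) A = emeasure (PiM I \<mu>) A" .
  qed
  then show ?thesis using assms by (auto simp: prodlaw_def)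
qed

lemma prodlaw_cong:
  assumes "prodlaw P I X \<mu>" "\<And>i \<omega>. i \<in> I \<Longrightarrow> X i \<omega> = Y i \<omega>" "\<And>i. i \<in> I \<Longrightarrow> \<mu> i = \<nu> i"
    "\<And>i. prob_space (\<nu> i)" "\<And>i. sets (\<nu> i) = sets borel"
  shows "prodlaw P I Y \<nu>"
proof -
  have 1: "PiM I \<mu> = PiM I \<nu>" by (rule PiM_cong) (use assms in auto)
  have 2: "(\<lambda>\<omega>. \<lambda>i\<in>I. X i \<omega>) = (\<lambda>\<omega>. \<lambda>i\<in>I. Y i \<omega>)"
    using assms(2) by (auto simp: fun_eq_iff restrict_def)
  have 3: "X i = Y i" if "i \<in> I" for i using assms(2)[OF that] by auto
  show ?thesis using assms 1 2 3 unfolding prodlaw_def by (metis (no_types, lifting))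
qed

text \<open>Covers both dropping variables and renaming them, as needed when an array is shifted by
  a row or a column. Injectivity of \<open>g\<close> prevents one variable from being listed
  twice.\<close>

lemma prodlaw_reindex:
  assumes X: "prodlaw P I X \<mu>" and g: "inj_on g J" "g ` J \<subseteq> I"
  shows "prodlaw P J (\<lambda>j. X (g j)) (\<lambda>j. \<mu> (g j))"
proof -
  interpret product_prob_space \<mu> using X by (auto simp: prodlaw_def product_prob_space_def product_prob_space_axioms_def product_sigma_finite_def intro: prob_space_imp_sigma_finite)
  have fin: "finite J" using X g by (metis finite_imageD finite_subset prodlaw_def)
  have fI: "finite I" using X by (auto simp: prodlaw_def)
  have meas[measurable]: "(\<lambda>f. \<lambda>j\<in>J. f (g j)) \<in> measurable (PiM I (\<lambda>_. borel :: real measure)) (PiM J (\<lambda>_. borel))"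
    using g by (intro measurable_restrict measurable_component_singleton) auto
  have s1: "sets (PiM J (\<lambda>j. \<mu> (g j))) = sets (PiM J (\<lambda>_. borel :: real measure))"
    using X by (intro sets_PiM_borel) (auto simp: prodlaw_def)
  have "distr P (PiM J (\<lambda>_. borel)) (\<lambda>\<omega>. \<lambda>j\<in>J. X (g j) \<omega>) =
     distr (distr P (PiM I (\<lambda>_. borel)) (\<lambda>\<omega>. \<lambda>i\<in>I. X i \<omega>)) (PiM J (\<lambda>_. borel)) (\<lambda>f. \<lambda>j\<in>J. f (g j))"
    by (subst distr_distr[OF meas prodlaw_measurable_PiM[OF X]])
       (use g in \<open>auto intro!: distr_cong simp: fun_eq_iff restrict_def image_subset_iff\<close>)
  also have "\<dots> = distr (PiM I \<mu>) (PiM J (\<lambda>_. borel)) (\<lambda>f. \<lambda>j\<in>J. f (g j))"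
    using X by (simp add: prodlaw_def)
  also have "\<dots> = distr (PiM I \<mu>) (PiM J (\<lambda>j. \<mu> (g j))) (\<lambda>f. \<lambda>j\<in>J. f (g j))"
    by (rule distr_cong) (use s1 in auto)
  also have "\<dots> = PiM J (\<lambda>j. \<mu> (g j))"
    using g X by (intro distr_PiM_reindex) (auto simp: prodlaw_def)
  finally show ?thesis using X g fin by (auto simp: prodlaw_def)
qed

lemma prodlaw_subset:
  assumes "prodlaw P I X \<mu>" "J \<subseteq> I"
  shows "prodlaw P J X \<mu>"
  using prodlaw_reindex[OF assms(1), of id J] assms(2) by simp

lemma PiM_insert2:
  assumes \<mu>: "\<And>i. prob_space (\<mu> i)" "\<And>i. sets (\<mu> i) = sets (borel :: real measure)"
    and K: "finite K" "k1 \<noteq> k2" "k1 \<notin> K" "k2 \<notin> K"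
    and f: "f \<in> borel_measurable (PiM (insert k2 (insert k1 K)) (\<lambda>_. borel :: real measure))"
  shows "(\<integral>\<^sup>+x. f x \<partial>PiM (insert k2 (insert k1 K)) \<mu>) =
    (\<integral>\<^sup>+g. (\<integral>\<^sup>+x. (\<integral>\<^sup>+y. f (g(k1 := x, k2 := y)) \<partial>\<mu> k2) \<partial>\<mu> k1) \<partial>PiM K \<mu>)"
proof -
  interpret product_prob_space \<mu> using \<mu> by (auto simp: product_prob_space_def product_prob_space_axioms_def product_sigma_finite_def intro: prob_space_imp_sigma_finite)
  interpret s: sigma_finite_measure "\<mu> k2" using \<mu> by (auto intro: prob_space_imp_sigma_finite)
  have [measurable_cong]: "sets (\<mu> i) = sets borel" for i by (rule \<mu>)
  have f'[measurable]: "f \<in> borel_measurable (PiM (insert k2 (insert k1 K)) \<mu>)"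
    using f by (simp add: measurable_cong_sets[OF sets_PiM_borel[OF \<mu>(2)] refl])
  have "(\<integral>\<^sup>+x. f x \<partial>PiM (insert k2 (insert k1 K)) \<mu>) =
     (\<integral>\<^sup>+g. (\<integral>\<^sup>+y. f (g(k2 := y)) \<partial>\<mu> k2) \<partial>PiM (insert k1 K) \<mu>)"
    using K by (intro product_nn_integral_insert) auto
  also have "\<dots> = (\<integral>\<^sup>+g. (\<integral>\<^sup>+x. (\<integral>\<^sup>+y. f (g(k1 := x, k2 := y)) \<partial>\<mu> k2) \<partial>\<mu> k1) \<partial>PiM K \<mu>)"
    using K by (intro product_nn_integral_insert) (auto, measurable)
  finally show ?thesis .
qed

text \<open>Independent inputs become independent outputs. Iterated integrals replace product
  measures so that the property applies directly under an integral over all other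
  coordinates.\<close>

definition pair_upd :: "real measure \<Rightarrow> real measure \<Rightarrow> (real \<Rightarrow> real \<Rightarrow> real \<times> real) \<Rightarrow> real measure \<Rightarrow> real measure \<Rightarrow> bool" where
  "pair_upd M1 M2 F N1 N2 \<longleftrightarrow> case_prod F \<in> borel_measurable borel \<and>
    (\<forall>H\<in>borel_measurable borel. (\<integral>\<^sup>+x. (\<integral>\<^sup>+y. (H (F x y) :: ennreal) \<partial>M2) \<partial>M1) = (\<integral>\<^sup>+x. (\<integral>\<^sup>+y. H (x, y) \<partial>N2) \<partial>N1))"

text \<open>The remaining coordinates are frozen as parameters of the test function and the
  two-variable identity is used under the integral over them. The outputs may overwrite the indices
  of the inputs, so a family can be updated in place like a bank of registers.\<close>

lemma prodlaw_pair_upd: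
  assumes X: "prodlaw P I X \<mu>" and k: "k1 \<in> I" "k2 \<in> I" "k1 \<noteq> k2"
    and l: "l1 \<noteq> l2" "l1 \<notin> I - {k1, k2}" "l2 \<notin> I - {k1, k2}"
    and F: "pair_upd (\<mu> k1) (\<mu> k2) F N1 N2"
    and N: "prob_space N1" "prob_space N2" "sets N1 = sets borel" "sets N2 = sets borel"
  shows "prodlaw P (insert l2 (insert l1 (I - {k1, k2})))
     (X(l1 := \<lambda>\<omega>. fst (F (X k1 \<omega>) (X k2 \<omega>)), l2 := \<lambda>\<omega>. snd (F (X k1 \<omega>) (X k2 \<omega>)))) (\<mu>(l1 := N1, l2 := N2))"
    (is "prodlaw P ?I ?X ?\<mu>")
proof (rule prodlawI_nn_integral)
  let ?K = "I - {k1, k2}"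
  have I: "I = insert k2 (insert k1 ?K)" using k by auto
  have \<mu>: "\<And>i. prob_space (\<mu> i)" "\<And>i. sets (\<mu> i) = sets borel" using X by (auto simp: prodlaw_def)
  have Fm[measurable]: "case_prod F \<in> borel_measurable borel" using F by (auto simp: pair_upd_def)
  have Fm1: "(\<lambda>x. fst (F (a x) (b x))) \<in> borel_measurable M" "(\<lambda>x. snd (F (a x) (b x))) \<in> borel_measurable M"
    if [measurable]: "a \<in> borel_measurable M" "b \<in> borel_measurable M" for a b :: "_ \<Rightarrow> real" and M
  proof -
    have "(\<lambda>x. case_prod F (a x, b x)) \<in> borel_measurable M" by measurable
    then have "(\<lambda>x. F (a x) (b x)) \<in> measurable M (borel \<Otimes>\<^sub>M borel)" by (simp add: borel_prod)
    then show "(\<lambda>x. fst (F (a x) (b x))) \<in> borel_measurable M" "(\<lambda>x. snd (F (a x) (b x))) \<in> borel_measurable M"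
      by measurable
  qed
  show "prob_space P" "finite ?I" using X by (auto simp: prodlaw_def)
  show "prob_space (?\<mu> i)" "sets (?\<mu> i) = sets borel" for i using \<mu> N by auto
  have Xm: "\<And>i. i \<in> I \<Longrightarrow> X i \<in> borel_measurable P" using X by (auto simp: prodlaw_def)
  show "?X i \<in> borel_measurable P" if "i \<in> ?I" for i
    using that Xm k by (auto intro!: Fm1)
  fix h :: "('b \<Rightarrow> real) \<Rightarrow> ennreal" assume h[measurable]: "h \<in> borel_measurable (PiM ?I (\<lambda>_. borel :: real measure))"
  define g where "g f = (\<lambda>i\<in>?I. (f(l1 := fst (F (f k1) (f k2)), l2 := snd (F (f k1) (f k2)))) i)" for f :: "'b \<Rightarrow> real"
  have gm[measurable]: "g \<in> measurable (PiM I (\<lambda>_. borel)) (PiM ?I (\<lambda>_. borel))"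
    unfolding g_def
  proof (intro measurable_restrict)
    fix i assume i: "i \<in> ?I"
    have 1[measurable]: "(\<lambda>f. f k1) \<in> borel_measurable (PiM I (\<lambda>_. borel :: real measure))"
       "(\<lambda>f. f k2) \<in> borel_measurable (PiM I (\<lambda>_. borel :: real measure))"
      using k by (auto intro: measurable_component_singleton)
    have 2: "i \<noteq> l1 \<Longrightarrow> i \<noteq> l2 \<Longrightarrow> (\<lambda>f. f i) \<in> borel_measurable (PiM I (\<lambda>_. borel :: real measure))"
      using i by (auto intro: measurable_component_singleton)
    show "(\<lambda>f. (f(l1 := fst (F (f k1) (f k2)), l2 := snd (F (f k1) (f k2)))) i) \<in> borel_measurable (PiM I (\<lambda>_. borel))"
      using 2 Fm1[OF 1] by (cases "i = l2"; cases "i = l1") auto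
  qed
  have "(\<integral>\<^sup>+\<omega>. h (\<lambda>i\<in>?I. ?X i \<omega>) \<partial>P) = (\<integral>\<^sup>+\<omega>. h (g (\<lambda>i\<in>I. X i \<omega>)) \<partial>P)"
    using k l by (intro nn_integral_cong arg_cong[where f=h]) (auto simp: g_def fun_eq_iff)
  also have "\<dots> = (\<integral>\<^sup>+f. h (g f) \<partial>PiM I \<mu>)"
    by (rule prodlaw_nn_integral[OF X]) measurable
  also have "\<dots> = (\<integral>\<^sup>+u. (\<integral>\<^sup>+x. (\<integral>\<^sup>+y. h (g (u(k1 := x, k2 := y))) \<partial>\<mu> k2) \<partial>\<mu> k1) \<partial>PiM ?K \<mu>)"
    by (subst I, rule PiM_insert2[OF \<mu>])
      (use X k in \<open>auto simp: prodlaw_def I[symmetric]\<close>)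
  also have "\<dots> = (\<integral>\<^sup>+u. (\<integral>\<^sup>+x. (\<integral>\<^sup>+y. h (u(l1 := x, l2 := y)) \<partial>N2) \<partial>N1) \<partial>PiM ?K \<mu>)"
  proof (rule nn_integral_cong)
    fix u assume u: "u \<in> space (PiM ?K \<mu>)"
    \<comment> \<open>Points of a product space are \<open>undefined\<close> off the index set; this
      makes both sides of \<open>*\<close> agree at an input index that is not reused for an
      output.\<close>
    have ue: "i \<notin> ?K \<Longrightarrow> u i = undefined" for i using u by (auto simp: space_PiM PiE_def extensional_def)
    define H where "H z = h (u(l1 := fst z, l2 := snd z))" for z :: "real \<times> real"
    have "(\<lambda>z. u(l1 := fst z, l2 := snd z)) \<in> measurable (borel \<Otimes>\<^sub>M borel) (PiM ?I (\<lambda>_. borel :: real measure))"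
    proof (rule measurable_PiM_single')
      show "(\<lambda>z. (u(l1 := fst z, l2 := snd z)) i) \<in> borel_measurable (borel \<Otimes>\<^sub>M borel)" for i
        by (cases "i = l2"; cases "i = l1") auto
    qed (use ue in \<open>auto simp: space_PiM PiE_def extensional_def space_pair_measure\<close>)
    then have "H \<in> borel_measurable (borel \<Otimes>\<^sub>M borel)" unfolding H_def by measurable
    then have Hm: "H \<in> borel_measurable borel" by (simp add: borel_prod)
    have *: "g (u(k1 := x, k2 := y)) = u(l1 := fst (F x y), l2 := snd (F x y))" for x y
      using k l ue by (auto simp: g_def fun_eq_iff)
    have "(\<integral>\<^sup>+x. (\<integral>\<^sup>+y. h (g (u(k1 := x, k2 := y))) \<partial>\<mu> k2) \<partial>\<mu> k1) = (\<integral>\<^sup>+x. (\<integral>\<^sup>+y. H (F x y) \<partial>\<mu> k2) \<partial>\<mu> k1)"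
      unfolding * H_def ..
    also have "\<dots> = (\<integral>\<^sup>+x. (\<integral>\<^sup>+y. H (x, y) \<partial>N2) \<partial>N1)" using F Hm by (auto simp: pair_upd_def)
    finally show "(\<integral>\<^sup>+x. (\<integral>\<^sup>+y. h (g (u(k1 := x, k2 := y))) \<partial>\<mu> k2) \<partial>\<mu> k1) = (\<integral>\<^sup>+x. (\<integral>\<^sup>+y. h (u(l1 := x, l2 := y)) \<partial>N2) \<partial>N1)"
      by (simp add: H_def)
  qed
  also have "\<dots> = (\<integral>\<^sup>+u. (\<integral>\<^sup>+x. (\<integral>\<^sup>+y. h (u(l1 := x, l2 := y)) \<partial>N2) \<partial>N1) \<partial>PiM ?K ?\<mu>)"
    by (rule arg_cong[where f="\<lambda>M. integral\<^sup>N M _"], rule PiM_cong) (use l in auto)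
  also have "\<dots> = (\<integral>\<^sup>+f. h f \<partial>PiM ?I ?\<mu>)"
    by (subst PiM_insert2) (use \<mu> N X l in \<open>auto simp: prodlaw_def\<close>)
  finally show "(\<integral>\<^sup>+\<omega>. h (\<lambda>i\<in>?I. ?X i \<omega>) \<partial>P) = (\<integral>\<^sup>+f. h f \<partial>PiM ?I ?\<mu>)" .
qed

text \<open>Four inputs for two outputs: two of them are noise that is consumed, because inverting a
  queue requires randomising the part of the service that its output does not reveal.\<close>

definition quad_upd :: "real measure \<Rightarrow> real measure \<Rightarrow> real measure \<Rightarrow> real measure \<Rightarrow>
    (real \<Rightarrow> real \<Rightarrow> real \<Rightarrow> real \<Rightarrow> real \<times> real) \<Rightarrow> real measure \<Rightarrow> real measure \<Rightarrow> bool" where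
  "quad_upd M1 M2 M3 M4 F N1 N2 \<longleftrightarrow> (\<lambda>(x, y, z, w). F x y z w) \<in> borel_measurable borel \<and>
    (\<forall>H\<in>borel_measurable borel. (\<integral>\<^sup>+x. (\<integral>\<^sup>+y. (\<integral>\<^sup>+z. (\<integral>\<^sup>+w. (H (F x y z w) :: ennreal) \<partial>M4) \<partial>M3) \<partial>M2) \<partial>M1) =
       (\<integral>\<^sup>+x. (\<integral>\<^sup>+y. H (x, y) \<partial>N2) \<partial>N1))"

lemma PiM_insert4:
  assumes \<mu>: "\<And>i. prob_space (\<mu> i)" "\<And>i. sets (\<mu> i) = sets (borel :: real measure)"
    and K: "finite K" "distinct [k1, k2, k3, k4]" "set [k1, k2, k3, k4] \<inter> K = {}"
    and f: "f \<in> borel_measurable (PiM (insert k4 (insert k3 (insert k2 (insert k1 K)))) (\<lambda>_. borel :: real measure))"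
  shows "(\<integral>\<^sup>+x. f x \<partial>PiM (insert k4 (insert k3 (insert k2 (insert k1 K)))) \<mu>) =
    (\<integral>\<^sup>+g. (\<integral>\<^sup>+x. (\<integral>\<^sup>+y. (\<integral>\<^sup>+z. (\<integral>\<^sup>+w. f (g(k1 := x, k2 := y, k3 := z, k4 := w)) \<partial>\<mu> k4) \<partial>\<mu> k3) \<partial>\<mu> k2) \<partial>\<mu> k1) \<partial>PiM K \<mu>)"
proof -
  interpret s3: sigma_finite_measure "\<mu> k3" using \<mu> by (auto intro: prob_space_imp_sigma_finite)
  interpret s4: sigma_finite_measure "\<mu> k4" using \<mu> by (auto intro: prob_space_imp_sigma_finite)
  have [measurable_cong]: "sets (\<mu> i) = sets borel" for i by (rule \<mu>)
  note f[measurable]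
  have "(\<integral>\<^sup>+x. f x \<partial>PiM (insert k4 (insert k3 (insert k2 (insert k1 K)))) \<mu>) =
    (\<integral>\<^sup>+g. (\<integral>\<^sup>+z. (\<integral>\<^sup>+w. f (g(k3 := z, k4 := w)) \<partial>\<mu> k4) \<partial>\<mu> k3) \<partial>PiM (insert k2 (insert k1 K)) \<mu>)"
    using K f by (intro PiM_insert2 \<mu>) auto
  also have "\<dots> = (\<integral>\<^sup>+g. (\<integral>\<^sup>+x. (\<integral>\<^sup>+y. (\<integral>\<^sup>+z. (\<integral>\<^sup>+w. f (g(k1 := x, k2 := y, k3 := z, k4 := w)) \<partial>\<mu> k4) \<partial>\<mu> k3) \<partial>\<mu> k2) \<partial>\<mu> k1) \<partial>PiM K \<mu>)"
    using K by (intro PiM_insert2 \<mu>) (auto, measurable)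
  finally show ?thesis .
qed

lemma prodlaw_quad_upd:
  assumes X: "prodlaw P I X \<mu>" and k: "set [k1, k2, k3, k4] \<subseteq> I" "distinct [k1, k2, k3, k4]"
    and l: "l1 \<noteq> l2" "l1 \<notin> I - {k1, k2, k3, k4}" "l2 \<notin> I - {k1, k2, k3, k4}"
    and F: "quad_upd (\<mu> k1) (\<mu> k2) (\<mu> k3) (\<mu> k4) F N1 N2"
    and N: "prob_space N1" "prob_space N2" "sets N1 = sets borel" "sets N2 = sets borel"
  shows "prodlaw P (insert l2 (insert l1 (I - {k1, k2, k3, k4})))
     (X(l1 := \<lambda>\<omega>. fst (F (X k1 \<omega>) (X k2 \<omega>) (X k3 \<omega>) (X k4 \<omega>)),
        l2 := \<lambda>\<omega>. snd (F (X k1 \<omega>) (X k2 \<omega>) (X k3 \<omega>) (X k4 \<omega>)))) (\<mu>(l1 := N1, l2 := N2))"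
    (is "prodlaw P ?I ?X ?\<mu>")
proof (rule prodlawI_nn_integral)
  let ?K = "I - {k1, k2, k3, k4}"
  have I: "I = insert k4 (insert k3 (insert k2 (insert k1 ?K)))" using k by auto
  have \<mu>: "\<And>i. prob_space (\<mu> i)" "\<And>i. sets (\<mu> i) = sets borel" using X by (auto simp: prodlaw_def)
  have Fm[measurable]: "(\<lambda>(x, y, z, w). F x y z w) \<in> borel_measurable borel" using F by (auto simp: quad_upd_def)
  have Fm1: "(\<lambda>x. fst (F (a x) (b x) (c x) (d x))) \<in> borel_measurable M" "(\<lambda>x. snd (F (a x) (b x) (c x) (d x))) \<in> borel_measurable M"
    if [measurable]: "a \<in> borel_measurable M" "b \<in> borel_measurable M" "c \<in> borel_measurable M" "d \<in> borel_measurable M"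
    for a b c d :: "_ \<Rightarrow> real" and M
  proof -
    have "(\<lambda>x. (\<lambda>(x, y, z, w). F x y z w) (a x, b x, c x, d x)) \<in> borel_measurable M" by measurable
    then have "(\<lambda>x. F (a x) (b x) (c x) (d x)) \<in> measurable M (borel \<Otimes>\<^sub>M borel)" by (simp add: borel_prod)
    then show "(\<lambda>x. fst (F (a x) (b x) (c x) (d x))) \<in> borel_measurable M" "(\<lambda>x. snd (F (a x) (b x) (c x) (d x))) \<in> borel_measurable M"
      by measurable
  qed
  show "prob_space P" "finite ?I" using X by (auto simp: prodlaw_def)
  show "prob_space (?\<mu> i)" "sets (?\<mu> i) = sets borel" for i using \<mu> N by auto
  have Xm: "\<And>i. i \<in> I \<Longrightarrow> X i \<in> borel_measurable P" using X by (auto simp: prodlaw_def)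
  show "?X i \<in> borel_measurable P" if "i \<in> ?I" for i
    using that Xm k by (auto intro!: Fm1)
  fix h :: "('b \<Rightarrow> real) \<Rightarrow> ennreal" assume h[measurable]: "h \<in> borel_measurable (PiM ?I (\<lambda>_. borel :: real measure))"
  define g where "g f = (\<lambda>i\<in>?I. (f(l1 := fst (F (f k1) (f k2) (f k3) (f k4)), l2 := snd (F (f k1) (f k2) (f k3) (f k4)))) i)" for f :: "'b \<Rightarrow> real"
  have gm[measurable]: "g \<in> measurable (PiM I (\<lambda>_. borel)) (PiM ?I (\<lambda>_. borel))"
    unfolding g_def
  proof (intro measurable_restrict)
    fix i assume i: "i \<in> ?I"
    have 1: "(\<lambda>f. f k1) \<in> borel_measurable (PiM I (\<lambda>_. borel :: real measure))"
       "(\<lambda>f. f k2) \<in> borel_measurable (PiM I (\<lambda>_. borel :: real measure))"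
       "(\<lambda>f. f k3) \<in> borel_measurable (PiM I (\<lambda>_. borel :: real measure))"
       "(\<lambda>f. f k4) \<in> borel_measurable (PiM I (\<lambda>_. borel :: real measure))"
      using k by (auto intro: measurable_component_singleton)
    have 2: "i \<noteq> l1 \<Longrightarrow> i \<noteq> l2 \<Longrightarrow> (\<lambda>f. f i) \<in> borel_measurable (PiM I (\<lambda>_. borel :: real measure))"
      using i by (auto intro: measurable_component_singleton)
    show "(\<lambda>f. (f(l1 := fst (F (f k1) (f k2) (f k3) (f k4)), l2 := snd (F (f k1) (f k2) (f k3) (f k4)))) i) \<in> borel_measurable (PiM I (\<lambda>_. borel))"
      using 2 Fm1[OF 1] by (cases "i = l2"; cases "i = l1") auto
  qed
  have "(\<integral>\<^sup>+\<omega>. h (\<lambda>i\<in>?I. ?X i \<omega>) \<partial>P) = (\<integral>\<^sup>+\<omega>. h (g (\<lambda>i\<in>I. X i \<omega>)) \<partial>P)"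
    using k l by (intro nn_integral_cong arg_cong[where f=h]) (auto simp: g_def fun_eq_iff)
  also have "\<dots> = (\<integral>\<^sup>+f. h (g f) \<partial>PiM I \<mu>)"
    by (rule prodlaw_nn_integral[OF X]) measurable
  also have "\<dots> = (\<integral>\<^sup>+u. (\<integral>\<^sup>+x. (\<integral>\<^sup>+y. (\<integral>\<^sup>+z. (\<integral>\<^sup>+w. h (g (u(k1 := x, k2 := y, k3 := z, k4 := w))) \<partial>\<mu> k4) \<partial>\<mu> k3) \<partial>\<mu> k2) \<partial>\<mu> k1) \<partial>PiM ?K \<mu>)"
    by (subst I, rule PiM_insert4[OF \<mu>])
      (use X k in \<open>auto simp: prodlaw_def I[symmetric]\<close>)
  also have "\<dots> = (\<integral>\<^sup>+u. (\<integral>\<^sup>+x. (\<integral>\<^sup>+y. h (u(l1 := x, l2 := y)) \<partial>N2) \<partial>N1) \<partial>PiM ?K \<mu>)"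
  proof (rule nn_integral_cong)
    fix u assume u: "u \<in> space (PiM ?K \<mu>)"
    have ue: "i \<notin> ?K \<Longrightarrow> u i = undefined" for i using u by (auto simp: space_PiM PiE_def extensional_def)
    define H where "H z = h (u(l1 := fst z, l2 := snd z))" for z :: "real \<times> real"
    have "(\<lambda>z. u(l1 := fst z, l2 := snd z)) \<in> measurable (borel \<Otimes>\<^sub>M borel) (PiM ?I (\<lambda>_. borel :: real measure))"
    proof (rule measurable_PiM_single')
      show "(\<lambda>z. (u(l1 := fst z, l2 := snd z)) i) \<in> borel_measurable (borel \<Otimes>\<^sub>M borel)" for i
        by (cases "i = l2"; cases "i = l1") auto
    qed (use ue in \<open>auto simp: space_PiM PiE_def extensional_def space_pair_measure\<close>)
    then have "H \<in> borel_measurable (borel \<Otimes>\<^sub>M borel)" unfolding H_def by measurable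
    then have Hm: "H \<in> borel_measurable borel" by (simp add: borel_prod)
    have *: "g (u(k1 := x, k2 := y, k3 := z, k4 := w)) = u(l1 := fst (F x y z w), l2 := snd (F x y z w))" for x y z w
      using k l ue by (auto simp: g_def fun_eq_iff)
    show "(\<integral>\<^sup>+x. (\<integral>\<^sup>+y. (\<integral>\<^sup>+z. (\<integral>\<^sup>+w. h (g (u(k1 := x, k2 := y, k3 := z, k4 := w))) \<partial>\<mu> k4) \<partial>\<mu> k3) \<partial>\<mu> k2) \<partial>\<mu> k1) = (\<integral>\<^sup>+x. (\<integral>\<^sup>+y. h (u(l1 := x, l2 := y)) \<partial>N2) \<partial>N1)"
      using F Hm unfolding * H_def[symmetric] quad_upd_def by (force simp: H_def)
  qed
  also have "\<dots> = (\<integral>\<^sup>+u. (\<integral>\<^sup>+x. (\<integral>\<^sup>+y. h (u(l1 := x, l2 := y)) \<partial>N2) \<partial>N1) \<partial>PiM ?K ?\<mu>)"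
    by (rule arg_cong[where f="\<lambda>M. integral\<^sup>N M _"], rule PiM_cong) (use l in auto)
  also have "\<dots> = (\<integral>\<^sup>+f. h f \<partial>PiM ?I ?\<mu>)"
    by (subst PiM_insert2) (use \<mu> N X l in \<open>auto simp: prodlaw_def\<close>)
  finally show "(\<integral>\<^sup>+\<omega>. h (\<lambda>i\<in>?I. ?X i \<omega>) \<partial>P) = (\<integral>\<^sup>+f. h f \<partial>PiM ?I ?\<mu>)" .
qed

section \<open>Laws preserved by the queue\<close>

text \<open>An atom of mass \<open>1 - q\<close> at zero is added to \<open>D\<close>. The form
  copies \<open>ber_exp_law\<close>, so that the law at parameter 1 unfolds to the given weight
  law.\<close>

definition mix :: "real \<Rightarrow> real measure \<Rightarrow> real measure" where
  "mix q D = distr (measure_pmf (bernoulli_pmf q) \<Otimes>\<^sub>M D) borel (\<lambda>(b, x). (if b then 1 else 0) * x)"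

lemma mix_measurable[measurable]:
  assumes [measurable_cong]: "sets D = sets (borel :: real measure)"
  shows "(\<lambda>(b, x :: real). (if b then 1 else 0) * x) \<in> borel_measurable (measure_pmf r \<Otimes>\<^sub>M D)"
proof -
  have [measurable]: "Measurable.pred (measure_pmf r) (\<lambda>b. b)" by simp
  show ?thesis by measurable
qed

lemma sets_mix[simp, measurable_cong]: "sets (mix q D) = sets borel"
  by (simp add: mix_def)

lemma prob_space_mix[intro, simp]:
  assumes "prob_space D" "sets D = sets borel"
  shows "prob_space (mix q D)"
proof -
  interpret D: prob_space D by fact
  interpret pair_prob_space "measure_pmf (bernoulli_pmf q)" D by unfold_locales
  show ?thesis unfolding mix_def by (rule prob_space_distr) (use assms in simp)
qed

lemma nn_integral_mix:
  assumes q: "0 \<le> q" "q \<le> 1" and D: "prob_space D" "sets D = sets borel"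
    and h: "h \<in> borel_measurable borel"
  shows "(\<integral>\<^sup>+x. h x \<partial>mix q D) = ennreal (1 - q) * h 0 + ennreal q * (\<integral>\<^sup>+x. h x \<partial>D)"
proof -
  interpret D: prob_space D by fact
  note h[measurable]
  note m[measurable] = mix_measurable[OF D(2)]
  have hD[measurable]: "h \<in> borel_measurable D" using h D(2) by (simp cong: measurable_cong_sets)
  have "(\<integral>\<^sup>+x. h x \<partial>mix q D) = (\<integral>\<^sup>+z. h (case z of (b, x) \<Rightarrow> (if b then 1 else 0) * x) \<partial>(measure_pmf (bernoulli_pmf q) \<Otimes>\<^sub>M D))"
    unfolding mix_def by (subst nn_integral_distr) auto
  also have "\<dots> = (\<integral>\<^sup>+b. (\<integral>\<^sup>+x. h ((if b then 1 else 0) * x) \<partial>D) \<partial>measure_pmf (bernoulli_pmf q))"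
    by (subst D.nn_integral_fst[symmetric]) (use m in auto)
  also have "\<dots> = ennreal (1 - q) * h 0 + ennreal q * (\<integral>\<^sup>+x. h x \<partial>D)"
    using q by (simp add: nn_integral_measure_pmf_finite[of "bernoulli_pmf q", OF finite_subset[OF subset_UNIV]]
        nn_integral_bernoulli_pmf D.emeasure_space_1 mult.commute add.commute)
  finally show ?thesis .
qed

text \<open>\<open>U a\<close> and \<open>V a 1\<close> are the laws of positive horizontal and vertical increments at parameter \<open>a\<close>,
  \<open>V a b\<close> that of a positive queue length in the two-type queue, and \<open>n b\<close> is extra noise that makes the
  dual service times independent. The identity \<open>race\<close> is the memoryless property, and \<open>race'\<close> is
  its consequence for the minimum of two competing clocks and the remaining excess.\<close>
locale queue_family =
  fixes p :: real and U :: "real \<Rightarrow> real measure" and V :: "real \<Rightarrow> real \<Rightarrow> real measure" and n :: "real \<Rightarrow> real measure"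
  assumes p: "0 < p" "p \<le> 1"
    and U_prob: "0 < a \<Longrightarrow> a \<le> 1 \<Longrightarrow> prob_space (U a)"
    and V_prob: "0 < a \<Longrightarrow> a < b \<Longrightarrow> b \<le> 1 \<Longrightarrow> prob_space (V a b)"
    and n_prob: "0 < b \<Longrightarrow> b \<le> 1 \<Longrightarrow> prob_space (n b)"
    and U_sets[simp, measurable_cong]: "sets (U a) = sets borel"
    and V_sets[simp, measurable_cong]: "sets (V a b) = sets borel"
    and n_sets[simp, measurable_cong]: "sets (n b) = sets borel"
    and U_pos: "0 < a \<Longrightarrow> a \<le> 1 \<Longrightarrow> AE x in U a. 0 < x"
    and V_pos: "0 < a \<Longrightarrow> a < b \<Longrightarrow> b \<le> 1 \<Longrightarrow> AE x in V a b. 0 < x"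
    and n_nonneg: "0 < b \<Longrightarrow> b \<le> 1 \<Longrightarrow> AE x in n b. 0 \<le> x"
    and race: "0 < a \<Longrightarrow> a < b \<Longrightarrow> b \<le> 1 \<Longrightarrow> H \<in> borel_measurable borel \<Longrightarrow>
      (\<integral>\<^sup>+s. (\<integral>\<^sup>+e. (H (s, e) :: ennreal) \<partial>U b) \<partial>V a b) =
        ennreal (a / b) * (\<integral>\<^sup>+x. (\<integral>\<^sup>+v. H (x + v, x) \<partial>V a b) \<partial>U a) +
        ennreal (1 - a / b) * (\<integral>\<^sup>+x. (\<integral>\<^sup>+w. H (x, x + w) \<partial>n b) \<partial>U a)"
    and race': "0 < a \<Longrightarrow> a < b \<Longrightarrow> b < 1 \<Longrightarrow> H \<in> borel_measurable borel \<Longrightarrow>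
      (\<integral>\<^sup>+q. (\<integral>\<^sup>+v. (H (min q v, max 0 (q - v)) :: ennreal) \<partial>V b 1) \<partial>V a b) =
        ennreal (a * (1 - b) / (b * (1 - a))) * (\<integral>\<^sup>+x. (\<integral>\<^sup>+d. H (x, d) \<partial>V a b) \<partial>V a 1) +
        ennreal (1 - a * (1 - b) / (b * (1 - a))) * (\<integral>\<^sup>+x. H (x, 0) \<partial>V a 1)"
begin

text \<open>The probability of a positive horizontal increment. It solves
  \<open>u = p * (1 - (1 - u) * (1 - a))\<close>, which says that the outgoing increment
  \<open>min (U + V) W\<close> is positive as often as the incoming \<open>U\<close>.\<close>

definition u :: "real \<Rightarrow> real" where "u a = p * a / (1 - p + p * a)"
definition s :: "real \<Rightarrow> real \<Rightarrow> real" where "s a b = 1 - (1 - u a) * (1 - a / b)"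
definition \<nu> :: "real \<Rightarrow> real measure" where "\<nu> a = mix (u a) (U a)"
definition \<pi> :: "real \<Rightarrow> real \<Rightarrow> real measure" where "\<pi> a b = mix (a / b) (V a b)"
definition \<sigma> :: "real \<Rightarrow> real \<Rightarrow> real measure" where "\<sigma> a b = mix (s a b) (V a b)"
text \<open>The law of the work left over, \<open>max 0 (q - v)\<close>, when \<open>q\<close> has
  law \<open>\<pi> a b\<close> and \<open>v\<close> has law \<open>\<pi> b 1\<close>.\<close>

definition \<rho> :: "real \<Rightarrow> real \<Rightarrow> real measure" where "\<rho> a b = mix (a * (1 - b) / (b * (1 - a))) (V a b)"

lemma u_bounds: assumes "0 < a" shows "0 < u a" "u a \<le> 1"
proof -
  have d: "0 < 1 - p + p * a" using p assms by (intro add_nonneg_pos) auto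
  show "0 < u a" "u a \<le> 1" using d p assms by (auto simp: u_def field_simps)
qed

lemma u_1: "u 1 = p" by (simp add: u_def)

lemma s_bounds: assumes "0 < a" "a < b" shows "0 < s a b" "s a b \<le> 1"
proof -
  have "0 < a / b" "a / b < 1" using assms by auto
  moreover have "(1 - u a) * (1 - a / b) \<le> 1 * (1 - a / b)"
    using u_bounds[of a] assms by (intro mult_right_mono) auto
  moreover have "0 \<le> (1 - u a) * (1 - a / b)"
    using u_bounds[of a] assms by (intro mult_nonneg_nonneg) auto
  moreover define P where "P = (1 - u a) * (1 - a / b)"
  ultimately have "P \<le> 1 - a / b" "0 \<le> P" "0 < a / b" by simp_all
  then have "0 < 1 - P" "1 - P \<le> 1" by linarith+
  then show "0 < s a b" "s a b \<le> 1" unfolding s_def P_def by auto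
qed

text \<open>A served amount \<open>min S E\<close> is positive exactly when \<open>S\<close> and
  \<open>E\<close> both are; this is the matching of atoms behind stationarity.\<close>

lemma u_eq_s: assumes "0 < a" "0 < b" shows "u a = s a b * u b"
proof -
  have d: "0 < 1 - p + p * a" "0 < 1 - p + p * b" using p assms by (auto intro!: add_nonneg_pos)
  have "1 - u a = (1 - p) / (1 - p + p * a)" using d by (simp add: u_def field_simps)
  then have "s a b = 1 - (1 - p) / (1 - p + p * a) * (1 - a / b)" by (simp add: s_def)
  also have "\<dots> = (a / b) * (1 - p + p * b) / (1 - p + p * a)"
    using d assms by (simp add: divide_simps) (simp add: algebra_simps)
  finally have "s a b * u b = (a / b) * (1 - p + p * b) / (1 - p + p * a) * (p * b / (1 - p + p * b))"
    by (simp add: u_def)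
  also have "\<dots> = u a" using d assms by (simp add: u_def)
  finally show ?thesis ..
qed

lemma \<kappa>_bounds:
  fixes a b :: real
  assumes "0 < a" "a < b" "b < 1"
  shows "0 < a * (1 - b) / (b * (1 - a))" "a * (1 - b) / (b * (1 - a)) < 1"
proof -
  have "0 < 1 - b" "0 < 1 - a" "0 < b" using assms by linarith+
  then show "0 < a * (1 - b) / (b * (1 - a))" using assms by (intro divide_pos_pos mult_pos_pos) auto
  have "a * (1 - b) < b * (1 - a)" "0 < b * (1 - a)" using assms by (auto simp: algebra_simps)
  then show "a * (1 - b) / (b * (1 - a)) < 1" by simp
qed

lemma sets_laws[simp, measurable_cong]: "sets (\<nu> a) = sets borel" "sets (\<pi> a b) = sets borel"
  "sets (\<sigma> a b) = sets borel" "sets (\<rho> a b) = sets borel"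
  by (auto simp: \<nu>_def \<pi>_def \<sigma>_def \<rho>_def)

lemma prob_laws:
  "0 < a \<Longrightarrow> a \<le> 1 \<Longrightarrow> prob_space (\<nu> a)"
  "0 < a \<Longrightarrow> a < b \<Longrightarrow> b \<le> 1 \<Longrightarrow> prob_space (\<pi> a b)"
  "0 < a \<Longrightarrow> a < b \<Longrightarrow> b \<le> 1 \<Longrightarrow> prob_space (\<sigma> a b)"
  "0 < a \<Longrightarrow> a < b \<Longrightarrow> b \<le> 1 \<Longrightarrow> prob_space (\<rho> a b)"
  by (auto simp: \<nu>_def \<pi>_def \<sigma>_def \<rho>_def U_prob V_prob)

lemma nn_integral_laws:
  assumes "h \<in> borel_measurable borel"
  shows "0 < a \<Longrightarrow> a \<le> 1 \<Longrightarrow> (\<integral>\<^sup>+x. h x \<partial>\<nu> a) = ennreal (1 - u a) * h 0 + ennreal (u a) * (\<integral>\<^sup>+x. h x \<partial>U a)"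
    "0 < a \<Longrightarrow> a < b \<Longrightarrow> b \<le> 1 \<Longrightarrow> (\<integral>\<^sup>+x. h x \<partial>\<pi> a b) = ennreal (1 - a / b) * h 0 + ennreal (a / b) * (\<integral>\<^sup>+x. h x \<partial>V a b)"
    "0 < a \<Longrightarrow> a < b \<Longrightarrow> b \<le> 1 \<Longrightarrow> (\<integral>\<^sup>+x. h x \<partial>\<sigma> a b) = ennreal (1 - s a b) * h 0 + ennreal (s a b) * (\<integral>\<^sup>+x. h x \<partial>V a b)"
    "0 < a \<Longrightarrow> a < b \<Longrightarrow> b < 1 \<Longrightarrow> (\<integral>\<^sup>+x. h x \<partial>\<rho> a b) =
        ennreal (1 - a * (1 - b) / (b * (1 - a))) * h 0 + ennreal (a * (1 - b) / (b * (1 - a))) * (\<integral>\<^sup>+x. h x \<partial>V a b)"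
  unfolding \<nu>_def \<pi>_def \<sigma>_def \<rho>_def using assms
  by (auto intro!: nn_integral_mix U_prob V_prob u_bounds s_bounds less_imp_le[OF u_bounds(1)]
     less_imp_le[OF s_bounds(1)] less_imp_le[OF \<kappa>_bounds(1)] less_imp_le[OF \<kappa>_bounds(2)])

text \<open>Reconstructs the service \<open>E\<close> from the outputs \<open>B = min S E\<close>
  and \<open>v = max 0 (S - E)\<close> of a queue. If work is left over, the service was used up and
  \<open>E = B\<close>. If a positive amount was served and nothing is left, \<open>E\<close>
  exceeds \<open>B\<close> by a memoryless excess. If there was no work at all, the output says
  nothing about \<open>E\<close>, and a fresh copy is drawn.\<close>

definition dual_service :: "real \<Rightarrow> real \<Rightarrow> real \<Rightarrow> real \<Rightarrow> real" where
  "dual_service B v \<epsilon> \<eta> = (if 0 < v then B else if 0 < B then B + \<epsilon> else \<eta>)"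

text \<open>Both sides are expanded over the atoms at zero. \<open>J2\<close> (work exhausted) and
  \<open>J3\<close> (work left over) combine to \<open>J4\<close> by \<open>race\<close>, the case
  of positive work and positive service; the weights of the remaining cases agree by
  \<open>u_eq_s\<close>.\<close>

lemma dual_service_quad_upd:
  assumes ab: "0 < a" "a < b" "b \<le> 1"
  shows "quad_upd (\<nu> a) (\<pi> a b) (n b) (\<nu> b) (\<lambda>B v \<epsilon> \<eta>. (B + v, dual_service B v \<epsilon> \<eta>)) (\<sigma> a b) (\<nu> b)"
  unfolding quad_upd_def
proof (intro conjI ballI)
  show "(\<lambda>(B, v, \<epsilon>, \<eta>). (B + v, dual_service B v \<epsilon> \<eta>)) \<in> borel_measurable borel"
    unfolding dual_service_def borel_prod[symmetric] split_beta' by measurable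
  fix H :: "real \<times> real \<Rightarrow> ennreal" assume Hm: "H \<in> borel_measurable borel"
  then have [measurable]: "H \<in> borel_measurable (borel \<Otimes>\<^sub>M borel)" by (simp add: borel_prod)
  have b: "0 < b" and a1: "a \<le> 1" using ab by auto
  interpret Ua: prob_space "U a" using ab by (intro U_prob) auto
  interpret Ub: prob_space "U b" using ab by (intro U_prob) auto
  interpret V: prob_space "V a b" using ab by (intro V_prob) auto
  interpret n: prob_space "n b" using ab by (intro n_prob) auto
  interpret \<nu>b: prob_space "\<nu> b" using ab by (intro prob_laws) auto
  interpret \<pi>: prob_space "\<pi> a b" using ab by (intro prob_laws) auto
  let ?k = "a / b"
  let ?R = "dual_service"
  have k: "0 < ?k" "?k < 1" using ab by auto
  note [measurable] = dual_service_def[abs_def]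
  have Rm[measurable]: "(\<lambda>x. ?R (f x) (g x) (h x) (i x)) \<in> borel_measurable M"
    if [measurable]: "f \<in> borel_measurable M" "g \<in> borel_measurable M" "h \<in> borel_measurable M" "i \<in> borel_measurable M" for f g h i :: "'z \<Rightarrow> real" and M
    unfolding dual_service_def by measurable
  define J0 where "J0 = (\<integral>\<^sup>+e. H (0, e) \<partial>\<nu> b)"
  define J1 where "J1 = (\<integral>\<^sup>+v. H (v, 0) \<partial>V a b)"
  define J2 where "J2 = (\<integral>\<^sup>+x. (\<integral>\<^sup>+w. H (x, x + w) \<partial>n b) \<partial>U a)"
  define J3 where "J3 = (\<integral>\<^sup>+x. (\<integral>\<^sup>+v. H (x + v, x) \<partial>V a b) \<partial>U a)"
  define J4 where "J4 = (\<integral>\<^sup>+s. (\<integral>\<^sup>+e. H (s, e) \<partial>U b) \<partial>V a b)"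
  define G where "G B v = (\<integral>\<^sup>+\<epsilon>. (\<integral>\<^sup>+\<eta>. H (B + v, ?R B v \<epsilon> \<eta>) \<partial>\<nu> b) \<partial>n b)" for B v
  have Gm[measurable]: "(\<lambda>(B, v). G B v) \<in> borel_measurable (borel \<Otimes>\<^sub>M borel)" unfolding G_def by measurable
  have G0: "G 0 0 = J0" by (simp add: G_def J0_def dual_service_def n.emeasure_space_1)
  have G1: "G x v = H (x + v, x)" if "0 < v" for x v using that
    by (simp add: G_def dual_service_def n.emeasure_space_1 \<nu>b.emeasure_space_1)
  have G2: "G x 0 = (\<integral>\<^sup>+w. H (x, x + w) \<partial>n b)" if "0 < x" for x using that
    by (simp add: G_def dual_service_def \<nu>b.emeasure_space_1)
  have "(\<integral>\<^sup>+B. (\<integral>\<^sup>+v. G B v \<partial>\<pi> a b) \<partial>\<nu> a) =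
     (\<integral>\<^sup>+B. ennreal (1 - ?k) * G B 0 + ennreal ?k * (\<integral>\<^sup>+v. H (B + v, B) \<partial>V a b) \<partial>\<nu> a)"
  proof (rule nn_integral_cong)
    fix B
    have "(\<integral>\<^sup>+v. G B v \<partial>V a b) = (\<integral>\<^sup>+v. H (B + v, B) \<partial>V a b)"
      by (rule nn_integral_cong_AE) (use V_pos[OF ab] in eventually_elim, simp add: G1)
    then show "(\<integral>\<^sup>+v. G B v \<partial>\<pi> a b) = ennreal (1 - ?k) * G B 0 + ennreal ?k * (\<integral>\<^sup>+v. H (B + v, B) \<partial>V a b)"
      using ab by (subst nn_integral_laws) auto
  qed
  also have "\<dots> = ennreal (1 - u a) * (ennreal (1 - ?k) * J0 + ennreal ?k * J1) +
      ennreal (u a) * (\<integral>\<^sup>+B. ennreal (1 - ?k) * G B 0 + ennreal ?k * (\<integral>\<^sup>+v. H (B + v, B) \<partial>V a b) \<partial>U a)"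
    using ab a1 by (subst nn_integral_laws) (auto simp: G0 J1_def)
  also have "(\<integral>\<^sup>+B. ennreal (1 - ?k) * G B 0 + ennreal ?k * (\<integral>\<^sup>+v. H (B + v, B) \<partial>V a b) \<partial>U a) =
      (\<integral>\<^sup>+B. ennreal (1 - ?k) * (\<integral>\<^sup>+w. H (B, B + w) \<partial>n b) + ennreal ?k * (\<integral>\<^sup>+v. H (B + v, B) \<partial>V a b) \<partial>U a)"
    by (rule nn_integral_cong_AE) (use U_pos[OF ab(1) a1] in eventually_elim, simp add: G2)
  also have "\<dots> = ennreal (1 - ?k) * J2 + ennreal ?k * J3"
    unfolding J2_def J3_def by (subst nn_integral_add) (auto simp: nn_integral_cmult)
  also have "\<dots> = J4" unfolding J4_def J2_def J3_def by (subst race[OF ab Hm]) (simp add: add.commute)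
  finally have 1: "(\<integral>\<^sup>+B. (\<integral>\<^sup>+v. G B v \<partial>\<pi> a b) \<partial>\<nu> a) =
     ennreal (1 - u a) * (ennreal (1 - ?k) * J0 + ennreal ?k * J1) + ennreal (u a) * J4" .
  have "(\<integral>\<^sup>+x. (\<integral>\<^sup>+y. H (x, y) \<partial>\<nu> b) \<partial>\<sigma> a b) = ennreal (1 - s a b) * J0 + ennreal (s a b) * (\<integral>\<^sup>+x. (\<integral>\<^sup>+y. H (x, y) \<partial>\<nu> b) \<partial>V a b)"
    using ab by (subst nn_integral_laws) (auto simp: J0_def)
  also have "(\<integral>\<^sup>+x. (\<integral>\<^sup>+y. H (x, y) \<partial>\<nu> b) \<partial>V a b) = (\<integral>\<^sup>+x. ennreal (1 - u b) * H (x, 0) + ennreal (u b) * (\<integral>\<^sup>+y. H (x, y) \<partial>U b) \<partial>V a b)"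
    using ab b by (subst nn_integral_laws) auto
  also have "\<dots> = ennreal (1 - u b) * J1 + ennreal (u b) * J4"
    unfolding J1_def J4_def by (subst nn_integral_add) (auto simp: nn_integral_cmult)
  finally have 2: "(\<integral>\<^sup>+x. (\<integral>\<^sup>+y. H (x, y) \<partial>\<nu> b) \<partial>\<sigma> a b) =
      ennreal (1 - s a b) * J0 + ennreal (s a b) * (ennreal (1 - u b) * J1 + ennreal (u b) * J4)" .
  have ub: "0 \<le> u a" "0 \<le> 1 - u a" "0 \<le> u b" "0 \<le> 1 - u b" "0 \<le> s a b" "0 \<le> 1 - s a b"
    using u_bounds[OF ab(1)] u_bounds[OF b] s_bounds[OF ab(1,2)] by auto
  have c1: "ennreal (1 - u a) * ennreal (1 - ?k) = ennreal (1 - s a b)"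
    using ub k by (subst ennreal_mult[symmetric]) (auto simp: s_def)
  have c3: "ennreal (s a b) * ennreal (u b) = ennreal (u a)"
    using ub u_eq_s[OF ab(1) b] by (subst ennreal_mult[symmetric]) auto
  have "s a b * (1 - u b) = s a b - u a" using u_eq_s[OF ab(1) b] by (simp add: right_diff_distrib)
  also have "\<dots> = (1 - u a) * ?k" by (simp add: s_def algebra_simps)
  finally have "(1 - u a) * ?k = s a b * (1 - u b)" ..
  then have c2: "ennreal (1 - u a) * ennreal ?k = ennreal (s a b) * ennreal (1 - u b)"
    using ub k by (subst (1 2) ennreal_mult[symmetric]) auto
  have "ennreal (1 - u a) * (ennreal (1 - ?k) * J0 + ennreal ?k * J1) + ennreal (u a) * J4 =
     ennreal (1 - u a) * ennreal (1 - ?k) * J0 + ennreal (1 - u a) * ennreal ?k * J1 + ennreal (u a) * J4"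
    by (simp add: distrib_left mult.assoc)
  also have "\<dots> = ennreal (1 - s a b) * J0 + ennreal (s a b) * (ennreal (1 - u b) * J1 + ennreal (u b) * J4)"
    unfolding c1 c2 by (simp add: distrib_left c3[symmetric] mult.assoc add.assoc)
  finally show "(\<integral>\<^sup>+x. (\<integral>\<^sup>+y. (\<integral>\<^sup>+z. (\<integral>\<^sup>+w. H (x + y, ?R x y z w) \<partial>\<nu> b) \<partial>n b) \<partial>\<pi> a b) \<partial>\<nu> a) = (\<integral>\<^sup>+x. (\<integral>\<^sup>+y. H (x, y) \<partial>\<nu> b) \<partial>\<sigma> a b)"
    using 1 2 by (simp add: G_def)
qed

text \<open>A Burke-type property obtained by reversal: draw the output pair first, extend it by
  noise to an input pair with the correct law, and check that the queue maps this input back to the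
  given output.\<close>

lemma queue_pair_upd:
  assumes ab: "0 < a" "a < b" "b \<le> 1"
  shows "pair_upd (\<sigma> a b) (\<nu> b) (\<lambda>S E. (min S E, max 0 (S - E))) (\<nu> a) (\<pi> a b)"
  unfolding pair_upd_def
proof (intro conjI ballI)
  have "(\<lambda>(S, E). (min S E, max 0 (S - E))) \<in> measurable (borel \<Otimes>\<^sub>M borel) (borel \<Otimes>\<^sub>M borel :: (real \<times> real) measure)"
    by measurable
  then show "(\<lambda>(S, E). (min S E, max 0 (S - E))) \<in> borel_measurable (borel :: (real \<times> real) measure)" by (simp add: borel_prod)
  fix H :: "real \<times> real \<Rightarrow> ennreal" assume Hm: "H \<in> borel_measurable borel"
  then have [measurable]: "H \<in> borel_measurable (borel \<Otimes>\<^sub>M borel)" by (simp add: borel_prod)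
  have a1: "a \<le> 1" and b: "0 < b" using ab by auto
  interpret n: prob_space "n b" using ab by (intro n_prob) auto
  interpret \<nu>b: prob_space "\<nu> b" using ab by (intro prob_laws) auto
  define H' where "H' z = H (min (fst z) (snd z), max 0 (fst z - snd z))" for z
  have H'm: "H' \<in> borel_measurable borel" unfolding H'_def borel_prod[symmetric] by measurable
  have nonneg\<nu>: "AE x in \<nu> c. 0 \<le> x" if "0 < c" "c \<le> 1" for c
  proof -
    interpret U: prob_space "U c" using that by (intro U_prob) auto
    have "emeasure (\<nu> c) {x. \<not> 0 \<le> x} = (\<integral>\<^sup>+x. indicator {x. \<not> 0 \<le> x} x \<partial>\<nu> c)" by simp
    also have "\<dots> = ennreal (u c) * (\<integral>\<^sup>+x. indicator {x. \<not> 0 \<le> x} x \<partial>U c)"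
      using that by (subst nn_integral_laws) auto
    also have "(\<integral>\<^sup>+x. indicator {x. \<not> 0 \<le> x} x \<partial>U c) = (\<integral>\<^sup>+x. 0 \<partial>U c)"
      by (rule nn_integral_cong_AE) (use U_pos[OF that] in eventually_elim, auto)
    finally show ?thesis by (intro AE_I[where N="{x. \<not> 0 \<le> x}"]) auto
  qed
  have nonneg\<pi>: "AE x in \<pi> a b. 0 \<le> x"
  proof -
    have "emeasure (\<pi> a b) {x. \<not> 0 \<le> x} = (\<integral>\<^sup>+x. indicator {x. \<not> 0 \<le> x} x \<partial>\<pi> a b)" by simp
    also have "\<dots> = ennreal (a / b) * (\<integral>\<^sup>+x. indicator {x. \<not> 0 \<le> x} x \<partial>V a b)"
      using ab by (subst nn_integral_laws) auto
    also have "(\<integral>\<^sup>+x. indicator {x. \<not> 0 \<le> x} x \<partial>V a b) = (\<integral>\<^sup>+x. 0 \<partial>V a b)"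
      by (rule nn_integral_cong_AE) (use V_pos[OF ab] in eventually_elim, auto)
    finally show ?thesis by (intro AE_I[where N="{x. \<not> 0 \<le> x}"]) auto
  qed
  have "(\<integral>\<^sup>+x. (\<integral>\<^sup>+y. H (min x y, max 0 (x - y)) \<partial>\<nu> b) \<partial>\<sigma> a b) = (\<integral>\<^sup>+x. (\<integral>\<^sup>+y. H' (x, y) \<partial>\<nu> b) \<partial>\<sigma> a b)"
    by (simp add: H'_def)
  also have "\<dots> = (\<integral>\<^sup>+x. (\<integral>\<^sup>+y. (\<integral>\<^sup>+z. (\<integral>\<^sup>+w. H' (x + y, dual_service x y z w) \<partial>\<nu> b) \<partial>n b) \<partial>\<pi> a b) \<partial>\<nu> a)"
    using dual_service_quad_upd[OF ab] H'm unfolding quad_upd_def by simp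
  also have "\<dots> = (\<integral>\<^sup>+x. (\<integral>\<^sup>+y. H (x, y) \<partial>\<pi> a b) \<partial>\<nu> a)"
  proof (rule nn_integral_cong_AE, use nonneg\<nu>[OF ab(1) a1] in eventually_elim)
    fix x :: real assume x: "0 \<le> x"
    show "(\<integral>\<^sup>+y. (\<integral>\<^sup>+z. (\<integral>\<^sup>+w. H' (x + y, dual_service x y z w) \<partial>\<nu> b) \<partial>n b) \<partial>\<pi> a b) = (\<integral>\<^sup>+y. H (x, y) \<partial>\<pi> a b)"
    proof (rule nn_integral_cong_AE, use nonneg\<pi> in eventually_elim)
      fix y :: real assume y: "0 \<le> y"
      have "(\<integral>\<^sup>+z. (\<integral>\<^sup>+w. H' (x + y, dual_service x y z w) \<partial>\<nu> b) \<partial>n b) = (\<integral>\<^sup>+z. (\<integral>\<^sup>+w. H (x, y) \<partial>\<nu> b) \<partial>n b)"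
      proof (rule nn_integral_cong_AE, use n_nonneg[OF b ab(3)] in eventually_elim)
        fix z :: real assume z: "0 \<le> z"
        show "(\<integral>\<^sup>+w. H' (x + y, dual_service x y z w) \<partial>\<nu> b) = (\<integral>\<^sup>+w. H (x, y) \<partial>\<nu> b)"
          by (rule nn_integral_cong_AE, use nonneg\<nu>[OF b ab(3)] in eventually_elim)
            (use x y z in \<open>auto simp: H'_def dual_service_def min_def max_def\<close>)
      qed
      then show "(\<integral>\<^sup>+z. (\<integral>\<^sup>+w. H' (x + y, dual_service x y z w) \<partial>\<nu> b) \<partial>n b) = H (x, y)"
        by (simp add: n.emeasure_space_1 \<nu>b.emeasure_space_1)
    qed
  qed
  finally show "(\<integral>\<^sup>+x. (\<integral>\<^sup>+y. H (min x y, max 0 (x - y)) \<partial>\<nu> b) \<partial>\<sigma> a b) = (\<integral>\<^sup>+x. (\<integral>\<^sup>+y. H (x, y) \<partial>\<pi> a b) \<partial>\<nu> a)" .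
qed

text \<open>Departures of a queue served by a \<open>b\<close>-increment are distributed as
  \<open>a\<close>-increments and are independent of what stays behind. For two positive variables
  this is \<open>race'\<close>; the atoms fit since \<open>a / b * b = a\<close>.\<close>

lemma min_queue_pair_upd:
  assumes ab: "0 < a" "a < b" "b < 1"
  shows "pair_upd (\<pi> a b) (\<pi> b 1) (\<lambda>q v. (min q v, max 0 (q - v))) (\<pi> a 1) (\<rho> a b)"
  unfolding pair_upd_def
proof (intro conjI ballI)
  have "(\<lambda>(S, E). (min S E, max 0 (S - E))) \<in> measurable (borel \<Otimes>\<^sub>M borel) (borel \<Otimes>\<^sub>M borel :: (real \<times> real) measure)"
    by measurable
  then show "(\<lambda>(S, E). (min S E, max 0 (S - E))) \<in> borel_measurable (borel :: (real \<times> real) measure)" by (simp add: borel_prod)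
  fix H :: "real \<times> real \<Rightarrow> ennreal" assume Hm: "H \<in> borel_measurable borel"
  then have [measurable]: "H \<in> borel_measurable (borel \<Otimes>\<^sub>M borel)" by (simp add: borel_prod)
  have b: "0 < b" "b \<le> 1" "a < 1" using ab by auto
  interpret Vab: prob_space "V a b" using ab by (intro V_prob) auto
  interpret Va1: prob_space "V a 1" using ab by (intro V_prob) auto
  interpret Vb1: prob_space "V b 1" using ab by (intro V_prob) auto
  interpret \<pi>b1: prob_space "\<pi> b 1" using ab by (intro prob_laws) auto
  interpret \<rho>: prob_space "\<rho> a b" using ab by (intro prob_laws) auto
  define k where "k = a * (1 - b) / (b * (1 - a))"
  have k: "0 < k" "k < 1" using \<kappa>_bounds[OF ab] by (auto simp: k_def)
  define J0 where "J0 = H (0, 0)"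
  define J1 where "J1 = (\<integral>\<^sup>+q. H (0, q) \<partial>V a b)"
  define J2 where "J2 = (\<integral>\<^sup>+x. (\<integral>\<^sup>+d. H (x, d) \<partial>V a b) \<partial>V a 1)"
  define J3 where "J3 = (\<integral>\<^sup>+x. H (x, 0) \<partial>V a 1)"
  have "(\<integral>\<^sup>+q. (\<integral>\<^sup>+v. H (min q v, max 0 (q - v)) \<partial>\<pi> b 1) \<partial>V a b) =
    (\<integral>\<^sup>+q. ennreal (1 - b) * H (0, q) + ennreal b * (\<integral>\<^sup>+v. H (min q v, max 0 (q - v)) \<partial>V b 1) \<partial>V a b)"
    by (rule nn_integral_cong_AE, use V_pos[OF ab(1,2) b(2)] in eventually_elim, subst nn_integral_laws) (use ab in auto)
  also have "\<dots> = ennreal (1 - b) * J1 + ennreal b * (\<integral>\<^sup>+q. (\<integral>\<^sup>+v. H (min q v, max 0 (q - v)) \<partial>V b 1) \<partial>V a b)"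
    unfolding J1_def by (subst nn_integral_add) (auto simp: nn_integral_cmult)
  also have "(\<integral>\<^sup>+q. (\<integral>\<^sup>+v. H (min q v, max 0 (q - v)) \<partial>V b 1) \<partial>V a b) = ennreal k * J2 + ennreal (1 - k) * J3"
    unfolding J2_def J3_def k_def by (rule race'[OF ab Hm])
  finally have 1: "(\<integral>\<^sup>+q. (\<integral>\<^sup>+v. H (min q v, max 0 (q - v)) \<partial>\<pi> b 1) \<partial>V a b) =
     ennreal (1 - b) * J1 + ennreal b * (ennreal k * J2 + ennreal (1 - k) * J3)" .
  have "(\<integral>\<^sup>+v. H (min 0 v, max 0 (0 - v)) \<partial>\<pi> b 1) = J0"
  proof -
    have "(\<integral>\<^sup>+v. H (min 0 v, max 0 (0 - v)) \<partial>V b 1) = (\<integral>\<^sup>+v. H (0, 0) \<partial>V b 1)"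
      by (rule nn_integral_cong_AE, use V_pos[OF b(1) ab(3) order_refl] in eventually_elim) auto
    then have "(\<integral>\<^sup>+v. H (min 0 v, max 0 (0 - v)) \<partial>\<pi> b 1) = ennreal (1 - b) * J0 + ennreal b * J0"
      using ab by (subst nn_integral_laws) (auto simp: J0_def Vb1.emeasure_space_1)
    also have "\<dots> = J0" using ab by (simp add: distrib_right[symmetric] ennreal_plus[symmetric] del: ennreal_plus)
    finally show ?thesis .
  qed
  then have L: "(\<integral>\<^sup>+q. (\<integral>\<^sup>+v. H (min q v, max 0 (q - v)) \<partial>\<pi> b 1) \<partial>\<pi> a b) = ennreal (1 - a / b) * J0 +
     ennreal (a / b) * (ennreal (1 - b) * J1 + ennreal b * (ennreal k * J2 + ennreal (1 - k) * J3))"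
    using ab b by (subst nn_integral_laws) (auto simp: 1)
  have "(\<integral>\<^sup>+x. (\<integral>\<^sup>+d. H (x, d) \<partial>\<rho> a b) \<partial>V a 1) = (\<integral>\<^sup>+x. ennreal (1 - k) * H (x, 0) + ennreal k * (\<integral>\<^sup>+d. H (x, d) \<partial>V a b) \<partial>V a 1)"
    using ab by (subst nn_integral_laws) (auto simp: k_def)
  also have "\<dots> = ennreal (1 - k) * J3 + ennreal k * J2"
    unfolding J2_def J3_def by (subst nn_integral_add) (auto simp: nn_integral_cmult)
  finally have 2: "(\<integral>\<^sup>+x. (\<integral>\<^sup>+d. H (x, d) \<partial>\<rho> a b) \<partial>V a 1) = ennreal (1 - k) * J3 + ennreal k * J2" .
  have 3: "(\<integral>\<^sup>+d. H (0, d) \<partial>\<rho> a b) = ennreal (1 - k) * J0 + ennreal k * J1"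
    using ab by (subst nn_integral_laws) (auto simp: k_def J0_def J1_def)
  have R: "(\<integral>\<^sup>+x. (\<integral>\<^sup>+d. H (x, d) \<partial>\<rho> a b) \<partial>\<pi> a 1) =
     ennreal (1 - a) * (ennreal (1 - k) * J0 + ennreal k * J1) + ennreal a * (ennreal (1 - k) * J3 + ennreal k * J2)"
    using ab b by (subst nn_integral_laws) (auto simp: 2 3)
  have k1: "1 - k = (b - a) / (b * (1 - a))" using ab b by (simp add: k_def divide_simps) (simp add: algebra_simps)
  have c0: "ennreal (1 - a) * ennreal (1 - k) = ennreal (1 - a / b)"
    using ab k b by (subst ennreal_mult[symmetric]) (auto simp: k1 divide_simps)
  have c1: "ennreal (a / b) * ennreal (1 - b) = ennreal (1 - a) * ennreal k"
    using ab k b by (subst (1 2) ennreal_mult[symmetric]) (auto simp: k_def divide_simps)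
  have c2: "ennreal (a / b) * ennreal b = ennreal a"
    using ab by (subst ennreal_mult[symmetric]) auto
  have "ennreal (1 - a / b) * J0 + ennreal (a / b) * (ennreal (1 - b) * J1 + ennreal b * (ennreal k * J2 + ennreal (1 - k) * J3)) =
     ennreal (1 - a / b) * J0 + ennreal (a / b) * ennreal (1 - b) * J1 + ennreal (a / b) * ennreal b * (ennreal k * J2 + ennreal (1 - k) * J3)"
    by (simp add: distrib_left mult.assoc add.assoc)
  also have "\<dots> = ennreal (1 - a) * (ennreal (1 - k) * J0 + ennreal k * J1) + ennreal a * (ennreal (1 - k) * J3 + ennreal k * J2)"
    unfolding c1 c2 c0[symmetric] by (simp add: distrib_left mult.assoc add.commute)
  finally show "(\<integral>\<^sup>+x. (\<integral>\<^sup>+y. H (min x y, max 0 (x - y)) \<partial>\<pi> b 1) \<partial>\<pi> a b) = (\<integral>\<^sup>+x. (\<integral>\<^sup>+y. H (x, y) \<partial>\<rho> a b) \<partial>\<pi> a 1)"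
    using L R by simp
qed

text \<open>The hypothesis \<open>AB\<close> is a renewal identity: a \<open>B\<close> variable is
  an \<open>A\<close> variable followed, with probability \<open>k\<close>, by a fresh
  \<open>B\<close> variable. Hence \<open>A\<close> plus \<open>mix k B\<close> is again
  \<open>B\<close>, and mixing with zero only changes the weight of the atom. The output 0 is
  padding that lets \<open>pair_upd\<close> be reused.\<close>

lemma mix_add_pair_upd:
  assumes q: "0 \<le> q" "q \<le> 1" "0 \<le> k" "k \<le> 1"
    and A: "prob_space A" "sets A = sets borel" and B: "prob_space B" "sets B = sets borel"
    and AB: "\<And>h. h \<in> borel_measurable borel \<Longrightarrow> (\<integral>\<^sup>+x. h x \<partial>B) =
      ennreal k * (\<integral>\<^sup>+x. (\<integral>\<^sup>+y. h (x + y) \<partial>B) \<partial>A) + ennreal (1 - k) * (\<integral>\<^sup>+x. h x \<partial>A)"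
  shows "pair_upd (mix q A) (mix k B) (\<lambda>x y. (x + y, 0)) (mix (1 - (1 - q) * (1 - k)) B) (return borel 0)"
  unfolding pair_upd_def
proof (intro conjI ballI)
  have "(\<lambda>(x, y). (x + y, 0 :: real)) \<in> measurable (borel \<Otimes>\<^sub>M borel) (borel \<Otimes>\<^sub>M borel :: (real \<times> real) measure)"
    by measurable
  then show "(\<lambda>(x, y). (x + y, 0 :: real)) \<in> borel_measurable (borel :: (real \<times> real) measure)" by (simp add: borel_prod)
  fix H :: "real \<times> real \<Rightarrow> ennreal" assume Hm: "H \<in> borel_measurable borel"
  then have [measurable]: "H \<in> borel_measurable (borel \<Otimes>\<^sub>M borel)" by (simp add: borel_prod)
  interpret A: prob_space A by fact
  interpret B: prob_space B by fact
  have [measurable_cong]: "sets A = sets borel" "sets B = sets borel" by fact+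
  have mB: "prob_space (mix k B)" using B by simp
  interpret mB: prob_space "mix k B" by fact
  define h where "h x = H (x, 0)" for x
  have h[measurable]: "h \<in> borel_measurable borel" unfolding h_def by measurable
  define s where "s = 1 - (1 - q) * (1 - k)"
  have "(1 - q) * (1 - k) \<le> 1 * 1" using q by (intro mult_mono) auto
  moreover have "0 \<le> (1 - q) * (1 - k)" using q by (intro mult_nonneg_nonneg) auto
  ultimately have s: "0 \<le> s" "s \<le> 1" by (auto simp: s_def)
  define J0 where "J0 = h 0"
  define JA where "JA = (\<integral>\<^sup>+x. h x \<partial>A)"
  define JB where "JB = (\<integral>\<^sup>+x. h x \<partial>B)"
  define JAB where "JAB = (\<integral>\<^sup>+x. (\<integral>\<^sup>+y. h (x + y) \<partial>B) \<partial>A)"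
  have JB: "JB = ennreal k * JAB + ennreal (1 - k) * JA" unfolding JA_def JB_def JAB_def by (rule AB[OF h])
  have "(\<integral>\<^sup>+x. (\<integral>\<^sup>+y. h (x + y) \<partial>mix k B) \<partial>mix q A) =
      ennreal (1 - q) * (\<integral>\<^sup>+y. h (0 + y) \<partial>mix k B) + ennreal q * (\<integral>\<^sup>+x. (\<integral>\<^sup>+y. h (x + y) \<partial>mix k B) \<partial>A)"
    by (rule nn_integral_mix) (use q A in auto)
  also have "(\<integral>\<^sup>+y. h (0 + y) \<partial>mix k B) = ennreal (1 - k) * J0 + ennreal k * JB"
    by (subst nn_integral_mix) (use q B in \<open>auto simp: J0_def JB_def\<close>)
  also have "(\<integral>\<^sup>+x. (\<integral>\<^sup>+y. h (x + y) \<partial>mix k B) \<partial>A) = (\<integral>\<^sup>+x. ennreal (1 - k) * h x + ennreal k * (\<integral>\<^sup>+y. h (x + y) \<partial>B) \<partial>A)"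
    by (subst nn_integral_mix) (use q B in auto)
  also have "\<dots> = JB"
    unfolding JB JA_def JAB_def by (subst nn_integral_add) (auto simp: nn_integral_cmult add.commute)
  also have "ennreal (1 - q) * (ennreal (1 - k) * J0 + ennreal k * JB) + ennreal q * JB =
     ennreal (1 - s) * J0 + ennreal s * JB"
  proof -
    have c1: "ennreal (1 - q) * ennreal (1 - k) = ennreal (1 - s)"
      using q by (subst ennreal_mult[symmetric]) (auto simp: s_def)
    have "ennreal (1 - q) * ennreal k + ennreal q = ennreal ((1 - q) * k + q)"
      using q by (simp add: ennreal_mult mult_nonneg_nonneg)
    then have c2: "ennreal (1 - q) * ennreal k + ennreal q = ennreal s"
      by (simp add: s_def algebra_simps)
    note c = c1 c2
    show ?thesis unfolding c[symmetric] by (simp add: distrib_left distrib_right mult.assoc add.assoc)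
  qed
  also have "\<dots> = (\<integral>\<^sup>+x. h x \<partial>mix s B)"
    by (subst nn_integral_mix) (use s B in \<open>auto simp: J0_def JB_def\<close>)
  also have "\<dots> = (\<integral>\<^sup>+x. (\<integral>\<^sup>+y. H (x, y) \<partial>return borel 0) \<partial>mix s B)"
    by (simp add: h_def nn_integral_return)
  finally show "(\<integral>\<^sup>+x. (\<integral>\<^sup>+y. H (x + y, 0) \<partial>mix k B) \<partial>mix q A) =
     (\<integral>\<^sup>+x. (\<integral>\<^sup>+y. H (x, y) \<partial>return borel 0) \<partial>mix (1 - (1 - q) * (1 - k)) B)"
    by (simp add: s_def h_def)
qed

text \<open>Integrating out the second coordinate of \<open>race\<close> gives the renewal identity
  for \<open>V a b\<close>.\<close>

lemma arrival_pair_upd: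
  assumes ab: "0 < a" "a < b" "b \<le> 1"
  shows "pair_upd (\<nu> a) (\<pi> a b) (\<lambda>x y. (x + y, 0)) (\<sigma> a b) (return borel 0)"
  unfolding \<nu>_def \<pi>_def \<sigma>_def s_def
proof (rule mix_add_pair_upd)
  interpret U: prob_space "U b" using ab by (intro U_prob) auto
  interpret Ua: prob_space "U a" using ab by (intro U_prob) auto
  interpret V: prob_space "V a b" using ab by (intro V_prob) auto
  interpret n: prob_space "n b" using ab by (intro n_prob) auto
  fix h :: "real \<Rightarrow> ennreal" assume [measurable]: "h \<in> borel_measurable borel"
  have m: "(\<lambda>z :: real \<times> real. h (fst z)) \<in> borel_measurable borel" unfolding borel_prod[symmetric] by measurable
  show "(\<integral>\<^sup>+x. h x \<partial>V a b) = ennreal (a / b) * (\<integral>\<^sup>+x. (\<integral>\<^sup>+y. h (x + y) \<partial>V a b) \<partial>U a) + ennreal (1 - a / b) * (\<integral>\<^sup>+x. h x \<partial>U a)"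
    using race[OF ab m] by (simp add: U.emeasure_space_1 n.emeasure_space_1)
qed (use ab u_bounds[OF ab(1)] U_prob V_prob in auto)

text \<open>As \<open>min q v + max 0 (q - v) = q\<close>, testing \<open>race'\<close> on the sum
  of coordinates gives a renewal identity. It shows that arrivals restore the law of the queue after
  a service, which closes the recursion for queue lengths.\<close>

lemma refill_pair_upd:
  assumes ab: "0 < a" "a < b" "b < 1"
  shows "pair_upd (\<pi> a 1) (\<rho> a b) (\<lambda>x y. (x + y, 0)) (\<pi> a b) (return borel 0)"
proof -
  have k: "1 - (1 - a) * (1 - a * (1 - b) / (b * (1 - a))) = a / b"
  proof -
    have "1 - a * (1 - b) / (b * (1 - a)) = (b - a) / (b * (1 - a))"
      using ab by (simp add: divide_simps) (simp add: algebra_simps)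
    then show ?thesis using ab by (simp add: divide_simps)
  qed
  have "pair_upd (mix a (V a 1)) (mix (a * (1 - b) / (b * (1 - a))) (V a b)) (\<lambda>x y. (x + y, 0))
     (mix (1 - (1 - a) * (1 - a * (1 - b) / (b * (1 - a)))) (V a b)) (return borel 0)"
  proof (rule mix_add_pair_upd)
    interpret Vab: prob_space "V a b" using ab by (intro V_prob) auto
    interpret Vb1: prob_space "V b 1" using ab by (intro V_prob) auto
    fix h :: "real \<Rightarrow> ennreal" assume [measurable]: "h \<in> borel_measurable borel"
    have m: "(\<lambda>z :: real \<times> real. h (fst z + snd z)) \<in> borel_measurable borel" unfolding borel_prod[symmetric] by measurable
    have e: "min q v + max 0 (q - v) = q" for q v :: real by (simp add: min_def max_def)
    show "(\<integral>\<^sup>+x. h x \<partial>V a b) = ennreal (a * (1 - b) / (b * (1 - a))) * (\<integral>\<^sup>+x. (\<integral>\<^sup>+y. h (x + y) \<partial>V a b) \<partial>V a 1) +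
       ennreal (1 - a * (1 - b) / (b * (1 - a))) * (\<integral>\<^sup>+x. h x \<partial>V a 1)"
      using race'[OF ab m] by (simp add: Vb1.emeasure_space_1 e)
  qed (use ab \<kappa>_bounds[OF ab] V_prob in \<open>auto simp: less_imp_le\<close>)
  then show ?thesis using ab unfolding k by (simp add: \<pi>_def \<rho>_def)
qed

end

section \<open>Passage times with boundary\<close>

text \<open>Arrays are indexed from the endpoint of the paths: \<open>i\<close> counts columns to the left and \<open>j\<close>
  rows downwards. The boundary heights increase by \<open>T\<close> along the top row and decrease by \<open>E\<close> down
  the rightmost column.\<close>
fun hgt :: "(nat \<Rightarrow> real) \<Rightarrow> (nat \<Rightarrow> real) \<Rightarrow> (nat \<Rightarrow> nat \<Rightarrow> real) \<Rightarrow> nat \<Rightarrow> nat \<Rightarrow> real" where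
  "hgt T E W i 0 = (\<Sum>k<i. T k)"
| "hgt T E W 0 (Suc j) = - (\<Sum>l<Suc j. E l)"
| "hgt T E W (Suc i) (Suc j) = min (hgt T E W (Suc i) j) (W i j + hgt T E W i (Suc j))"

definition Uf :: "(nat \<Rightarrow> real) \<Rightarrow> (nat \<Rightarrow> real) \<Rightarrow> (nat \<Rightarrow> nat \<Rightarrow> real) \<Rightarrow> nat \<Rightarrow> nat \<Rightarrow> real" where
  "Uf T E W i j = hgt T E W (Suc i) j - hgt T E W i j"

definition Vf :: "(nat \<Rightarrow> real) \<Rightarrow> (nat \<Rightarrow> real) \<Rightarrow> (nat \<Rightarrow> nat \<Rightarrow> real) \<Rightarrow> nat \<Rightarrow> nat \<Rightarrow> real" where
  "Vf T E W i j = hgt T E W i j - hgt T E W i (Suc j)"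

lemma hgt_0: "hgt T E W 0 j = - (\<Sum>l<j. E l)"
  by (cases j) auto

lemma Uf_0[simp]: "Uf T E W i 0 = T i"
  by (simp add: Uf_def)

lemma Vf_0[simp]: "Vf T E W 0 j = E j"
  by (simp add: Vf_def hgt_0)

lemma Uf_Suc: "Uf T E W i (Suc j) = min (Uf T E W i j + Vf T E W i j) (W i j)"
  by (simp add: Uf_def Vf_def min_def)

lemma Vf_Suc: "Vf T E W (Suc i) j = max 0 (Uf T E W i j + Vf T E W i j - W i j)"
  by (simp add: Uf_def Vf_def min_def max_def)

lemma hgt_eq_sum: "hgt T E W m n = (\<Sum>k<m. T k) - (\<Sum>l<n. Vf T E W m l)"
  by (induction n) (auto simp: Vf_def)

lemma Vf_nonneg: "(\<And>l. 0 \<le> E l) \<Longrightarrow> 0 \<le> Vf T E W i j"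
  by (cases i) (auto simp: Vf_Suc)

lemma Vf_nonneg_Suc: "0 \<le> Vf T E W (Suc i) j"
  by (auto simp: Vf_Suc)

lemma UV_cong:
  assumes "\<And>k. k < m \<Longrightarrow> T k = T' k" "\<And>l. l < n \<Longrightarrow> E l = E' l" "\<And>k l. k < m \<Longrightarrow> l < n \<Longrightarrow> W k l = W' k l"
  shows "i \<le> m \<Longrightarrow> j \<le> n \<Longrightarrow> hgt T E W i j = hgt T' E' W' i j"
  using assms by (induction T E W i j rule: hgt.induct) auto

lemma Vf_cong:
  assumes "\<And>k. k < i \<Longrightarrow> T k = T' k" "\<And>l. l \<le> j \<Longrightarrow> E l = E' l" "\<And>k l. k < i \<Longrightarrow> l \<le> j \<Longrightarrow> W k l = W' k l"
  shows "Vf T E W i j = Vf T' E' W' i j"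
  unfolding Vf_def
  using UV_cong[of i T T' "Suc j" E E' W W' i j] UV_cong[of i T T' "Suc j" E E' W W' i "Suc j"] assms by auto

text \<open>Restarting at an interior point, with the increments found there as boundary data,
  changes heights only by a constant. This carries stationarity from the boundary into the
  interior.\<close>

lemma hgt_shift:
  "hgt (\<lambda>k. Uf T E W (k + i0) j0) (\<lambda>l. Vf T E W i0 (l + j0)) (\<lambda>k l. W (k + i0) (l + j0)) i j =
     hgt T E W (i + i0) (j + j0) - hgt T E W i0 j0"
proof -
  define T' E' W' where "T' = (\<lambda>k. Uf T E W (k + i0) j0)" "E' = (\<lambda>l. Vf T E W i0 (l + j0))" "W' = (\<lambda>k l. W (k + i0) (l + j0))"
  have 1: "(\<Sum>k<i. Uf T E W (k + i0) j0) = hgt T E W (i + i0) j0 - hgt T E W i0 j0" for i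
    by (induction i) (auto simp: Uf_def)
  have 2: "(\<Sum>l<j. Vf T E W i0 (l + j0)) = hgt T E W i0 j0 - hgt T E W i0 (j + j0)" for j
    by (induction j) (auto simp: Vf_def)
  have "hgt T' E' W' i j = hgt T E W (i + i0) (j + j0) - hgt T E W i0 j0"
  proof (induction i arbitrary: j)
    case 0
    show ?case by (simp add: hgt_0 T'_E'_W'_def 2)
  next
    case (Suc i j)
    show ?case
    proof (induction j)
      case 0
      show ?case using 1[of "Suc i"] by (simp add: T'_E'_W'_def)
    next
      case (Suc j')
      then show ?case using Suc.prems \<open>\<And>j. hgt T' E' W' i j = _\<close>[of "Suc j'"]
        by (simp add: T'_E'_W'_def(3) min_def)
    qed
  qed
  then show ?thesis by (simp add: T'_E'_W'_def)
qed

lemma UV_shift: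
  "Vf (\<lambda>k. Uf T E W (k + i0) j0) (\<lambda>l. Vf T E W i0 (l + j0)) (\<lambda>k l. W (k + i0) (l + j0)) i j = Vf T E W (i + i0) (j + j0)"
  "Uf (\<lambda>k. Uf T E W (k + i0) j0) (\<lambda>l. Vf T E W i0 (l + j0)) (\<lambda>k l. W (k + i0) (l + j0)) i j = Uf T E W (i + i0) (j + j0)"
  by (simp_all add: Vf_def[of "\<lambda>k. Uf T E W (k + i0) j0"] Uf_def[of "\<lambda>k. Uf T E W (k + i0) j0"] hgt_shift)
    (simp_all add: Vf_def Uf_def)

lemma hgt_mono:
  assumes "\<And>i. (\<Sum>k<i. T k) \<le> (\<Sum>k<i. T' k)" "\<And>j. (\<Sum>l<j. E' l) \<le> (\<Sum>l<j. E l)"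
  shows "hgt T E W i j \<le> hgt T' E' W i j"
proof (induction i arbitrary: j)
  case 0
  show ?case using assms by (simp add: hgt_0)
next
  case (Suc i j)
  show ?case
  proof (induction j)
    case 0
    then show ?case using assms(1)[of "Suc i"] by simp
  next
    case (Suc j')
    have "W i j' + hgt T E W i (Suc j') \<le> W i j' + hgt T' E' W i (Suc j')"
      using \<open>\<And>j. hgt T E W i j \<le> hgt T' E' W i j\<close> by simp
    then show ?case using Suc by (auto simp: min_le_iff_disj)
  qed
qed

text \<open>An optimal path leaves through the top row or through the rightmost column. Putting the
  column increments to zero, or raising the top increments to \<open>T\<close>, makes one exit more
  expensive and leaves the other alone, so the cheaper of the two modified heights is the original
  one.\<close>

lemma hgt_min:
  assumes "\<And>k. I k \<le> T k" "\<And>l. 0 \<le> E l"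
  shows "hgt I E W i j = min (hgt I (\<lambda>_. 0) W i j) (hgt T E W i j)"
proof (induction i arbitrary: j)
  case 0
  show ?case using assms(2) by (simp add: hgt_0 sum_nonneg)
next
  case (Suc i j)
  show ?case
  proof (induction j)
    case 0
    have "(\<Sum>k<Suc i. I k) \<le> (\<Sum>k<Suc i. T k)" by (intro sum_mono assms)
    then show ?case by simp
  next
    case (Suc j')
    have "hgt I E W i (Suc j') = min (hgt I (\<lambda>_. 0) W i (Suc j')) (hgt T E W i (Suc j'))"
      using \<open>\<And>j. hgt I E W i j = _\<close> by simp
    then show ?case using Suc by (simp add: min_def)
  qed
qed

lemma UV_mono:
  assumes "\<And>k. T k \<le> T' k" "\<And>l. E l \<le> E' l"
  shows "Uf T E W i j \<le> Uf T' E' W i j \<and> Vf T E W i j \<le> Vf T' E' W i j"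
proof (induction i arbitrary: j)
  case 0
  have V: "Vf T E W 0 j \<le> Vf T' E' W 0 j" for j using assms by simp
  have "Uf T E W 0 j \<le> Uf T' E' W 0 j" for j
  proof (induction j)
    case (Suc j)
    then show ?case using V[of j] by (auto simp: Uf_Suc min_le_iff_disj)
  qed (use assms in simp)
  then show ?case using V by blast
next
  case (Suc i)
  have V: "Vf T E W (Suc i) j \<le> Vf T' E' W (Suc i) j" for j
    using Suc[of j] by (auto simp: Vf_Suc max_def)
  have "Uf T E W (Suc i) j \<le> Uf T' E' W (Suc i) j" for j
  proof (induction j)
    case (Suc j)
    then show ?case using V[of j] by (auto simp: Uf_Suc min_le_iff_disj)
  qed (use assms in simp)
  then show ?case using V by blast
qed

text \<open>Point-to-point passage time to the corner. Going up the rightmost column is free, hence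
  the zero column boundary; the top row must pay the weights of row 0, hence the other rows of
  \<open>W\<close> are shifted by one.\<close>

definition pt :: "(nat \<Rightarrow> nat \<Rightarrow> real) \<Rightarrow> nat \<Rightarrow> nat \<Rightarrow> real" where
  "pt W i j = hgt (\<lambda>k. W k 0) (\<lambda>_. 0) (\<lambda>k l. W k (Suc l)) i j"

definition pV :: "(nat \<Rightarrow> nat \<Rightarrow> real) \<Rightarrow> nat \<Rightarrow> nat \<Rightarrow> real" where
  "pV W i j = pt W i j - pt W i (Suc j)"

lemma pV_eq_Vf: "pV W i j = Vf (\<lambda>k. W k 0) (\<lambda>_. 0) (\<lambda>k l. W k (Suc l)) i j"
  by (simp add: pV_def pt_def Vf_def)

lemma pV_nonneg: "0 \<le> pV W i j"
  by (simp add: pV_eq_Vf Vf_nonneg)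

text \<open>If the top boundary is at least as large as the weights of row 0, the next row sees
  exactly these weights. One extra row thus turns an array with boundary into a point-to-point one,
  which explains the index \<open>Suc j\<close>.\<close>

lemma pV_eq_Vf_large_top:
  assumes "\<And>k. W k 0 \<le> T k"
  shows "pV W i j = Vf T (\<lambda>_. 0) W i (Suc j)"
proof -
  have "Uf T (\<lambda>_. 0) W k 1 = W k 0" for k
  proof -
    have "W k 0 \<le> T k + Vf T (\<lambda>_. 0) W k 0" using assms[of k] Vf_nonneg[of "\<lambda>_. 0" T W k 0] by simp
    then show ?thesis using Uf_Suc[of T "\<lambda>_. 0" W k 0] by simp
  qed
  then have "Vf (\<lambda>k. W k 0) (\<lambda>l. Vf T (\<lambda>_. 0) W 0 (l + 1)) (\<lambda>k l. W (k + 0) (l + 1)) i j = Vf T (\<lambda>_. 0) W (i + 0) (j + 1)"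
    using UV_shift(1)[of T "\<lambda>_. 0" W 0 1 i j] by simp
  then show ?thesis by (simp add: pV_eq_Vf)
qed

text \<open>If the height is realised from the right column, raising the top boundary keeps it and
  can only lower the increment below, while \<open>pV\<close> stays under the increment for the
  raised boundary. If it is realised from the top row, the smaller top \<open>I'\<close> brings the
  height down for any column \<open>E'\<close>. With well chosen parameters the second alternative
  is improbable.\<close>

lemma pV_le_Vf_or:
  assumes nn: "\<And>k. 0 \<le> I k" "\<And>k. 0 \<le> I' k" "\<And>l. 0 \<le> E l" "\<And>l. 0 \<le> E' l" "\<And>k. 0 \<le> W k 0"
    and I: "\<And>k. I' k \<le> I k"
  shows "pV W m n \<le> Vf I E W m (Suc n) \<or> hgt I' E' W m (Suc n) \<le> hgt I E W m (Suc n)"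
proof -
  define T where "T k = I k + W k 0" for k
  have T: "\<And>k. W k 0 \<le> T k" "\<And>k. I k \<le> T k" using nn by (auto simp: T_def)
  have min: "hgt I E W i j = min (hgt I (\<lambda>_. 0) W i j) (hgt T E W i j)" for i j
    by (rule hgt_min) (use T nn in auto)
  show ?thesis
  proof (cases "hgt I (\<lambda>_. 0) W m (Suc n) \<le> hgt T E W m (Suc n)")
    case True
    have "hgt I' E' W m (Suc n) \<le> hgt I (\<lambda>_. 0) W m (Suc n)"
      by (rule hgt_mono) (use I nn in \<open>auto intro: sum_mono sum_nonneg\<close>)
    then show ?thesis using min[of m "Suc n"] True by simp
  next
    case False
    have "hgt I E W m (Suc (Suc n)) \<le> hgt T E W m (Suc (Suc n))" using min by simp
    then have "Vf T E W m (Suc n) \<le> Vf I E W m (Suc n)" using min[of m "Suc n"] False by (simp add: Vf_def)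
    moreover have "Vf T (\<lambda>_. 0) W m (Suc n) \<le> Vf T E W m (Suc n)" using UV_mono[of T T "\<lambda>_. 0" E W m "Suc n"] nn by simp
    ultimately show ?thesis using pV_eq_Vf_large_top[of W T m n, OF T(1)] by simp
  qed
qed

text \<open>The mirror image of \<open>pV_le_Vf_or\<close>: the column boundary is enlarged, and the
  heights are compared one row further down, because now the lower end of the increment decides
  which exit is used.\<close>

lemma Vf_le_pV_or:
  assumes nn: "\<And>k. 0 \<le> I k" "\<And>k. 0 \<le> I' k" "\<And>l. 0 \<le> E l" "\<And>k. 0 \<le> W k 0"
    and E: "\<And>l. E l \<le> E' l"
  shows "Vf I E W m (Suc n) \<le> pV W m n \<or> hgt I' E' W m (Suc (Suc n)) \<le> hgt I E W m (Suc (Suc n))"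
proof -
  define T where "T k = I k + I' k + W k 0" for k
  have T: "\<And>k. W k 0 \<le> T k" "\<And>k. I k \<le> T k" "\<And>k. I' k \<le> T k" using nn by (auto simp: T_def)
  have min: "hgt I E W i j = min (hgt I (\<lambda>_. 0) W i j) (hgt T E W i j)" for i j
    by (rule hgt_min) (use T nn in auto)
  show ?thesis
  proof (cases "hgt T E W m (Suc (Suc n)) \<le> hgt I (\<lambda>_. 0) W m (Suc (Suc n))")
    case True
    have "hgt I' E' W m (Suc (Suc n)) \<le> hgt T E W m (Suc (Suc n))"
      by (rule hgt_mono) (use E T in \<open>auto intro: sum_mono sum_nonneg\<close>)
    then show ?thesis using min[of m "Suc (Suc n)"] True by simp
  next
    case False
    have "hgt I E W m (Suc n) \<le> hgt I (\<lambda>_. 0) W m (Suc n)" using min by simp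
    then have "Vf I E W m (Suc n) \<le> Vf I (\<lambda>_. 0) W m (Suc n)" using min[of m "Suc (Suc n)"] False by (simp add: Vf_def)
    moreover have "Vf I (\<lambda>_. 0) W m (Suc n) \<le> Vf T (\<lambda>_. 0) W m (Suc n)" using UV_mono[of I T "\<lambda>_. 0" "\<lambda>_. 0" W m "Suc n"] T by simp
    ultimately show ?thesis using pV_eq_Vf_large_top[of W T m n, OF T(1)] by simp
  qed
qed

text \<open>Running the weights \<open>W\<close> through the \<open>b\<close>-field first and then through the two-type queue is
  the same as running the dual services \<open>R\<close>: this is what makes the queue construction stationary.\<close>
lemma two_type_cell:
  fixes A B W Qt v q R :: real
  assumes "0 \<le> v" "0 \<le> q" "0 \<le> B" "B \<le> R" "0 < v \<Longrightarrow> R = B"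
  shows "min (min (A + (Qt + max 0 (q - v))) B + min q v) W = min (min (A + Qt) R + q) (min (B + v) W)" (is ?A)
    and "max 0 (min (A + (Qt + max 0 (q - v))) B + min q v - W) =
       min (max 0 (min (A + Qt) R + q - min (B + v) W)) (max 0 (B + v - W))" (is ?B)
    and "max 0 (A + Qt - R) + max 0 (max 0 (min (A + Qt) R + q - min (B + v) W) - max 0 (B + v - W)) =
       max 0 (A + (Qt + max 0 (q - v)) - B)" (is ?C)
proof -
  define S where "S = A + Qt"
  define c where "c = min (S + max 0 (q - v)) B + min q v"
  \<comment> \<open>\<open>c\<close> is the total \<open>a\<close>-increment that enters the cell.
    Its truncation by \<open>B + v\<close>, the entering \<open>b\<close>-increment, shows that the
    \<open>a\<close>-field stays below the \<open>b\<close>-field.\<close>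
  have c: "c = min (min S R + q) (B + v)"
  proof (cases "v = 0")
    case True
    have "min (min S R + q) B = min (S + q) B"
      using assms(2,4) by (cases "S \<le> R") auto
    then show ?thesis using assms(2) True by (simp add: c_def)
  next
    case False
    then have "R = B" using assms(1,5) by auto
    then show ?thesis by (cases "q \<le> v"; cases "S \<le> B"; cases "S + (q - v) \<le> B") (auto simp: c_def)
  qed
  show ?A using c by (simp add: c_def S_def add.assoc min.assoc)
  have "max 0 (min x y - W) = min (max 0 (x - min y W)) (max 0 (y - W))" for x y :: real
    by (cases "y \<le> W"; cases "x \<le> y") auto
  then have B: "max 0 (c - W) = min (max 0 (min S R + q - min (B + v) W)) (max 0 (B + v - W))"
    unfolding c .
  then show ?B by (simp only: c_def S_def add.assoc)
  have "max 0 (max 0 (x - min y W) - max 0 (y - W)) = max 0 (x - y)" for x y :: real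
    by (cases "y \<le> W") auto
  then have "max 0 (max 0 (min S R + q - min (B + v) W) - max 0 (B + v - W)) = max 0 (min S R + q - (B + v))" .
  moreover have "max 0 (S - R) + max 0 (min S R + q - (B + v)) = max 0 (S + max 0 (q - v) - B)"
  proof (cases "v = 0")
    case True
    then show ?thesis using assms(2,4) by (cases "S \<le> R") auto
  next
    case False
    then have "R = B" using assms(1,5) by auto
    then show ?thesis by (cases "S \<le> B"; cases "q \<le> v") auto
  qed
  ultimately show ?C by (simp only: S_def add.assoc)
qed

section \<open>Marginals, box probabilities and transfer between probability spaces\<close>

lemma prodlaw_prob_space: "prodlaw P I X \<mu> \<Longrightarrow> prob_space P"
  by (simp add: prodlaw_def)

lemma prodlaw_measurable: "prodlaw P I X \<mu> \<Longrightarrow> i \<in> I \<Longrightarrow> X i \<in> borel_measurable P"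
  by (simp add: prodlaw_def)

lemma prodlaw_distr:
  assumes X: "prodlaw P I X \<mu>" and i: "i \<in> I"
  shows "distr P borel (X i) = \<mu> i"
proof -
  interpret product_prob_space \<mu> using X by (auto simp: prodlaw_def product_prob_space_def product_prob_space_axioms_def product_sigma_finite_def intro: prob_space_imp_sigma_finite)
  have fI: "finite I" using X by (auto simp: prodlaw_def)
  have c: "(\<lambda>f. f i) \<in> measurable (PiM I (\<lambda>_. borel :: real measure)) borel"
    using i by (rule measurable_component_singleton)
  have "distr P borel (X i) = distr (distr P (PiM I (\<lambda>_. borel)) (\<lambda>\<omega>. \<lambda>i\<in>I. X i \<omega>)) borel (\<lambda>f. f i)"
    by (subst distr_distr[OF c prodlaw_measurable_PiM[OF X]]) (use i in \<open>auto intro!: distr_cong simp: comp_def\<close>)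
  also have "\<dots> = distr (PiM I \<mu>) borel (\<lambda>f. f i)" using X by (simp add: prodlaw_def)
  also have "\<dots> = distr (PiM I \<mu>) (\<mu> i) (\<lambda>f. f i)" by (rule distr_cong) (use X in \<open>auto simp: prodlaw_def\<close>)
  also have "\<dots> = \<mu> i" by (rule distr_PiM_component) (use X i in \<open>auto simp: prodlaw_def\<close>)
  finally show ?thesis .
qed

lemma prodlaw_AE:
  assumes X: "prodlaw P I X \<mu>" and AE: "\<And>i. i \<in> I \<Longrightarrow> AE x in \<mu> i. Q i x"
    and m: "\<And>i. i \<in> I \<Longrightarrow> {x. Q i x} \<in> sets borel"
  shows "AE \<omega> in P. \<forall>i\<in>I. Q i (X i \<omega>)"
proof -
  have "AE \<omega> in P. Q i (X i \<omega>)" if i: "i \<in> I" for i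
  proof -
    have "AE x in distr P borel (X i). Q i x" unfolding prodlaw_distr[OF X i] by (rule AE[OF i])
    then show ?thesis using prodlaw_measurable[OF X i] m[OF i] by (subst (asm) AE_distr_iff) auto
  qed
  moreover have "finite I" using X by (simp add: prodlaw_def)
  ultimately show ?thesis by (simp add: AE_ball_countable countable_finite)
qed

lemma prodlaw_prob_box:
  assumes X: "prodlaw P I X \<mu>" and J: "J \<subseteq> I" and A: "\<And>i. i \<in> J \<Longrightarrow> A i \<in> sets borel"
  shows "measure P {\<omega>\<in>space P. \<forall>i\<in>J. X i \<omega> \<in> A i} = (\<Prod>i\<in>J. measure (\<mu> i) (A i))"
proof -
  have XJ: "prodlaw P J X \<mu>" by (rule prodlaw_subset[OF X J])
  interpret product_prob_space \<mu> using X by (auto simp: prodlaw_def product_prob_space_def product_prob_space_axioms_def product_sigma_finite_def intro: prob_space_imp_sigma_finite)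
  have fJ: "finite J" using XJ by (auto simp: prodlaw_def)
  interpret fp: finite_product_prob_space \<mu> J using fJ by unfold_locales
  have "measure (PiM J \<mu>) (Pi\<^sub>E J A) = (\<Prod>i\<in>J. measure (\<mu> i) (A i))"
    using A X by (intro fp.finite_measure_PiM_emb) (auto simp: prodlaw_def)
  moreover have "measure (PiM J \<mu>) (Pi\<^sub>E J A) = measure (distr P (PiM J (\<lambda>_. borel)) (\<lambda>\<omega>. \<lambda>i\<in>J. X i \<omega>)) (Pi\<^sub>E J A)"
    using XJ by (simp add: prodlaw_def)
  moreover have "\<dots> = measure P ((\<lambda>\<omega>. \<lambda>i\<in>J. X i \<omega>) -` Pi\<^sub>E J A \<inter> space P)"
    using fJ A by (intro measure_distr prodlaw_measurable_PiM[OF XJ] sets_PiM_I_finite) auto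
  moreover have "(\<lambda>\<omega>. \<lambda>i\<in>J. X i \<omega>) -` Pi\<^sub>E J A \<inter> space P = {\<omega>\<in>space P. \<forall>i\<in>J. X i \<omega> \<in> A i}"
    by (auto simp: PiE_iff)
  ultimately show ?thesis by simp
qed

lemma prodlaw_measure:
  assumes X: "prodlaw P I X \<mu>"
    and Q: "{f\<in>space (PiM I (\<lambda>_. borel :: real measure)). Q f} \<in> sets (PiM I (\<lambda>_. borel))"
  shows "measure P {\<omega>\<in>space P. Q (\<lambda>i\<in>I. X i \<omega>)} = measure (PiM I \<mu>) {f\<in>space (PiM I (\<lambda>_. borel :: real measure)). Q f}"
proof -
  have "measure (PiM I \<mu>) {f\<in>space (PiM I (\<lambda>_. borel :: real measure)). Q f} =
     measure (distr P (PiM I (\<lambda>_. borel)) (\<lambda>\<omega>. \<lambda>i\<in>I. X i \<omega>)) {f\<in>space (PiM I (\<lambda>_. borel :: real measure)). Q f}"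
    using X by (simp add: prodlaw_def)
  also have "\<dots> = measure P {\<omega>\<in>space P. Q (\<lambda>i\<in>I. X i \<omega>)}"
    by (subst measure_distr[OF prodlaw_measurable_PiM[OF X] Q])
      (auto intro!: arg_cong[where f="measure P"] simp: space_PiM)
  finally show ?thesis by simp
qed

lemma prodlaw_transfer:
  assumes "prodlaw P I X \<mu>" "prodlaw P' I X' \<mu>"
    "{f\<in>space (PiM I (\<lambda>_. borel :: real measure)). Q f} \<in> sets (PiM I (\<lambda>_. borel))"
  shows "measure P {\<omega>\<in>space P. Q (\<lambda>i\<in>I. X i \<omega>)} = measure P' {\<omega>\<in>space P'. Q (\<lambda>i\<in>I. X' i \<omega>)}"
  using prodlaw_measure[OF assms(1,3)] prodlaw_measure[OF assms(2,3)] by simp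

lemma prodlaw_PiM:
  assumes "finite I" "\<And>i. prob_space (\<mu> i)" "\<And>i. sets (\<mu> i) = sets borel"
  shows "prodlaw (PiM I \<mu>) I (\<lambda>i f. f i) \<mu>"
proof -
  have s: "sets (PiM I \<mu>) = sets (PiM I (\<lambda>_. borel))" by (rule sets_PiM_borel) (rule assms)
  have "distr (PiM I \<mu>) (PiM I (\<lambda>_. borel)) (\<lambda>\<omega>. \<lambda>i\<in>I. \<omega> i) = distr (PiM I \<mu>) (PiM I \<mu>) (\<lambda>\<omega>. \<omega>)"
    by (rule distr_cong) (use s in \<open>auto simp: space_PiM PiE_def extensional_restrict\<close>)
  moreover have "i \<in> I \<Longrightarrow> (\<lambda>f. f i) \<in> borel_measurable (PiM I \<mu>)" for i
    using measurable_component_singleton[of i I \<mu>] assms(3) by (simp cong: measurable_cong_sets)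
  ultimately show ?thesis using assms by (auto simp: prodlaw_def intro!: prob_space_PiM)
qed

lemma prodlaw_indep_vars:
  assumes M: "prob_space M" and X: "prob_space.indep_vars M (\<lambda>_. borel) X K" "I \<subseteq> K" "finite I" and ne: "I \<noteq> {}"
    and d: "\<And>i. i \<in> I \<Longrightarrow> distr M borel (X i) = \<mu> i"
    and \<mu>: "\<And>i. prob_space (\<mu> i)" "\<And>i. sets (\<mu> i) = sets borel"
  shows "prodlaw M I X \<mu>"
proof -
  interpret prob_space M by fact
  have i: "indep_vars (\<lambda>_. borel) X I" by (rule indep_vars_subset[OF X(1,2)])
  then have m: "\<And>i. i \<in> I \<Longrightarrow> X i \<in> borel_measurable M" by (auto simp: indep_vars_def)
  have "distr M (PiM I (\<lambda>_. borel)) (\<lambda>x. \<lambda>i\<in>I. X i x) = PiM I (\<lambda>i. distr M borel (X i))"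
    using indep_vars_iff_distr_eq_PiM'[of I X "\<lambda>_. borel"] ne m i by auto
  also have "\<dots> = PiM I \<mu>" by (rule PiM_cong) (use d in auto)
  finally show ?thesis using assms m by (auto simp: prodlaw_def)
qed

section \<open>One cell of the recursion acting on independent variables\<close>

context queue_family
begin

text \<open>One unit square: the two incoming increments are added, then the sum is served by the
  weight. Both outgoing increments keep the laws of the incoming ones and stay independent of the
  rest; the weight is used up.\<close>

lemma prodlaw_cell:
  assumes X: "prodlaw P I X \<mu>" and k: "t \<in> I" "c \<in> I" "w \<in> I" "t \<noteq> c" "t \<noteq> w" "c \<noteq> w"
    and ab: "0 < a" "a < b" "b \<le> 1" and \<mu>: "\<mu> t = \<nu> a" "\<mu> c = \<pi> a b" "\<mu> w = \<nu> b"
  shows "prodlaw P (I - {w}) (X(t := \<lambda>\<omega>. min (X t \<omega> + X c \<omega>) (X w \<omega>), c := \<lambda>\<omega>. max 0 (X t \<omega> + X c \<omega> - X w \<omega>))) \<mu>"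
proof -
  have pr: "prob_space (\<sigma> a b)" "prob_space (return borel (0 :: real))" "prob_space (\<nu> a)" "prob_space (\<pi> a b)" "prob_space (\<nu> b)"
    using ab by (auto intro!: prob_laws prob_space_return)
  have \<mu>pr: "\<And>i. prob_space (\<mu> i)" "\<And>i. sets (\<mu> i) = sets borel" using X by (auto simp: prodlaw_def)
  let ?X1 = "X(t := \<lambda>\<omega>. X t \<omega> + X c \<omega>, c := \<lambda>\<omega>. 0)"
  let ?\<mu>1 = "\<mu>(t := \<sigma> a b, c := return borel 0)"
  have "prodlaw P (insert c (insert t (I - {t, c}))) ?X1 ?\<mu>1"
    using prodlaw_pair_upd[OF X k(1,2,4), of t c "\<lambda>x y. (x + y, 0)" "\<sigma> a b" "return borel 0"]
      arrival_pair_upd[OF ab] k \<mu> pr by simp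
  then have 1: "prodlaw P (I - {c}) ?X1 ?\<mu>1" by (rule prodlaw_subset) (use k in auto)
  let ?X2 = "?X1(t := \<lambda>\<omega>. min (X t \<omega> + X c \<omega>) (X w \<omega>), c := \<lambda>\<omega>. max 0 (X t \<omega> + X c \<omega> - X w \<omega>))"
  let ?\<mu>2 = "?\<mu>1(t := \<nu> a, c := \<pi> a b)"
  have "prodlaw P (insert c (insert t (I - {c} - {t, w}))) ?X2 ?\<mu>2"
    using prodlaw_pair_upd[OF 1, of t w t c "\<lambda>S E. (min S E, max 0 (S - E))" "\<nu> a" "\<pi> a b"]
      queue_pair_upd[OF ab] k \<mu> pr by (simp add: fun_upd_twist)
  then have "prodlaw P (I - {w}) ?X2 ?\<mu>2" by (rule prodlaw_subset) (use k in auto)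
  then show ?thesis by (rule prodlaw_cong) (use k \<mu> \<mu>pr in auto)
qed

text \<open>Here the index of the weight is not given up but receives the dual service, which is
  distributed like a fresh weight and independent of both outgoing increments. The price is the
  noise at \<open>e\<close> and \<open>h\<close>.\<close>

lemma prodlaw_dual_cell:
  assumes X: "prodlaw P I X \<mu>" and k: "{t, c, w, e, h} \<subseteq> I" "distinct [t, c, w, e, h]"
    and a: "0 < a" "a < 1" and \<mu>: "\<mu> t = \<nu> a" "\<mu> c = \<pi> a 1" "\<mu> w = \<nu> 1" "\<mu> e = n 1" "\<mu> h = \<nu> 1"
  shows "prodlaw P (I - {e, h}) (X(t := \<lambda>\<omega>. min (X t \<omega> + X c \<omega>) (X w \<omega>), c := \<lambda>\<omega>. max 0 (X t \<omega> + X c \<omega> - X w \<omega>),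
     w := \<lambda>\<omega>. dual_service (X t \<omega>) (X c \<omega>) (X e \<omega>) (X h \<omega>))) \<mu>"
proof -
  have pr: "prob_space (\<sigma> a 1)" "prob_space (\<nu> a)" "prob_space (\<pi> a 1)" "prob_space (\<nu> 1)"
    using a by (auto intro!: prob_laws)
  have \<mu>pr: "\<And>i. prob_space (\<mu> i)" "\<And>i. sets (\<mu> i) = sets borel" using X by (auto simp: prodlaw_def)
  let ?R = "\<lambda>\<omega>. dual_service (X t \<omega>) (X c \<omega>) (X e \<omega>) (X h \<omega>)"
  let ?X1 = "X(t := \<lambda>\<omega>. X t \<omega> + X c \<omega>, c := ?R)"
  let ?\<mu>1 = "\<mu>(t := \<sigma> a 1, c := \<nu> 1)"
  have "prodlaw P (insert c (insert t (I - {t, c, e, h}))) ?X1 ?\<mu>1"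
    using prodlaw_quad_upd[OF X, of t c e h t c "\<lambda>B v \<epsilon> \<eta>. (B + v, dual_service B v \<epsilon> \<eta>)" "\<sigma> a 1" "\<nu> 1"]
      dual_service_quad_upd[of a 1] a k \<mu> pr by simp
  then have 1: "prodlaw P (I - {e, h}) ?X1 ?\<mu>1" by (rule prodlaw_subset) (use k in auto)
  let ?X2 = "?X1(t := \<lambda>\<omega>. min (X t \<omega> + X c \<omega>) (X w \<omega>), w := \<lambda>\<omega>. max 0 (X t \<omega> + X c \<omega> - X w \<omega>))"
  let ?\<mu>2 = "?\<mu>1(t := \<nu> a, w := \<pi> a 1)"
  have "prodlaw P (insert w (insert t (I - {e, h} - {t, w})))
     (?X1(t := \<lambda>\<omega>. fst (min (?X1 t \<omega>) (?X1 w \<omega>), max 0 (?X1 t \<omega> - ?X1 w \<omega>)),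
          w := \<lambda>\<omega>. snd (min (?X1 t \<omega>) (?X1 w \<omega>), max 0 (?X1 t \<omega> - ?X1 w \<omega>)))) ?\<mu>2"
    by (rule prodlaw_pair_upd[OF 1]) (use queue_pair_upd[of a 1] a k \<mu> pr in auto)
  then have 2: "prodlaw P (I - {e, h}) ?X2 ?\<mu>2"
    by (rule prodlaw_cong[OF prodlaw_subset]) (use k \<mu>pr pr in auto)
  \<comment> \<open>The two updates leave the dual service at \<open>c\<close> and the new column
    entry at \<open>w\<close>; exchanging the names puts both in their proper places.\<close>
  let ?g = "\<lambda>r. if r = c then w else if r = w then c else r"
  have "prodlaw P (I - {e, h}) (\<lambda>r. ?X2 (?g r)) (\<lambda>r. ?\<mu>2 (?g r))"
    by (rule prodlaw_reindex[OF 2]) (use k in \<open>auto simp: inj_on_def\<close>)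
  then show ?thesis by (rule prodlaw_cong) (use k \<mu> \<mu>pr in auto)
qed

end

section \<open>Stationary systems and the two-type law\<close>

text \<open>Indices of all random variables in play: top row, rightmost column and cells of the array of the
  \<open>b\<close>-field; top row and rightmost column of the auxiliary array with parameter \<open>a\<close>; the noise for the dual
  services; and the initial queue length.\<close>
datatype reg = Top nat | Col nat | Cell nat nat | ATop nat | ACol nat | Eps nat nat | Eta nat nat | Bot

definition sys :: "(nat \<Rightarrow> 'a \<Rightarrow> real) \<Rightarrow> (nat \<Rightarrow> 'a \<Rightarrow> real) \<Rightarrow> (nat \<Rightarrow> nat \<Rightarrow> 'a \<Rightarrow> real) \<Rightarrow> reg \<Rightarrow> 'a \<Rightarrow> real" where
  "sys B v W r = (case r of Top k \<Rightarrow> B k | Col l \<Rightarrow> v l | Cell k l \<Rightarrow> W k l | _ \<Rightarrow> (\<lambda>_. 0))"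

definition rect :: "nat \<Rightarrow> nat \<Rightarrow> reg set" where
  "rect m N = Top ` {..<m} \<union> Col ` {..<N} \<union> (\<lambda>(k, l). Cell k l) ` ({..<m} \<times> {..<N})"

lemma rect_iff[simp]: "Top k \<in> rect m N \<longleftrightarrow> k < m" "Col l \<in> rect m N \<longleftrightarrow> l < N" "Cell k l \<in> rect m N \<longleftrightarrow> k < m \<and> l < N"
  "ATop k \<notin> rect m N" "ACol k \<notin> rect m N" "Eps k l \<notin> rect m N" "Eta k l \<notin> rect m N" "Bot \<notin> rect m N"
  by (auto simp: rect_def)

lemma finite_rect[simp]: "finite (rect m N)"
  by (simp add: rect_def)

context queue_family
begin

definition laws :: "real \<Rightarrow> reg \<Rightarrow> real measure" where
  "laws a r = (case r of Top k \<Rightarrow> \<nu> a | Col l \<Rightarrow> \<pi> a 1 | _ \<Rightarrow> \<nu> 1)"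

text \<open>Only boundary and weights are mentioned; stationarity of the interior increments is a
  consequence, drawn in \<open>stat_shift\<close>.\<close>

definition stat :: "real \<Rightarrow> nat \<Rightarrow> nat \<Rightarrow> 'a measure \<Rightarrow> (nat \<Rightarrow> 'a \<Rightarrow> real) \<Rightarrow> (nat \<Rightarrow> 'a \<Rightarrow> real) \<Rightarrow> (nat \<Rightarrow> nat \<Rightarrow> 'a \<Rightarrow> real) \<Rightarrow> bool" where
  "stat a m N P B v W \<longleftrightarrow> prodlaw P (rect m N) (sys B v W) (laws a)"

lemma laws_prob: assumes "0 < a" "a < 1" shows "prob_space (laws a r)" "sets (laws a r) = sets borel"
  using assms by (auto simp: laws_def split: reg.split intro!: prob_laws)

abbreviation UF where "UF B v W i j \<omega> \<equiv> Uf (\<lambda>k. B k \<omega>) (\<lambda>l. v l \<omega>) (\<lambda>k l. W k l \<omega>) i j"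
abbreviation VF where "VF B v W i j \<omega> \<equiv> Vf (\<lambda>k. B k \<omega>) (\<lambda>l. v l \<omega>) (\<lambda>k l. W k l \<omega>) i j"

text \<open>The first column is swept downwards cell by cell. In \<open>X j\<close> the register
  \<open>Top 0\<close> carries the horizontal increment in row \<open>j\<close>, and the column
  registers above row \<open>j\<close> already hold the increments of the next column.\<close>

lemma stat_shift_col:
  assumes a: "0 < a" "a < 1" and S: "stat a (Suc m) N P B v W"
  shows "stat a m N P (\<lambda>k. B (Suc k)) (\<lambda>l. VF B v W 1 l) (\<lambda>k l. W (Suc k) l)"
proof -
  define X where "X j r = (case r of Top k \<Rightarrow> if k = 0 then UF B v W 0 j else B k
     | Col l \<Rightarrow> if l < j then VF B v W 1 l else v l | Cell k l \<Rightarrow> W k l | _ \<Rightarrow> (\<lambda>_. 0))" for j r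
  have "prodlaw P (rect (Suc m) N - Cell 0 ` {..<j}) (X j) (laws a)" if "j \<le> N" for j
    using that
  proof (induction j)
    case 0
    show ?case using S unfolding stat_def
      by (rule prodlaw_cong[OF prodlaw_subset]) (auto simp: X_def sys_def laws_prob[OF a] split: reg.split)
  next
    case (Suc j)
    have IH: "prodlaw P (rect (Suc m) N - Cell 0 ` {..<j}) (X j) (laws a)" using Suc by simp
    have "prodlaw P (rect (Suc m) N - Cell 0 ` {..<j} - {Cell 0 j})
      ((X j)(Top 0 := \<lambda>\<omega>. min (X j (Top 0) \<omega> + X j (Col j) \<omega>) (X j (Cell 0 j) \<omega>),
         Col j := \<lambda>\<omega>. max 0 (X j (Top 0) \<omega> + X j (Col j) \<omega> - X j (Cell 0 j) \<omega>))) (laws a)"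
      using Suc.prems a by (intro prodlaw_cell[OF IH, where a=a and b=1]) (auto simp: laws_def)
    then show ?case
      by (rule prodlaw_cong[OF prodlaw_subset])
        (auto simp: X_def Uf_Suc Vf_Suc laws_prob[OF a] split: reg.split)
  qed
  then have 1: "prodlaw P (rect (Suc m) N - Cell 0 ` {..<N}) (X N) (laws a)" by simp
  define g where "g r = (case r of Top k \<Rightarrow> Top (Suc k) | Col l \<Rightarrow> Col l | Cell k l \<Rightarrow> Cell (Suc k) l | _ \<Rightarrow> r)" for r
  have "prodlaw P (rect m N) (\<lambda>r. X N (g r)) (\<lambda>r. laws a (g r))"
  proof (rule prodlaw_reindex[OF 1])
    show "inj_on g (rect m N)" by (auto simp: inj_on_def g_def split: reg.splits)
    show "g ` rect m N \<subseteq> rect (Suc m) N - Cell 0 ` {..<N}" by (auto simp: g_def rect_def)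
  qed
  then show ?thesis unfolding stat_def
    by (rule prodlaw_cong) (auto simp: X_def sys_def g_def laws_def laws_prob[OF a, unfolded laws_def] split: reg.splits)
qed

lemma stat_shift_row:
  assumes a: "0 < a" "a < 1" and S: "stat a m (Suc N) P B v W"
  shows "stat a m N P (\<lambda>k. UF B v W k 1) (\<lambda>l. v (Suc l)) (\<lambda>k l. W k (Suc l))"
proof -
  define X where "X i r = (case r of Top k \<Rightarrow> if k < i then UF B v W k 1 else B k
     | Col l \<Rightarrow> if l = 0 then VF B v W i 0 else v l | Cell k l \<Rightarrow> W k l | _ \<Rightarrow> (\<lambda>_. 0))" for i r
  let ?C = "\<lambda>i. (\<lambda>k. Cell k 0) ` {..<i}"
  have "prodlaw P (rect m (Suc N) - ?C i) (X i) (laws a)" if "i \<le> m" for i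
    using that
  proof (induction i)
    case 0
    show ?case using S unfolding stat_def
      by (rule prodlaw_cong[OF prodlaw_subset]) (auto simp: X_def sys_def laws_prob[OF a] split: reg.split)
  next
    case (Suc i)
    have IH: "prodlaw P (rect m (Suc N) - ?C i) (X i) (laws a)" using Suc by simp
    have "prodlaw P (rect m (Suc N) - ?C i - {Cell i 0})
      ((X i)(Top i := \<lambda>\<omega>. min (X i (Top i) \<omega> + X i (Col 0) \<omega>) (X i (Cell i 0) \<omega>),
         Col 0 := \<lambda>\<omega>. max 0 (X i (Top i) \<omega> + X i (Col 0) \<omega> - X i (Cell i 0) \<omega>))) (laws a)"
      using Suc.prems a by (intro prodlaw_cell[OF IH, where a=a and b=1]) (auto simp: laws_def)
    then show ?case
      by (rule prodlaw_cong[OF prodlaw_subset])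
        (auto simp: X_def Uf_Suc Vf_Suc laws_prob[OF a] split: reg.split)
  qed
  then have 1: "prodlaw P (rect m (Suc N) - ?C m) (X m) (laws a)" by simp
  define g where "g r = (case r of Top k \<Rightarrow> Top k | Col l \<Rightarrow> Col (Suc l) | Cell k l \<Rightarrow> Cell k (Suc l) | _ \<Rightarrow> r)" for r
  have "prodlaw P (rect m N) (\<lambda>r. X m (g r)) (\<lambda>r. laws a (g r))"
  proof (rule prodlaw_reindex[OF 1])
    show "inj_on g (rect m N)" by (auto simp: inj_on_def g_def split: reg.splits)
    show "g ` rect m N \<subseteq> rect m (Suc N) - ?C m" by (auto simp: g_def rect_def)
  qed
  then show ?thesis unfolding stat_def
    by (rule prodlaw_cong) (auto simp: X_def sys_def g_def laws_def rect_def laws_prob[OF a, unfolded laws_def] split: reg.splits)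
qed

lemma stat_shift:
  assumes a: "0 < a" "a < 1" and S: "stat a M N P B v W"
  shows "i0 + m = M \<Longrightarrow> j0 + n' = N \<Longrightarrow>
    stat a m n' P (\<lambda>k. UF B v W (k + i0) j0) (\<lambda>l. VF B v W i0 (l + j0)) (\<lambda>k l. W (k + i0) (l + j0))"
proof (induction i0 arbitrary: m)
  case 0
  show ?case using 0(2)
  proof (induction j0 arbitrary: n')
    case 0
    then show ?case using S \<open>0 + m = M\<close> by simp
  next
    case (Suc j0)
    from Suc.IH[of "Suc n'"] Suc.prems
    have "stat a m (Suc n') P (\<lambda>k. UF B v W (k + 0) j0) (\<lambda>l. VF B v W 0 (l + j0)) (\<lambda>k l. W (k + 0) (l + j0))" by simp
    moreover have "Uf (\<lambda>k. UF B v W k j0 \<omega>) (\<lambda>l. v (l + j0) \<omega>) (\<lambda>k l. W k (l + j0) \<omega>) k (Suc 0) = UF B v W k (Suc j0) \<omega>" for k \<omega>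
      using UV_shift(2)[of "\<lambda>k. B k \<omega>" "\<lambda>l. v l \<omega>" "\<lambda>k l. W k l \<omega>" 0 j0 k 1] by simp
    ultimately show ?case using stat_shift_row[OF a, of m n' P "\<lambda>k. UF B v W k j0" "\<lambda>l. v (l + j0)" "\<lambda>k l. W k (l + j0)"] by simp
  qed
next
  case (Suc i0)
  from Suc.IH[of "Suc m"] Suc.prems
  have "stat a (Suc m) n' P (\<lambda>k. UF B v W (k + i0) j0) (\<lambda>l. VF B v W i0 (l + j0)) (\<lambda>k l. W (k + i0) (l + j0))" by simp
  moreover have "Vf (\<lambda>k. UF B v W (k + i0) j0 \<omega>) (\<lambda>l. VF B v W i0 (l + j0) \<omega>) (\<lambda>k l. W (k + i0) (l + j0) \<omega>) (Suc 0) l = VF B v W (Suc i0) (l + j0) \<omega>" for l \<omega>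
    using UV_shift(1)[of "\<lambda>k. B k \<omega>" "\<lambda>l. v l \<omega>" "\<lambda>k l. W k l \<omega>" i0 j0 1 l] by simp
  ultimately show ?case using stat_shift_col[OF a, of m n' P "\<lambda>k. UF B v W (k + i0) j0" "\<lambda>l. VF B v W i0 (l + j0)" "\<lambda>k l. W (k + i0) (l + j0)"] by simp
qed

end

text \<open>Pathwise core of the construction. Inside a column \<open>q\<close> is a queue run
  upwards from row \<open>N\<close>, fed by \<open>qt\<close> and served by \<open>vb\<close>; its
  departures are the vertical increments of the \<open>a\<close>-field. The first claim says that
  \<open>q\<close> also evolves from column to column as a queue, with arrivals \<open>ua\<close>
  and services \<open>ub\<close>. It is proved from the bottom row upwards with
  \<open>two_type_cell\<close> as the step, and it is what makes the departures of the separate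
  columns fit into one field.\<close>

lemma two_type_queue:
  fixes ua qt ub vb R W q :: "nat \<Rightarrow> nat \<Rightarrow> real"
  assumes ub: "\<And>i j. ub i (Suc j) = min (ub i j + vb i j) (W i j)"
    and vb: "\<And>i j. vb (Suc i) j = max 0 (ub i j + vb i j - W i j)"
    and ua: "\<And>i j. ua i (Suc j) = min (ua i j + qt i j) (R i j)"
    and qt: "\<And>i j. qt (Suc i) j = max 0 (ua i j + qt i j - R i j)"
    and q: "\<And>i j. j < N \<Longrightarrow> q i j = qt i j + max 0 (q i (Suc j) - vb i j)"
    and qN: "\<And>i. q (Suc i) N = max 0 (ua i N + q i N - ub i N)"
    and nn: "\<And>i. i < m \<Longrightarrow> 0 \<le> ub i 0" "\<And>j. j < N \<Longrightarrow> 0 \<le> vb 0 j" "\<And>i j. i < m \<Longrightarrow> j < N \<Longrightarrow> 0 \<le> W i j"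
      "\<And>j. j < N \<Longrightarrow> 0 \<le> qt 0 j" "0 \<le> q 0 N"
    and R: "\<And>i j. i < m \<Longrightarrow> j < N \<Longrightarrow> 0 \<le> ub i j \<Longrightarrow> ub i j \<le> R i j"
      "\<And>i j. i < m \<Longrightarrow> j < N \<Longrightarrow> 0 < vb i j \<Longrightarrow> R i j = ub i j"
  shows "\<And>i j. i < m \<Longrightarrow> j \<le> N \<Longrightarrow> q (Suc i) j = max 0 (ua i j + q i j - ub i j)"
    and "\<And>i j. i \<le> m \<Longrightarrow> j < N \<Longrightarrow> Vf (\<lambda>k. min (ua k 0 + q k 0) (ub k 0)) (\<lambda>l. min (q 0 (Suc l)) (vb 0 l)) W i j = min (q i (Suc j)) (vb i j)"
    and "\<And>i j. i \<le> m \<Longrightarrow> j < N \<Longrightarrow> 0 \<le> vb i j" "\<And>i j. i \<le> m \<Longrightarrow> j < N \<Longrightarrow> 0 \<le> qt i j" "\<And>i j. i \<le> m \<Longrightarrow> j \<le> N \<Longrightarrow> 0 \<le> q i j"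
proof -
  show vb0: "0 \<le> vb i j" if "i \<le> m" "j < N" for i j using that nn by (cases i) (auto simp: vb)
  show qt0: "0 \<le> qt i j" if "i \<le> m" "j < N" for i j using that nn by (cases i) (auto simp: qt)
  have ub0: "0 \<le> ub i j" if "i < m" "j \<le> N" for i j using that
  proof (induction j)
    case (Suc j)
    then have "0 \<le> ub i j + vb i j" "0 \<le> W i j" using vb0[of i j] nn(3)[of i j] by auto
    then show ?case by (simp add: ub)
  qed (use nn in auto)
  have qN0: "0 \<le> q i N" for i by (cases i) (auto simp: qN nn)
  show q0: "0 \<le> q i j" if "i \<le> m" "j \<le> N" for i j
    using that(2) qN0[of i] q[of j i] qt0[OF that(1), of j] by (cases "j = N") auto
  show h: "q (Suc i) j = max 0 (ua i j + q i j - ub i j)" if i: "i < m" and j: "j \<le> N" for i j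
    using j
  proof (induction rule: inc_induct)
    case base
    show ?case by (rule qN)
  next
    case (step j)
    have IH: "q (Suc i) (Suc j) = max 0 (ua i (Suc j) + q i (Suc j) - ub i (Suc j))" using step by simp
    have "q (Suc i) j = qt (Suc i) j + max 0 (q (Suc i) (Suc j) - vb (Suc i) j)" using step by (intro q) auto
    also have "\<dots> = max 0 (ua i j + qt i j - R i j) + max 0 (max 0 (min (ua i j + qt i j) (R i j) + q i (Suc j) - min (ub i j + vb i j) (W i j)) - max 0 (ub i j + vb i j - W i j))"
      unfolding IH by (simp add: qt vb ua ub)
    also have "\<dots> = max 0 (ua i j + (qt i j + max 0 (q i (Suc j) - vb i j)) - ub i j)"
      by (rule two_type_cell(3)) (use i step vb0[of i j] q0[of i "Suc j"] ub0[of i j] R[of i j] in auto)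
    also have "qt i j + max 0 (q i (Suc j) - vb i j) = q i j" using step q by simp
    finally show ?case .
  qed
  let ?T = "\<lambda>k. min (ua k 0 + q k 0) (ub k 0)" and ?E = "\<lambda>l. min (q 0 (Suc l)) (vb 0 l)"
  show "Vf ?T ?E W i j = min (q i (Suc j)) (vb i j)" if "i \<le> m" "j < N" for i j
    using that
  proof (induction i arbitrary: j)
    case 0
    show ?case by simp
  next
    case (Suc i)
    have V: "Vf ?T ?E W i j = min (q i (Suc j)) (vb i j)" if "j < N" for j using Suc that by simp
    have U: "Uf ?T ?E W i j = min (ua i j + q i j) (ub i j)" if "j \<le> N" for j using that
    proof (induction j)
      case 0
      show ?case by simp
    next
      case (Suc j)
      have "Uf ?T ?E W i (Suc j) = min (min (ua i j + (qt i j + max 0 (q i (Suc j) - vb i j))) (ub i j) + min (q i (Suc j)) (vb i j)) (W i j)"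
        using Suc V[of j] q[of j i] by (simp add: Uf_Suc)
      also have "\<dots> = min (min (ua i j + qt i j) (R i j) + q i (Suc j)) (min (ub i j + vb i j) (W i j))"
        by (rule two_type_cell(1)) (use \<open>Suc i \<le> m\<close> Suc.prems vb0[of i j] q0[of i "Suc j"] ub0[of i j] R[of i j] in auto)
      finally show ?case by (simp add: ua ub)
    qed
    have "Vf ?T ?E W (Suc i) j = max 0 (min (ua i j + (qt i j + max 0 (q i (Suc j) - vb i j))) (ub i j) + min (q i (Suc j)) (vb i j) - W i j)"
      using Suc V[of j] U[of j] q[of j i] by (simp add: Vf_Suc)
    also have "\<dots> = min (max 0 (min (ua i j + qt i j) (R i j) + q i (Suc j) - min (ub i j + vb i j) (W i j))) (max 0 (ub i j + vb i j - W i j))"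
      by (rule two_type_cell(2)) (use Suc.prems vb0[of i j] q0[of i "Suc j"] ub0[of i j] R[of i j] in auto)
    also have "\<dots> = min (q (Suc i) (Suc j)) (vb (Suc i) j)"
      using Suc.prems by (subst h) (auto simp: ua ub vb)
    finally show ?case .
  qed
qed

section \<open>The coupled system with two parameters\<close>

definition rect2 :: "nat \<Rightarrow> nat \<Rightarrow> nat \<Rightarrow> reg set" where
  "rect2 i m N = Top ` {i..<m} \<union> ATop ` {i..<m} \<union> Col ` {..<N} \<union> ACol ` {..<N} \<union> {Bot} \<union>
     (\<lambda>(k, l). Cell k l) ` ({i..<m} \<times> {..<N}) \<union> (\<lambda>(k, l). Eps k l) ` ({i..<m} \<times> {..<N}) \<union> (\<lambda>(k, l). Eta k l) ` ({i..<m} \<times> {..<N})"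

lemma rect2_iff[simp]: "Top k \<in> rect2 i m N \<longleftrightarrow> i \<le> k \<and> k < m" "ATop k \<in> rect2 i m N \<longleftrightarrow> i \<le> k \<and> k < m"
  "Col l \<in> rect2 i m N \<longleftrightarrow> l < N" "ACol l \<in> rect2 i m N \<longleftrightarrow> l < N" "Bot \<in> rect2 i m N"
  "Cell k l \<in> rect2 i m N \<longleftrightarrow> i \<le> k \<and> k < m \<and> l < N" "Eps k l \<in> rect2 i m N \<longleftrightarrow> i \<le> k \<and> k < m \<and> l < N"
  "Eta k l \<in> rect2 i m N \<longleftrightarrow> i \<le> k \<and> k < m \<and> l < N"
  by (auto simp: rect2_def)

lemma finite_rect2[simp]: "finite (rect2 i m N)"
  by (simp add: rect2_def)

lemma mix_AE:
  assumes q: "0 \<le> q" "q \<le> 1" and D: "prob_space D" "sets D = sets borel"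
    and Q: "AE x in D. Q x" "Q 0" and m: "{x. Q x} \<in> sets borel"
  shows "AE x in mix q D. Q x"
proof -
  have m': "{x. \<not> Q x} \<in> sets borel" using borel_comp[OF m] by (simp add: Collect_neg_eq)
  have "emeasure (mix q D) {x. \<not> Q x} = (\<integral>\<^sup>+x. indicator {x. \<not> Q x} x \<partial>mix q D)"
    using m' by simp
  also have "\<dots> = ennreal q * (\<integral>\<^sup>+x. indicator {x. \<not> Q x} x \<partial>D)"
    using assms m' by (subst nn_integral_mix) auto
  also have "(\<integral>\<^sup>+x. indicator {x. \<not> Q x} x \<partial>D) = (\<integral>\<^sup>+x. 0 \<partial>D)"
    by (rule nn_integral_cong_AE) (use Q(1) in eventually_elim, auto)
  finally show ?thesis using m' by (intro AE_I[where N="{x. \<not> Q x}"]) auto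
qed

lemma measure_mix_pos:
  assumes q: "0 \<le> q" "q \<le> 1" and D: "prob_space D" "sets D = sets borel" and pos: "AE x in D. 0 < x"
  shows "measure (mix q D) {0<..} = q" "measure (mix q D) {0} = 1 - q"
proof -
  interpret prob_space D by fact
  have "(\<integral>\<^sup>+x. indicator {0<..} x \<partial>D) = (\<integral>\<^sup>+x. 1 \<partial>D)"
    by (rule nn_integral_cong_AE) (use pos in eventually_elim, auto)
  then have 1: "(\<integral>\<^sup>+x. indicator {0<..} x \<partial>D) = 1" by (simp add: emeasure_space_1)
  have "(\<integral>\<^sup>+x. indicator {0 :: real} x \<partial>D) = (\<integral>\<^sup>+x. 0 \<partial>D)"
    by (rule nn_integral_cong_AE) (use pos in eventually_elim, auto)
  then have 2: "(\<integral>\<^sup>+x. indicator {0 :: real} x \<partial>D) = 0" by simp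
  have "emeasure (mix q D) {0<..} = (\<integral>\<^sup>+x. indicator {0<..} x \<partial>mix q D)" by simp
  also have "\<dots> = ennreal q" using assms by (subst nn_integral_mix) (auto simp: 1)
  finally show "measure (mix q D) {0<..} = q" using q by (simp add: measure_def)
  have "emeasure (mix q D) {0} = (\<integral>\<^sup>+x. indicator {0} x \<partial>mix q D)" by simp
  also have "\<dots> = ennreal (1 - q)" using assms by (subst nn_integral_mix) (auto simp: 2)
  finally show "measure (mix q D) {0} = 1 - q" using q by (simp add: measure_def)
qed

context queue_family
begin

lemma laws_nonneg:
  shows "0 < a \<Longrightarrow> a \<le> 1 \<Longrightarrow> AE x in \<nu> a. 0 \<le> x"
    and "0 < a \<Longrightarrow> a < b \<Longrightarrow> b \<le> 1 \<Longrightarrow> AE x in \<pi> a b. 0 \<le> x"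
    and "0 < a \<Longrightarrow> a < b \<Longrightarrow> b \<le> 1 \<Longrightarrow> AE x in \<sigma> a b. 0 \<le> x"
proof -
  assume a: "0 < a" "a \<le> 1"
  have "AE x in U a. 0 \<le> x" using U_pos[OF a] by eventually_elim simp
  then show "AE x in \<nu> a. 0 \<le> x" unfolding \<nu>_def using a u_bounds[of a]
    by (intro mix_AE) (auto simp: U_prob)
next
  assume a: "0 < a" "a < b" "b \<le> 1"
  have V: "AE x in V a b. 0 \<le> x" using V_pos[OF a] by eventually_elim simp
  show "AE x in \<pi> a b. 0 \<le> x" unfolding \<pi>_def using a V
    by (intro mix_AE) (auto simp: V_prob)
  show "AE x in \<sigma> a b. 0 \<le> x" unfolding \<sigma>_def using a V s_bounds[of a b]
    by (intro mix_AE) (auto simp: V_prob)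
qed

lemma measure_\<pi>:
  assumes "0 < a" "a < b" "b \<le> 1"
  shows "measure (\<pi> a b) {0<..} = a / b" "measure (\<pi> a b) {0} = 1 - a / b"
  using assms by (auto simp: \<pi>_def V_prob V_pos intro!: measure_mix_pos)

definition laws2 :: "real \<Rightarrow> real \<Rightarrow> reg \<Rightarrow> real measure" where
  "laws2 a b r = (case r of Top k \<Rightarrow> \<nu> b | ATop k \<Rightarrow> \<nu> a | Col l \<Rightarrow> \<pi> b 1 | ACol l \<Rightarrow> \<pi> a 1 | Bot \<Rightarrow> \<pi> a b
     | Cell k l \<Rightarrow> \<nu> 1 | Eps k l \<Rightarrow> n 1 | Eta k l \<Rightarrow> \<nu> 1)"

lemma laws2_prob: assumes "0 < a" "a < b" "b < 1" shows "prob_space (laws2 a b r)" "sets (laws2 a b r) = sets borel"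
  using assms by (auto simp: laws2_def split: reg.split intro!: prob_laws n_prob)

end

locale two_type = queue_family +
  fixes a b :: real and m N :: nat and P :: "'w measure" and X :: "reg \<Rightarrow> 'w \<Rightarrow> real"
  assumes ab: "0 < a" "a < b" "b < 1" and X: "prodlaw P (rect2 0 m N) X (laws2 a b)"
begin

abbreviation "W k l \<equiv> X (Cell k l)"
definition "ub i j \<omega> = UF (\<lambda>k. X (Top k)) (\<lambda>l. X (Col l)) (\<lambda>k l. X (Cell k l)) i j \<omega>"
definition "vb i j \<omega> = VF (\<lambda>k. X (Top k)) (\<lambda>l. X (Col l)) (\<lambda>k l. X (Cell k l)) i j \<omega>"
definition "R i j \<omega> = dual_service (ub i j \<omega>) (vb i j \<omega>) (X (Eps i j) \<omega>) (X (Eta i j) \<omega>)"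
definition "ua i j \<omega> = UF (\<lambda>k. X (ATop k)) (\<lambda>l. X (ACol l)) R i j \<omega>"
definition "qt i j \<omega> = VF (\<lambda>k. X (ATop k)) (\<lambda>l. X (ACol l)) R i j \<omega>"
primrec Qb where
  "Qb 0 \<omega> = X Bot \<omega>"
| "Qb (Suc i) \<omega> = max 0 (ua i N \<omega> + Qb i \<omega> - ub i N \<omega>)"
text \<open>The queue is built upwards from the bottom row, so the recursion counts the number
  \<open>d\<close> of rows above row \<open>N\<close>.\<close>

primrec qd where
  "qd i 0 \<omega> = Qb i \<omega>"
| "qd i (Suc d) \<omega> = qt i (N - Suc d) \<omega> + max 0 (qd i d \<omega> - vb i (N - Suc d) \<omega>)"
definition "q i j \<omega> = qd i (N - j) \<omega>"

lemma rec:
  "ub i (Suc j) \<omega> = min (ub i j \<omega> + vb i j \<omega>) (W i j \<omega>)"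
  "vb (Suc i) j \<omega> = max 0 (ub i j \<omega> + vb i j \<omega> - W i j \<omega>)"
  "ua i (Suc j) \<omega> = min (ua i j \<omega> + qt i j \<omega>) (R i j \<omega>)"
  "qt (Suc i) j \<omega> = max 0 (ua i j \<omega> + qt i j \<omega> - R i j \<omega>)"
  "ub i 0 \<omega> = X (Top i) \<omega>" "vb 0 j \<omega> = X (Col j) \<omega>" "ua i 0 \<omega> = X (ATop i) \<omega>" "qt 0 j \<omega> = X (ACol j) \<omega>"
  by (simp_all add: ub_def vb_def ua_def qt_def Uf_Suc Vf_Suc)

lemma q_rec: "j < N \<Longrightarrow> q i j \<omega> = qt i j \<omega> + max 0 (q i (Suc j) \<omega> - vb i j \<omega>)" "q (Suc i) N \<omega> = max 0 (ua i N \<omega> + q i N \<omega> - ub i N \<omega>)"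
proof -
  assume "j < N"
  then have "N - j = Suc (N - Suc j)" "N - Suc (N - Suc j) = j" by auto
  then show "q i j \<omega> = qt i j \<omega> + max 0 (q i (Suc j) \<omega> - vb i j \<omega>)" by (simp add: q_def)
qed (simp add: q_def)

text \<open>At each cell the \<open>b\<close>-field is updated and its weight replaced by the dual
  service, which at once acts as the weight of the auxiliary \<open>a\<close>-array. Independence of
  the dual services from the outgoing \<open>b\<close>-increments keeps the \<open>b\<close>-column,
  the \<open>a\<close>-column and the queue \<open>Bot\<close> independent in every column.\<close>

lemma columns_aux:
  assumes "i \<le> m"
  shows "prodlaw P (rect2 i m N) (\<lambda>r. case r of Col l \<Rightarrow> vb i l | ACol l \<Rightarrow> qt i l | Bot \<Rightarrow> Qb i | _ \<Rightarrow> X r) (laws2 a b)"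
  using assms
proof (induction i)
  case 0
  show ?case by (rule prodlaw_cong[OF X]) (auto simp: rec laws2_prob[OF ab] split: reg.split)
next
  case (Suc i)
  define Z where "Z j r = (case r of Top k \<Rightarrow> if k = i then ub i j else X r | ATop k \<Rightarrow> if k = i then ua i j else X r
    | Col l \<Rightarrow> if l < j then vb (Suc i) l else vb i l | ACol l \<Rightarrow> if l < j then qt (Suc i) l else qt i l | Bot \<Rightarrow> Qb i | _ \<Rightarrow> X r)" for j r
  define I where "I j = rect2 i m N - Cell i ` {..<j} - Eps i ` {..<j} - Eta i ` {..<j}" for j
  have "prodlaw P (I j) (Z j) (laws2 a b)" if "j \<le> N" for j using that
  proof (induction j)
    case 0
    have "prodlaw P (rect2 i m N) (\<lambda>r. case r of Col l \<Rightarrow> vb i l | ACol l \<Rightarrow> qt i l | Bot \<Rightarrow> Qb i | _ \<Rightarrow> X r) (laws2 a b)"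
      using Suc by simp
    then show ?case
      by (rule prodlaw_cong[OF prodlaw_subset]) (auto simp: I_def Z_def rec laws2_prob[OF ab] split: reg.split)
  next
    case (Suc j)
    have IH: "prodlaw P (I j) (Z j) (laws2 a b)" using Suc by simp
    let ?Z1 = "(Z j)(Top i := \<lambda>\<omega>. min (Z j (Top i) \<omega> + Z j (Col j) \<omega>) (Z j (Cell i j) \<omega>),
       Col j := \<lambda>\<omega>. max 0 (Z j (Top i) \<omega> + Z j (Col j) \<omega> - Z j (Cell i j) \<omega>),
       Cell i j := \<lambda>\<omega>. dual_service (Z j (Top i) \<omega>) (Z j (Col j) \<omega>) (Z j (Eps i j) \<omega>) (Z j (Eta i j) \<omega>))"
    have 1: "prodlaw P (I j - {Eps i j, Eta i j}) ?Z1 (laws2 a b)"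
      by (rule prodlaw_dual_cell[OF IH, where a=b])
        (use Suc.prems \<open>Suc i \<le> m\<close> ab in \<open>auto simp: I_def laws2_def\<close>)
    have "prodlaw P (I j - {Eps i j, Eta i j} - {Cell i j}) (?Z1(ATop i := \<lambda>\<omega>. min (?Z1 (ATop i) \<omega> + ?Z1 (ACol j) \<omega>) (?Z1 (Cell i j) \<omega>),
       ACol j := \<lambda>\<omega>. max 0 (?Z1 (ATop i) \<omega> + ?Z1 (ACol j) \<omega> - ?Z1 (Cell i j) \<omega>))) (laws2 a b)"
      by (rule prodlaw_cell[OF 1, where a=a and b=1])
        (use Suc.prems \<open>Suc i \<le> m\<close> ab in \<open>auto simp: I_def laws2_def\<close>)
    then show ?case
      by (rule prodlaw_cong[OF prodlaw_subset])
        (auto simp: I_def Z_def rec R_def laws2_prob[OF ab] split: reg.splits)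
  qed
  then have 2: "prodlaw P (I N) (Z N) (laws2 a b)" by simp
  \<comment> \<open>At the foot of the column \<open>ATop i\<close> and \<open>Top i\<close> hold
    \<open>ua i N\<close> and \<open>ub i N\<close>, the arrival and the service of the queue in
    \<open>Bot\<close>.\<close>
  have "prodlaw P (I N - {Top i}) ((Z N)(ATop i := \<lambda>\<omega>. min (Z N (ATop i) \<omega> + Z N Bot \<omega>) (Z N (Top i) \<omega>),
      Bot := \<lambda>\<omega>. max 0 (Z N (ATop i) \<omega> + Z N Bot \<omega> - Z N (Top i) \<omega>))) (laws2 a b)"
    by (rule prodlaw_cell[OF 2, where a=a and b=b])
      (use Suc.prems ab in \<open>auto simp: I_def laws2_def\<close>)
  then show ?case
  proof (rule prodlaw_cong[OF prodlaw_subset])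
    show "rect2 (Suc i) m N \<subseteq> I N - {Top i}"
      by (auto simp: rect2_def I_def)
  qed (auto simp: Z_def laws2_prob[OF ab] split: reg.splits)
qed

lemma columns: "prodlaw P (rect2 m m N) (\<lambda>r. case r of Col l \<Rightarrow> vb m l | ACol l \<Rightarrow> qt m l | Bot \<Rightarrow> Qb m | _ \<Rightarrow> X r) (laws2 a b)"
  by (rule columns_aux) simp

primrec qtop where
  "qtop 0 \<omega> = q 0 0 \<omega>"
| "qtop (Suc k) \<omega> = max 0 (X (ATop k) \<omega> + qtop k \<omega> - X (Top k) \<omega>)"
definition "topa k \<omega> = min (X (ATop k) \<omega> + qtop k \<omega>) (X (Top k) \<omega>)"
definition "cola l \<omega> = min (q 0 (Suc l) \<omega>) (X (Col l) \<omega>)"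

lemma stat_b: "stat b m N P (\<lambda>k. X (Top k)) (\<lambda>l. X (Col l)) W"
  unfolding stat_def
  by (rule prodlaw_cong[OF prodlaw_subset[OF X]])
    (use ab in \<open>auto simp: sys_def laws_def laws2_def rect_def laws_prob[unfolded laws_def] split: reg.split\<close>)

text \<open>The queue is first run up the rightmost column: each departure is an
  \<open>a\<close>-increment, and each refill restores the law of the queue. It is then carried
  along the top row, where its departures are the horizontal \<open>a\<close>-increments. All of
  them are independent since every departure is independent of the queue that moves on.\<close>

lemma stat_a: "stat a m N P topa cola W"
proof -
  have ab1: "b \<le> 1" "a < 1" using ab by auto
  define Y where "Y d r = (case r of Bot \<Rightarrow> qd 0 d | Col l \<Rightarrow> if N - d \<le> l then cola l else X r | _ \<Rightarrow> X r)" for d r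
  define L where "L d r = (case r of Col l \<Rightarrow> if N - d \<le> l then \<pi> a 1 else \<pi> b 1 | _ \<Rightarrow> laws2 a b r)" for d r
  define I where "I d = rect2 0 m N - ACol ` {N - d..<N}" for d
  have Lp: "prob_space (L d r)" "sets (L d r) = sets borel" for d r
    using laws2_prob[OF ab] ab by (auto simp: L_def split: reg.splits intro!: prob_laws)
  have "prodlaw P (I d) (Y d) (L d)" if "d \<le> N" for d using that
  proof (induction d)
    case 0
    show ?case
      by (rule prodlaw_cong[OF prodlaw_subset[OF X]]) (use Lp in \<open>auto simp: I_def Y_def L_def laws2_def rec split: reg.splits\<close>)
  next
    case (Suc d)
    define l where "l = N - Suc d"
    have l: "N - d = Suc l" "l < N" "N - Suc d = l" "N - Suc l = d" using Suc.prems by (auto simp: l_def)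
    have IH: "prodlaw P (I d) (Y d) (L d)" using Suc by simp
    let ?Y1 = "(Y d)(Col l := \<lambda>\<omega>. fst (min (Y d Bot \<omega>) (Y d (Col l) \<omega>), max 0 (Y d Bot \<omega> - Y d (Col l) \<omega>)),
       Bot := \<lambda>\<omega>. snd (min (Y d Bot \<omega>) (Y d (Col l) \<omega>), max 0 (Y d Bot \<omega> - Y d (Col l) \<omega>)))"
    let ?L1 = "(L d)(Col l := \<pi> a 1, Bot := \<rho> a b)"
    have 1: "prodlaw P (insert Bot (insert (Col l) (I d - {Bot, Col l}))) ?Y1 ?L1"
    proof (rule prodlaw_pair_upd[OF IH])
      show "pair_upd (L d Bot) (L d (Col l)) (\<lambda>q v. (min q v, max 0 (q - v))) (\<pi> a 1) (\<rho> a b)"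
        using min_queue_pair_upd[OF ab] l by (simp add: L_def laws2_def)
    qed (use ab l in \<open>auto simp: I_def intro!: prob_laws\<close>)
    let ?Y2 = "?Y1(Bot := \<lambda>\<omega>. fst (?Y1 (ACol l) \<omega> + ?Y1 Bot \<omega>, 0 :: real), ACol l := \<lambda>\<omega>. snd (?Y1 (ACol l) \<omega> + ?Y1 Bot \<omega>, 0 :: real))"
    have "prodlaw P (insert (ACol l) (insert Bot (insert Bot (insert (Col l) (I d - {Bot, Col l})) - {ACol l, Bot})))
       ?Y2 (?L1(Bot := \<pi> a b, ACol l := return borel 0))"
    proof (rule prodlaw_pair_upd[OF 1])
      show "pair_upd (?L1 (ACol l)) (?L1 Bot) (\<lambda>x y. (x + y, 0)) (\<pi> a b) (return borel 0)"
        using refill_pair_upd[OF ab] by (simp add: L_def laws2_def)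
    qed (use ab l in \<open>auto simp: I_def intro!: prob_laws prob_space_return\<close>)
    then show ?case
    proof (rule prodlaw_cong[OF prodlaw_subset])
      show "I (Suc d) \<subseteq> insert (ACol l) (insert Bot (insert Bot (insert (Col l) (I d - {Bot, Col l})) - {ACol l, Bot}))"
        by (auto simp: I_def l)
      show "?Y2 r \<omega> = Y (Suc d) r \<omega>" if "r \<in> I (Suc d)" for r \<omega>
        using that l by (auto simp: I_def Y_def rec cola_def q_def split: reg.splits)
      show "(?L1(Bot := \<pi> a b, ACol l := return borel 0)) r = L (Suc d) r" if "r \<in> I (Suc d)" for r
        using that l by (auto simp: I_def L_def laws2_def split: reg.splits)
    qed (rule Lp)+
  qed
  then have 1: "prodlaw P (I N) (Y N) (L N)" by simp
  define Z where "Z k r = (case r of Bot \<Rightarrow> qtop k | ATop k' \<Rightarrow> if k' < k then topa k' else X r | Col l \<Rightarrow> cola l | _ \<Rightarrow> X r)" for k r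
  define J where "J k = rect2 0 m N - ACol ` {..<N} - Top ` {..<k}" for k
  have "prodlaw P (J k) (Z k) (L N)" if "k \<le> m" for k using that
  proof (induction k)
    case 0
    show ?case
      by (rule prodlaw_cong[OF prodlaw_subset[OF 1]]) (use Lp in \<open>auto simp: I_def J_def Y_def Z_def q_def split: reg.splits\<close>)
  next
    case (Suc k)
    have IH: "prodlaw P (J k) (Z k) (L N)" using Suc by simp
    have "prodlaw P (J k - {Top k}) ((Z k)(ATop k := \<lambda>\<omega>. min (Z k (ATop k) \<omega> + Z k Bot \<omega>) (Z k (Top k) \<omega>),
        Bot := \<lambda>\<omega>. max 0 (Z k (ATop k) \<omega> + Z k Bot \<omega> - Z k (Top k) \<omega>))) (L N)"
      by (rule prodlaw_cell[OF IH, where a=a and b=b])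
        (use Suc.prems ab in \<open>auto simp: J_def L_def laws2_def\<close>)
    then show ?case
      by (rule prodlaw_cong[OF prodlaw_subset])
        (use Lp in \<open>auto simp: J_def Z_def topa_def split: reg.splits\<close>)
  qed
  then have 2: "prodlaw P (J m) (Z m) (L N)" by simp
  define g where "g r = (case r of Top k \<Rightarrow> ATop k | _ \<Rightarrow> r)" for r
  have "prodlaw P (rect m N) (\<lambda>r. Z m (g r)) (\<lambda>r. L N (g r))"
  proof (rule prodlaw_reindex[OF 2])
    show "inj_on g (rect m N)" by (auto simp: inj_on_def g_def rect_def split: reg.splits)
    show "g ` rect m N \<subseteq> J m" by (auto simp: g_def rect_def J_def)
  qed
  then show ?thesis unfolding stat_def
    by (rule prodlaw_cong) (use laws_prob[of a] ab in \<open>auto simp: Z_def sys_def g_def L_def laws_def laws2_def rect_def split: reg.splits\<close>)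
qed

lemma X_nonneg: "AE \<omega> in P. \<forall>r\<in>rect2 0 m N. 0 \<le> X r \<omega>"
proof (rule prodlaw_AE[OF X])
  have *: "Q (laws2 a b r)" if "Q (\<nu> b)" "Q (\<nu> a)" "Q (\<pi> b 1)" "Q (\<pi> a 1)" "Q (\<pi> a b)" "Q (\<nu> 1)" "Q (n 1)" for Q r
    using that by (cases r) (simp_all add: laws2_def)
  show "AE x in laws2 a b r. 0 \<le> x" for r
    by (rule *) (use ab laws_nonneg n_nonneg[of 1] in auto)
qed simp

lemma two_type_VF:
  "AE \<omega> in P. (\<forall>j<N. VF topa cola W m j \<omega> = min (q m (Suc j) \<omega>) (vb m j \<omega>)) \<and>
     (\<forall>j<N. 0 \<le> vb m j \<omega> \<and> 0 \<le> qt m j \<omega>) \<and> (\<forall>j\<le>N. 0 \<le> q m j \<omega>)"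
  using X_nonneg
proof eventually_elim
  fix \<omega> assume X0: "\<forall>r\<in>rect2 0 m N. 0 \<le> X r \<omega>"
  have X0': "0 \<le> X r \<omega>" if "r \<in> rect2 0 m N" for r using X0 that by blast
  note tt = two_type_queue[of "\<lambda>i j. ub i j \<omega>" "\<lambda>i j. vb i j \<omega>" "\<lambda>i j. W i j \<omega>" "\<lambda>i j. ua i j \<omega>" "\<lambda>i j. qt i j \<omega>"
     "\<lambda>i j. R i j \<omega>" N "\<lambda>i j. q i j \<omega>" m]
  have R: "ub i j \<omega> \<le> R i j \<omega>" if "i < m" "j < N" "0 \<le> ub i j \<omega>" for i j
    using that X0'[of "Eps i j"] X0'[of "Eta i j"] by (auto simp: R_def dual_service_def)
  have R': "R i j \<omega> = ub i j \<omega>" if "i < m" "j < N" "0 < vb i j \<omega>" for i j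
    using that by (simp add: R_def dual_service_def)
  have prems: "0 \<le> ub i 0 \<omega>" if "i < m" for i using that X0' by (simp add: rec)
  have prems': "0 \<le> vb 0 j \<omega>" "0 \<le> qt 0 j \<omega>" if "j < N" for j using that X0' by (auto simp: rec)
  have q0: "0 \<le> q 0 N \<omega>" using X0'[of Bot] by (simp add: q_def)
  have W0: "0 \<le> W i j \<omega>" if "i < m" "j < N" for i j using that X0' by auto
  have h: "q (Suc i) j \<omega> = max 0 (ua i j \<omega> + q i j \<omega> - ub i j \<omega>)" if "i < m" "j \<le> N" for i j
    by (rule tt(1)) (fact rec q_rec R R' prems prems' q0 W0 that)+
  have V: "Vf (\<lambda>k. min (ua k 0 \<omega> + q k 0 \<omega>) (ub k 0 \<omega>)) (\<lambda>l. min (q 0 (Suc l) \<omega>) (vb 0 l \<omega>)) (\<lambda>k l. W k l \<omega>) m j =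
     min (q m (Suc j) \<omega>) (vb m j \<omega>)" if "j < N" for j
    by (rule tt(2)) (fact rec q_rec R R' prems prems' q0 W0 that order_refl)+
  have nn1: "0 \<le> vb m j \<omega>" if "j < N" for j
    by (rule tt(3)) (fact rec q_rec R R' prems prems' q0 W0 that order_refl)+
  have nn2: "0 \<le> qt m j \<omega>" if "j < N" for j
    by (rule tt(4)) (fact rec q_rec R R' prems prems' q0 W0 that order_refl)+
  note nn = nn1 nn2
  have nq: "0 \<le> q m j \<omega>" if "j \<le> N" for j
    by (rule tt(5)) (fact rec q_rec R R' prems prems' q0 W0 that order_refl)+
  have qtop: "qtop k \<omega> = q k 0 \<omega>" if "k \<le> m" for k using that
    by (induction k) (auto simp: h rec)
  have "VF topa cola W m j \<omega> = Vf (\<lambda>k. min (ua k 0 \<omega> + q k 0 \<omega>) (ub k 0 \<omega>)) (\<lambda>l. min (q 0 (Suc l) \<omega>) (vb 0 l \<omega>)) (\<lambda>k l. W k l \<omega>) m j" for j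
    by (rule Vf_cong) (auto simp: topa_def cola_def rec qtop)
  then show "(\<forall>j<N. VF topa cola W m j \<omega> = min (q m (Suc j) \<omega>) (vb m j \<omega>)) \<and>
     (\<forall>j<N. 0 \<le> vb m j \<omega> \<and> 0 \<le> qt m j \<omega>) \<and> (\<forall>j\<le>N. 0 \<le> q m j \<omega>)" using V nn nq by auto
qed

definition "cols r = (case r of Col l \<Rightarrow> vb m l | ACol l \<Rightarrow> qt m l | Bot \<Rightarrow> Qb m | _ \<Rightarrow> X r)"

lemma VF_Top: "VF (\<lambda>k. X (Top k)) (\<lambda>l. X (Col l)) W m j \<omega> = vb m j \<omega>"
  by (simp add: vb_def)

text \<open>In the bottom row the departure is the minimum of \<open>Qb m\<close> and the
  \<open>b\<close>-increment, so the event is a box for three independent variables: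
  \<open>a / b * b * (1 - b)\<close>.\<close>

lemma prob_lower_row:
  assumes N: "N = Suc (Suc N')"
    and m1: "VF topa cola W m (Suc N') \<in> borel_measurable P" and m2: "vb m N' \<in> borel_measurable P"
  shows "measure P {\<omega>\<in>space P. 0 < VF topa cola W m (Suc N') \<omega> \<and> VF (\<lambda>k. X (Top k)) (\<lambda>l. X (Col l)) W m N' \<omega> = 0} = a * (1 - b)"
proof -
  have P: "prob_space P" by (rule prodlaw_prob_space[OF X])
  interpret prob_space P by fact
  have C: "prodlaw P (rect2 m m N) cols (laws2 a b)" using columns by (simp add: cols_def[abs_def])
  note [measurable] = m1 m2
  have cm: "cols (Col N') \<in> borel_measurable P" "cols (Col (Suc N')) \<in> borel_measurable P"
    "cols (ACol (Suc N')) \<in> borel_measurable P" "cols Bot \<in> borel_measurable P"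
    by (rule prodlaw_measurable[OF C], simp add: N)+
  let ?J = "{Bot, Col (Suc N'), Col N'}"
  define A where "A r = (if r = Col N' then {0 :: real} else {0<..})" for r
  have box: "measure P {\<omega>\<in>space P. \<forall>r\<in>?J. cols r \<omega> \<in> A r} = (\<Prod>r\<in>?J. measure (laws2 a b r) (A r))"
    by (rule prodlaw_prob_box[OF C]) (auto simp: A_def N)
  have J: "{\<omega>\<in>space P. \<forall>r\<in>?J. cols r \<omega> \<in> A r} \<in> sets P"
  proof -
    have "{\<omega>\<in>space P. \<forall>r\<in>?J. cols r \<omega> \<in> A r} = (\<Inter>r\<in>?J. cols r -` A r \<inter> space P)" by auto
    also have "\<dots> \<in> sets P" by (intro sets.finite_INT) (auto simp: A_def intro!: measurable_sets[where A=borel] cm)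
    finally show ?thesis .
  qed
  have "measure P {\<omega>\<in>space P. 0 < VF topa cola W m (Suc N') \<omega> \<and> VF (\<lambda>k. X (Top k)) (\<lambda>l. X (Col l)) W m N' \<omega> = 0} =
      measure P {\<omega>\<in>space P. \<forall>r\<in>?J. cols r \<omega> \<in> A r}"
  proof (rule finite_measure_eq_AE)
    show "AE \<omega> in P. \<omega> \<in> {\<omega>\<in>space P. 0 < VF topa cola W m (Suc N') \<omega> \<and> VF (\<lambda>k. X (Top k)) (\<lambda>l. X (Col l)) W m N' \<omega> = 0} \<longleftrightarrow>
       \<omega> \<in> {\<omega>\<in>space P. \<forall>r\<in>?J. cols r \<omega> \<in> A r}"
      using two_type_VF
    proof eventually_elim
      fix \<omega> assume h: "(\<forall>j<N. VF topa cola W m j \<omega> = min (q m (Suc j) \<omega>) (vb m j \<omega>)) \<and>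
         (\<forall>j<N. 0 \<le> vb m j \<omega> \<and> 0 \<le> qt m j \<omega>) \<and> (\<forall>j\<le>N. 0 \<le> q m j \<omega>)"
      have "Suc N' < N" by (simp add: N)
      then have h1: "VF topa cola W m (Suc N') \<omega> = min (q m (Suc (Suc N')) \<omega>) (vb m (Suc N') \<omega>)" using h by blast
      have q1: "q m (Suc (Suc N')) \<omega> = Qb m \<omega>" unfolding N[symmetric] by (simp add: q_def)
      show "\<omega> \<in> {\<omega>\<in>space P. 0 < VF topa cola W m (Suc N') \<omega> \<and> VF (\<lambda>k. X (Top k)) (\<lambda>l. X (Col l)) W m N' \<omega> = 0} \<longleftrightarrow>
         \<omega> \<in> {\<omega>\<in>space P. \<forall>r\<in>?J. cols r \<omega> \<in> A r}"
        unfolding VF_Top mem_Collect_eq using h1 q1 by (auto simp: A_def cols_def)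
    qed
    show "{\<omega>\<in>space P. 0 < VF topa cola W m (Suc N') \<omega> \<and> VF (\<lambda>k. X (Top k)) (\<lambda>l. X (Col l)) W m N' \<omega> = 0} \<in> sets P"
      unfolding VF_Top by measurable
  qed (rule J)
  also have "\<dots> = a * (1 - b)"
    unfolding box using ab by (simp add: A_def laws2_def measure_\<pi>)
  finally show ?thesis .
qed

text \<open>If the \<open>b\<close>-increment in the bottom row is zero, nothing departs there and
  the queue one row above is \<open>qt + Qb\<close>, which is positive unless both parts vanish.
  Hence the probability is \<open>b * (1 - b)\<close> minus the same product times
  \<open>(1 - a) * (1 - a / b)\<close>.\<close>

lemma prob_upper_row:
  assumes N: "N = Suc (Suc N')"
    and m1: "VF topa cola W m N' \<in> borel_measurable P" and m2: "vb m (Suc N') \<in> borel_measurable P"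
  shows "measure P {\<omega>\<in>space P. 0 < VF topa cola W m N' \<omega> \<and> VF (\<lambda>k. X (Top k)) (\<lambda>l. X (Col l)) W m (Suc N') \<omega> = 0} = a * (1 - b) * (1 + b - a)"
proof -
  have P: "prob_space P" by (rule prodlaw_prob_space[OF X])
  interpret prob_space P by fact
  have C: "prodlaw P (rect2 m m N) cols (laws2 a b)" using columns by (simp add: cols_def[abs_def])
  note [measurable] = m1 m2
  have cm: "cols (Col N') \<in> borel_measurable P" "cols (Col (Suc N')) \<in> borel_measurable P"
    "cols (ACol (Suc N')) \<in> borel_measurable P" "cols Bot \<in> borel_measurable P"
    by (rule prodlaw_measurable[OF C], simp add: N)+
  let ?J = "{Col N', Col (Suc N')}" and ?K = "{Col N', Col (Suc N'), ACol (Suc N'), Bot}"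
  define A where "A r = (if r = Col N' then {0 :: real<..} else {0})" for r
  have box: "measure P {\<omega>\<in>space P. \<forall>r\<in>J. cols r \<omega> \<in> A r} = (\<Prod>r\<in>J. measure (laws2 a b r) (A r))"
    if "J \<subseteq> ?K" for J
    by (rule prodlaw_prob_box[OF C]) (use that in \<open>auto simp: A_def N\<close>)
  have Jm: "{\<omega>\<in>space P. \<forall>r\<in>J. cols r \<omega> \<in> A r} \<in> sets P" if "J \<subseteq> ?K" "J \<noteq> {}" for J
  proof -
    have "{\<omega>\<in>space P. \<forall>r\<in>J. cols r \<omega> \<in> A r} = (\<Inter>r\<in>J. cols r -` A r \<inter> space P)" using that by auto
    also have "\<dots> \<in> sets P" using that
      by (intro sets.finite_INT) (auto simp: A_def intro!: measurable_sets[where A=borel] cm intro: finite_subset[OF that(1)])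
    finally show ?thesis .
  qed
  have "measure P {\<omega>\<in>space P. 0 < VF topa cola W m N' \<omega> \<and> VF (\<lambda>k. X (Top k)) (\<lambda>l. X (Col l)) W m (Suc N') \<omega> = 0} =
      measure P ({\<omega>\<in>space P. \<forall>r\<in>?J. cols r \<omega> \<in> A r} - {\<omega>\<in>space P. \<forall>r\<in>?K. cols r \<omega> \<in> A r})"
  proof (rule finite_measure_eq_AE)
    show "AE \<omega> in P. \<omega> \<in> {\<omega>\<in>space P. 0 < VF topa cola W m N' \<omega> \<and> VF (\<lambda>k. X (Top k)) (\<lambda>l. X (Col l)) W m (Suc N') \<omega> = 0} \<longleftrightarrow>
       \<omega> \<in> {\<omega>\<in>space P. \<forall>r\<in>?J. cols r \<omega> \<in> A r} - {\<omega>\<in>space P. \<forall>r\<in>?K. cols r \<omega> \<in> A r}"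
      using two_type_VF
    proof eventually_elim
      fix \<omega> assume h: "(\<forall>j<N. VF topa cola W m j \<omega> = min (q m (Suc j) \<omega>) (vb m j \<omega>)) \<and>
         (\<forall>j<N. 0 \<le> vb m j \<omega> \<and> 0 \<le> qt m j \<omega>) \<and> (\<forall>j\<le>N. 0 \<le> q m j \<omega>)"
      have q1: "q m (Suc N') \<omega> = qt m (Suc N') \<omega> + max 0 (Qb m \<omega> - vb m (Suc N') \<omega>)"
      proof -
        have "Suc N' < N" by (simp add: N)
        moreover have "q m (Suc (Suc N')) \<omega> = Qb m \<omega>" unfolding N[symmetric] by (simp add: q_def)
        ultimately show ?thesis using q_rec(1)[of "Suc N'" m \<omega>] by simp
      qed
      have "N' < N" "Suc N' < N" using N by auto
      moreover have "N \<le> N" "q m N \<omega> = Qb m \<omega>" by (simp_all add: q_def)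
      ultimately have h1: "VF topa cola W m N' \<omega> = min (q m (Suc N') \<omega>) (vb m N' \<omega>)" "0 \<le> qt m (Suc N') \<omega>" "0 \<le> Qb m \<omega>"
        using h by auto
      show "\<omega> \<in> {\<omega>\<in>space P. 0 < VF topa cola W m N' \<omega> \<and> VF (\<lambda>k. X (Top k)) (\<lambda>l. X (Col l)) W m (Suc N') \<omega> = 0} \<longleftrightarrow>
         \<omega> \<in> {\<omega>\<in>space P. \<forall>r\<in>?J. cols r \<omega> \<in> A r} - {\<omega>\<in>space P. \<forall>r\<in>?K. cols r \<omega> \<in> A r}"
        unfolding VF_Top mem_Collect_eq Diff_iff using h1 q1 by (auto simp: A_def cols_def min_def max_def split: if_splits)
    qed
    show "{\<omega>\<in>space P. 0 < VF topa cola W m N' \<omega> \<and> VF (\<lambda>k. X (Top k)) (\<lambda>l. X (Col l)) W m (Suc N') \<omega> = 0} \<in> sets P"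
      unfolding VF_Top by measurable
    show "{\<omega>\<in>space P. \<forall>r\<in>?J. cols r \<omega> \<in> A r} - {\<omega>\<in>space P. \<forall>r\<in>?K. cols r \<omega> \<in> A r} \<in> sets P"
      by (intro sets.Diff Jm) auto
  qed
  also have "\<dots> = measure P {\<omega>\<in>space P. \<forall>r\<in>?J. cols r \<omega> \<in> A r} - measure P {\<omega>\<in>space P. \<forall>r\<in>?K. cols r \<omega> \<in> A r}"
    by (rule finite_measure_Diff[OF Jm Jm]) auto
  also have "\<dots> = b * (1 - b) - b * (1 - b) * (1 - a) * (1 - a / b)"
    using ab by (subst (1 2) box) (auto simp: A_def laws2_def measure_\<pi>)
  also have "\<dots> = a * (1 - b) * (1 + b - a)" using ab by (simp add: field_simps)
  finally show ?thesis .
qed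

end

section \<open>Concentration and comparison with stationary increments\<close>

lemma prodlaw_imp_indep_vars:
  assumes X: "prodlaw P I X \<mu>" and J: "J \<subseteq> I" "J \<noteq> {}"
  shows "prob_space.indep_vars P (\<lambda>_. borel) X J"
proof -
  interpret prob_space P by (rule prodlaw_prob_space[OF X])
  have XJ: "prodlaw P J X \<mu>" by (rule prodlaw_subset[OF X J(1)])
  have "PiM J \<mu> = PiM J (\<lambda>i. distr P borel (X i))"
    by (rule PiM_cong) (simp_all add: prodlaw_distr[OF XJ])
  then show ?thesis using XJ J(2)
    by (subst indep_vars_iff_distr_eq_PiM') (auto simp: prodlaw_def)
qed

lemma prodlaw_sum_moments:
  fixes D :: "real measure" and e v :: real
  assumes X: "prodlaw P I X \<mu>" and J: "J \<subseteq> I" and D: "\<And>j. j \<in> J \<Longrightarrow> \<mu> j = D" and sq: "integrable D (\<lambda>x. x\<^sup>2)"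
  defines "e \<equiv> (\<integral>x. x \<partial>D)" and "v \<equiv> (\<integral>x. (x - (\<integral>x. x \<partial>D))\<^sup>2 \<partial>D)"
  shows "integrable P (\<lambda>\<omega>. \<Sum>j\<in>J. X j \<omega> - e) \<and> integrable P (\<lambda>\<omega>. (\<Sum>j\<in>J. X j \<omega> - e)\<^sup>2) \<and>
    (\<integral>\<omega>. (\<Sum>j\<in>J. X j \<omega> - e) \<partial>P) = 0 \<and> (\<integral>\<omega>. (\<Sum>j\<in>J. X j \<omega> - e)\<^sup>2 \<partial>P) = card J * v"
proof -
  interpret prob_space P by (rule prodlaw_prob_space[OF X])
  have "finite J" using X J by (meson finite_subset prodlaw_def)
  then show ?thesis using J D
  proof (induction J rule: finite_induct)
    case empty
    show ?case by simp
  next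
    case (insert i J)
    let ?Y = "\<lambda>j \<omega>. X j \<omega> - e" and ?S = "\<lambda>\<omega>. \<Sum>j\<in>J. X j \<omega> - e"
    have iI: "i \<in> I" and \<mu>i: "\<mu> i = D" using insert by auto
    interpret D: prob_space D using X \<mu>i by (metis prodlaw_def)
    have sD: "sets D = sets borel" using X \<mu>i by (metis prodlaw_def)
    have Xm[measurable]: "X i \<in> borel_measurable P" by (rule prodlaw_measurable[OF X iI])
    have id: "(\<lambda>x. x) \<in> borel_measurable D" using sD by (simp add: measurable_ident_sets)
    have intD: "integrable D (\<lambda>x. x)" using id sq by (rule D.square_integrable_imp_integrable)
    have intD2: "integrable D (\<lambda>x. (x - e)\<^sup>2)"
      using sq intD by (simp add: power2_diff)
    have di: "distr P borel (X i) = D" using prodlaw_distr[OF X iI] \<mu>i by simp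
    have Y1: "integrable P (?Y i)" "(\<integral>\<omega>. ?Y i \<omega> \<partial>P) = 0"
    proof -
      have "integrable (distr P borel (X i)) (\<lambda>x. x - e)" unfolding di using intD by simp
      then show "integrable P (?Y i)" by (subst (asm) integrable_distr_eq) auto
      have "(\<integral>\<omega>. ?Y i \<omega> \<partial>P) = (\<integral>x. x - e \<partial>distr P borel (X i))" by (subst integral_distr) auto
      also have "\<dots> = 0" unfolding di using intD by (simp add: e_def D.prob_space)
      finally show "(\<integral>\<omega>. ?Y i \<omega> \<partial>P) = 0" .
    qed
    have Y2: "integrable P (\<lambda>\<omega>. (?Y i \<omega>)\<^sup>2)" "(\<integral>\<omega>. (?Y i \<omega>)\<^sup>2 \<partial>P) = v"
    proof -
      have "integrable (distr P borel (X i)) (\<lambda>x. (x - e)\<^sup>2)" unfolding di by (rule intD2)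
      then show "integrable P (\<lambda>\<omega>. (?Y i \<omega>)\<^sup>2)" by (subst (asm) integrable_distr_eq) auto
      have "(\<integral>\<omega>. (?Y i \<omega>)\<^sup>2 \<partial>P) = (\<integral>x. (x - e)\<^sup>2 \<partial>distr P borel (X i))" by (subst integral_distr) auto
      also have "\<dots> = v" unfolding di by (simp add: e_def v_def)
      finally show "(\<integral>\<omega>. (?Y i \<omega>)\<^sup>2 \<partial>P) = v" .
    qed
    have IH: "integrable P ?S" "integrable P (\<lambda>\<omega>. (?S \<omega>)\<^sup>2)" "(\<integral>\<omega>. ?S \<omega> \<partial>P) = 0" "(\<integral>\<omega>. (?S \<omega>)\<^sup>2 \<partial>P) = card J * v"
      using insert by auto
    have "indep_vars (\<lambda>_. borel) X (insert i J)" using insert by (intro prodlaw_imp_indep_vars[OF X]) auto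
    then have "indep_vars (\<lambda>_. borel) (\<lambda>j. (\<lambda>x. x - e) \<circ> X j) (insert i J)"
      by (rule indep_vars_compose) auto
    then have "indep_vars (\<lambda>_. borel) ?Y (insert i J)" by (simp add: comp_def)
    then have ind: "indep_var borel (?Y i) borel ?S" using insert by (intro indep_vars_sum) auto
    have prod: "integrable P (\<lambda>\<omega>. ?Y i \<omega> * ?S \<omega>)" "(\<integral>\<omega>. ?Y i \<omega> * ?S \<omega> \<partial>P) = 0"
      using indep_var_integrable[OF ind Y1(1) IH(1)] indep_var_lebesgue_integral[OF ind Y1(1) IH(1)] Y1 IH by auto
    have e1: "(\<Sum>j\<in>insert i J. X j \<omega> - e) = ?Y i \<omega> + ?S \<omega>" for \<omega> using insert by simp
    have e2: "(\<Sum>j\<in>insert i J. X j \<omega> - e)\<^sup>2 = (?Y i \<omega>)\<^sup>2 + (?S \<omega>)\<^sup>2 + 2 * (?Y i \<omega> * ?S \<omega>)" for \<omega>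
      unfolding e1 by (simp add: power2_sum)
    have "integrable P (\<lambda>\<omega>. ?Y i \<omega> + ?S \<omega>) \<and> integrable P (\<lambda>\<omega>. (?Y i \<omega>)\<^sup>2 + (?S \<omega>)\<^sup>2 + 2 * (?Y i \<omega> * ?S \<omega>)) \<and>
       (\<integral>\<omega>. ?Y i \<omega> + ?S \<omega> \<partial>P) = 0 \<and>
       (\<integral>\<omega>. (?Y i \<omega>)\<^sup>2 + (?S \<omega>)\<^sup>2 + 2 * (?Y i \<omega> * ?S \<omega>) \<partial>P) = real (card (insert i J)) * v"
    proof (intro conjI)
      show "integrable P (\<lambda>\<omega>. ?Y i \<omega> + ?S \<omega>)" using Y1 IH by (intro Bochner_Integration.integrable_add)
      show "integrable P (\<lambda>\<omega>. (?Y i \<omega>)\<^sup>2 + (?S \<omega>)\<^sup>2 + 2 * (?Y i \<omega> * ?S \<omega>))"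
        by (intro Bochner_Integration.integrable_add integrable_mult_right Y2 IH prod)
      show "(\<integral>\<omega>. ?Y i \<omega> + ?S \<omega> \<partial>P) = 0" using Bochner_Integration.integral_add[OF Y1(1) IH(1)] Y1 IH by simp
      have "(\<integral>\<omega>. (?Y i \<omega>)\<^sup>2 + (?S \<omega>)\<^sup>2 + 2 * (?Y i \<omega> * ?S \<omega>) \<partial>P) =
         (\<integral>\<omega>. (?Y i \<omega>)\<^sup>2 + (?S \<omega>)\<^sup>2 \<partial>P) + (\<integral>\<omega>. 2 * (?Y i \<omega> * ?S \<omega>) \<partial>P)"
        by (intro Bochner_Integration.integral_add Bochner_Integration.integrable_add integrable_mult_right Y2 IH prod)
      also have "(\<integral>\<omega>. (?Y i \<omega>)\<^sup>2 + (?S \<omega>)\<^sup>2 \<partial>P) = v + card J * v"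
        using Bochner_Integration.integral_add[OF Y2(1) IH(2)] Y2 IH by simp
      also have "(\<integral>\<omega>. 2 * (?Y i \<omega> * ?S \<omega>) \<partial>P) = 2 * 0"
        using prod(2) by (simp only: integral_mult_right_zero)
      finally show "(\<integral>\<omega>. (?Y i \<omega>)\<^sup>2 + (?S \<omega>)\<^sup>2 + 2 * (?Y i \<omega> * ?S \<omega>) \<partial>P) = real (card (insert i J)) * v"
        using insert by (simp add: algebra_simps)
    qed
    then show ?case unfolding e2[symmetric] unfolding e1[symmetric] .
  qed
qed

lemma prodlaw_chebyshev:
  fixes D :: "real measure"
  assumes X: "prodlaw P I X \<mu>" and J: "J \<subseteq> I" and D: "\<And>j. j \<in> J \<Longrightarrow> \<mu> j = D" and sq: "integrable D (\<lambda>x. x\<^sup>2)" and t: "0 < t"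
  shows "measure P {\<omega>\<in>space P. t \<le> \<bar>(\<Sum>j\<in>J. X j \<omega>) - card J * (\<integral>x. x \<partial>D)\<bar>} \<le> card J * (\<integral>x. (x - (\<integral>x. x \<partial>D))\<^sup>2 \<partial>D) / t\<^sup>2"
proof -
  interpret prob_space P by (rule prodlaw_prob_space[OF X])
  note m = prodlaw_sum_moments[OF X J D sq]
  have "measure P {\<omega>\<in>space P. \<bar>\<Sum>j\<in>J. X j \<omega> - (\<integral>x. x \<partial>D)\<bar> \<ge> t} \<le> (\<integral>\<omega>. (\<Sum>j\<in>J. X j \<omega> - (\<integral>x. x \<partial>D))\<^sup>2 \<partial>P) / t\<^sup>2"
    using m t by (intro second_moment_method) auto
  then show ?thesis using m by (simp add: sum_subtractf)
qed

lemma mix_moments: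
  assumes q: "0 \<le> q" "q \<le> 1" and D: "prob_space D" "sets D = sets borel" "AE x in D. 0 < x" and sq: "integrable D (\<lambda>x. x\<^sup>2)"
  shows "integrable (mix q D) (\<lambda>x. x\<^sup>2)" "(\<integral>x. x \<partial>mix q D) = q * (\<integral>x. x \<partial>D)"
proof -
  interpret D: prob_space D by fact
  have [measurable_cong]: "sets D = sets borel" by fact
  have "(\<integral>\<^sup>+x. ennreal (norm (x\<^sup>2)) \<partial>mix q D) = ennreal q * (\<integral>\<^sup>+x. ennreal (norm (x\<^sup>2)) \<partial>D)"
    using q D by (subst nn_integral_mix) auto
  also have "\<dots> < \<infinity>" using sq by (simp add: integrable_iff_bounded ennreal_mult_less_top)
  finally show "integrable (mix q D) (\<lambda>x. x\<^sup>2)" by (intro integrableI_bounded) auto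
  have iD: "integrable D (\<lambda>x. x)" by (rule D.square_integrable_imp_integrable[OF _ sq]) simp
  have nD: "AE x in D. 0 \<le> x" using D(3) by eventually_elim simp
  have "(\<integral>x. x \<partial>mix q D) = enn2real (\<integral>\<^sup>+x. ennreal x \<partial>mix q D)"
    by (rule integral_eq_nn_integral) (use mix_AE[OF q D(1,2) nD] in auto)
  also have "(\<integral>\<^sup>+x. ennreal x \<partial>mix q D) = ennreal q * (\<integral>\<^sup>+x. ennreal x \<partial>D)"
    using q D by (subst nn_integral_mix) auto
  also have "(\<integral>\<^sup>+x. ennreal x \<partial>D) = ennreal (\<integral>x. x \<partial>D)" by (rule nn_integral_eq_integral[OF iD nD])
  finally show "(\<integral>x. x \<partial>mix q D) = q * (\<integral>x. x \<partial>D)"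
    using q nD by (simp add: ennreal_mult'[symmetric] integral_nonneg_AE)
qed

lemma hgt_measurable:
  assumes "\<And>k. k < m \<Longrightarrow> B k \<in> borel_measurable M" "\<And>l. l < n \<Longrightarrow> v l \<in> borel_measurable M"
    "\<And>k l. k < m \<Longrightarrow> l < n \<Longrightarrow> W k l \<in> borel_measurable M"
  shows "i \<le> m \<Longrightarrow> j \<le> n \<Longrightarrow> (\<lambda>\<omega>. hgt (\<lambda>k. B k \<omega>) (\<lambda>l. v l \<omega>) (\<lambda>k l. W k l \<omega>) i j) \<in> borel_measurable M"
proof (induction i arbitrary: j)
  case 0
  have "(\<lambda>\<omega>. - (\<Sum>l<j. v l \<omega>)) \<in> borel_measurable M"
    using 0 assms by (intro borel_measurable_uminus borel_measurable_sum) auto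
  then show ?case by (simp add: hgt_0)
next
  case (Suc i j)
  show ?case using Suc.prems(2)
  proof (induction j)
    case 0
    have "(\<lambda>\<omega>. (\<Sum>k<Suc i. B k \<omega>)) \<in> borel_measurable M"
      using Suc assms by (intro borel_measurable_sum) auto
    then show ?case by simp
  next
    case (Suc j)
    have [measurable]: "(\<lambda>\<omega>. hgt (\<lambda>k. B k \<omega>) (\<lambda>l. v l \<omega>) (\<lambda>k l. W k l \<omega>) i (Suc j)) \<in> borel_measurable M"
      "(\<lambda>\<omega>. hgt (\<lambda>k. B k \<omega>) (\<lambda>l. v l \<omega>) (\<lambda>k l. W k l \<omega>) (Suc i) j) \<in> borel_measurable M" "W i j \<in> borel_measurable M"
      using Suc \<open>Suc i \<le> m\<close> \<open>\<And>j. i \<le> m \<Longrightarrow> j \<le> n \<Longrightarrow> _\<close> assms(3)[of i j] by auto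
    show ?case by simp
  qed
qed

lemma Vf_measurable:
  assumes "\<And>k. k < i \<Longrightarrow> B k \<in> borel_measurable M" "\<And>l. l \<le> j \<Longrightarrow> v l \<in> borel_measurable M"
    "\<And>k l. k < i \<Longrightarrow> l \<le> j \<Longrightarrow> W k l \<in> borel_measurable M"
  shows "(\<lambda>\<omega>. Vf (\<lambda>k. B k \<omega>) (\<lambda>l. v l \<omega>) (\<lambda>k l. W k l \<omega>) i j) \<in> borel_measurable M"
proof -
  have 1: "(\<lambda>\<omega>. hgt (\<lambda>k. B k \<omega>) (\<lambda>l. v l \<omega>) (\<lambda>k l. W k l \<omega>) i j') \<in> borel_measurable M" if "j' \<le> Suc j" for j'
    by (rule hgt_measurable[where m=i and n="Suc j"]) (use assms that in auto)
  have [measurable]: "(\<lambda>\<omega>. hgt (\<lambda>k. B k \<omega>) (\<lambda>l. v l \<omega>) (\<lambda>k l. W k l \<omega>) i j) \<in> borel_measurable M"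
    "(\<lambda>\<omega>. hgt (\<lambda>k. B k \<omega>) (\<lambda>l. v l \<omega>) (\<lambda>k l. W k l \<omega>) i (Suc j)) \<in> borel_measurable M"
    using 1[of j] 1[of "Suc j"] by auto
  show ?thesis unfolding Vf_def by measurable
qed

lemma pV_measurable:
  assumes "\<And>k l. k < i \<Longrightarrow> l \<le> Suc j \<Longrightarrow> W k l \<in> borel_measurable M"
  shows "(\<lambda>\<omega>. pV (\<lambda>k l. W k l \<omega>) i j) \<in> borel_measurable M"
  unfolding pV_eq_Vf using assms by (intro Vf_measurable[where v="\<lambda>_ _. 0" and W="\<lambda>k l. W k (Suc l)" and B="\<lambda>k. W k 0"]) auto

lemma pV_cong:
  assumes "\<And>k l. k < i \<Longrightarrow> l \<le> Suc j \<Longrightarrow> W k l = W' k l"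
  shows "pV W i j = pV W' i j"
  unfolding pV_eq_Vf by (rule Vf_cong) (use assms in auto)

text \<open>Here \<open>c a\<close> is the characteristic slope (columns per row) at parameter \<open>a\<close>: by \<open>flux_deriv\<close>,
  \<open>a\<close> is the critical point of the mean height \<open>\<lambda>a'. c a * E U\<^sup>a' - E V\<^sup>a'\<close> in direction \<open>c a\<close>.\<close>
locale queue_moments = queue_family +
  fixes c :: "real \<Rightarrow> real"
  assumes U_sq: "0 < a \<Longrightarrow> a < 1 \<Longrightarrow> integrable (U a) (\<lambda>x. x\<^sup>2)"
    and V_sq: "0 < a \<Longrightarrow> a < 1 \<Longrightarrow> integrable (V a 1) (\<lambda>x. x\<^sup>2)"
    and c_pos: "0 < a \<Longrightarrow> a < 1 \<Longrightarrow> 0 < c a"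
    and c_mono: "0 < a \<Longrightarrow> a < b \<Longrightarrow> b < 1 \<Longrightarrow> c a < c b"
    and c_cont: "continuous_on {0<..<1} c"
    and flux_deriv: "0 < a \<Longrightarrow> a < 1 \<Longrightarrow> \<exists>g'>0.
       ((\<lambda>a. u a * (\<integral>x. x \<partial>U a)) has_real_derivative g') (at a) \<and>
       ((\<lambda>a. a * (\<integral>x. x \<partial>V a 1)) has_real_derivative c a * g') (at a)"
begin

definition "mU a = (\<integral>x. x \<partial>\<nu> a)"
definition "mV a = (\<integral>x. x \<partial>\<pi> a 1)"
definition "sU a = (\<integral>x. (x - (\<integral>x. x \<partial>\<nu> a))\<^sup>2 \<partial>\<nu> a)"
definition "sV a = (\<integral>x. (x - (\<integral>x. x \<partial>\<pi> a 1))\<^sup>2 \<partial>\<pi> a 1)"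

lemma moments:
  assumes "0 < a" "a < 1"
  shows "integrable (\<nu> a) (\<lambda>x. x\<^sup>2)" "integrable (\<pi> a 1) (\<lambda>x. x\<^sup>2)"
    "mU a = u a * (\<integral>x. x \<partial>U a)" "mV a = a * (\<integral>x. x \<partial>V a 1)" "0 \<le> sU a" "0 \<le> sV a"
proof -
  note 1 = mix_moments[of "u a" "U a"] and 2 = mix_moments[of a "V a 1"]
  show "integrable (\<nu> a) (\<lambda>x. x\<^sup>2)" "mU a = u a * (\<integral>x. x \<partial>U a)"
    unfolding mU_def \<nu>_def using assms u_bounds[of a] by (auto intro!: 1 U_prob U_pos U_sq)
  show "integrable (\<pi> a 1) (\<lambda>x. x\<^sup>2)" "mV a = a * (\<integral>x. x \<partial>V a 1)"
    unfolding mV_def \<pi>_def using assms by (auto intro!: 2 V_prob V_pos V_sq)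
qed (auto simp: sU_def sV_def)

lemma mUV_deriv:
  assumes "0 < a" "a < 1"
  obtains g' where "0 < g'" "(mU has_real_derivative g') (at a)" "(mV has_real_derivative c a * g') (at a)"
proof -
  from flux_deriv[OF assms] obtain g' where g': "0 < g'" "((\<lambda>a. u a * (\<integral>x. x \<partial>U a)) has_real_derivative g') (at a)"
     "((\<lambda>a. a * (\<integral>x. x \<partial>V a 1)) has_real_derivative c a * g') (at a)" by blast
  have o: "open {0<..<1 :: real}" by simp
  have "(mU has_real_derivative g') (at a)"
    by (rule has_field_derivative_transform_within_open[OF g'(2) o]) (use assms moments(3) in auto)
  moreover have "(mV has_real_derivative c a * g') (at a)"
    by (rule has_field_derivative_transform_within_open[OF g'(3) o]) (use assms moments(4) in auto)
  ultimately show ?thesis using that g'(1) by blast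
qed

text \<open>Per row, the mean height in direction \<open>r\<close> at parameter \<open>x\<close> is
  \<open>r * mU x - mV x\<close>, with derivative \<open>(r - c a) * g'\<close> at \<open>a\<close>.
  For \<open>r < c a\<close> it is therefore strictly larger at a slightly smaller
  parameter.\<close>

lemma secant_left:
  assumes "0 < a" "a < 1" "r < c a"
  obtains a' where "0 < a'" "a' < a" "mU a' < mU a" "0 < (mV a - mV a') - r * (mU a - mU a')"
proof -
  obtain g' where g': "0 < g'" "(mU has_real_derivative g') (at a)" "(mV has_real_derivative c a * g') (at a)"
    using mUV_deriv assms by metis
  have "((\<lambda>x. mV x - r * mU x) has_real_derivative c a * g' - r * g') (at a)"
    by (intro derivative_eq_intros) (use g' in auto)
  moreover have "0 < c a * g' - r * g'" using assms g' by (simp add: left_diff_distrib[symmetric])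
  ultimately obtain d where d: "0 < d" "\<And>h. 0 < h \<Longrightarrow> h < d \<Longrightarrow> mV (a - h) - r * mU (a - h) < mV a - r * mU a"
    using DERIV_pos_inc_left by blast
  obtain d' where d': "0 < d'" "\<And>h. 0 < h \<Longrightarrow> h < d' \<Longrightarrow> mU (a - h) < mU a"
    using DERIV_pos_inc_left[OF g'(2,1)] by blast
  define h where "h = min d (min d' a) / 2"
  have "0 < h" "h < d" "h < a" "h < d'" using d d' assms by (auto simp: h_def min_def)
  then show ?thesis using d(2)[of h] d'(2)[of h] assms by (intro that[of "a - h"]) (auto simp: algebra_simps)
qed

text \<open>For \<open>r > c a\<close> the derivative has the opposite sign, and larger mean heights
  occur at slightly larger parameters.\<close>

lemma secant_right:
  assumes "0 < a" "a < 1" "c a < r"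
  obtains a' where "a < a'" "a' < 1" "mU a < mU a'" "0 < r * (mU a' - mU a) - (mV a' - mV a)"
proof -
  obtain g' where g': "0 < g'" "(mU has_real_derivative g') (at a)" "(mV has_real_derivative c a * g') (at a)"
    using mUV_deriv assms by metis
  have "((\<lambda>x. mV x - r * mU x) has_real_derivative c a * g' - r * g') (at a)"
    by (intro derivative_eq_intros) (use g' in auto)
  moreover have "c a * g' - r * g' < 0" using assms g' by (simp add: left_diff_distrib[symmetric] mult_neg_pos)
  ultimately obtain d where d: "0 < d" "\<And>h. 0 < h \<Longrightarrow> h < d \<Longrightarrow> mV a - r * mU a > mV (a + h) - r * mU (a + h)"
    using DERIV_neg_dec_right by blast
  obtain d' where d': "0 < d'" "\<And>h. 0 < h \<Longrightarrow> h < d' \<Longrightarrow> mU a < mU (a + h)"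
    using DERIV_pos_inc_right[OF g'(2,1)] by blast
  define h where "h = min d (min d' (1 - a)) / 2"
  have "0 < h" "h < d" "h < 1 - a" "h < d'" using d d' assms by (auto simp: h_def min_def)
  then show ?thesis using d(2)[of h] d'(2)[of h] assms by (intro that[of "a + h"]) (auto simp: algebra_simps)
qed

lemma stat_column:
  assumes a: "0 < a" "a < 1" and S: "stat a m N P B v W"
  shows "prodlaw P (Col ` {..<N}) (\<lambda>r. case r of Col l \<Rightarrow> VF B v W m l | _ \<Rightarrow> \<lambda>_. 0) (laws a)"
proof -
  have "stat a 0 N P (\<lambda>k. UF B v W (k + m) 0) (\<lambda>l. VF B v W m (l + 0)) (\<lambda>k l. W (k + m) (l + 0))"
    by (rule stat_shift[OF a S]) auto
  then show ?thesis unfolding stat_def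
    by (rule prodlaw_cong[OF prodlaw_subset]) (auto simp: sys_def laws_prob[OF a])
qed

lemma stat_concentration:
  assumes a: "0 < a" "a < 1" and S: "stat a m N P B v W" and t: "0 < t" and h: "h \<le> N"
  shows "measure P {\<omega>\<in>space P. t \<le> \<bar>(\<Sum>k<m. B k \<omega>) - m * mU a\<bar>} \<le> m * sU a / t\<^sup>2"
    and "measure P {\<omega>\<in>space P. t \<le> \<bar>(\<Sum>l<h. VF B v W m l \<omega>) - h * mV a\<bar>} \<le> h * sV a / t\<^sup>2"
    and "(\<lambda>\<omega>. \<Sum>k<m. B k \<omega>) \<in> borel_measurable P" and "(\<lambda>\<omega>. \<Sum>l<h. VF B v W m l \<omega>) \<in> borel_measurable P"
proof -
  have inj: "inj_on Top A" "inj_on Col A" for A by (auto simp: inj_on_def)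
  have 1: "(\<Sum>j\<in>Top ` {..<m}. sys B v W j \<omega>) = (\<Sum>k<m. B k \<omega>)" for \<omega>
    by (subst sum.reindex) (auto simp: inj sys_def)
  have "measure P {\<omega>\<in>space P. t \<le> \<bar>(\<Sum>j\<in>Top ` {..<m}. sys B v W j \<omega>) - card (Top ` {..<m}) * (\<integral>x. x \<partial>\<nu> a)\<bar>} \<le>
     card (Top ` {..<m}) * (\<integral>x. (x - (\<integral>x. x \<partial>\<nu> a))\<^sup>2 \<partial>\<nu> a) / t\<^sup>2"
    using S unfolding stat_def
    by (rule prodlaw_chebyshev) (use t moments[OF a] in \<open>auto simp: laws_def\<close>)
  then show "measure P {\<omega>\<in>space P. t \<le> \<bar>(\<Sum>k<m. B k \<omega>) - m * mU a\<bar>} \<le> m * sU a / t\<^sup>2"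
    unfolding 1 by (simp add: card_image inj mU_def sU_def)
  let ?X = "\<lambda>r. case r of Col l \<Rightarrow> VF B v W m l | _ \<Rightarrow> \<lambda>_. 0"
  note C = stat_column[OF a S]
  have 2: "(\<Sum>j\<in>Col ` {..<h}. ?X j \<omega>) = (\<Sum>l<h. VF B v W m l \<omega>)" for \<omega>
    by (subst sum.reindex) (auto simp: inj)
  have "measure P {\<omega>\<in>space P. t \<le> \<bar>(\<Sum>j\<in>Col ` {..<h}. ?X j \<omega>) - card (Col ` {..<h}) * (\<integral>x. x \<partial>\<pi> a 1)\<bar>} \<le>
     card (Col ` {..<h}) * (\<integral>x. (x - (\<integral>x. x \<partial>\<pi> a 1))\<^sup>2 \<partial>\<pi> a 1) / t\<^sup>2"
    by (rule prodlaw_chebyshev[OF C]) (use t moments[OF a] h in \<open>auto simp: laws_def\<close>)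
  then show "measure P {\<omega>\<in>space P. t \<le> \<bar>(\<Sum>l<h. VF B v W m l \<omega>) - h * mV a\<bar>} \<le> h * sV a / t\<^sup>2"
    unfolding 2 by (simp add: card_image inj mV_def sV_def)
  have "B k \<in> borel_measurable P" if "k < m" for k
    using prodlaw_measurable[OF S[unfolded stat_def], of "Top k"] that by (simp add: sys_def)
  then show "(\<lambda>\<omega>. \<Sum>k<m. B k \<omega>) \<in> borel_measurable P" by (intro borel_measurable_sum) auto
  have "(\<lambda>\<omega>. VF B v W m l \<omega>) \<in> borel_measurable P" if "l < h" for l
    using prodlaw_measurable[OF C, of "Col l"] that h by simp
  then show "(\<lambda>\<omega>. \<Sum>l<h. VF B v W m l \<omega>) \<in> borel_measurable P" by (intro borel_measurable_sum) auto
qed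

text \<open>A height is the sum of the top row minus the sum of the last column, each a sum of
  independent variables. A gap of \<open>4 * t\<close> between the means forces one of the four sums
  to deviate by \<open>t\<close>, so no information on the dependence among the sums enters the
  union bound.\<close>

lemma hgt_order_prob:
  assumes a: "0 < a" "a < 1" and a': "0 < a'" "a' < 1"
    and S: "stat a m N P B v W" and S': "stat a' m N P B' v' W" and h: "h \<le> N" and t: "0 < t"
    and sep: "4 * t \<le> (m * mU a' - h * mV a') - (m * mU a - h * mV a)"
  shows "{\<omega>\<in>space P. hgt (\<lambda>k. B' k \<omega>) (\<lambda>l. v' l \<omega>) (\<lambda>k l. W k l \<omega>) m h \<le> hgt (\<lambda>k. B k \<omega>) (\<lambda>l. v l \<omega>) (\<lambda>k l. W k l \<omega>) m h} \<in> sets P" (is "?E \<in> _")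
    and "measure P {\<omega>\<in>space P. hgt (\<lambda>k. B' k \<omega>) (\<lambda>l. v' l \<omega>) (\<lambda>k l. W k l \<omega>) m h \<le> hgt (\<lambda>k. B k \<omega>) (\<lambda>l. v l \<omega>) (\<lambda>k l. W k l \<omega>) m h}
      \<le> (m * (sU a + sU a') + h * (sV a + sV a')) / t\<^sup>2"
proof -
  interpret prob_space P using S by (auto simp: stat_def prodlaw_prob_space)
  note c = stat_concentration[OF a S t h] and c' = stat_concentration[OF a' S' t h]
  note [measurable] = c(3,4) c'(3,4)
  let ?A = "{\<omega>\<in>space P. t \<le> \<bar>(\<Sum>k<m. B k \<omega>) - m * mU a\<bar>}" and ?B = "{\<omega>\<in>space P. t \<le> \<bar>(\<Sum>l<h. VF B v W m l \<omega>) - h * mV a\<bar>}"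
  let ?A' = "{\<omega>\<in>space P. t \<le> \<bar>(\<Sum>k<m. B' k \<omega>) - m * mU a'\<bar>}" and ?B' = "{\<omega>\<in>space P. t \<le> \<bar>(\<Sum>l<h. VF B' v' W m l \<omega>) - h * mV a'\<bar>}"
  show m: "?E \<in> sets P" unfolding hgt_eq_sum by measurable
  have "?E \<subseteq> ?A \<union> ?B \<union> (?A' \<union> ?B')" unfolding hgt_eq_sum using sep by auto
  then have "measure P ?E \<le> measure P (?A \<union> ?B \<union> (?A' \<union> ?B'))" by (intro finite_measure_mono) auto
  also have "\<dots> \<le> measure P (?A \<union> ?B) + measure P (?A' \<union> ?B')" by (rule measure_Un_le) auto
  also have "\<dots> \<le> (measure P ?A + measure P ?B) + (measure P ?A' + measure P ?B')"
    by (intro add_mono measure_Un_le) auto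
  also have "\<dots> \<le> (m * sU a / t\<^sup>2 + h * sV a / t\<^sup>2) + (m * sU a' / t\<^sup>2 + h * sV a' / t\<^sup>2)"
    by (intro add_mono c c')
  also have "\<dots> = (m * (sU a + sU a') + h * (sV a + sV a')) / t\<^sup>2"
    by (simp add: add_divide_distrib distrib_left)
  finally show "measure P ?E \<le> (m * (sU a + sU a') + h * (sV a + sV a')) / t\<^sup>2" .
qed

end

text \<open>Provides ordered boundaries on one space: the minimum with a partner has the law of the
  smaller parameter. The partners are then given up in the independence claim.\<close>

lemma prodlaw_min_pairs:
  assumes X: "prodlaw P I X \<mu>" and A: "finite A" "inj_on g A" "A \<inter> g ` A = {}" "A \<union> g ` A \<subseteq> I"
    and F: "\<And>r. r \<in> A \<Longrightarrow> pair_upd (\<mu> r) (\<mu> (g r)) (\<lambda>x y. (min x y, max 0 (x - y))) N1 N2"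
    and N: "prob_space N1" "prob_space N2" "sets N1 = sets borel" "sets N2 = sets borel"
  shows "prodlaw P (I - g ` A) (\<lambda>r \<omega>. if r \<in> A then min (X r \<omega>) (X (g r) \<omega>) else X r \<omega>) (\<lambda>r. if r \<in> A then N1 else \<mu> r)"
  using A F
proof (induction A rule: finite_induct)
  case empty
  show ?case using X by simp
next
  case (insert a A)
  have \<mu>: "\<And>i. prob_space (\<mu> i)" "\<And>i. sets (\<mu> i) = sets borel" using X by (auto simp: prodlaw_def)
  let ?Y = "\<lambda>A r \<omega>. if r \<in> A then min (X r \<omega>) (X (g r) \<omega>) else X r \<omega>" and ?L = "\<lambda>A r. if r \<in> A then N1 else \<mu> r"
  have ga: "g a \<notin> A" "g a \<notin> g ` A" "a \<notin> g ` A" "g a \<noteq> a" "a \<in> I" "g a \<in> I" "a \<notin> A"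
    using insert by (auto simp: inj_on_def)
  have IH: "prodlaw P (I - g ` A) (?Y A) (?L A)"
    by (rule insert.IH) (use insert.prems in \<open>auto simp: inj_on_def\<close>)
  have "prodlaw P (insert (g a) (insert a (I - g ` A - {a, g a})))
      ((?Y A)(a := \<lambda>\<omega>. fst (min (?Y A a \<omega>) (?Y A (g a) \<omega>), max 0 (?Y A a \<omega> - ?Y A (g a) \<omega>)),
         g a := \<lambda>\<omega>. snd (min (?Y A a \<omega>) (?Y A (g a) \<omega>), max 0 (?Y A a \<omega> - ?Y A (g a) \<omega>)))) ((?L A)(a := N1, g a := N2))"
  proof (rule prodlaw_pair_upd[OF IH])
    show "pair_upd (?L A a) (?L A (g a)) (\<lambda>x y. (min x y, max 0 (x - y))) N1 N2" using ga insert.prems(4)[of a] by simp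
  qed (use ga N in auto)
  then show ?case
  proof (rule prodlaw_cong[OF prodlaw_subset])
    show "I - g ` insert a A \<subseteq> insert (g a) (insert a (I - g ` A - {a, g a}))" by auto
  qed (use ga N \<mu> in auto)
qed

section \<open>Comparison of point-to-point with stationary increments\<close>

context queue_moments
begin

text \<open>The increments are measurable functions of finitely many independent variables, so their
  joint law does not depend on the system that realises it; the estimate may be proved on a space
  carrying a convenient coupling.\<close>

lemma stat_transfer:
  assumes S: "stat a m N P B v W" and S': "stat a m N P' B' v' W'" and j: "Suc j < N" and A: "A \<in> sets (borel \<Otimes>\<^sub>M borel)"
  shows "measure P {\<omega>\<in>space P. (VF B v W m (Suc j) \<omega>, pV (\<lambda>k l. W k l \<omega>) m j) \<in> A} =
    measure P' {\<omega>\<in>space P'. (VF B' v' W' m (Suc j) \<omega>, pV (\<lambda>k l. W' k l \<omega>) m j) \<in> A}"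
proof -
  define Q where "Q f \<longleftrightarrow> (Vf (\<lambda>k. f (Top k)) (\<lambda>l. f (Col l)) (\<lambda>k l. f (Cell k l)) m (Suc j), pV (\<lambda>k l. f (Cell k l)) m j) \<in> A" for f :: "reg \<Rightarrow> real"
  have Qm: "{f\<in>space (PiM (rect m N) (\<lambda>_. borel :: real measure)). Q f} \<in> sets (PiM (rect m N) (\<lambda>_. borel))"
  proof -
    have [measurable]: "(\<lambda>f. Vf (\<lambda>k. f (Top k)) (\<lambda>l. f (Col l)) (\<lambda>k l. f (Cell k l)) m (Suc j)) \<in> borel_measurable (PiM (rect m N) (\<lambda>_. borel :: real measure))"
      by (rule Vf_measurable[where B="\<lambda>k f. f (Top k)" and v="\<lambda>l f. f (Col l)" and W="\<lambda>k l f. f (Cell k l)"])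
        (use j in \<open>auto intro!: measurable_component_singleton\<close>)
    have [measurable]: "(\<lambda>f. pV (\<lambda>k l. f (Cell k l)) m j) \<in> borel_measurable (PiM (rect m N) (\<lambda>_. borel :: real measure))"
      by (rule pV_measurable[where W="\<lambda>k l f. f (Cell k l)"]) (use j in \<open>auto intro!: measurable_component_singleton\<close>)
    show ?thesis unfolding Q_def using A by measurable
  qed
  have Q: "Q (\<lambda>i\<in>rect m N. sys B v W i \<omega>) \<longleftrightarrow> (VF B v W m (Suc j) \<omega>, pV (\<lambda>k l. W k l \<omega>) m j) \<in> A"
    for B v W and \<omega> :: 'z
  proof -
    have 1: "Vf (\<lambda>k. (\<lambda>i\<in>rect m N. sys B v W i \<omega>) (Top k)) (\<lambda>l. (\<lambda>i\<in>rect m N. sys B v W i \<omega>) (Col l))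
       (\<lambda>k l. (\<lambda>i\<in>rect m N. sys B v W i \<omega>) (Cell k l)) m (Suc j) = VF B v W m (Suc j) \<omega>"
      by (rule Vf_cong) (use j in \<open>auto simp: sys_def\<close>)
    have 2: "pV (\<lambda>k l. (\<lambda>i\<in>rect m N. sys B v W i \<omega>) (Cell k l)) m j = pV (\<lambda>k l. W k l \<omega>) m j"
      by (rule pV_cong) (use j in \<open>auto simp: sys_def\<close>)
    show ?thesis unfolding Q_def 1 2 ..
  qed
  show ?thesis
    using prodlaw_transfer[OF S[unfolded stat_def] S'[unfolded stat_def] Qm] unfolding Q .
qed

definition rect3 where "rect3 m N = rect m N \<union> ATop ` {..<m} \<union> ACol ` {..<N}"

lemma rect3_iff[simp]: "Top k \<in> rect3 m N \<longleftrightarrow> k < m" "Col l \<in> rect3 m N \<longleftrightarrow> l < N" "Cell k l \<in> rect3 m N \<longleftrightarrow> k < m \<and> l < N"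
  "ATop k \<in> rect3 m N \<longleftrightarrow> k < m" "ACol l \<in> rect3 m N \<longleftrightarrow> l < N" "Eps k l \<notin> rect3 m N" "Eta k l \<notin> rect3 m N" "Bot \<notin> rect3 m N"
  by (auto simp: rect3_def)

lemma finite_rect3[simp]: "finite (rect3 m N)" by (simp add: rect3_def)

definition laws3 :: "real measure \<Rightarrow> real measure \<Rightarrow> real measure \<Rightarrow> real measure \<Rightarrow> reg \<Rightarrow> real measure" where
  "laws3 L1 L2 L3 L4 r = (case r of Top k \<Rightarrow> L1 | ATop k \<Rightarrow> L2 | Col l \<Rightarrow> L3 | ACol l \<Rightarrow> L4 | _ \<Rightarrow> \<nu> 1)"

text \<open>Zero outside the index set, because the deterministic comparison lemmas ask for
  nonnegative boundary data at all indices.\<close>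

definition coord3 :: "nat \<Rightarrow> nat \<Rightarrow> reg \<Rightarrow> (reg \<Rightarrow> real) \<Rightarrow> real" where
  "coord3 m N r f = (if r \<in> rect3 m N then f r else 0)"

lemma coord3_prodlaw:
  assumes "\<And>r. prob_space (laws3 L1 L2 L3 L4 r)" "\<And>r. sets (laws3 L1 L2 L3 L4 r) = sets borel"
    and nn: "AE x in L1. 0 \<le> x" "AE x in L2. 0 \<le> x" "AE x in L3. 0 \<le> x" "AE x in L4. 0 \<le> x"
  shows "prodlaw (PiM (rect3 m N) (laws3 L1 L2 L3 L4)) (rect3 m N) (coord3 m N) (laws3 L1 L2 L3 L4)" (is ?p)
    and "AE f in PiM (rect3 m N) (laws3 L1 L2 L3 L4). \<forall>r. 0 \<le> coord3 m N r f"
proof -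
  show p: ?p
    by (rule prodlaw_cong[OF prodlaw_PiM]) (use assms in \<open>auto simp: coord3_def\<close>)
  have *: "Q (laws3 L1 L2 L3 L4 r)" if "Q L1" "Q L2" "Q L3" "Q L4" "Q (\<nu> 1)" for Q r
    using that by (cases r) (simp_all add: laws3_def)
  have "AE f in PiM (rect3 m N) (laws3 L1 L2 L3 L4). \<forall>r\<in>rect3 m N. 0 \<le> coord3 m N r f"
  proof (rule prodlaw_AE[OF p])
    show "AE x in laws3 L1 L2 L3 L4 r. 0 \<le> x" for r
      by (rule *) (use nn laws_nonneg(1)[of 1] in auto)
  qed simp
  then show "AE f in PiM (rect3 m N) (laws3 L1 L2 L3 L4). \<forall>r. 0 \<le> coord3 m N r f"
    by eventually_elim (auto simp: coord3_def)
qed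

definition steps :: "real \<Rightarrow> nat \<Rightarrow> nat" where "steps a h = nat \<lfloor>c a * real h\<rfloor>"

lemma steps_bounds: assumes "0 < a" "a < 1" shows "real (steps a h) \<le> c a * h" "c a * h - 1 < real (steps a h)"
proof -
  have "0 \<le> c a * h" using c_pos[OF assms] by simp
  then show "real (steps a h) \<le> c a * h" "c a * h - 1 < real (steps a h)" unfolding steps_def by linarith+
qed

definition aux_key :: "reg \<Rightarrow> reg" where
  "aux_key r = (case r of Top k \<Rightarrow> ATop k | Col l \<Rightarrow> ACol l | _ \<Rightarrow> r)"

lemma aux_key_simps[simp]: "aux_key (Top k) = ATop k" "aux_key (Col k) = ACol k" "aux_key (Cell k l) = Cell k l"
  by (simp_all add: aux_key_def)

lemma inj_on_aux_key: "inj_on aux_key (rect m N)"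
  by (auto simp: inj_on_def rect_def)

lemma order_sets: "{z :: real \<times> real. fst z < snd z} \<in> sets (borel \<Otimes>\<^sub>M borel)" "{z :: real \<times> real. snd z < fst z} \<in> sets (borel \<Otimes>\<^sub>M borel)"
proof -
  have "{z\<in>space (borel \<Otimes>\<^sub>M borel). fst z < (snd z :: real)} \<in> sets (borel \<Otimes>\<^sub>M borel)"
    "{z\<in>space (borel \<Otimes>\<^sub>M borel). snd z < (fst z :: real)} \<in> sets (borel \<Otimes>\<^sub>M borel)" by measurable
  then show "{z :: real \<times> real. fst z < snd z} \<in> sets (borel \<Otimes>\<^sub>M borel)" "{z :: real \<times> real. snd z < fst z} \<in> sets (borel \<Otimes>\<^sub>M borel)"
    by (simp_all add: space_pair_measure)
qed

text \<open>Since \<open>c a2 < c a\<close>, some \<open>a' < a\<close> has a larger mean height in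
  direction \<open>c a2\<close>, by \<delta> per row. By \<open>pV_le_Vf_or\<close> a failure of the
  comparison puts the two heights in the wrong order, which has probability of order
  \<open>1 / h\<close>. Only the top rows must be ordered; the two columns can be
  independent.\<close>

lemma compare_upper:
  assumes a: "0 < a2" "a2 < a" "a < 1"
  shows "\<exists>C\<ge>0. \<forall>(P :: 'w measure) B v W h. stat a (steps a2 (Suc h)) (Suc (Suc h)) P B v W \<longrightarrow>
     measure P {\<omega>\<in>space P. VF B v W (steps a2 (Suc h)) (Suc h) \<omega> < pV (\<lambda>k l. W k l \<omega>) (steps a2 (Suc h)) h} \<le> C / Suc h"
proof -
  have a0: "0 < a" using a by simp
  obtain a' where a': "0 < a'" "a' < a" "mU a' < mU a" "0 < (mV a - mV a') - c a2 * (mU a - mU a')"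
    using secant_left[OF a0 a(3) c_mono[OF a]] .
  define \<delta> where "\<delta> = (mV a - mV a') - c a2 * (mU a - mU a')"
  have \<delta>: "0 < \<delta>" using a' by (simp add: \<delta>_def)
  have a'1: "a' < 1" using a' a by simp
  define K where "K = c a2 * (sU a + sU a') + (sV a + sV a')"
  define C where "C = 16 * K / \<delta>\<^sup>2"
  have cc: "0 < c a2" using c_pos[of a2] a by simp
  have s0: "0 \<le> sU a + sU a'" "0 \<le> sV a + sV a'" using moments(5,6)[of a] moments(5,6)[of a'] a a' by auto
  then have K0: "0 \<le> K" using cc by (simp add: K_def)
  have "measure P {\<omega>\<in>space P. VF B v W (steps a2 (Suc h)) (Suc h) \<omega> < pV (\<lambda>k l. W k l \<omega>) (steps a2 (Suc h)) h} \<le> C / Suc h"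
    if S: "stat a (steps a2 (Suc h)) (Suc (Suc h)) P B v W" for P :: "'w measure" and B v W h
  proof -
    define m N where "m = steps a2 (Suc h)" and "N = Suc (Suc h)"
    have mb: "real m \<le> c a2 * Suc h" unfolding m_def by (rule steps_bounds) (use a in auto)
    \<comment> \<open>By \<open>queue_pair_upd\<close>, the minimum of a
      \<open>\<sigma> a' a\<close> and a \<open>\<nu> a\<close> variable has law
      \<open>\<nu> a'\<close>; so the top row for \<open>a'\<close> lies below the one for
      \<open>a\<close>.\<close>
    define L where "L = laws3 (\<nu> a) (\<sigma> a' a) (\<pi> a 1) (\<pi> a' 1)"
    define Q where "Q = PiM (rect3 m N) L"
    have Lp: "prob_space (L r)" "sets (L r) = sets borel" for r
      using a a' a'1 by (auto simp: L_def laws3_def split: reg.split intro!: prob_laws)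
    have p: "prodlaw Q (rect3 m N) (coord3 m N) L" and nn: "AE f in Q. \<forall>r. 0 \<le> coord3 m N r f"
      unfolding Q_def L_def using Lp[unfolded L_def] a a' a'1 by (auto intro!: coord3_prodlaw laws_nonneg)
    let ?B = "\<lambda>k. coord3 m N (Top k)" and ?v = "\<lambda>l. coord3 m N (Col l)" and ?W = "\<lambda>k l. coord3 m N (Cell k l)"
    let ?B' = "\<lambda>k \<omega>. min (coord3 m N (ATop k) \<omega>) (coord3 m N (Top k) \<omega>)" and ?v' = "\<lambda>l. coord3 m N (ACol l)"
    have Sa: "stat a m N Q ?B ?v ?W" unfolding stat_def
      by (rule prodlaw_cong[OF prodlaw_subset[OF p]])
        (use laws_prob[of a] a0 a in \<open>auto simp: rect3_def sys_def laws_def L_def laws3_def split: reg.split\<close>)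
    define tp where "tp r = (case r of ATop k \<Rightarrow> Top k | _ \<Rightarrow> r)" for r
    have "prodlaw Q (rect3 m N - tp ` ATop ` {..<m})
       (\<lambda>r \<omega>. if r \<in> ATop ` {..<m} then min (coord3 m N r \<omega>) (coord3 m N (tp r) \<omega>) else coord3 m N r \<omega>)
       (\<lambda>r. if r \<in> ATop ` {..<m} then \<nu> a' else L r)"
    proof (rule prodlaw_min_pairs[OF p])
      show "pair_upd (L r) (L (tp r)) (\<lambda>x y. (min x y, max 0 (x - y))) (\<nu> a') (\<pi> a' a)" if "r \<in> ATop ` {..<m}" for r
        using that queue_pair_upd[of a' a] a a' by (auto simp: L_def laws3_def tp_def)
    qed (use a a' a'1 in \<open>auto simp: tp_def inj_on_def intro!: prob_laws\<close>)
    from prodlaw_reindex[OF this inj_on_aux_key, of m N]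
    have Sa': "stat a' m N Q ?B' ?v' ?W" unfolding stat_def
    proof (rule prodlaw_cong)
      show "aux_key ` rect m N \<subseteq> rect3 m N - tp ` ATop ` {..<m}" by (auto simp: rect_def tp_def)
    qed (use laws_prob[of a'] a' a'1 in \<open>auto simp: rect_def sys_def laws_def L_def laws3_def tp_def\<close>)
    interpret Q: prob_space Q by (rule prodlaw_prob_space[OF p])
    define t where "t = Suc h * \<delta> / 4"
    have t: "0 < t" using \<delta> by (simp add: t_def)
    have *: "c a2 * Suc h * (mU a - mU a') \<ge> m * (mU a - mU a')" using mb a' by (intro mult_right_mono) auto
    have sep: "4 * t \<le> (m * mU a' - Suc h * mV a') - (m * mU a - Suc h * mV a)"
    proof -
      have "4 * t = Suc h * (mV a - mV a') - c a2 * Suc h * (mU a - mU a')"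
        by (simp add: t_def \<delta>_def) (simp add: algebra_simps)
      then show ?thesis using * by (simp only: right_diff_distrib)
    qed
    let ?E = "{\<omega>\<in>space Q. hgt (\<lambda>k. ?B' k \<omega>) (\<lambda>l. ?v' l \<omega>) (\<lambda>k l. ?W k l \<omega>) m (Suc h) \<le> hgt (\<lambda>k. ?B k \<omega>) (\<lambda>l. ?v l \<omega>) (\<lambda>k l. ?W k l \<omega>) m (Suc h)}"
    have E: "?E \<in> sets Q" "measure Q ?E \<le> (m * (sU a + sU a') + Suc h * (sV a + sV a')) / t\<^sup>2"
      using hgt_order_prob[OF a0 a(3) a'(1) a'1 Sa Sa' _ t sep] by (auto simp: N_def)
    have "measure Q {\<omega>\<in>space Q. (VF ?B ?v ?W m (Suc h) \<omega>, pV (\<lambda>k l. ?W k l \<omega>) m h) \<in> {z. fst z < snd z}} \<le> measure Q ?E"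
    proof (rule Q.finite_measure_mono_AE)
      show "AE \<omega> in Q. \<omega> \<in> {\<omega>\<in>space Q. (VF ?B ?v ?W m (Suc h) \<omega>, pV (\<lambda>k l. ?W k l \<omega>) m h) \<in> {z. fst z < snd z}} \<longrightarrow> \<omega> \<in> ?E"
        using nn
      proof eventually_elim
        fix \<omega> assume "\<forall>r. 0 \<le> coord3 m N r \<omega>"
        then show "\<omega> \<in> {\<omega>\<in>space Q. (VF ?B ?v ?W m (Suc h) \<omega>, pV (\<lambda>k l. ?W k l \<omega>) m h) \<in> {z. fst z < snd z}} \<longrightarrow> \<omega> \<in> ?E"
          using pV_le_Vf_or[of "\<lambda>k. ?B k \<omega>" "\<lambda>k. ?B' k \<omega>" "\<lambda>l. ?v l \<omega>" "\<lambda>l. ?v' l \<omega>" "\<lambda>k l. ?W k l \<omega>" m h] by auto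
      qed
    qed (rule E)
    also have "\<dots> \<le> (m * (sU a + sU a') + Suc h * (sV a + sV a')) / t\<^sup>2" by (rule E)
    also have "\<dots> \<le> (Suc h * K) / t\<^sup>2"
    proof (rule divide_right_mono)
      have "m * (sU a + sU a') \<le> c a2 * Suc h * (sU a + sU a')" using mb s0 by (intro mult_right_mono) auto
      then show "m * (sU a + sU a') + Suc h * (sV a + sV a') \<le> Suc h * K" by (simp add: K_def algebra_simps)
    qed simp
    also have "\<dots> = C / Suc h"
    proof -
      have "x * K / (x * \<delta> / 4)\<^sup>2 = 16 * K / \<delta>\<^sup>2 / x" if "x \<noteq> 0" for x
        using that \<delta> by (simp add: power2_eq_square field_simps)
      from this[of "real (Suc h)"] show ?thesis by (simp only: C_def t_def)
    qed
    finally have "measure Q {\<omega>\<in>space Q. (VF ?B ?v ?W m (Suc h) \<omega>, pV (\<lambda>k l. ?W k l \<omega>) m h) \<in> {z. fst z < snd z}} \<le> C / Suc h" .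
    moreover have "measure P {\<omega>\<in>space P. (VF B v W m (Suc h) \<omega>, pV (\<lambda>k l. W k l \<omega>) m h) \<in> {z. fst z < snd z}} =
        measure Q {\<omega>\<in>space Q. (VF ?B ?v ?W m (Suc h) \<omega>, pV (\<lambda>k l. ?W k l \<omega>) m h) \<in> {z. fst z < snd z}}"
      by (rule stat_transfer[OF S[folded m_def N_def] Sa _ order_sets(1)]) (simp add: N_def)
    ultimately show ?thesis by (simp add: m_def)
  qed
  moreover have "0 \<le> C" using K0 by (simp add: C_def)
  ultimately show ?thesis by blast
qed

text \<open>Now \<open>c a2 > c a\<close>, and the larger mean height belongs to a parameter
  \<open>a' > a\<close>. The columns are the boundaries that must be ordered, while the top rows can
  be independent.\<close>

lemma compare_lower:
  assumes a: "0 < a" "a < a2" "a2 < 1"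
  shows "\<exists>C\<ge>0. \<forall>(P :: 'w measure) B v W h. stat a (steps a2 (Suc h)) (Suc (Suc h)) P B v W \<longrightarrow>
     measure P {\<omega>\<in>space P. pV (\<lambda>k l. W k l \<omega>) (steps a2 (Suc h)) h < VF B v W (steps a2 (Suc h)) (Suc h) \<omega>} \<le> C / Suc h"
proof -
  have a1: "a < 1" using a by simp
  obtain a' where a': "a < a'" "a' < 1" "mU a < mU a'" "0 < c a2 * (mU a' - mU a) - (mV a' - mV a)"
    using secant_right[OF a(1) a1 c_mono[OF a]] .
  define \<delta> where "\<delta> = c a2 * (mU a' - mU a) - (mV a' - mV a)"
  have \<delta>: "0 < \<delta>" using a' by (simp add: \<delta>_def)
  have a'0: "0 < a'" using a' a by simp
  define K where "K = c a2 * (sU a + sU a') + 2 * (sV a + sV a')"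
  \<comment> \<open>The loss in the gap of means caused by rounding down the number of columns and
    by comparing one row lower. As long as it exceeds half the gap, the choice of \<open>C\<close>
    makes the claimed bound at least 1.\<close>
  define e where "e = (mU a' - mU a) + (mV a' - mV a)"
  define C where "C = max (64 * K / \<delta>\<^sup>2) (2 * e / \<delta>)"
  have cc: "0 < c a2" using c_pos[of a2] a by simp
  have s0: "0 \<le> sU a + sU a'" "0 \<le> sV a + sV a'" using moments(5,6)[of a] moments(5,6)[of a'] a a' by auto
  then have K0: "0 \<le> K" using cc by (simp add: K_def)
  have "measure P {\<omega>\<in>space P. pV (\<lambda>k l. W k l \<omega>) (steps a2 (Suc h)) h < VF B v W (steps a2 (Suc h)) (Suc h) \<omega>} \<le> C / Suc h"
    if S: "stat a (steps a2 (Suc h)) (Suc (Suc h)) P B v W" for P :: "'w measure" and B v W h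
  proof (cases "Suc h * \<delta> / 2 < e")
    case True
    interpret P: prob_space P using S by (auto simp: stat_def prodlaw_prob_space)
    have "Suc h * \<delta> \<le> 2 * e" using True by simp
    then have "1 \<le> 2 * e / (Suc h * \<delta>)" using \<delta> by simp
    then have "1 \<le> 2 * e / \<delta> / Suc h" by (simp add: mult.commute)
    also have "\<dots> \<le> C / Suc h" by (intro divide_right_mono) (auto simp: C_def)
    finally show ?thesis using P.prob_le_1 order_trans by blast
  next
    case False
    define m N where "m = steps a2 (Suc h)" and "N = Suc (Suc h)"
    have mb: "real m \<le> c a2 * Suc h" "c a2 * Suc h - 1 < real m" unfolding m_def by (rule steps_bounds; use a in auto)+
    \<comment> \<open>By \<open>min_queue_pair_upd\<close>, the minimum of a
      \<open>\<pi> a a'\<close> and a \<open>\<pi> a' 1\<close> variable has law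
      \<open>\<pi> a 1\<close>; so the column for \<open>a\<close> lies below the one for
      \<open>a'\<close>.\<close>
    define L where "L = laws3 (\<nu> a) (\<nu> a') (\<pi> a a') (\<pi> a' 1)"
    define Q where "Q = PiM (rect3 m N) L"
    have Lp: "prob_space (L r)" "sets (L r) = sets borel" for r
      using a a' a'0 by (auto simp: L_def laws3_def split: reg.split intro!: prob_laws)
    have p: "prodlaw Q (rect3 m N) (coord3 m N) L" and nn: "AE f in Q. \<forall>r. 0 \<le> coord3 m N r f"
      unfolding Q_def L_def using Lp[unfolded L_def] a a' a'0 by (auto intro!: coord3_prodlaw laws_nonneg)
    let ?B = "\<lambda>k. coord3 m N (Top k)" and ?W = "\<lambda>k l. coord3 m N (Cell k l)"
    let ?v = "\<lambda>l \<omega>. min (coord3 m N (Col l) \<omega>) (coord3 m N (ACol l) \<omega>)"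
    let ?B' = "\<lambda>k. coord3 m N (ATop k)" and ?v' = "\<lambda>l. coord3 m N (ACol l)"
    from prodlaw_reindex[OF p inj_on_aux_key, of m N]
    have Sa': "stat a' m N Q ?B' ?v' ?W" unfolding stat_def
    proof (rule prodlaw_cong)
      show "aux_key ` rect m N \<subseteq> rect3 m N" by (auto simp: rect_def)
    qed (use laws_prob[of a'] a' a'0 in \<open>auto simp: rect_def sys_def laws_def L_def laws3_def\<close>)
    define ac where "ac r = (case r of Col l \<Rightarrow> ACol l | _ \<Rightarrow> r)" for r
    have "prodlaw Q (rect3 m N - ac ` Col ` {..<N})
       (\<lambda>r \<omega>. if r \<in> Col ` {..<N} then min (coord3 m N r \<omega>) (coord3 m N (ac r) \<omega>) else coord3 m N r \<omega>)
       (\<lambda>r. if r \<in> Col ` {..<N} then \<pi> a 1 else L r)"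
    proof (rule prodlaw_min_pairs[OF p])
      show "pair_upd (L r) (L (ac r)) (\<lambda>x y. (min x y, max 0 (x - y))) (\<pi> a 1) (\<rho> a a')" if "r \<in> Col ` {..<N}" for r
        using that min_queue_pair_upd[of a a'] a a' by (auto simp: L_def laws3_def ac_def)
    qed (use a a' a'0 a1 in \<open>auto simp: ac_def inj_on_def intro!: prob_laws\<close>)
    then have Sa: "stat a m N Q ?B ?v ?W" unfolding stat_def
      by (rule prodlaw_cong[OF prodlaw_subset])
        (use laws_prob[of a] a1 a in \<open>auto simp: rect3_def rect_def sys_def laws_def L_def laws3_def ac_def split: reg.split\<close>)
    interpret Q: prob_space Q by (rule prodlaw_prob_space[OF p])
    define t where "t = Suc h * \<delta> / 8"
    have t: "0 < t" using \<delta> by (simp add: t_def)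
    have *: "(c a2 * Suc h - 1) * (mU a' - mU a) \<le> m * (mU a' - mU a)" using mb a' by (intro mult_right_mono) auto
    have sep: "4 * t \<le> (m * mU a' - Suc (Suc h) * mV a') - (m * mU a - Suc (Suc h) * mV a)"
    proof -
      have "Suc h * \<delta> = c a2 * Suc h * (mU a' - mU a) - Suc h * (mV a' - mV a)"
        by (simp add: \<delta>_def right_diff_distrib mult.assoc mult.left_commute)
      moreover have "4 * t = Suc h * \<delta> / 2" by (simp add: t_def)
      ultimately have "4 * t \<le> c a2 * Suc h * (mU a' - mU a) - Suc h * (mV a' - mV a) - e" using False by linarith
      also have "\<dots> = (c a2 * Suc h - 1) * (mU a' - mU a) - Suc (Suc h) * (mV a' - mV a)"
        by (simp add: e_def algebra_simps)
      also have "\<dots> \<le> m * (mU a' - mU a) - Suc (Suc h) * (mV a' - mV a)" using * by simp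
      finally show ?thesis by (simp add: algebra_simps)
    qed
    let ?E = "{\<omega>\<in>space Q. hgt (\<lambda>k. ?B' k \<omega>) (\<lambda>l. ?v' l \<omega>) (\<lambda>k l. ?W k l \<omega>) m (Suc (Suc h)) \<le> hgt (\<lambda>k. ?B k \<omega>) (\<lambda>l. ?v l \<omega>) (\<lambda>k l. ?W k l \<omega>) m (Suc (Suc h))}"
    have E: "?E \<in> sets Q" "measure Q ?E \<le> (m * (sU a + sU a') + Suc (Suc h) * (sV a + sV a')) / t\<^sup>2"
      using hgt_order_prob[OF a(1) a1 a'0 a'(2) Sa Sa' _ t sep] by (auto simp: N_def)
    have "measure Q {\<omega>\<in>space Q. (VF ?B ?v ?W m (Suc h) \<omega>, pV (\<lambda>k l. ?W k l \<omega>) m h) \<in> {z. snd z < fst z}} \<le> measure Q ?E"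
    proof (rule Q.finite_measure_mono_AE)
      show "AE \<omega> in Q. \<omega> \<in> {\<omega>\<in>space Q. (VF ?B ?v ?W m (Suc h) \<omega>, pV (\<lambda>k l. ?W k l \<omega>) m h) \<in> {z. snd z < fst z}} \<longrightarrow> \<omega> \<in> ?E"
        using nn
      proof eventually_elim
        fix \<omega> assume "\<forall>r. 0 \<le> coord3 m N r \<omega>"
        then show "\<omega> \<in> {\<omega>\<in>space Q. (VF ?B ?v ?W m (Suc h) \<omega>, pV (\<lambda>k l. ?W k l \<omega>) m h) \<in> {z. snd z < fst z}} \<longrightarrow> \<omega> \<in> ?E"
          using Vf_le_pV_or[of "\<lambda>k. ?B k \<omega>" "\<lambda>k. ?B' k \<omega>" "\<lambda>l. ?v l \<omega>" "\<lambda>k l. ?W k l \<omega>" "\<lambda>l. ?v' l \<omega>" m h] by auto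
      qed
    qed (rule E)
    also have "\<dots> \<le> (m * (sU a + sU a') + Suc (Suc h) * (sV a + sV a')) / t\<^sup>2" by (rule E)
    also have "\<dots> \<le> (Suc h * K) / t\<^sup>2"
    proof (rule divide_right_mono)
      have "m * (sU a + sU a') \<le> c a2 * Suc h * (sU a + sU a')" using mb s0 by (intro mult_right_mono) auto
      moreover have "Suc (Suc h) * (sV a + sV a') \<le> (2 * Suc h) * (sV a + sV a')" using s0 by (intro mult_right_mono) auto
      ultimately show "m * (sU a + sU a') + Suc (Suc h) * (sV a + sV a') \<le> Suc h * K" by (simp add: K_def algebra_simps)
    qed simp
    also have "\<dots> = 64 * K / \<delta>\<^sup>2 / Suc h"
    proof -
      have "x * K / (x * \<delta> / 8)\<^sup>2 = 64 * K / \<delta>\<^sup>2 / x" if "x \<noteq> 0" for x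
        using that \<delta> by (simp add: power2_eq_square field_simps)
      from this[of "real (Suc h)"] show ?thesis by (simp only: t_def)
    qed
    also have "\<dots> \<le> C / Suc h" by (intro divide_right_mono) (auto simp: C_def)
    finally have "measure Q {\<omega>\<in>space Q. (VF ?B ?v ?W m (Suc h) \<omega>, pV (\<lambda>k l. ?W k l \<omega>) m h) \<in> {z. snd z < fst z}} \<le> C / Suc h" .
    moreover have "measure P {\<omega>\<in>space P. (VF B v W m (Suc h) \<omega>, pV (\<lambda>k l. W k l \<omega>) m h) \<in> {z. snd z < fst z}} =
        measure Q {\<omega>\<in>space Q. (VF ?B ?v ?W m (Suc h) \<omega>, pV (\<lambda>k l. ?W k l \<omega>) m h) \<in> {z. snd z < fst z}}"
      by (rule stat_transfer[OF S[folded m_def N_def] Sa _ order_sets(2)]) (simp add: N_def)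
    ultimately show ?thesis by (simp add: m_def)
  qed
  moreover have "0 \<le> C" using K0 by (simp add: C_def le_max_iff_disj)
  ultimately show ?thesis by blast
qed

end

section \<open>Increments towards endpoints at square heights\<close>

context queue_moments
begin

lemma stat_mono: "stat a m N P B v W \<Longrightarrow> m' \<le> m \<Longrightarrow> N' \<le> N \<Longrightarrow> stat a m' N' P B v W"
  unfolding stat_def by (erule prodlaw_subset) (auto simp: rect_def)

lemma stat_prob_space: "stat a m N P B v W \<Longrightarrow> prob_space P"
  unfolding stat_def by (rule prodlaw_prob_space)

lemma stat_W_measurable: "stat a m N P B v W \<Longrightarrow> i < m \<Longrightarrow> j < N \<Longrightarrow> W i j \<in> borel_measurable P"
  unfolding stat_def using prodlaw_measurable[of P "rect m N" "sys B v W" "laws a" "Cell i j"] by (simp add: sys_def)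

lemma stat_VF_measurable:
  assumes "stat a m N P B v W" "j < N"
  shows "VF B v W m j \<in> borel_measurable P"
proof -
  have "sys B v W r \<in> borel_measurable P" if "r \<in> rect m N" for r
    using assms that unfolding stat_def by (auto intro: prodlaw_measurable)
  from this[of "Top _"] this[of "Col _"] this[of "Cell _ _"]
  have "B k \<in> borel_measurable P" "v l \<in> borel_measurable P" "W k l \<in> borel_measurable P" if "k < m" "l < N" for k l
    using that by (auto simp: sys_def)
  moreover have "v l \<in> borel_measurable P" if "l < N" for l
    using \<open>\<And>r. r \<in> rect m N \<Longrightarrow> _\<close>[of "Col l"] that by (auto simp: sys_def)
  ultimately show ?thesis using assms by (intro Vf_measurable) auto
qed

lemma stat_exists:
  assumes "0 < a" "a < 1"
  shows "\<exists>(P :: (reg \<Rightarrow> real) measure) B v W. stat a m N P B v W"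
proof -
  have "prodlaw (PiM (rect m N) (laws a)) (rect m N) (\<lambda>i f. f i) (laws a)"
    by (rule prodlaw_PiM) (use laws_prob[OF assms] in auto)
  then have "stat a m N (PiM (rect m N) (laws a)) (\<lambda>k f. f (Top k)) (\<lambda>l f. f (Col l)) (\<lambda>k l f. f (Cell k l))"
    unfolding stat_def by (rule prodlaw_cong) (use laws_prob[OF assms] in \<open>auto simp: sys_def rect_def split: reg.split\<close>)
  then show ?thesis by blast
qed

lemma two_type_exists:
  assumes ab: "0 < a" "a < b" "b < 1"
  shows "\<exists>(P :: (reg \<Rightarrow> real) measure) Ba va Bb vb W. stat a m (Suc (Suc N)) P Ba va W \<and> stat b m (Suc (Suc N)) P Bb vb W \<and>
    measure P {\<omega>\<in>space P. 0 < VF Ba va W m (Suc N) \<omega> \<and> VF Bb vb W m N \<omega> = 0} = a * (1 - b) \<and>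
    measure P {\<omega>\<in>space P. 0 < VF Ba va W m N \<omega> \<and> VF Bb vb W m (Suc N) \<omega> = 0} = a * (1 - b) * (1 + b - a)"
proof -
  define X :: "reg \<Rightarrow> (reg \<Rightarrow> real) \<Rightarrow> real" where "X r f = f r" for r f
  define P where "P = PiM (rect2 0 m (Suc (Suc N))) (laws2 a b)"
  interpret t: two_type p U V n a b m "Suc (Suc N)" P X
  proof
    show "prodlaw P (rect2 0 m (Suc (Suc N))) X (laws2 a b)"
      unfolding P_def X_def[abs_def] by (rule prodlaw_PiM) (use laws2_prob[OF ab] in auto)
  qed (rule ab)+
  note Sa = t.stat_a and Sb = t.stat_b
  have vb: "t.vb m j \<in> borel_measurable P" if "j < Suc (Suc N)" for j
    using stat_VF_measurable[OF Sb that] unfolding t.VF_Top .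
  have l: "N < Suc (Suc N)" "Suc N < Suc (Suc N)" by auto
  show ?thesis
    by (intro exI conjI, rule Sa, rule Sb)
      (rule t.prob_lower_row[OF refl stat_VF_measurable[OF Sa l(2)] vb[OF l(1)]],
       rule t.prob_upper_row[OF refl stat_VF_measurable[OF Sa l(1)] vb[OF l(2)]])
qed

text \<open>The increment seen from the site in the corner of an array, towards the point \<open>steps a (k\<^sup>2)\<close> columns
  and \<open>k\<^sup>2\<close> rows away; \<open>r\<close> is the row of the site.\<close>
definition Dn :: "real \<Rightarrow> nat \<Rightarrow> nat \<Rightarrow> nat \<Rightarrow> (nat \<Rightarrow> nat \<Rightarrow> real) \<Rightarrow> real" where
  "Dn a m r k W = pV (\<lambda>i j. W (i + (m - steps a (k\<^sup>2))) (j + (r - k\<^sup>2))) (steps a (k\<^sup>2)) (k\<^sup>2 - 1)"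

lemma Dn_cong:
  assumes "steps a (k\<^sup>2) \<le> m" "k\<^sup>2 \<le> r" "0 < k" "\<And>i j. i < m \<Longrightarrow> j \<le> r \<Longrightarrow> W i j = W' i j"
  shows "Dn a m r k W = Dn a m r k W'"
proof -
  have k: "Suc (k\<^sup>2 - 1) = k\<^sup>2" using assms(3) by simp
  show ?thesis unfolding Dn_def by (rule pV_cong) (use assms k in auto)
qed

lemma Dn_measurable:
  assumes "steps a (k\<^sup>2) \<le> m" "k\<^sup>2 \<le> r" "0 < k" "\<And>i j. i < m \<Longrightarrow> j \<le> r \<Longrightarrow> W i j \<in> borel_measurable P"
  shows "(\<lambda>\<omega>. Dn a m r k (\<lambda>i j. W i j \<omega>)) \<in> borel_measurable P"
proof -
  have k: "Suc (k\<^sup>2 - 1) = k\<^sup>2" using assms(3) by simp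
  show ?thesis unfolding Dn_def
    by (rule pV_measurable[where W="\<lambda>i j. W (i + (m - steps a (k\<^sup>2))) (j + (r - k\<^sup>2))"]) (use assms k in auto)
qed

text \<open>The sub-array between site and endpoint is again stationary, and the stationary
  increment at the site is the same for every endpoint. One random variable can thus be compared
  with the increments towards many endpoints.\<close>

lemma stat_sub:
  assumes a: "0 < a" "a < 1" and S: "stat a m N P B v W" and r: "r < N" and k: "steps a2 (k\<^sup>2) \<le> m" "k\<^sup>2 \<le> r" "0 < k"
  defines "h \<equiv> k\<^sup>2 - 1" and "i0 \<equiv> m - steps a2 (k\<^sup>2)" and "j0 \<equiv> r - k\<^sup>2"
  shows "stat a (steps a2 (Suc h)) (Suc (Suc h)) P (\<lambda>k. UF B v W (k + i0) j0) (\<lambda>l. VF B v W i0 (l + j0)) (\<lambda>k l. W (k + i0) (l + j0))"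
    and "VF (\<lambda>k. UF B v W (k + i0) j0) (\<lambda>l. VF B v W i0 (l + j0)) (\<lambda>k l. W (k + i0) (l + j0)) (steps a2 (Suc h)) (Suc h) \<omega> = VF B v W m r \<omega>"
    and "pV (\<lambda>k l. W (k + i0) (l + j0) \<omega>) (steps a2 (Suc h)) h = Dn a2 m r k (\<lambda>i j. W i j \<omega>)"
proof -
  have h: "Suc h = k\<^sup>2" using k by (simp add: h_def)
  have S': "stat a m (Suc r) P B v W" by (rule stat_mono[OF S]) (use r in auto)
  show "stat a (steps a2 (Suc h)) (Suc (Suc h)) P (\<lambda>k. UF B v W (k + i0) j0) (\<lambda>l. VF B v W i0 (l + j0)) (\<lambda>k l. W (k + i0) (l + j0))"
    by (rule stat_shift[OF a S']) (use k h in \<open>auto simp: i0_def j0_def\<close>)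
  have "steps a2 (Suc h) + i0 = m" "Suc h + j0 = r" using k h by (auto simp: i0_def j0_def)
  then show "VF (\<lambda>k. UF B v W (k + i0) j0) (\<lambda>l. VF B v W i0 (l + j0)) (\<lambda>k l. W (k + i0) (l + j0)) (steps a2 (Suc h)) (Suc h) \<omega> = VF B v W m r \<omega>"
    using UV_shift(1)[of "\<lambda>k. B k \<omega>" "\<lambda>l. v l \<omega>" "\<lambda>k l. W k l \<omega>" i0 j0 "steps a2 (Suc h)" "Suc h"] by simp
  show "pV (\<lambda>k l. W (k + i0) (l + j0) \<omega>) (steps a2 (Suc h)) h = Dn a2 m r k (\<lambda>i j. W i j \<omega>)"
    using h by (simp add: Dn_def h_def i0_def j0_def)
qed

lemma Dn_upper:
  assumes a: "0 < a2" "a2 < a" "a < 1"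
  shows "\<exists>C\<ge>0. \<forall>(P :: 'w measure) B v W m N r k. stat a m N P B v W \<longrightarrow> r < N \<longrightarrow> steps a2 (k\<^sup>2) \<le> m \<longrightarrow> k\<^sup>2 \<le> r \<longrightarrow> 0 < k \<longrightarrow>
     measure P {\<omega>\<in>space P. VF B v W m r \<omega> < Dn a2 m r k (\<lambda>i j. W i j \<omega>)} \<le> C / (real k)\<^sup>2"
proof -
  from compare_upper[OF a] obtain C where C: "0 \<le> C" "\<And>(P :: 'w measure) B v W h. stat a (steps a2 (Suc h)) (Suc (Suc h)) P B v W \<Longrightarrow>
     measure P {\<omega>\<in>space P. VF B v W (steps a2 (Suc h)) (Suc h) \<omega> < pV (\<lambda>k l. W k l \<omega>) (steps a2 (Suc h)) h} \<le> C / Suc h" by blast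
  have a0: "0 < a" using a by simp
  show ?thesis
  proof (intro exI[of _ C] conjI allI impI C(1))
    fix P :: "'w measure" and B v W m N r k
    assume S: "stat a m N P B v W" and r: "r < N" "steps a2 (k\<^sup>2) \<le> m" "k\<^sup>2 \<le> r" "0 < k"
    note sub = stat_sub[OF a0 a(3) S r]
    have "Suc (k\<^sup>2 - 1) = k\<^sup>2" using r by simp
    then show "measure P {\<omega>\<in>space P. VF B v W m r \<omega> < Dn a2 m r k (\<lambda>i j. W i j \<omega>)} \<le> C / (real k)\<^sup>2"
      using C(2)[OF sub(1)] unfolding sub(2,3) by simp
  qed
qed

lemma Dn_lower:
  assumes a: "0 < a" "a < a2" "a2 < 1"
  shows "\<exists>C\<ge>0. \<forall>(P :: 'w measure) B v W m N r k. stat a m N P B v W \<longrightarrow> r < N \<longrightarrow> steps a2 (k\<^sup>2) \<le> m \<longrightarrow> k\<^sup>2 \<le> r \<longrightarrow> 0 < k \<longrightarrow>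
     measure P {\<omega>\<in>space P. Dn a2 m r k (\<lambda>i j. W i j \<omega>) < VF B v W m r \<omega>} \<le> C / (real k)\<^sup>2"
proof -
  from compare_lower[OF a] obtain C where C: "0 \<le> C" "\<And>(P :: 'w measure) B v W h. stat a (steps a2 (Suc h)) (Suc (Suc h)) P B v W \<Longrightarrow>
     measure P {\<omega>\<in>space P. pV (\<lambda>k l. W k l \<omega>) (steps a2 (Suc h)) h < VF B v W (steps a2 (Suc h)) (Suc h) \<omega>} \<le> C / Suc h" by blast
  have a1: "a < 1" using a by simp
  show ?thesis
  proof (intro exI[of _ C] conjI allI impI C(1))
    fix P :: "'w measure" and B v W m N r k
    assume S: "stat a m N P B v W" and r: "r < N" "steps a2 (k\<^sup>2) \<le> m" "k\<^sup>2 \<le> r" "0 < k"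
    note sub = stat_sub[OF a(1) a1 S r]
    have "Suc (k\<^sup>2 - 1) = k\<^sup>2" using r by simp
    then show "measure P {\<omega>\<in>space P. Dn a2 m r k (\<lambda>i j. W i j \<omega>) < VF B v W m r \<omega>} \<le> C / (real k)\<^sup>2"
      using C(2)[OF sub(1)] unfolding sub(2,3) by simp
  qed
qed

end

section \<open>Almost sure behaviour of the increments\<close>

lemma sum_inverse_squares_le:
  assumes "0 < k0"
  shows "(\<Sum>k\<in>{k0<..K}. 1 / (real k)\<^sup>2) \<le> 1 / real k0"
proof (cases "k0 \<le> K")
  case True
  have "(\<Sum>k\<in>{k0<..K}. 1 / (real k)\<^sup>2) \<le> 1 / real k0 - 1 / real K"
    using True
  proof (induction K rule: dec_induct)
    case (step K)
    have "{k0<..Suc K} = insert (Suc K) {k0<..K}" using step by auto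
    moreover have "1 / (real (Suc K))\<^sup>2 \<le> 1 / real K - 1 / real (Suc K)"
      using step assms by (simp add: divide_simps power2_eq_square)
    ultimately show ?case using step by simp
  qed simp
  also have "\<dots> \<le> 1 / real k0" by simp
  finally show ?thesis .
qed (simp add: assms)

locale swfpp = queue_moments p U V n c for p U V n c +
  fixes M :: "'a measure" and w :: "'a \<Rightarrow> site \<Rightarrow> real"
  assumes M: "prob_space M" and indep: "prob_space.indep_vars M (\<lambda>_. borel) (\<lambda>z \<omega>. w \<omega> z) UNIV"
    and distr: "\<And>z. distr M borel (\<lambda>\<omega>. w \<omega> z) = \<nu> 1"
begin

sublocale M: prob_space M by (rule M)

lemma w_measurable[measurable]: "(\<lambda>\<omega>. w \<omega> z) \<in> borel_measurable M"
  using indep unfolding M.indep_vars_def by blast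

text \<open>The lattice is reflected in both coordinates, since array indices count away from the
  endpoint.\<close>

definition "cells mb nb \<omega> i j = w \<omega> (int mb - 1 - int i, int nb - 1 - int j)"

text \<open>The passage time from \<open>(0, y + 1)\<close> minus that from \<open>(0, y)\<close>,
  both to the point \<open>steps a (k\<^sup>2)\<close> columns to the right of and
  \<open>k\<^sup>2\<close> rows above \<open>(0, y)\<close>.\<close>

definition "D a y k \<omega> = pV (\<lambda>i j. w \<omega> (int (steps a (k\<^sup>2)) - 1 - int i, int y + int (k\<^sup>2) - int j)) (steps a (k\<^sup>2)) (k\<^sup>2 - 1)"

lemma D_nonneg: "0 \<le> D a y k \<omega>"
  by (simp add: D_def pV_nonneg)

lemma D_measurable[measurable]: "D a y k \<in> borel_measurable M"
  unfolding D_def by (rule pV_measurable[where W="\<lambda>i j \<omega>. w \<omega> (int (steps a (k\<^sup>2)) - 1 - int i, int y + int (k\<^sup>2) - int j)"]) simp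

lemma D_eq_Dn:
  assumes "steps a (k\<^sup>2) \<le> mb" "k\<^sup>2 + y < nb" "0 < k"
  shows "D a y k \<omega> = Dn a mb (nb - 1 - y) k (cells mb nb \<omega>)"
proof -
  have 1: "int mb - 1 - int (i + (mb - steps a (k\<^sup>2))) = int (steps a (k\<^sup>2)) - 1 - int i" for i using assms by auto
  have 2: "int nb - 1 - int (j + (nb - 1 - y - k\<^sup>2)) = int y + int (k\<^sup>2) - int j" for j using assms by auto
  show ?thesis by (simp only: D_def Dn_def cells_def 1 2)
qed

definition "cell_set mb nb = (\<lambda>(k, l). Cell k l) ` ({..<mb} \<times> {..<nb})"

text \<open>The cells of a stationary system are independent with the weight law, so events about
  the weights in a finite box can be evaluated there. The boundary variables serve as extra
  randomness that \<open>M\<close> need not carry.\<close>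

lemma cell_transfer:
  assumes S: "stat a mb nb P B v W" and a: "0 < a" "a < 1" and pos: "0 < mb" "0 < nb"
    and meas: "{f\<in>space (PiM (cell_set mb nb) (\<lambda>_. borel :: real measure)). \<Phi> (\<lambda>i j. f (Cell i j))} \<in> sets (PiM (cell_set mb nb) (\<lambda>_. borel))"
    and dep: "\<And>W W'. (\<And>i j. i < mb \<Longrightarrow> j < nb \<Longrightarrow> W i j = W' i j) \<Longrightarrow> \<Phi> W \<longleftrightarrow> \<Phi> W'"
  shows "measure M {\<omega>\<in>space M. \<Phi> (cells mb nb \<omega>)} = measure P {\<omega>\<in>space P. \<Phi> (\<lambda>i j. W i j \<omega>)}"
proof -
  let ?I = "cell_set mb nb"
  define key where "key r = (case r of Cell i j \<Rightarrow> (int mb - 1 - int i, int nb - 1 - int j) | _ \<Rightarrow> (0, 0))" for r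
  have fin: "finite ?I" by (simp add: cell_set_def)
  have ne: "?I \<noteq> {}" using pos by (auto simp: cell_set_def)
  have inj: "inj_on key ?I" by (auto simp: inj_on_def cell_set_def key_def)
  have \<nu>1: "prob_space (\<nu> 1)" by (rule prob_laws) auto
  have "prodlaw M (key ` ?I) (\<lambda>z \<omega>. w \<omega> z) (\<lambda>_. \<nu> 1)"
    by (rule prodlaw_indep_vars[OF M indep]) (use fin ne distr \<nu>1 in auto)
  then have "prodlaw M ?I (\<lambda>r \<omega>. w \<omega> (key r)) (\<lambda>r. \<nu> 1)"
    by (rule prodlaw_reindex[OF _ inj]) auto
  then have 1: "prodlaw M ?I (\<lambda>r \<omega>. case r of Cell i j \<Rightarrow> cells mb nb \<omega> i j | _ \<Rightarrow> 0) (\<lambda>r. \<nu> 1)"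
    by (rule prodlaw_cong) (auto simp: cell_set_def key_def cells_def \<nu>1)
  have 2: "prodlaw P ?I (\<lambda>r \<omega>. case r of Cell i j \<Rightarrow> W i j \<omega> | _ \<Rightarrow> 0) (\<lambda>r. \<nu> 1)"
    by (rule prodlaw_cong[OF prodlaw_subset[OF S[unfolded stat_def]]]) (auto simp: cell_set_def rect_def sys_def laws_def \<nu>1)
  have 3: "\<Phi> (\<lambda>i j. (\<lambda>r\<in>?I. (\<lambda>r \<omega>. case r of Cell i j \<Rightarrow> X i j \<omega> | _ \<Rightarrow> 0) r \<omega>) (Cell i j)) \<longleftrightarrow> \<Phi> (\<lambda>i j. X i j \<omega>)"
    for X and \<omega> :: 'z
    by (rule dep) (auto simp: cell_set_def)
  show ?thesis using prodlaw_transfer[OF 1 2 meas]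
    unfolding 3[of "\<lambda>i j \<omega>. cells mb nb \<omega> i j"] 3[of W] by simp
qed

lemma Dn_coordinate_measurable:
  assumes "steps a (k\<^sup>2) \<le> mb" "k\<^sup>2 \<le> r" "r < nb" "0 < k"
  shows "(\<lambda>f. Dn a mb r k (\<lambda>i j. f (Cell i j))) \<in> borel_measurable (PiM (cell_set mb nb) (\<lambda>_. borel :: real measure))"
  by (rule Dn_measurable[where W="\<lambda>i j f. f (Cell i j)"])
    (use assms in \<open>auto simp: cell_set_def intro!: measurable_component_singleton\<close>)

text \<open>A stationary increment at an intermediate parameter separates the increments for
  \<open>a'\<close> from those for \<open>a\<close>. As this separator is one variable for all
  \<open>k\<close> and \<open>l\<close>, a union bound over single indices suffices, and the tail of
  the inverse squares beyond \<open>k0\<close> is at most \<open>1 / k0\<close>, uniformly in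
  \<open>K\<close>.\<close>

lemma sandwich_order:
  assumes a: "0 < a'" "a' < a" "a < 1"
  shows "\<exists>C\<ge>0. \<forall>k0>0. \<forall>K. measure M {\<omega>\<in>space M. \<exists>k\<in>{k0<..K}. \<exists>l\<in>{k0<..K}. D a y k \<omega> < D a' y l \<omega>} \<le> C / real k0"
proof -
  define \<theta> where "\<theta> = (a + a') / 2"
  have \<theta>: "a' < \<theta>" "\<theta> < a" "0 < \<theta>" "\<theta> < 1" using a by (auto simp: \<theta>_def)
  obtain C1 where C1: "0 \<le> C1" "\<And>(P :: (reg \<Rightarrow> real) measure) B v W m N r k. stat \<theta> m N P B v W \<Longrightarrow> r < N \<Longrightarrow> steps a' (k\<^sup>2) \<le> m \<Longrightarrow> k\<^sup>2 \<le> r \<Longrightarrow> 0 < k \<Longrightarrow>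
     measure P {\<omega>\<in>space P. VF B v W m r \<omega> < Dn a' m r k (\<lambda>i j. W i j \<omega>)} \<le> C1 / (real k)\<^sup>2"
    using Dn_upper[OF a(1) \<theta>(1,4)] by blast
  obtain C2 where C2: "0 \<le> C2" "\<And>(P :: (reg \<Rightarrow> real) measure) B v W m N r k. stat \<theta> m N P B v W \<Longrightarrow> r < N \<Longrightarrow> steps a (k\<^sup>2) \<le> m \<Longrightarrow> k\<^sup>2 \<le> r \<Longrightarrow> 0 < k \<Longrightarrow>
     measure P {\<omega>\<in>space P. Dn a m r k (\<lambda>i j. W i j \<omega>) < VF B v W m r \<omega>} \<le> C2 / (real k)\<^sup>2"
    using Dn_lower[OF \<theta>(3,2) a(3)] by blast
  show ?thesis
  proof (intro exI[of _ "C1 + C2"] conjI allI impI)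
    show "0 \<le> C1 + C2" using C1 C2 by simp
    fix k0 K :: nat assume k0: "0 < k0"
    let ?K = "{k0<..K}"
    \<comment> \<open>One array that is large enough for every endpoint with index at most
      \<open>K\<close>.\<close>
    define mb where "mb = Suc (\<Sum>k\<le>K. steps a (k\<^sup>2) + steps a' (k\<^sup>2))"
    define r where "r = K\<^sup>2"
    define nb where "nb = Suc (r + y)"
    have st: "steps a (k\<^sup>2) \<le> mb" "steps a' (k\<^sup>2) \<le> mb" if "k \<in> ?K" for k
    proof -
      have "steps a (k\<^sup>2) + steps a' (k\<^sup>2) \<le> (\<Sum>k\<le>K. steps a (k\<^sup>2) + steps a' (k\<^sup>2))"
        using that by (intro member_le_sum) auto
      then show "steps a (k\<^sup>2) \<le> mb" "steps a' (k\<^sup>2) \<le> mb" by (auto simp: mb_def)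
    qed
    have kr: "k\<^sup>2 \<le> r" "0 < k" if "k \<in> ?K" for k using that by (auto simp: r_def)
    have rn: "r < nb" "nb - 1 - y = r" by (auto simp: nb_def)
    obtain P :: "(reg \<Rightarrow> real) measure" and B v W where S: "stat \<theta> mb nb P B v W" using stat_exists[OF \<theta>(3,4)] by blast
    interpret P: prob_space P by (rule stat_prob_space[OF S])
    define A where "A k = {\<omega>\<in>space P. VF B v W mb r \<omega> < Dn a' mb r k (\<lambda>i j. W i j \<omega>)}" for k
    define A' where "A' k = {\<omega>\<in>space P. Dn a mb r k (\<lambda>i j. W i j \<omega>) < VF B v W mb r \<omega>}" for k
    have Dm: "(\<lambda>\<omega>. Dn a mb r k (\<lambda>i j. W i j \<omega>)) \<in> borel_measurable P" "(\<lambda>\<omega>. Dn a' mb r k (\<lambda>i j. W i j \<omega>)) \<in> borel_measurable P" if "k \<in> ?K" for k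
      by (rule Dn_measurable[OF _ kr[OF that]]; use st[OF that] stat_W_measurable[OF S] rn in auto)+
    have Am: "A k \<in> sets P" "A' k \<in> sets P" if "k \<in> ?K" for k
      unfolding A_def A'_def by (intro borel_measurable_less Dm[OF that] stat_VF_measurable[OF S rn(1)])+
    define \<Phi> where "\<Phi> F \<longleftrightarrow> (\<exists>k\<in>?K. \<exists>l\<in>?K. Dn a mb r k F < Dn a' mb r l F)" for F
    have meas: "{f\<in>space (PiM (cell_set mb nb) (\<lambda>_. borel :: real measure)). \<Phi> (\<lambda>i j. f (Cell i j))} \<in> sets (PiM (cell_set mb nb) (\<lambda>_. borel))"
      unfolding \<Phi>_def
      by (intro sets.sets_Collect_finite_Ex borel_measurable_less Dn_coordinate_measurable) (use st kr rn in auto)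
    have dep: "\<Phi> F \<longleftrightarrow> \<Phi> F'" if "\<And>i j. i < mb \<Longrightarrow> j < nb \<Longrightarrow> F i j = F' i j" for F F'
    proof -
      have "Dn a mb r k F = Dn a mb r k F'" "Dn a' mb r k F = Dn a' mb r k F'" if "k \<in> ?K" for k
        by (rule Dn_cong; use st[OF that] kr[OF that] rn \<open>\<And>i j. i < mb \<Longrightarrow> j < nb \<Longrightarrow> F i j = F' i j\<close> in auto)+
      then show ?thesis by (simp add: \<Phi>_def)
    qed
    have "D a y k \<omega> = Dn a mb r k (cells mb nb \<omega>)" "D a' y k \<omega> = Dn a' mb r k (cells mb nb \<omega>)" if "k \<in> ?K" for k \<omega>
      using D_eq_Dn[of a k mb y nb \<omega>] D_eq_Dn[of a' k mb y nb \<omega>] st[OF that] kr[OF that] rn by (auto simp: nb_def)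
    then have "measure M {\<omega>\<in>space M. \<exists>k\<in>?K. \<exists>l\<in>?K. D a y k \<omega> < D a' y l \<omega>} = measure M {\<omega>\<in>space M. \<Phi> (cells mb nb \<omega>)}"
      by (simp add: \<Phi>_def)
    also have "\<dots> = measure P {\<omega>\<in>space P. \<Phi> (\<lambda>i j. W i j \<omega>)}"
      by (rule cell_transfer[OF S \<theta>(3,4) _ _ meas dep]) (auto simp: mb_def nb_def)
    also have "\<dots> \<le> measure P ((\<Union>k\<in>?K. A k) \<union> (\<Union>k\<in>?K. A' k))"
    proof (rule P.finite_measure_mono)
      show "{\<omega>\<in>space P. \<Phi> (\<lambda>i j. W i j \<omega>)} \<subseteq> (\<Union>k\<in>?K. A k) \<union> (\<Union>k\<in>?K. A' k)"
      proof
        fix \<omega> assume "\<omega> \<in> {\<omega>\<in>space P. \<Phi> (\<lambda>i j. W i j \<omega>)}"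
        then obtain k l where kl: "\<omega> \<in> space P" "k \<in> ?K" "l \<in> ?K" "Dn a mb r k (\<lambda>i j. W i j \<omega>) < Dn a' mb r l (\<lambda>i j. W i j \<omega>)"
          unfolding \<Phi>_def by blast
        then have "\<omega> \<in> A l \<or> \<omega> \<in> A' k" by (auto simp: A_def A'_def)
        then show "\<omega> \<in> (\<Union>k\<in>?K. A k) \<union> (\<Union>k\<in>?K. A' k)" using kl by blast
      qed
      show "(\<Union>k\<in>?K. A k) \<union> (\<Union>k\<in>?K. A' k) \<in> sets P" by (intro sets.Un sets.finite_UN Am finite_greaterThanAtMost)
    qed
    also have "\<dots> \<le> measure P (\<Union>k\<in>?K. A k) + measure P (\<Union>k\<in>?K. A' k)"
      by (intro measure_Un_le sets.finite_UN Am finite_greaterThanAtMost)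
    also have "\<dots> \<le> (\<Sum>k\<in>?K. measure P (A k)) + (\<Sum>k\<in>?K. measure P (A' k))"
      by (intro add_mono measure_UNION_le Am finite_greaterThanAtMost)
    also have "\<dots> \<le> (\<Sum>k\<in>?K. C1 / (real k)\<^sup>2) + (\<Sum>k\<in>?K. C2 / (real k)\<^sup>2)"
      unfolding A_def A'_def by (intro add_mono sum_mono C1(2)[OF S] C2(2)[OF S] st kr rn)
    also have "\<dots> = (C1 + C2) * (\<Sum>k\<in>?K. 1 / (real k)\<^sup>2)"
      by (simp add: sum.distrib[symmetric] sum_distrib_left add_divide_distrib)
    also have "\<dots> \<le> (C1 + C2) * (1 / real k0)"
      by (intro mult_left_mono sum_inverse_squares_le k0) (use C1 C2 in auto)
    finally show "measure M {\<omega>\<in>space M. \<exists>k\<in>?K. \<exists>l\<in>?K. D a y k \<omega> < D a' y l \<omega>} \<le> (C1 + C2) / real k0" by simp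
  qed
qed

text \<open>The bound does not depend on \<open>K\<close>, so by monotone limits the failures beyond
  \<open>k0\<close> have probability at most \<open>C / k0\<close>, and failures beyond every
  \<open>k0\<close> form a null set.\<close>

lemma AE_order:
  assumes a: "0 < a'" "a' < a" "a < 1"
  shows "AE \<omega> in M. \<exists>k0. \<forall>k>k0. \<forall>l>k0. D a' y l \<omega> \<le> D a y k \<omega>"
proof -
  from sandwich_order[OF a, of y] obtain C where C0: "0 \<le> C" and
    C1: "\<forall>k0>0. \<forall>K. measure M {\<omega>\<in>space M. \<exists>k\<in>{k0<..K}. \<exists>l\<in>{k0<..K}. D a y k \<omega> < D a' y l \<omega>} \<le> C / real k0"
    by (elim exE conjE)
  have C: "measure M {\<omega>\<in>space M. \<exists>k\<in>{k0<..K}. \<exists>l\<in>{k0<..K}. D a y k \<omega> < D a' y l \<omega>} \<le> C / real k0" if "0 < k0" for k0 K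
    using C1 that by (elim allE impE)
  define E where "E k0 K = {\<omega>\<in>space M. \<exists>k\<in>{k0<..K}. \<exists>l\<in>{k0<..K}. D a y k \<omega> < D a' y l \<omega>}" for k0 K
  define F where "F k0 = (\<Union>K. E k0 K)" for k0
  have Em: "E k0 K \<in> sets M" for k0 K unfolding E_def
    by (intro sets.sets_Collect_finite_Ex borel_measurable_less D_measurable finite_greaterThanAtMost)
  have Fm: "F k0 \<in> sets M" for k0 unfolding F_def using Em by (intro sets.countable_UN) auto
  have F: "measure M (F k0) \<le> C / real k0" if "0 < k0" for k0
  proof (rule LIMSEQ_le_const2)
    have "incseq (E k0)"
    proof (intro incseq_SucI subsetI)
      fix K \<omega> assume "\<omega> \<in> E k0 K"
      then obtain k l where "\<omega> \<in> space M" "k \<in> {k0<..K}" "l \<in> {k0<..K}" "D a y k \<omega> < D a' y l \<omega>" unfolding E_def by blast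
      moreover from this have "k \<in> {k0<..Suc K}" "l \<in> {k0<..Suc K}" by auto
      ultimately show "\<omega> \<in> E k0 (Suc K)" unfolding E_def by blast
    qed
    then show "(\<lambda>K. measure M (E k0 K)) \<longlonglongrightarrow> measure M (F k0)"
      unfolding F_def by (intro M.finite_Lim_measure_incseq) (use Em in auto)
    show "\<exists>N. \<forall>K\<ge>N. measure M (E k0 K) \<le> C / real k0" using C[OF that] unfolding E_def by (intro exI[of _ 0] allI impI)
  qed
  have "measure M (\<Inter>k0. F k0) \<le> 0"
  proof (rule LIMSEQ_le_const)
    show "(\<lambda>k0. C / real k0) \<longlonglongrightarrow> 0" by (rule lim_const_over_n)
    have "measure M (\<Inter>k0. F k0) \<le> C / real k0" if "1 \<le> k0" for k0
    proof -
      have "measure M (\<Inter>k0. F k0) \<le> measure M (F k0)" by (intro M.finite_measure_mono Fm) auto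
      then show ?thesis using F[of k0] that by simp
    qed
    then show "\<exists>N. \<forall>n\<ge>N. measure M (\<Inter>k0. F k0) \<le> C / real n" by blast
  qed
  then have "measure M (\<Inter>k0. F k0) = 0" by (simp add: measure_le_0_iff)
  then have "(\<Inter>k0. F k0) \<in> null_sets M"
    using Fm by (intro null_setsI sets.countable_INT) (auto simp: M.emeasure_eq_measure)
  then show ?thesis
  proof (rule AE_I')
    show "{\<omega>\<in>space M. \<not> (\<exists>k0. \<forall>k>k0. \<forall>l>k0. D a' y l \<omega> \<le> D a y k \<omega>)} \<subseteq> (\<Inter>k0. F k0)"
    proof (intro subsetI INT_I)
      fix \<omega> k0 assume "\<omega> \<in> {\<omega>\<in>space M. \<not> (\<exists>k0. \<forall>k>k0. \<forall>l>k0. D a' y l \<omega> \<le> D a y k \<omega>)}"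
      then have \<omega>: "\<omega> \<in> space M" "\<not> (\<forall>k>k0. \<forall>l>k0. D a' y l \<omega> \<le> D a y k \<omega>)" by blast+
      then obtain k l where kl: "k > k0" "l > k0" "D a y k \<omega> < D a' y l \<omega>" by (meson not_le)
      then have "k \<in> {k0<..max k l}" "l \<in> {k0<..max k l}" by auto
      then have "\<omega> \<in> E k0 (max k l)" unfolding E_def using \<omega>(1) kl(3) by blast
      then show "\<omega> \<in> F k0" unfolding F_def by blast
    qed
  qed
qed

text \<open>Recurrence instead of a limit: convergence of \<open>D a y k\<close> in \<open>k\<close>
  is not established, but \<open>AE_Z\<close> turns infinitely many zeros at \<open>a\<close> into
  zeros from some index on at every smaller parameter.\<close>

definition "Z a y \<omega> \<longleftrightarrow> (\<forall>k0. \<exists>k>k0. D a y k \<omega> = 0)"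

lemma Z_measurable[measurable]: "Measurable.pred M (Z a y)"
  unfolding Z_def[abs_def] by measurable

text \<open>With all late \<open>D a'\<close> below all late \<open>D a\<close>, a single late zero
  of \<open>D a\<close> makes the late \<open>D a'\<close> vanish, and a single late positive value
  of \<open>D a'\<close> bounds the late \<open>D a\<close> from below.\<close>

lemma AE_Z:
  assumes a: "0 < a'" "a' < a" "a < 1"
  shows "AE \<omega> in M. (Z a y \<omega> \<longrightarrow> (\<exists>k0. \<forall>l>k0. D a' y l \<omega> = 0)) \<and>
     (\<not> Z a' y \<omega> \<longrightarrow> (\<exists>\<delta>>0. \<exists>k0. \<forall>k>k0. \<delta> \<le> D a y k \<omega>))"
  using AE_order[OF a, of y]
proof eventually_elim
  fix \<omega> assume "\<exists>k0. \<forall>k>k0. \<forall>l>k0. D a' y l \<omega> \<le> D a y k \<omega>"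
  then obtain k0 where k0: "\<And>k l. k > k0 \<Longrightarrow> l > k0 \<Longrightarrow> D a' y l \<omega> \<le> D a y k \<omega>" by blast
  show "(Z a y \<omega> \<longrightarrow> (\<exists>k0. \<forall>l>k0. D a' y l \<omega> = 0)) \<and>
     (\<not> Z a' y \<omega> \<longrightarrow> (\<exists>\<delta>>0. \<exists>k0. \<forall>k>k0. \<delta> \<le> D a y k \<omega>))"
  proof (intro conjI impI)
    assume "Z a y \<omega>"
    then obtain k where k: "k > k0" "D a y k \<omega> = 0" by (auto simp: Z_def)
    have "D a' y l \<omega> = 0" if "l > k0" for l using k0[OF k(1) that] k(2) D_nonneg[of a' y l \<omega>] by simp
    then show "\<exists>k0. \<forall>l>k0. D a' y l \<omega> = 0" by blast
  next
    assume "\<not> Z a' y \<omega>"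
    then obtain k1 where k1: "\<And>k. k > k1 \<Longrightarrow> D a' y k \<omega> \<noteq> 0" by (auto simp: Z_def)
    define l where "l = Suc (max k0 k1)"
    have l: "l > k0" "l > k1" by (auto simp: l_def)
    then have "D a' y l \<omega> > 0" using k1[of l] D_nonneg[of a' y l \<omega>] by (simp add: less_le)
    then show "\<exists>\<delta>>0. \<exists>k0. \<forall>k>k0. \<delta> \<le> D a y k \<omega>"
      by (intro exI[of _ "D a' y l \<omega>"] exI[of _ k0] conjI allI impI k0 l(1))
  qed
qed

text \<open>\<open>y\<close> is the row of the site that carries the \<open>a\<close>-increment;
  \<open>y = 0\<close> is the lower of the two sites.\<close>

definition "pair_prob y a b = (if y = (0 :: nat) then a * (1 - b) else a * (1 - b) * (1 + b - a))" for a b :: real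

lemma two_type_rows:
  assumes ab: "0 < a" "a < b" "b < 1" and y: "y \<le> 1"
  shows "\<exists>(P :: (reg \<Rightarrow> real) measure) Ba va Bb vb W. stat a m (Suc (Suc N)) P Ba va W \<and> stat b m (Suc (Suc N)) P Bb vb W \<and>
    measure P {\<omega>\<in>space P. 0 < VF Ba va W m (Suc N - y) \<omega> \<and> VF Bb vb W m (Suc N - (1 - y)) \<omega> = 0} = pair_prob y a b"
proof -
  obtain P :: "(reg \<Rightarrow> real) measure" and Ba va Bb vb W where S: "stat a m (Suc (Suc N)) P Ba va W" "stat b m (Suc (Suc N)) P Bb vb W"
    and l: "measure P {\<omega>\<in>space P. 0 < VF Ba va W m (Suc N) \<omega> \<and> VF Bb vb W m N \<omega> = 0} = a * (1 - b)"
    and u: "measure P {\<omega>\<in>space P. 0 < VF Ba va W m N \<omega> \<and> VF Bb vb W m (Suc N) \<omega> = 0} = a * (1 - b) * (1 + b - a)"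
    using two_type_exists[OF ab, of m N] by (elim exE conjE)
  have "y = 0 \<or> y = 1" using y by auto
  then have "measure P {\<omega>\<in>space P. 0 < VF Ba va W m (Suc N - y) \<omega> \<and> VF Bb vb W m (Suc N - (1 - y)) \<omega> = 0} = pair_prob y a b"
    using l u by (elim disjE) (simp_all add: pair_prob_def)
  with S show ?thesis by (intro exI conjI)
qed

lemma pair_event_embed:
  assumes y: "y \<le> 1" and k: "0 < k" and ab: "0 < a0" "a0 < b0" "b0 < 1" and a: "0 < a" "a < 1" and b: "0 < b" "b < 1"
  obtains P :: "(reg \<Rightarrow> real) measure" and Ba va Bb vb W m N where
    "stat a0 m (Suc (Suc N)) P Ba va W" "stat b0 m (Suc (Suc N)) P Bb vb W" "0 < m"
    "measure P {\<omega>\<in>space P. 0 < VF Ba va W m (Suc N - y) \<omega> \<and> VF Bb vb W m (Suc N - (1 - y)) \<omega> = 0} = pair_prob y a0 b0"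
    "measure M {\<omega>\<in>space M. 0 < D a y k \<omega> \<and> D b (1 - y) k \<omega> = 0} =
      measure P {\<omega>\<in>space P. 0 < Dn a m (Suc N - y) k (\<lambda>i j. W i j \<omega>) \<and> Dn b m (Suc N - (1 - y)) k (\<lambda>i j. W i j \<omega>) = 0}"
    "steps a (k\<^sup>2) \<le> m" "steps b (k\<^sup>2) \<le> m" "k\<^sup>2 \<le> Suc N - y" "k\<^sup>2 \<le> Suc N - (1 - y)"
    "{\<omega>\<in>space P. 0 < Dn a m (Suc N - y) k (\<lambda>i j. W i j \<omega>) \<and> Dn b m (Suc N - (1 - y)) k (\<lambda>i j. W i j \<omega>) = 0} \<in> sets P"
proof -
  define m where "m = Suc (steps a (k\<^sup>2) + steps b (k\<^sup>2))"
  \<comment> \<open>The array has \<open>N + 2\<close> rows and the two sites sit in rows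
    \<open>N\<close> and \<open>Suc N\<close>, so both have at least \<open>k\<^sup>2\<close> rows
    above them.\<close>
  define N where "N = k\<^sup>2"
  obtain P :: "(reg \<Rightarrow> real) measure" and Ba va Bb vb W where P: "stat a0 m (Suc (Suc N)) P Ba va W" "stat b0 m (Suc (Suc N)) P Bb vb W"
    "measure P {\<omega>\<in>space P. 0 < VF Ba va W m (Suc N - y) \<omega> \<and> VF Bb vb W m (Suc N - (1 - y)) \<omega> = 0} = pair_prob y a0 b0"
    using two_type_rows[OF ab y, of m N] by (elim exE conjE)
  have st: "steps a (k\<^sup>2) \<le> m" "steps b (k\<^sup>2) \<le> m" "k\<^sup>2 \<le> Suc N - y" "k\<^sup>2 \<le> Suc N - (1 - y)" "0 < m"
    "Suc N - y < Suc (Suc N)" "Suc N - (1 - y) < Suc (Suc N)"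
    using y by (auto simp: m_def N_def)
  define \<Phi> where "\<Phi> F \<longleftrightarrow> 0 < Dn a m (Suc N - y) k F \<and> Dn b m (Suc N - (1 - y)) k F = 0" for F
  have meas: "{f\<in>space (PiM (cell_set m (Suc (Suc N))) (\<lambda>_. borel :: real measure)). \<Phi> (\<lambda>i j. f (Cell i j))} \<in> sets (PiM (cell_set m (Suc (Suc N))) (\<lambda>_. borel))"
    unfolding \<Phi>_def
    by (intro sets.sets_Collect_conj borel_measurable_less borel_measurable_eq borel_measurable_const Dn_coordinate_measurable st k)
  have dep: "\<Phi> F \<longleftrightarrow> \<Phi> F'" if F: "\<And>i j. i < m \<Longrightarrow> j < Suc (Suc N) \<Longrightarrow> F i j = F' i j" for F F'
  proof -
    have "Dn a m (Suc N - y) k F = Dn a m (Suc N - y) k F'" by (rule Dn_cong) (use st k F in auto)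
    moreover have "Dn b m (Suc N - (1 - y)) k F = Dn b m (Suc N - (1 - y)) k F'" by (rule Dn_cong) (use st k F in auto)
    ultimately show ?thesis by (simp add: \<Phi>_def)
  qed
  have D: "D a y k \<omega> = Dn a m (Suc N - y) k (cells m (Suc (Suc N)) \<omega>)" "D b (1 - y) k \<omega> = Dn b m (Suc N - (1 - y)) k (cells m (Suc (Suc N)) \<omega>)" for \<omega>
    using D_eq_Dn[of a k m y "Suc (Suc N)" \<omega>] D_eq_Dn[of b k m "1 - y" "Suc (Suc N)" \<omega>] st k y by (auto simp: N_def)
  have a01: "a0 < 1" using ab by simp
  have T: "measure M {\<omega>\<in>space M. \<Phi> (cells m (Suc (Suc N)) \<omega>)} = measure P {\<omega>\<in>space P. \<Phi> (\<lambda>i j. W i j \<omega>)}"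
    by (rule cell_transfer[OF P(1) ab(1) a01 _ _ meas dep]) (auto simp: st)
  have ms: "{\<omega>\<in>space P. \<Phi> (\<lambda>i j. W i j \<omega>)} \<in> sets P" unfolding \<Phi>_def
    by (intro sets.sets_Collect_conj borel_measurable_less borel_measurable_eq borel_measurable_const Dn_measurable st k stat_W_measurable[OF P(1)]) (use st in auto)
  have "measure M {\<omega>\<in>space M. 0 < D a y k \<omega> \<and> D b (1 - y) k \<omega> = 0} =
      measure P {\<omega>\<in>space P. 0 < Dn a m (Suc N - y) k (\<lambda>i j. W i j \<omega>) \<and> Dn b m (Suc N - (1 - y)) k (\<lambda>i j. W i j \<omega>) = 0}"
    using T unfolding \<Phi>_def by (simp only: D)
  then show ?thesis by (rule that[OF P(1,2) st(5) P(3) _ st(1-4) ms[unfolded \<Phi>_def]])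
qed

text \<open>Up to two rare failures, \<open>D a\<close> is at most the stationary increment for
  \<open>a1\<close> and \<open>D b\<close> at least the one for \<open>b1\<close>. A positive
  \<open>D a\<close> next to a vanishing \<open>D b\<close> is then inherited by the stationary
  pair, whose law is known.\<close>

lemma pair_upper:
  assumes y: "y \<le> 1" and ab: "0 < a" "a < a1" "a1 < b1" "b1 < b" "b < 1"
  shows "\<exists>C\<ge>0. \<forall>k>0. measure M {\<omega>\<in>space M. 0 < D a y k \<omega> \<and> D b (1 - y) k \<omega> = 0} \<le> pair_prob y a1 b1 + C / (real k)\<^sup>2"
proof -
  have o: "0 < a1" "a1 < 1" "0 < b1" "b1 < 1" "0 < b" "a < 1" using ab by auto
  from Dn_upper[OF ab(1,2) o(2), where 'w="reg \<Rightarrow> real"] obtain C1 where C1: "0 \<le> C1" "\<And>(P :: (reg \<Rightarrow> real) measure) B v W m N r k. stat a1 m N P B v W \<Longrightarrow> r < N \<Longrightarrow> steps a (k\<^sup>2) \<le> m \<Longrightarrow> k\<^sup>2 \<le> r \<Longrightarrow> 0 < k \<Longrightarrow>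
     measure P {\<omega>\<in>space P. VF B v W m r \<omega> < Dn a m r k (\<lambda>i j. W i j \<omega>)} \<le> C1 / (real k)\<^sup>2"
    by blast
  from Dn_lower[OF o(3) ab(4,5), where 'w="reg \<Rightarrow> real"] obtain C2 where C2: "0 \<le> C2" "\<And>(P :: (reg \<Rightarrow> real) measure) B v W m N r k. stat b1 m N P B v W \<Longrightarrow> r < N \<Longrightarrow> steps b (k\<^sup>2) \<le> m \<Longrightarrow> k\<^sup>2 \<le> r \<Longrightarrow> 0 < k \<Longrightarrow>
     measure P {\<omega>\<in>space P. Dn b m r k (\<lambda>i j. W i j \<omega>) < VF B v W m r \<omega>} \<le> C2 / (real k)\<^sup>2"
    by blast
  show ?thesis
  proof (intro exI[of _ "C1 + C2"] conjI allI impI)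
    show "0 \<le> C1 + C2" using C1 C2 by simp
    fix k :: nat assume k: "0 < k"
    obtain P :: "(reg \<Rightarrow> real) measure" and Ba va Bb vb W m N where P:
      "stat a1 m (Suc (Suc N)) P Ba va W" "stat b1 m (Suc (Suc N)) P Bb vb W" "0 < m"
      "measure P {\<omega>\<in>space P. 0 < VF Ba va W m (Suc N - y) \<omega> \<and> VF Bb vb W m (Suc N - (1 - y)) \<omega> = 0} = pair_prob y a1 b1"
      "measure M {\<omega>\<in>space M. 0 < D a y k \<omega> \<and> D b (1 - y) k \<omega> = 0} =
        measure P {\<omega>\<in>space P. 0 < Dn a m (Suc N - y) k (\<lambda>i j. W i j \<omega>) \<and> Dn b m (Suc N - (1 - y)) k (\<lambda>i j. W i j \<omega>) = 0}"
      "steps a (k\<^sup>2) \<le> m" "steps b (k\<^sup>2) \<le> m" "k\<^sup>2 \<le> Suc N - y" "k\<^sup>2 \<le> Suc N - (1 - y)"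
      "{\<omega>\<in>space P. 0 < Dn a m (Suc N - y) k (\<lambda>i j. W i j \<omega>) \<and> Dn b m (Suc N - (1 - y)) k (\<lambda>i j. W i j \<omega>) = 0} \<in> sets P"
      by (rule pair_event_embed[OF y k o(1) ab(3) o(4) ab(1) o(6) o(5) ab(5)])
    interpret P: prob_space P by (rule stat_prob_space[OF P(1)])
    have r: "Suc N - y < Suc (Suc N)" "Suc N - (1 - y) < Suc (Suc N)" by auto
    have Vm: "VF Ba va W m (Suc N - y) \<in> borel_measurable P" "VF Bb vb W m (Suc N - (1 - y)) \<in> borel_measurable P"
      by (rule stat_VF_measurable[OF P(1) r(1)], rule stat_VF_measurable[OF P(2) r(2)])
    have Dma: "(\<lambda>\<omega>. Dn a m (Suc N - y) k (\<lambda>i j. W i j \<omega>)) \<in> borel_measurable P"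
      by (rule Dn_measurable[OF P(6,8) k]) (use stat_W_measurable[OF P(1)] r in auto)
    have Dmb: "(\<lambda>\<omega>. Dn b m (Suc N - (1 - y)) k (\<lambda>i j. W i j \<omega>)) \<in> borel_measurable P"
      by (rule Dn_measurable[OF P(7,9) k]) (use stat_W_measurable[OF P(1)] r in auto)
    note Dm = Dma Dmb
    let ?V = "{\<omega>\<in>space P. 0 < VF Ba va W m (Suc N - y) \<omega> \<and> VF Bb vb W m (Suc N - (1 - y)) \<omega> = 0}"
    let ?A = "{\<omega>\<in>space P. VF Ba va W m (Suc N - y) \<omega> < Dn a m (Suc N - y) k (\<lambda>i j. W i j \<omega>)}"
    let ?B = "{\<omega>\<in>space P. Dn b m (Suc N - (1 - y)) k (\<lambda>i j. W i j \<omega>) < VF Bb vb W m (Suc N - (1 - y)) \<omega>}"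
    have s: "?V \<in> sets P" "?A \<in> sets P" "?B \<in> sets P"
      by (intro sets.sets_Collect_conj borel_measurable_less borel_measurable_eq borel_measurable_const Vm Dm)+
    obtain m' where m': "m = Suc m'" using P(3) by (cases m) auto
    have nn: "0 \<le> VF Bb vb W m (Suc N - (1 - y)) \<omega>" for \<omega> unfolding m' by (rule Vf_nonneg_Suc)
    have "measure P {\<omega>\<in>space P. 0 < Dn a m (Suc N - y) k (\<lambda>i j. W i j \<omega>) \<and> Dn b m (Suc N - (1 - y)) k (\<lambda>i j. W i j \<omega>) = 0} \<le> measure P (?V \<union> (?A \<union> ?B))"
    proof (rule P.finite_measure_mono)
      show "{\<omega>\<in>space P. 0 < Dn a m (Suc N - y) k (\<lambda>i j. W i j \<omega>) \<and> Dn b m (Suc N - (1 - y)) k (\<lambda>i j. W i j \<omega>) = 0} \<subseteq> ?V \<union> (?A \<union> ?B)"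
      proof
        fix \<omega> assume "\<omega> \<in> {\<omega>\<in>space P. 0 < Dn a m (Suc N - y) k (\<lambda>i j. W i j \<omega>) \<and> Dn b m (Suc N - (1 - y)) k (\<lambda>i j. W i j \<omega>) = 0}"
        then show "\<omega> \<in> ?V \<union> (?A \<union> ?B)" using nn[of \<omega>] by auto
      qed
    qed (intro sets.Un s)
    also have "\<dots> \<le> measure P ?V + (measure P ?A + measure P ?B)"
      by (intro order_trans[OF measure_Un_le] add_left_mono measure_Un_le sets.Un s)
    also have "\<dots> \<le> pair_prob y a1 b1 + (C1 / (real k)\<^sup>2 + C2 / (real k)\<^sup>2)"
      using P(4) C1(2)[OF P(1) r(1) P(6,8) k] C2(2)[OF P(2) r(2) P(7,9) k] by simp
    finally show "measure M {\<omega>\<in>space M. 0 < D a y k \<omega> \<and> D b (1 - y) k \<omega> = 0} \<le> pair_prob y a1 b1 + (C1 + C2) / (real k)\<^sup>2"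
      unfolding P(5) by (simp add: add_divide_distrib)
  qed
qed

text \<open>Moving the parameters outwards instead of inwards reverses both inequalities, so the
  stationary event is inherited by the pair of \<open>D\<close>.\<close>

lemma pair_lower:
  assumes y: "y \<le> 1" and ab: "0 < a0" "a0 < a" "a < b" "b < b0" "b0 < 1"
  shows "\<exists>C\<ge>0. \<forall>k>0. pair_prob y a0 b0 - C / (real k)\<^sup>2 \<le> measure M {\<omega>\<in>space M. 0 < D a y k \<omega> \<and> D b (1 - y) k \<omega> = 0}"
proof -
  have o: "0 < a" "a < 1" "0 < b" "b < 1" "a0 < b0" using ab by auto
  from Dn_lower[OF ab(1,2) o(2), where 'w="reg \<Rightarrow> real"] obtain C1 where C1: "0 \<le> C1" "\<And>(P :: (reg \<Rightarrow> real) measure) B v W m N r k. stat a0 m N P B v W \<Longrightarrow> r < N \<Longrightarrow> steps a (k\<^sup>2) \<le> m \<Longrightarrow> k\<^sup>2 \<le> r \<Longrightarrow> 0 < k \<Longrightarrow>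
     measure P {\<omega>\<in>space P. Dn a m r k (\<lambda>i j. W i j \<omega>) < VF B v W m r \<omega>} \<le> C1 / (real k)\<^sup>2"
    by blast
  from Dn_upper[OF o(3) ab(4,5), where 'w="reg \<Rightarrow> real"] obtain C2 where C2: "0 \<le> C2" "\<And>(P :: (reg \<Rightarrow> real) measure) B v W m N r k. stat b0 m N P B v W \<Longrightarrow> r < N \<Longrightarrow> steps b (k\<^sup>2) \<le> m \<Longrightarrow> k\<^sup>2 \<le> r \<Longrightarrow> 0 < k \<Longrightarrow>
     measure P {\<omega>\<in>space P. VF B v W m r \<omega> < Dn b m r k (\<lambda>i j. W i j \<omega>)} \<le> C2 / (real k)\<^sup>2"
    by blast
  show ?thesis
  proof (intro exI[of _ "C1 + C2"] conjI allI impI)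
    show "0 \<le> C1 + C2" using C1 C2 by simp
    fix k :: nat assume k: "0 < k"
    obtain P :: "(reg \<Rightarrow> real) measure" and Ba va Bb vb W m N where P:
      "stat a0 m (Suc (Suc N)) P Ba va W" "stat b0 m (Suc (Suc N)) P Bb vb W" "0 < m"
      "measure P {\<omega>\<in>space P. 0 < VF Ba va W m (Suc N - y) \<omega> \<and> VF Bb vb W m (Suc N - (1 - y)) \<omega> = 0} = pair_prob y a0 b0"
      "measure M {\<omega>\<in>space M. 0 < D a y k \<omega> \<and> D b (1 - y) k \<omega> = 0} =
        measure P {\<omega>\<in>space P. 0 < Dn a m (Suc N - y) k (\<lambda>i j. W i j \<omega>) \<and> Dn b m (Suc N - (1 - y)) k (\<lambda>i j. W i j \<omega>) = 0}"
      "steps a (k\<^sup>2) \<le> m" "steps b (k\<^sup>2) \<le> m" "k\<^sup>2 \<le> Suc N - y" "k\<^sup>2 \<le> Suc N - (1 - y)"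
      "{\<omega>\<in>space P. 0 < Dn a m (Suc N - y) k (\<lambda>i j. W i j \<omega>) \<and> Dn b m (Suc N - (1 - y)) k (\<lambda>i j. W i j \<omega>) = 0} \<in> sets P"
      by (rule pair_event_embed[OF y k ab(1) o(5) ab(5) o(1,2,3,4)])
    interpret P: prob_space P by (rule stat_prob_space[OF P(1)])
    have r: "Suc N - y < Suc (Suc N)" "Suc N - (1 - y) < Suc (Suc N)" by auto
    have Vm: "VF Ba va W m (Suc N - y) \<in> borel_measurable P" "VF Bb vb W m (Suc N - (1 - y)) \<in> borel_measurable P"
      by (rule stat_VF_measurable[OF P(1) r(1)], rule stat_VF_measurable[OF P(2) r(2)])
    have Dma: "(\<lambda>\<omega>. Dn a m (Suc N - y) k (\<lambda>i j. W i j \<omega>)) \<in> borel_measurable P"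
      by (rule Dn_measurable[OF P(6,8) k]) (use stat_W_measurable[OF P(1)] r in auto)
    have Dmb: "(\<lambda>\<omega>. Dn b m (Suc N - (1 - y)) k (\<lambda>i j. W i j \<omega>)) \<in> borel_measurable P"
      by (rule Dn_measurable[OF P(7,9) k]) (use stat_W_measurable[OF P(1)] r in auto)
    note Dm = Dma Dmb
    let ?D = "{\<omega>\<in>space P. 0 < Dn a m (Suc N - y) k (\<lambda>i j. W i j \<omega>) \<and> Dn b m (Suc N - (1 - y)) k (\<lambda>i j. W i j \<omega>) = 0}"
    let ?V = "{\<omega>\<in>space P. 0 < VF Ba va W m (Suc N - y) \<omega> \<and> VF Bb vb W m (Suc N - (1 - y)) \<omega> = 0}"
    let ?A = "{\<omega>\<in>space P. Dn a m (Suc N - y) k (\<lambda>i j. W i j \<omega>) < VF Ba va W m (Suc N - y) \<omega>}"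
    let ?B = "{\<omega>\<in>space P. VF Bb vb W m (Suc N - (1 - y)) \<omega> < Dn b m (Suc N - (1 - y)) k (\<lambda>i j. W i j \<omega>)}"
    have s: "?V \<in> sets P" "?A \<in> sets P" "?B \<in> sets P"
      by (intro sets.sets_Collect_conj borel_measurable_less borel_measurable_eq borel_measurable_const Vm Dm)+
    have nn: "0 \<le> Dn b m (Suc N - (1 - y)) k (\<lambda>i j. W i j \<omega>)" for \<omega> unfolding Dn_def by (rule pV_nonneg)
    have "measure P ?V \<le> measure P (?D \<union> (?A \<union> ?B))"
    proof (rule P.finite_measure_mono)
      show "?V \<subseteq> ?D \<union> (?A \<union> ?B)"
      proof
        fix \<omega> assume "\<omega> \<in> ?V"
        then show "\<omega> \<in> ?D \<union> (?A \<union> ?B)" using nn[of \<omega>] by auto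
      qed
    qed (intro sets.Un s P(10))
    also have "\<dots> \<le> measure P ?D + (measure P ?A + measure P ?B)"
      by (intro order_trans[OF measure_Un_le] add_left_mono measure_Un_le sets.Un s P(10))
    also have "\<dots> \<le> measure P ?D + (C1 / (real k)\<^sup>2 + C2 / (real k)\<^sup>2)"
      using C1(2)[OF P(1) r(1) P(6,8) k] C2(2)[OF P(2) r(2) P(7,9) k] by simp
    finally show "pair_prob y a0 b0 - (C1 + C2) / (real k)\<^sup>2 \<le> measure M {\<omega>\<in>space M. 0 < D a y k \<omega> \<and> D b (1 - y) k \<omega> = 0}"
      unfolding P(5) using P(4) by (simp add: add_divide_distrib)
  qed
qed

lemma liminf_prob_le:
  assumes F: "\<And>k. F k \<in> sets M" and C: "\<And>k. 0 < k \<Longrightarrow> measure M (F k) \<le> g + C / (real k)\<^sup>2"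
  shows "measure M (\<Union>k0. \<Inter>k\<in>{k0<..}. F k) \<le> g"
proof -
  define G where "G k0 = (\<Inter>k\<in>{k0<..}. F k)" for k0
  have Gm: "G k0 \<in> sets M" for k0 unfolding G_def using F by (intro sets.countable_INT') auto
  have lim: "(\<lambda>k. g + C / (real k)\<^sup>2) \<longlonglongrightarrow> g + 0"
    by (intro tendsto_intros real_tendsto_divide_at_top[OF tendsto_const]
      filterlim_pow_at_top filterlim_real_sequentially) auto
  have "measure M (G k0) \<le> g" for k0
  proof (rule LIMSEQ_le_const[OF lim[simplified]])
    have "measure M (G k0) \<le> g + C / (real k)\<^sup>2" if "k > k0" for k
    proof -
      have "measure M (G k0) \<le> measure M (F k)" using that by (intro M.finite_measure_mono F) (auto simp: G_def)
      then show ?thesis using C[of k] that by simp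
    qed
    then show "\<exists>N. \<forall>k\<ge>N. measure M (G k0) \<le> g + C / (real k)\<^sup>2"
      by (intro exI[of _ "Suc k0"]) auto
  qed
  moreover have "(\<lambda>k0. measure M (G k0)) \<longlonglongrightarrow> measure M (\<Union>k0. G k0)"
    using Gm by (intro M.finite_Lim_measure_incseq) (auto simp: incseq_def G_def)
  ultimately have "measure M (\<Union>k0. G k0) \<le> g"
    by (intro LIMSEQ_le_const2) auto
  then show ?thesis by (simp add: G_def)
qed

text \<open>Failure of \<open>Z a\<close> makes \<open>D a\<close> positive from some index on, but
  \<open>Z b\<close> only gives infinitely many zeros. At the smaller \<open>b'\<close> these become
  zeros from some index on, and the event lies in a limit inferior.\<close>

lemma prob_Z_upper:
  assumes y: "y \<le> 1" and ab: "0 < a" "a < a1" "a1 < b1" "b1 < b" "b < 1"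
  shows "measure M {\<omega>\<in>space M. \<not> Z a y \<omega> \<and> Z b (1 - y) \<omega>} \<le> pair_prob y a1 b1"
proof -
  define b' where "b' = (b1 + b) / 2"
  have b': "b1 < b'" "b' < b" "b' < 1" "0 < b'" using ab by (auto simp: b'_def)
  from pair_upper[OF y ab(1-3) b'(1,3)] obtain C where
    "\<forall>k>0. measure M {\<omega>\<in>space M. 0 < D a y k \<omega> \<and> D b' (1 - y) k \<omega> = 0} \<le> pair_prob y a1 b1 + C / (real k)\<^sup>2"
    by (elim exE conjE)
  then have C: "measure M {\<omega>\<in>space M. 0 < D a y k \<omega> \<and> D b' (1 - y) k \<omega> = 0} \<le> pair_prob y a1 b1 + C / (real k)\<^sup>2" if "0 < k" for k
    using that by blast
  define F where "F k = {\<omega>\<in>space M. 0 < D a y k \<omega> \<and> D b' (1 - y) k \<omega> = 0}" for k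
  define G where "G k0 = (\<Inter>k\<in>{k0<..}. F k)" for k0
  have Fm: "F k \<in> sets M" for k unfolding F_def by measurable
  have Gm: "G k0 \<in> sets M" for k0 unfolding G_def using Fm by (intro sets.countable_INT') auto
  have 1: "measure M (\<Union>k0. G k0) \<le> pair_prob y a1 b1"
    unfolding G_def by (rule liminf_prob_le[OF Fm]) (use C in \<open>simp add: F_def\<close>)
  have "measure M {\<omega>\<in>space M. \<not> Z a y \<omega> \<and> Z b (1 - y) \<omega>} \<le> measure M (\<Union>k0. G k0)"
  proof (rule M.finite_measure_mono_AE)
    show "AE \<omega> in M. \<omega> \<in> {\<omega>\<in>space M. \<not> Z a y \<omega> \<and> Z b (1 - y) \<omega>} \<longrightarrow> \<omega> \<in> (\<Union>k0. G k0)"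
      using AE_Z[OF b'(4,2) ab(5), of "1 - y"]
    proof eventually_elim
      fix \<omega> assume h: "(Z b (1 - y) \<omega> \<longrightarrow> (\<exists>k0. \<forall>l>k0. D b' (1 - y) l \<omega> = 0)) \<and>
         (\<not> Z b' (1 - y) \<omega> \<longrightarrow> (\<exists>\<delta>>0. \<exists>k0. \<forall>k>k0. \<delta> \<le> D b (1 - y) k \<omega>))"
      show "\<omega> \<in> {\<omega>\<in>space M. \<not> Z a y \<omega> \<and> Z b (1 - y) \<omega>} \<longrightarrow> \<omega> \<in> (\<Union>k0. G k0)"
      proof
        assume "\<omega> \<in> {\<omega>\<in>space M. \<not> Z a y \<omega> \<and> Z b (1 - y) \<omega>}"
        then have \<omega>: "\<omega> \<in> space M" "\<not> Z a y \<omega>" "Z b (1 - y) \<omega>" by auto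
        obtain k0 where k0: "\<And>l. l > k0 \<Longrightarrow> D b' (1 - y) l \<omega> = 0" using h \<omega>(3) by blast
        obtain k1 where k1: "\<And>l. l > k1 \<Longrightarrow> D a y l \<omega> \<noteq> 0" using \<omega>(2) by (auto simp: Z_def)
        have "\<omega> \<in> F k" if "k > max k0 k1" for k
        proof -
          have "k0 < k" "k1 < k" using that by auto
          then have "D b' (1 - y) k \<omega> = 0" "D a y k \<omega> \<noteq> 0" using k0 k1 by blast+
          then show ?thesis using \<omega>(1) D_nonneg[of a y k \<omega>] by (simp add: F_def less_le)
        qed
        then have "\<omega> \<in> G (max k0 k1)" by (auto simp: G_def)
        then show "\<omega> \<in> (\<Union>k0. G k0)" by blast
      qed
    qed
  qed (use Gm in auto)
  then show ?thesis using 1 by simp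
qed

text \<open>A limit superior has at least the limiting probability. If \<open>D a'\<close> is
  positive and \<open>D b\<close> zero infinitely often, then \<open>Z b\<close> holds, and
  \<open>Z a\<close> is excluded because it would make \<open>D a'\<close> vanish from some index
  on.\<close>

lemma prob_Z_lower:
  assumes y: "y \<le> 1" and ab: "0 < a0" "a0 < a" "a < b" "b < b0" "b0 < 1"
  shows "pair_prob y a0 b0 \<le> measure M {\<omega>\<in>space M. \<not> Z a y \<omega> \<and> Z b (1 - y) \<omega>}"
proof -
  define a' where "a' = (a0 + a) / 2"
  have a': "a0 < a'" "a' < a" "0 < a'" "a < 1" "a' < b" using ab by (auto simp: a'_def)
  from pair_lower[OF y ab(1) a'(1,5) ab(4,5)] obtain C where
    "\<forall>k>0. pair_prob y a0 b0 - C / (real k)\<^sup>2 \<le> measure M {\<omega>\<in>space M. 0 < D a' y k \<omega> \<and> D b (1 - y) k \<omega> = 0}"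
    by (elim exE conjE)
  then have C: "pair_prob y a0 b0 - C / (real k)\<^sup>2 \<le> measure M {\<omega>\<in>space M. 0 < D a' y k \<omega> \<and> D b (1 - y) k \<omega> = 0}" if "0 < k" for k
    using that by blast
  define F where "F k = {\<omega>\<in>space M. 0 < D a' y k \<omega> \<and> D b (1 - y) k \<omega> = 0}" for k
  define G where "G k0 = (\<Union>k\<in>{k0<..}. F k)" for k0
  have Fm: "F k \<in> sets M" for k unfolding F_def by measurable
  have Gm: "G k0 \<in> sets M" for k0 unfolding G_def using Fm by (intro sets.countable_UN') auto
  have lim: "(\<lambda>k. pair_prob y a0 b0 - C / (real k)\<^sup>2) \<longlonglongrightarrow> pair_prob y a0 b0 - 0"
    by (intro tendsto_intros real_tendsto_divide_at_top[OF tendsto_const]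
      filterlim_pow_at_top filterlim_real_sequentially) auto
  have "pair_prob y a0 b0 \<le> measure M (G k0)" for k0
  proof (rule LIMSEQ_le_const2[OF lim[simplified]])
    have "pair_prob y a0 b0 - C / (real k)\<^sup>2 \<le> measure M (G k0)" if "k > k0" for k
    proof -
      have "measure M (F k) \<le> measure M (G k0)" using that by (intro M.finite_measure_mono Gm) (auto simp: G_def)
      then show ?thesis using C[of k] that by (simp add: F_def)
    qed
    then show "\<exists>N. \<forall>k\<ge>N. pair_prob y a0 b0 - C / (real k)\<^sup>2 \<le> measure M (G k0)"
      by (intro exI[of _ "Suc k0"]) auto
  qed
  moreover have "(\<lambda>k0. measure M (G k0)) \<longlonglongrightarrow> measure M (\<Inter>k0. G k0)"
  proof (intro M.finite_Lim_measure_decseq)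
    show "decseq G" unfolding G_def by (intro antimonoI UN_mono) auto
  qed (use Gm in auto)
  ultimately have 1: "pair_prob y a0 b0 \<le> measure M (\<Inter>k0. G k0)"
    by (intro LIMSEQ_le_const) auto
  have "measure M (\<Inter>k0. G k0) \<le> measure M {\<omega>\<in>space M. \<not> Z a y \<omega> \<and> Z b (1 - y) \<omega>}"
  proof (rule M.finite_measure_mono_AE)
    show "AE \<omega> in M. \<omega> \<in> (\<Inter>k0. G k0) \<longrightarrow> \<omega> \<in> {\<omega>\<in>space M. \<not> Z a y \<omega> \<and> Z b (1 - y) \<omega>}"
      using AE_Z[OF a'(3,2,4), of y]
    proof eventually_elim
      fix \<omega> assume h: "(Z a y \<omega> \<longrightarrow> (\<exists>k0. \<forall>l>k0. D a' y l \<omega> = 0)) \<and>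
         (\<not> Z a' y \<omega> \<longrightarrow> (\<exists>\<delta>>0. \<exists>k0. \<forall>k>k0. \<delta> \<le> D a y k \<omega>))"
      show "\<omega> \<in> (\<Inter>k0. G k0) \<longrightarrow> \<omega> \<in> {\<omega>\<in>space M. \<not> Z a y \<omega> \<and> Z b (1 - y) \<omega>}"
      proof
        assume \<omega>: "\<omega> \<in> (\<Inter>k0. G k0)"
        have ex: "\<exists>k>k0. \<omega> \<in> space M \<and> 0 < D a' y k \<omega> \<and> D b (1 - y) k \<omega> = 0" for k0
        proof -
          have "\<omega> \<in> G k0" using \<omega> by blast
          then show ?thesis unfolding G_def F_def by auto
        qed
        have "Z b (1 - y) \<omega>" unfolding Z_def using ex by blast
        moreover have "\<not> Z a y \<omega>"
        proof
          assume "Z a y \<omega>"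
          then obtain k0 where "\<And>l. l > k0 \<Longrightarrow> D a' y l \<omega> = 0" using h by blast
          then show False using ex[of k0] by force
        qed
        ultimately show "\<omega> \<in> {\<omega>\<in>space M. \<not> Z a y \<omega> \<and> Z b (1 - y) \<omega>}" using ex[of 0] by blast
      qed
    qed
  qed auto
  then show ?thesis using 1 by simp
qed

lemma prob_Z:
  assumes y: "y \<le> 1" and ab: "0 < a" "a < b" "b < 1"
  shows "measure M {\<omega>\<in>space M. \<not> Z a y \<omega> \<and> Z b (1 - y) \<omega>} = pair_prob y a b"
proof (rule antisym)
  let ?m = "measure M {\<omega>\<in>space M. \<not> Z a y \<omega> \<and> Z b (1 - y) \<omega>}"
  \<comment> \<open>For \<open>h < d\<close> the parameters stay ordered when moved inwards by
    \<open>h\<close> and stay in (0, 1) when moved outwards; continuity of \<open>pair_prob\<close>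
    then closes the gap as \<open>h\<close> tends to 0.\<close>
  define d where "d = min ((b - a) / 2) (min a (1 - b))"
  have d: "0 < d" using ab by (auto simp: d_def)
  have lim: "((\<lambda>h. pair_prob y (a + h) (b - h)) \<longlongrightarrow> pair_prob y (a + 0) (b - 0)) (at_right 0)"
  proof (cases "y = 0")
    case True
    show ?thesis unfolding pair_prob_def True if_P[OF refl] by (intro tendsto_intros)
  next
    case False
    show ?thesis unfolding pair_prob_def if_not_P[OF False] by (intro tendsto_intros)
  qed
  have lim': "((\<lambda>h. pair_prob y (a - h) (b + h)) \<longlongrightarrow> pair_prob y (a - 0) (b + 0)) (at_right 0)"
  proof (cases "y = 0")
    case True
    show ?thesis unfolding pair_prob_def True if_P[OF refl] by (intro tendsto_intros)
  next
    case False
    show ?thesis unfolding pair_prob_def if_not_P[OF False] by (intro tendsto_intros)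
  qed
  have ev: "eventually (\<lambda>h. h \<in> {0<..<d}) (at_right 0)" using d by (rule eventually_at_right_real)
  show "?m \<le> pair_prob y a b"
  proof (rule tendsto_lowerbound[OF lim[simplified]])
    show "\<forall>\<^sub>F h in at_right 0. ?m \<le> pair_prob y (a + h) (b - h)"
      using ev
    proof eventually_elim
      case (elim h)
      then show ?case using ab by (intro prob_Z_upper[OF y]) (auto simp: d_def)
    qed
  qed simp
  show "pair_prob y a b \<le> ?m"
  proof (rule tendsto_upperbound[OF lim'[simplified]])
    show "\<forall>\<^sub>F h in at_right 0. pair_prob y (a - h) (b + h) \<le> ?m"
      using ev
    proof eventually_elim
      case (elim h)
      then show ?case using ab by (intro prob_Z_lower[OF y]) (auto simp: d_def)
    qed
  qed simp
qed

end

section \<open>Busemann functions and critical angles\<close>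

text \<open>Seen from an endpoint one step further right, the first column acts as a nonnegative
  column boundary in place of the zero boundary, which can only raise the increments.\<close>

lemma pV_mono_right: "pV (\<lambda>i j. W (Suc i) j) m h \<le> pV W (Suc m) h"
proof -
  let ?T = "\<lambda>k. W k 0" and ?E = "\<lambda>_ :: nat. 0 :: real" and ?F = "\<lambda>k l. W k (Suc l)"
  have "pV W (Suc m) h = Vf (\<lambda>k. W (Suc k) 0) (\<lambda>l. Vf ?T ?E ?F 1 l) (\<lambda>k l. W (Suc k) (Suc l)) m h"
    using UV_shift(1)[of ?T ?E ?F 1 0 m h] by (simp add: pV_eq_Vf)
  also have "\<dots> \<ge> Vf (\<lambda>k. W (Suc k) 0) ?E (\<lambda>k l. W (Suc k) (Suc l)) m h"
    using UV_mono[of "\<lambda>k. W (Suc k) 0" "\<lambda>k. W (Suc k) 0" ?E "\<lambda>l. Vf ?T ?E ?F 1 l" "\<lambda>k l. W (Suc k) (Suc l)" m h]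
    by (simp add: Vf_nonneg)
  finally show ?thesis by (simp add: pV_eq_Vf)
qed

text \<open>With one more row on top, the horizontal increments entering the next row are capped by
  its weights; without it they equal these weights.\<close>

lemma pV_mono_up: "pV W m (Suc h) \<le> pV (\<lambda>i j. W i (Suc j)) m h"
proof -
  let ?T = "\<lambda>k. W k 0" and ?E = "\<lambda>_ :: nat. 0 :: real" and ?F = "\<lambda>k l. W k (Suc l)"
  have "pV W m (Suc h) = Vf (\<lambda>k. Uf ?T ?E ?F k 1) ?E (\<lambda>k l. W k (Suc (Suc l))) m h"
    using UV_shift(1)[of ?T ?E ?F 0 1 m h] by (simp add: pV_eq_Vf)
  also have "\<dots> \<le> Vf (\<lambda>k. W k (Suc 0)) ?E (\<lambda>k l. W k (Suc (Suc l))) m h"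
    using UV_mono[of "\<lambda>k. Uf ?T ?E ?F k 1" "\<lambda>k. W k (Suc 0)" ?E ?E "\<lambda>k l. W k (Suc (Suc l))" m h]
    by (simp add: Uf_Suc)
  finally show ?thesis by (simp add: pV_eq_Vf)
qed

definition incr :: "(site \<Rightarrow> real) \<Rightarrow> nat \<Rightarrow> nat \<Rightarrow> nat \<Rightarrow> real" where
  "incr W y m h = pV (\<lambda>i j. W (int m - 1 - int i, int y + int h - int j)) m (h - 1)"

text \<open>This planar monotonicity lets the sparse endpoints at square heights control all
  endpoints.\<close>

lemma incr_mono:
  assumes "m \<le> m'" "h' \<le> h" "0 < h'"
  shows "incr W y m h \<le> incr W y m' h'"
proof -
  have r: "incr W y m h \<le> incr W y (Suc m) h" for m h
    using pV_mono_right[of "\<lambda>i j. W (int (Suc m) - 1 - int i, int y + int h - int j)" m "h - 1"]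
    by (simp add: incr_def algebra_simps)
  have u: "incr W y m (Suc h) \<le> incr W y m h" if "0 < h" for m h
    using pV_mono_up[of "\<lambda>i j. W (int m - 1 - int i, int y + int (Suc h) - int j)" m "h - 1"] that
    by (simp add: incr_def algebra_simps)
  have "incr W y m h \<le> incr W y m' h" using assms(1) by (induction rule: dec_induct) (auto intro: order_trans r)
  also have "\<dots> \<le> incr W y m' h'" using assms(2)
  proof (induction rule: dec_induct)
    case (step k)
    then show ?case using u[of k m'] assms(3) by simp
  qed simp
  finally show ?thesis .
qed

lemma incr_nonneg: "0 \<le> incr W y m h"
  by (simp add: incr_def pV_nonneg)

section \<open>Passage times as minima over finitely many paths\<close>

definition paths :: "(site \<Rightarrow> real) \<Rightarrow> site \<Rightarrow> site \<Rightarrow> real set" where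
  "paths W x v = {path_wt W x s | s. path_end x s = v}"

lemma path_end_simps:
  "path_end x [] = x" "path_end x (True # s) = path_end (fst x + 1, snd x) s" "path_end x (False # s) = path_end (fst x, snd x + 1) s"
  by (auto simp: path_end_def)

lemma path_end_ge: "fst x \<le> fst (path_end x s)" "snd x \<le> snd (path_end x s)"
  by (auto simp: path_end_def)

lemma paths_step:
  assumes "x \<noteq> v"
  shows "paths W x v = (+) (W x) ` paths W (fst x + 1, snd x) v \<union> paths W (fst x, snd x + 1) v"
proof (intro equalityI subsetI)
  fix z assume "z \<in> paths W x v"
  then obtain s where s: "z = path_wt W x s" "path_end x s = v" by (auto simp: paths_def)
  with assms obtain b s' where "s = b # s'" by (cases s) (auto simp: path_end_simps)
  with s show "z \<in> (+) (W x) ` paths W (fst x + 1, snd x) v \<union> paths W (fst x, snd x + 1) v"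
    by (cases b) (auto simp: paths_def path_end_simps)
next
  fix z assume "z \<in> (+) (W x) ` paths W (fst x + 1, snd x) v \<union> paths W (fst x, snd x + 1) v"
  then obtain s where "(z = path_wt W x (True # s) \<and> path_end x (True # s) = v) \<or> (z = path_wt W x (False # s) \<and> path_end x (False # s) = v)"
    by (auto simp: paths_def path_end_simps)
  then show "z \<in> paths W x v" unfolding paths_def by blast
qed

lemma paths_empty: "fst v < fst x \<or> snd v < snd x \<Longrightarrow> paths W x v = {}"
proof -
  assume h: "fst v < fst x \<or> snd v < snd x"
  have "path_end x t \<noteq> v" for t using path_end_ge[of x t] h by auto
  then show ?thesis by (simp add: paths_def)
qed

lemma paths_refl: "paths W v v = {0}"
proof -
  have "path_end v s = v \<longleftrightarrow> s = []" for s
  proof (cases s)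
    case (Cons b s')
    then show ?thesis using path_end_ge[of "(fst v + 1, snd v)" s'] path_end_ge[of "(fst v, snd v + 1)" s']
      by (cases b) (auto simp: path_end_simps)
  qed (simp add: path_end_simps)
  then show ?thesis by (auto simp: paths_def)
qed

text \<open>Splitting off the first step of a path is exactly the recursion of \<open>hgt\<close>.
  Finiteness and nonemptiness are carried through the induction because \<open>Min\<close> over a
  union and over a translate needs them; they also turn the infimum in \<open>L\<close> into a
  minimum.\<close>

lemma paths_pt:
  "finite (paths W (fst v - int i, snd v - int j) v) \<and> paths W (fst v - int i, snd v - int j) v \<noteq> {} \<and>
    Min (paths W (fst v - int i, snd v - int j) v) = pt (\<lambda>k l. W (fst v - 1 - int k, snd v - int l)) i j"
proof -
  let ?S = "\<lambda>i j. paths W (fst v - int i, snd v - int j) v" and ?W = "\<lambda>k l. W (fst v - 1 - int k, snd v - int l)"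
  define Q where "Q i j \<longleftrightarrow> finite (?S i j) \<and> ?S i j \<noteq> {} \<and> Min (?S i j) = pt ?W i j" for i j
  have Min_add: "Min ((+) c ` A) = c + Min A" if "finite A" "A \<noteq> {}" for c :: real and A
    using that mono_Min_commute[of "(+) c" A] by (simp add: mono_def)
  have S1: "?S (Suc i) 0 = (+) (?W i 0) ` ?S i 0" for i
    using paths_step[of "(fst v - int (Suc i), snd v)" v W] paths_empty[of v "(fst v - int (Suc i), snd v + 1)" W]
    by (cases v) (auto simp: algebra_simps)
  have S2: "?S 0 (Suc j) = ?S 0 j" for j
    using paths_step[of "(fst v, snd v - int (Suc j))" v W] paths_empty[of v "(fst v + 1, snd v - int (Suc j))" W]
    by (cases v) (auto simp: algebra_simps)
  have S3: "?S (Suc i) (Suc j) = (+) (?W i (Suc j)) ` ?S i (Suc j) \<union> ?S (Suc i) j" for i j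
    using paths_step[of "(fst v - int (Suc i), snd v - int (Suc j))" v W]
    by (cases v) (auto simp: algebra_simps)
  have S0: "?S 0 0 = {0}" using paths_refl[of W v] by simp
  have pt0: "pt ?W 0 j = 0" for j by (simp add: pt_def hgt_0)
  have ptS0: "pt ?W (Suc i) 0 = ?W i 0 + pt ?W i 0" for i by (simp add: pt_def)
  have ptSS: "pt ?W (Suc i) (Suc j) = min (pt ?W (Suc i) j) (?W i (Suc j) + pt ?W i (Suc j))" for i j by (simp add: pt_def)
  have "Q i j"
  proof (induction i arbitrary: j)
    case 0
    show ?case
    proof (induction j)
      case 0
      show ?case unfolding Q_def S0 by (simp add: pt0)
    next
      case (Suc j)
      then show ?case unfolding Q_def S2 by (simp add: pt0)
    qed
  next
    case (Suc i)
    show ?case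
    proof (induction j)
      case 0
      show ?case using Suc.IH[of 0] unfolding Q_def S1 ptS0 by (simp add: Min_add)
    next
      case (Suc j)
      have A: "finite (?S i (Suc j))" "?S i (Suc j) \<noteq> {}" "Min (?S i (Suc j)) = pt ?W i (Suc j)"
        using \<open>\<And>j. Q i j\<close>[of "Suc j"] unfolding Q_def by blast+
      have B: "finite (?S (Suc i) j)" "?S (Suc i) j \<noteq> {}" "Min (?S (Suc i) j) = pt ?W (Suc i) j"
        using Suc.IH unfolding Q_def by blast+
      have "Min ((+) (?W i (Suc j)) ` ?S i (Suc j) \<union> ?S (Suc i) j) = min (Min ((+) (?W i (Suc j)) ` ?S i (Suc j))) (Min (?S (Suc i) j))"
        using A B by (intro Min_Un) auto
      also have "\<dots> = pt ?W (Suc i) (Suc j)" using A B by (simp add: Min_add ptSS min.commute)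
      finally show ?case unfolding Q_def S3 using A(1) B(1,2) by blast
    qed
  qed
  then show ?thesis unfolding Q_def .
qed

lemma L_eq_pt: "L W (fst v - int i, snd v - int j) v = pt (\<lambda>k l. W (fst v - 1 - int k, snd v - int l)) i j"
proof -
  have "L W (fst v - int i, snd v - int j) v = Inf (paths W (fst v - int i, snd v - int j) v)"
    by (simp add: L_def paths_def)
  also have "\<dots> = Min (paths W (fst v - int i, snd v - int j) v)"
    using paths_pt[of W v i j] by (intro cInf_eq_Min) auto
  finally show ?thesis using paths_pt[of W v i j] by simp
qed

lemma L_increment:
  assumes "0 < h"
  shows "L W (0, int y) (int m, int y + int h) - L W (0, int y + 1) (int m, int y + int h) = - incr W y m h"
proof -
  obtain h' where h: "h = Suc h'" using assms by (cases h) auto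
  show ?thesis
    using L_eq_pt[of W "(int m, int y + int h)" m h] L_eq_pt[of W "(int m, int y + int h)" m h']
    by (simp add: incr_def pV_def h)
qed

section \<open>Sequences with a given direction, and the squares next to their heights\<close>

lemma dir_seq_coords:
  assumes v: "dir_seq t v" and t: "0 < t" "t < 1"
  shows "filterlim (\<lambda>k. real_of_int (snd (v k) - int y)) at_top sequentially"
    and "eventually (\<lambda>k. 0 < fst (v k)) sequentially"
    and "(\<lambda>k. real_of_int (fst (v k)) / real_of_int (snd (v k) - int y)) \<longlonglongrightarrow> t / (1 - t)"
proof -
  define s where "s k = real_of_int (\<bar>fst (v k)\<bar> + \<bar>snd (v k)\<bar>)" for k
  have s: "filterlim s at_top sequentially" and f: "(\<lambda>k. real_of_int (fst (v k)) / s k) \<longlonglongrightarrow> t"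
    and g: "(\<lambda>k. real_of_int (snd (v k)) / s k) \<longlonglongrightarrow> 1 - t"
    using v by (auto simp: dir_seq_def s_def[abs_def])
  have s0: "eventually (\<lambda>k. 0 < s k) sequentially" using s by (simp add: filterlim_at_top_dense)
  have "(\<lambda>k. real y / s k) \<longlonglongrightarrow> 0" by (rule real_tendsto_divide_at_top[OF tendsto_const s])
  from tendsto_diff[OF g this] have "(\<lambda>k. real_of_int (snd (v k)) / s k - real y / s k) \<longlonglongrightarrow> 1 - t" by simp
  then have g': "(\<lambda>k. real_of_int (snd (v k) - int y) / s k) \<longlonglongrightarrow> 1 - t"
    by (simp add: diff_divide_distrib)
  have "filterlim (\<lambda>k. real_of_int (snd (v k) - int y) / s k * s k) at_top sequentially"
    by (rule filterlim_tendsto_pos_mult_at_top[OF g' _ s]) (use t in simp)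
  then show "filterlim (\<lambda>k. real_of_int (snd (v k) - int y)) at_top sequentially"
    by (rule filterlim_mono_eventually) (use s0 in \<open>auto elim!: eventually_mono\<close>)
  have "eventually (\<lambda>k. 0 < real_of_int (fst (v k)) / s k) sequentially" using f t(1) by (rule order_tendstoD)
  then show "eventually (\<lambda>k. 0 < fst (v k)) sequentially"
    using s0 by eventually_elim (simp add: zero_less_divide_iff)
  have "(\<lambda>k. (real_of_int (fst (v k)) / s k) / (real_of_int (snd (v k) - int y) / s k)) \<longlonglongrightarrow> t / (1 - t)"
    by (rule tendsto_divide[OF f g']) (use t in simp)
  then show "(\<lambda>k. real_of_int (fst (v k)) / real_of_int (snd (v k) - int y)) \<longlonglongrightarrow> t / (1 - t)"
    by (rule Lim_transform_eventually) (use s0 in \<open>auto elim!: eventually_mono\<close>)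
qed

lemma dir_seq_exists:
  assumes t: "0 < t" "t < 1"
  shows "\<exists>v. dir_seq t v"
proof -
  define v where "v k = (\<lfloor>t * real k\<rfloor>, \<lfloor>(1 - t) * real k\<rfloor>)" for k
  have lim: "(\<lambda>k. real_of_int \<lfloor>r * real k\<rfloor> / real k) \<longlonglongrightarrow> r" if "0 < r" for r :: real
  proof (rule tendsto_sandwich)
    show "\<forall>\<^sub>F k in sequentially. r - 1 / real k \<le> real_of_int \<lfloor>r * real k\<rfloor> / real k"
      using eventually_gt_at_top[of 0]
    proof eventually_elim
      case (elim k)
      have "r * real k - 1 \<le> real_of_int \<lfloor>r * real k\<rfloor>" by linarith
      then have "(r * real k - 1) / real k \<le> real_of_int \<lfloor>r * real k\<rfloor> / real k" by (intro divide_right_mono) auto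
      then show ?case using elim by (simp add: diff_divide_distrib)
    qed
    show "\<forall>\<^sub>F k in sequentially. real_of_int \<lfloor>r * real k\<rfloor> / real k \<le> r"
      using eventually_gt_at_top[of 0] by eventually_elim (simp add: divide_le_eq)
    show "(\<lambda>k. r - 1 / real k) \<longlonglongrightarrow> r"
      using tendsto_diff[OF tendsto_const lim_const_over_n[of 1], of r] by simp
  qed simp
  define s where "s k = real_of_int (\<bar>fst (v k)\<bar> + \<bar>snd (v k)\<bar>)" for k
  have s: "s k = real_of_int \<lfloor>t * real k\<rfloor> + real_of_int \<lfloor>(1 - t) * real k\<rfloor>" for k
    using t by (simp add: s_def v_def)
  have l1: "(\<lambda>k. s k / real k) \<longlonglongrightarrow> 1"
    using tendsto_add[OF lim[OF t(1)] lim[of "1 - t"]] t by (simp add: s add_divide_distrib)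
  have ev: "\<forall>\<^sub>F k in sequentially. 0 < real k" using eventually_gt_at_top[of 0] by eventually_elim simp
  have sT': "filterlim (\<lambda>k. s k / real k * real k) at_top sequentially"
    by (rule filterlim_tendsto_pos_mult_at_top[OF l1 _ filterlim_real_sequentially]) simp
  have "eventually (\<lambda>k. s k / real k * real k = s k) sequentially" using ev by eventually_elim simp
  from filterlim_cong[OF refl refl this, THEN iffD1, OF sT'] have sT: "filterlim s at_top sequentially" .
  have canc: "eventually (\<lambda>k. (f k / real k) / (s k / real k) = f k / s k) sequentially" for f :: "nat \<Rightarrow> real"
    using ev by eventually_elim simp
  have "(\<lambda>k. (real_of_int \<lfloor>t * real k\<rfloor> / real k) / (s k / real k)) \<longlonglongrightarrow> t / 1"
    by (rule tendsto_divide[OF lim[OF t(1)] l1]) simp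
  then have 1: "(\<lambda>k. real_of_int \<lfloor>t * real k\<rfloor> / s k) \<longlonglongrightarrow> t"
    using Lim_transform_eventually[OF _ canc] by simp
  have "(\<lambda>k. (real_of_int \<lfloor>(1 - t) * real k\<rfloor> / real k) / (s k / real k)) \<longlonglongrightarrow> (1 - t) / 1"
    by (rule tendsto_divide[OF lim l1]) (use t in auto)
  then have 2: "(\<lambda>k. real_of_int \<lfloor>(1 - t) * real k\<rfloor> / s k) \<longlonglongrightarrow> 1 - t"
    using Lim_transform_eventually[OF _ canc] by simp
  have "fst (v k) = \<lfloor>t * real k\<rfloor>" "snd (v k) = \<lfloor>(1 - t) * real k\<rfloor>" for k by (simp_all add: v_def)
  then have "dir_seq t v" unfolding dir_seq_def s_def[symmetric] using sT 1 2 by simp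
  then show ?thesis by blast
qed

text \<open>\<open>j\<^sup>2\<close> is the largest square not exceeding \<open>N k\<close>.
  Consecutive squares have ratio tending to 1, so the gap between \<open>r\<close> and
  \<open>c\<close> absorbs the rounding; an intermediate slope \<open>r'\<close> leaves room for
  both the limit and the subtracted 1.\<close>

lemma eventually_square_below:
  assumes r: "r < c" "0 \<le> r" and N: "filterlim N at_top sequentially" and m: "(\<lambda>k. m k / N k) \<longlonglongrightarrow> r"
    and int: "\<And>k. N k = real_of_int (Ni k)"
  shows "eventually (\<lambda>k. \<exists>j>lb. real (j\<^sup>2) \<le> N k \<and> m k \<le> c * real (j\<^sup>2) - 1) sequentially"
proof -
  define r' where "r' = (r + c) / 2"
  have r': "r < r'" "r' < c" "0 < r'" using r by (auto simp: r'_def)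
  have "(\<lambda>j :: nat. r' * (1 + 1 / real j)\<^sup>2 + 1 / (real j)\<^sup>2) \<longlonglongrightarrow> r' * (1 + 0)\<^sup>2 + 0"
    by (intro tendsto_intros lim_const_over_n real_tendsto_divide_at_top[OF tendsto_const] filterlim_pow_at_top filterlim_real_sequentially) auto
  then have "eventually (\<lambda>j. r' * (1 + 1 / real j)\<^sup>2 + 1 / (real j)\<^sup>2 < c) sequentially" using r' by (intro order_tendstoD(2)) auto
  then obtain j1 where j1: "\<And>j. j \<ge> j1 \<Longrightarrow> r' * (1 + 1 / real j)\<^sup>2 + 1 / (real j)\<^sup>2 < c" by (auto simp: eventually_sequentially)
  define J where "J = Suc (max lb j1)"
  have "eventually (\<lambda>k. real (J\<^sup>2) \<le> N k) sequentially" using N by (simp add: filterlim_at_top)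
  moreover have "eventually (\<lambda>k. m k / N k < r') sequentially" using m r'(1) by (rule order_tendstoD)
  ultimately show ?thesis
  proof eventually_elim
    case (elim k)
    define j where "j = nat \<lfloor>sqrt (N k)\<rfloor>"
    have "0 < real (J\<^sup>2)" by (simp add: J_def)
    then have N0: "0 < N k" using elim(1) by (rule less_le_trans)
    have "real J \<le> sqrt (N k)" using elim by (intro real_le_rsqrt) simp
    then have jJ: "J \<le> j" unfolding j_def by (simp add: le_nat_floor)
    have "real j = real_of_int \<lfloor>sqrt (N k)\<rfloor>" unfolding j_def using N0 by (intro of_nat_nat) simp
    then have j1': "real j \<le> sqrt (N k)" "sqrt (N k) < real j + 1" by linarith+
    have "(real j)\<^sup>2 \<le> (sqrt (N k))\<^sup>2" using j1' by (intro power_mono) auto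
    then have a: "real (j\<^sup>2) \<le> N k" using N0 by simp
    have "(sqrt (N k))\<^sup>2 \<le> (real j + 1)\<^sup>2" using j1' N0 by (intro power_mono) auto
    then have b: "N k \<le> (real j + 1)\<^sup>2" using N0 by simp
    have jp: "0 < real j" using jJ by (simp add: J_def)
    have "m k \<le> r' * N k" using elim N0 by (simp add: divide_less_eq)
    also have "\<dots> \<le> r' * (real j + 1)\<^sup>2" using b r' by simp
    also have "real j + 1 = (1 + 1 / real j) * real j" using jp by (simp add: distrib_right)
    also have "r' * ((1 + 1 / real j) * real j)\<^sup>2 = r' * (1 + 1 / real j)\<^sup>2 * (real j)\<^sup>2" by (simp only: power_mult_distrib mult.assoc)
    also have "\<dots> \<le> (c - 1 / (real j)\<^sup>2) * (real j)\<^sup>2"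
    proof (rule mult_right_mono)
      have "j1 \<le> j" using jJ by (simp add: J_def)
      from j1[OF this] show "r' * (1 + 1 / real j)\<^sup>2 \<le> c - 1 / (real j)\<^sup>2" by simp
    qed simp
    also have "\<dots> = c * real (j\<^sup>2) - 1" using jp by (simp add: left_diff_distrib)
    finally show ?case using a jJ by (intro exI[of _ j]) (auto simp: J_def)
  qed
qed

text \<open>The same with the smallest square not below \<open>N k\<close>, using that
  \<open>(1 - 1 / j)^2\<close> tends to 1.\<close>

lemma eventually_square_above:
  assumes r: "c < r" "0 < c" and N: "filterlim N at_top sequentially" and m: "(\<lambda>k. m k / N k) \<longlonglongrightarrow> r"
  shows "eventually (\<lambda>k. \<exists>j>lb. N k \<le> real (j\<^sup>2) \<and> c * real (j\<^sup>2) \<le> m k) sequentially"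
proof -
  define r' where "r' = (r + c) / 2"
  have r': "r' < r" "c < r'" "0 < r'" using r by (auto simp: r'_def)
  have "(\<lambda>j :: nat. r' * (1 - 1 / real j)\<^sup>2) \<longlonglongrightarrow> r' * (1 - 0)\<^sup>2"
    by (intro tendsto_intros lim_const_over_n)
  then have "eventually (\<lambda>j. c < r' * (1 - 1 / real j)\<^sup>2) sequentially" using r' by (intro order_tendstoD(1)) auto
  then obtain j1 where j1: "\<And>j. j \<ge> j1 \<Longrightarrow> c < r' * (1 - 1 / real j)\<^sup>2" by (auto simp: eventually_sequentially)
  define J where "J = Suc (max lb j1)"
  have "eventually (\<lambda>k. real (J\<^sup>2) \<le> N k) sequentially" using N by (simp add: filterlim_at_top)
  moreover have "eventually (\<lambda>k. r' < m k / N k) sequentially" using m r'(1) by (rule order_tendstoD)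
  ultimately show ?thesis
  proof eventually_elim
    case (elim k)
    define j where "j = nat \<lceil>sqrt (N k)\<rceil>"
    have "0 < real (J\<^sup>2)" by (simp add: J_def)
    then have N0: "0 < N k" using elim(1) by (rule less_le_trans)
    have sJ: "real J \<le> sqrt (N k)" using elim by (intro real_le_rsqrt) simp
    have "real j = real_of_int \<lceil>sqrt (N k)\<rceil>" unfolding j_def using real_sqrt_gt_zero[OF N0] by (intro of_nat_nat) linarith
    then have j1': "sqrt (N k) \<le> real j" "real j - 1 < sqrt (N k)" by linarith+
    have jJ: "J \<le> j" using sJ j1' by simp
    have "(sqrt (N k))\<^sup>2 \<le> (real j)\<^sup>2" using j1' N0 by (intro power_mono) auto
    then have a: "N k \<le> real (j\<^sup>2)" using N0 by simp
    have jp: "1 \<le> real j" using jJ by (simp add: J_def)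
    have "(real j - 1)\<^sup>2 \<le> (sqrt (N k))\<^sup>2" using j1' jp by (intro power_mono) auto
    then have b: "(real j - 1)\<^sup>2 \<le> N k" using N0 by simp
    have "c * real (j\<^sup>2) \<le> r' * (1 - 1 / real j)\<^sup>2 * (real j)\<^sup>2" using j1[of j] jJ by (intro mult_right_mono less_imp_le) (auto simp: J_def)
    also have "\<dots> = r' * ((1 - 1 / real j) * real j)\<^sup>2" by (simp only: power_mult_distrib mult.assoc)
    also have "\<dots> = r' * (real j - 1)\<^sup>2" using jp by (simp add: left_diff_distrib)
    also have "\<dots> \<le> r' * N k" using b r' by simp
    also have "\<dots> \<le> m k" using elim N0 by (simp add: less_divide_eq)
    finally show ?case using a jJ by (intro exI[of _ j]) (auto simp: J_def)
  qed
qed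

text \<open>Every sequence of direction \<open>t\<close> is eventually weakly to the left of and
  above an endpoint of slope \<open>c\<close> at a square height, so by monotonicity its increments
  are exactly zero, not merely small.\<close>

lemma busemann_zero:
  assumes t: "0 < t" "t < 1" and c: "t / (1 - t) < c" and z: "\<And>k. k > k0 \<Longrightarrow> incr W y (nat \<lfloor>c * real (k\<^sup>2)\<rfloor>) (k\<^sup>2) = 0"
  shows "busemann_is W t (0, int y) (0, int y + 1) 0"
  unfolding busemann_is_def
proof (intro allI impI)
  fix v assume v: "dir_seq t v"
  note d = dir_seq_coords(1)[OF v t, of y] dir_seq_coords(2)[OF v t] dir_seq_coords(3)[OF v t, of y]
  have "0 \<le> t / (1 - t)" using t by simp
  note e = eventually_square_below[OF c this d(1,3) refl, where lb=k0]
  have "eventually (\<lambda>k. L W (0, int y) (v k) - L W (0, int y + 1) (v k) = 0) sequentially"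
    using e d(2)
  proof eventually_elim
    case (elim k)
    then obtain j where j: "j > k0" "real (j\<^sup>2) \<le> real_of_int (snd (v k) - int y)" "real_of_int (fst (v k)) \<le> c * real (j\<^sup>2) - 1" by blast
    define m h where "m = nat (fst (v k))" and "h = nat (snd (v k) - int y)"
    have hj: "j\<^sup>2 \<le> h" unfolding h_def using j(2) by linarith
    have j0: "0 < j\<^sup>2" using j(1) by simp
    have "fst (v k) \<le> \<lfloor>c * real (j\<^sup>2)\<rfloor>" using j(3) by linarith
    then have mj: "m \<le> nat \<lfloor>c * real (j\<^sup>2)\<rfloor>" by (simp add: m_def)
    have "0 < h" using hj j0 by linarith
    have vk: "v k = (int m, int y + int h)" using elim \<open>0 < h\<close> by (cases "v k") (auto simp: m_def h_def)
    have "incr W y m h \<le> 0" using incr_mono[OF mj hj j0, of W y] z[OF j(1)] by simp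
    then show ?case using L_increment[OF \<open>0 < h\<close>, of W y m] incr_nonneg[of W y m h] by (simp add: vk)
  qed
  then show "(\<lambda>k. L W (0, int y) (v k) - L W (0, int y + 1) (v k)) \<longlonglongrightarrow> 0" by (rule tendsto_eventually)
qed

text \<open>A single sequence of direction \<open>t\<close> refutes the limit 0: it is eventually
  weakly to the right of and below endpoints whose increments are at least \<delta>.\<close>

lemma busemann_nonzero:
  assumes t: "0 < t" "t < 1" and c: "c < t / (1 - t)" "0 < c" and \<delta>: "0 < \<delta>"
    and z: "\<And>k. k > k0 \<Longrightarrow> \<delta> \<le> incr W y (nat \<lfloor>c * real (k\<^sup>2)\<rfloor>) (k\<^sup>2)"
  shows "\<not> busemann_is W t (0, int y) (0, int y + 1) 0"
proof
  assume B: "busemann_is W t (0, int y) (0, int y + 1) 0"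
  obtain v where v: "dir_seq t v" using dir_seq_exists[OF t] by blast
  have lim: "(\<lambda>k. L W (0, int y) (v k) - L W (0, int y + 1) (v k)) \<longlonglongrightarrow> 0" using B v by (simp add: busemann_is_def)
  note d = dir_seq_coords(1)[OF v t, of y] dir_seq_coords(2)[OF v t] dir_seq_coords(3)[OF v t, of y]
  note e = eventually_square_above[OF c d(1,3), where lb=k0]
  have h1: "eventually (\<lambda>k. 1 \<le> real_of_int (snd (v k) - int y)) sequentially" using d(1) by (simp add: filterlim_at_top)
  have "eventually (\<lambda>k. L W (0, int y) (v k) - L W (0, int y + 1) (v k) \<le> - \<delta>) sequentially"
    using e d(2) h1
  proof eventually_elim
    case (elim k)
    then obtain j where j: "j > k0" "real_of_int (snd (v k) - int y) \<le> real (j\<^sup>2)" "c * real (j\<^sup>2) \<le> real_of_int (fst (v k))" by blast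
    define m h where "m = nat (fst (v k))" and "h = nat (snd (v k) - int y)"
    have hj: "h \<le> j\<^sup>2" unfolding h_def using j(2) by linarith
    have "\<lfloor>c * real (j\<^sup>2)\<rfloor> \<le> fst (v k)" using j(3) by linarith
    then have mj: "nat \<lfloor>c * real (j\<^sup>2)\<rfloor> \<le> m" by (simp add: m_def nat_mono)
    have h0: "0 < h" using elim by (simp add: h_def)
    have vk: "v k = (int m, int y + int h)" using elim h0 by (cases "v k") (auto simp: m_def h_def)
    have "\<delta> \<le> incr W y m h" using incr_mono[OF mj hj h0, of W y] z[OF j(1)] by simp
    then show ?case using L_increment[OF h0, of W y m] by (simp add: vk)
  qed
  from tendsto_upperbound[OF lim this] have "0 \<le> - \<delta>" by simp
  then show False using \<delta> by simp
qed

text \<open>\<open>c / (1 + c)\<close> is the \<open>t\<close> with \<open>t / (1 - t) = c\<close>.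
  Nonemptiness is recorded for the upper bound, since the supremum of an empty set carries no
  information.\<close>

lemma crit_angle_ge:
  assumes c: "0 < c" and z: "\<And>k. k > k0 \<Longrightarrow> incr W y (nat \<lfloor>c * real (k\<^sup>2)\<rfloor>) (k\<^sup>2) = 0"
  shows "c / (1 + c) \<le> crit_angle W (0, int y)" "{t. 0 < t \<and> t < 1 \<and> busemann_is W t (0, int y) ((0, int y) + e2) 0} \<noteq> {}"
proof -
  let ?T = "{t. 0 < t \<and> t < 1 \<and> busemann_is W t (0, int y) ((0, int y) + e2) 0}"
  have bdd: "bdd_above ?T" by (auto intro!: bdd_aboveI[of _ 1])
  have T: "t \<in> ?T" if "0 < t" "t < c / (1 + c)" for t
  proof -
    have "c / (1 + c) < 1" using c by simp
    then have t1: "t < 1" using that by simp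
    have "t * (1 + c) < c" using that c by (simp add: less_divide_eq)
    then have "t < c * (1 - t)" by (simp add: algebra_simps)
    then have "t / (1 - t) < c" using t1 by (simp add: divide_less_eq)
    from busemann_zero[OF that(1) t1 this z] show ?thesis using that(1) t1 by (simp add: e2_def)
  qed
  have pos: "0 < c / (1 + c)" using c by simp
  then obtain q where "0 < q" "q < c / (1 + c)" using dense by blast
  from T[OF this] show "?T \<noteq> {}" by blast
  show "c / (1 + c) \<le> crit_angle W (0, int y)" unfolding crit_angle_def
  proof (rule dense_le_bounded[OF pos])
    show "t \<le> Sup ?T" if "0 < t" "t < c / (1 + c)" for t using T[OF that] bdd by (rule cSup_upper)
  qed
qed

lemma crit_angle_le:
  assumes c: "0 < c" and \<delta>: "0 < \<delta>" and z: "\<And>k. k > k0 \<Longrightarrow> \<delta> \<le> incr W y (nat \<lfloor>c * real (k\<^sup>2)\<rfloor>) (k\<^sup>2)"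
    and ne: "{t. 0 < t \<and> t < 1 \<and> busemann_is W t (0, int y) ((0, int y) + e2) 0} \<noteq> {}"
  shows "crit_angle W (0, int y) \<le> c / (1 + c)"
  unfolding crit_angle_def
proof (rule cSup_least[OF ne])
  fix t assume t: "t \<in> {t. 0 < t \<and> t < 1 \<and> busemann_is W t (0, int y) ((0, int y) + e2) 0}"
  show "t \<le> c / (1 + c)"
  proof (rule ccontr)
    assume "\<not> ?thesis"
    then have "c < t * (1 + c)" using c by (simp add: divide_less_eq not_le)
    then have "c * (1 - t) < t" by (simp add: algebra_simps)
    then have "c < t / (1 - t)" using t by (simp add: less_divide_eq)
    from busemann_nonzero[OF _ _ this c \<delta> z] t show False by (auto simp: e2_def)
  qed
qed

section \<open>Thresholds and the dyadic grid\<close>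

text \<open>An event on critical angles need only agree with a measurable set off a null set; it
  then belongs to the completion and has the measure of that set.\<close>

lemma measure_completion_eq_AE:
  assumes N: "N \<in> null_sets M" and A: "A \<in> sets M" and S: "S \<subseteq> space M"
    and eq: "\<And>\<omega>. \<omega> \<in> space M \<Longrightarrow> \<omega> \<notin> N \<Longrightarrow> \<omega> \<in> S \<longleftrightarrow> \<omega> \<in> A"
  shows "measure (completion M) S = measure M A"
proof -
  have A': "A \<in> sets (completion M)" "A - N \<in> sets (completion M)" using A N by (auto dest: null_setsD2)
  have N': "N \<in> null_sets (completion M)" using N by (rule null_sets_completionI)
  then have "S \<inter> N \<in> null_sets (completion M)" by (rule null_sets_completion_subset[rotated]) auto
  then have "measure (completion M) ((A - N) \<union> (S \<inter> N)) = measure (completion M) (A - N)"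
    using A' by (intro measure_Un_null_set) auto
  moreover have "(A - N) \<union> (S \<inter> N) = S" using eq S sets.sets_into_space[OF A] by blast
  moreover have "measure (completion M) (A - N) = measure (completion M) A"
    using A' N' by (intro measure_Diff_null_set)
  ultimately show ?thesis using A by (simp add: measure_completion)
qed

text \<open>Countable, so almost sure statements hold for all of them at once, and exhausted by
  nested grids, so that crossings can be counted cell by cell.\<close>

definition dyadics :: "real set" where "dyadics = {real i / 2 ^ k | i k. 0 < i \<and> i < 2 ^ k}"

lemma dyadicsI: "0 < i \<Longrightarrow> i < 2 ^ k \<Longrightarrow> real i / 2 ^ k \<in> dyadics"
  by (auto simp: dyadics_def)

lemma dyadics_bounds: "a \<in> dyadics \<Longrightarrow> 0 < a" "a \<in> dyadics \<Longrightarrow> a < 1"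
proof -
  have "real i < 2 ^ k" if "i < 2 ^ k" for i k using that by (metis of_nat_less_iff of_nat_numeral of_nat_power)
  then show "a \<in> dyadics \<Longrightarrow> 0 < a" "a \<in> dyadics \<Longrightarrow> a < 1" by (auto simp: dyadics_def)
qed

lemma countable_dyadics: "countable dyadics"
proof -
  have "dyadics \<subseteq> (\<lambda>(i, k). real i / 2 ^ k) ` (UNIV :: (nat \<times> nat) set)" by (auto simp: dyadics_def)
  then show ?thesis by (rule countable_subset) simp
qed

lemma dyadics_dense:
  assumes "0 \<le> x" "x < z" "z \<le> 1"
  obtains d where "d \<in> dyadics" "x < d" "d < z"
proof -
  obtain k where k: "(1 / 2) ^ k < z - x" using real_arch_pow_inv[of "z - x" "1 / 2"] assms by auto
  define i where "i = nat \<lfloor>x * 2 ^ k\<rfloor> + 1"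
  have i: "real i = real_of_int \<lfloor>x * 2 ^ k\<rfloor> + 1" using assms by (simp add: i_def)
  have "x * 2 ^ k < real i" "real i \<le> x * 2 ^ k + 1" unfolding i by linarith+
  moreover have "x * 2 ^ k + 1 < z * 2 ^ k"
  proof -
    have "1 = (1 / 2 :: real) ^ k * 2 ^ k" by (simp add: power_mult_distrib[symmetric])
    also have "\<dots> < (z - x) * 2 ^ k" using k by simp
    finally show ?thesis by (simp add: left_diff_distrib)
  qed
  ultimately have "x * 2 ^ k < real i" "real i < z * 2 ^ k" by linarith+
  then have a: "x < real i / 2 ^ k" "real i / 2 ^ k < z" by (simp_all only: less_divide_eq divide_less_eq) auto
  have "real i / 2 ^ k < 1" using a assms by linarith
  then have "real i < real (2 ^ k)" by (simp add: divide_less_eq)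
  then have "i < 2 ^ k" by (simp only: of_nat_less_iff)
  then have "real i / 2 ^ k \<in> dyadics" by (intro dyadicsI) (auto simp: i_def)
  then show ?thesis using a by (rule that)
qed

lemma dyadics_grid:
  assumes "a \<in> dyadics" "b \<in> dyadics" "a < b"
  obtains i k where "0 < i" "Suc i < 2 ^ k" "a = real i / 2 ^ k" "real (Suc i) / 2 ^ k \<le> b"
proof -
  obtain i1 k1 where 1: "a = real i1 / 2 ^ k1" "0 < i1" "i1 < 2 ^ k1" using assms by (auto simp: dyadics_def)
  obtain i2 k2 where 2: "b = real i2 / 2 ^ k2" "0 < i2" "i2 < 2 ^ k2" using assms by (auto simp: dyadics_def)
  define i j k where "i = i1 * 2 ^ k2" and "j = i2 * 2 ^ k1" and "k = k1 + k2"
  have a: "a = real i / 2 ^ k" and b: "b = real j / 2 ^ k" by (simp_all add: 1 2 i_def j_def k_def power_add)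
  have "real i < real j" using assms(3) unfolding a b by (simp add: divide_less_cancel)
  then have ij: "Suc i \<le> j" by simp
  have "j < 2 ^ k" using 2 by (simp add: j_def k_def power_add mult.commute)
  then have "Suc i < 2 ^ k" using ij by simp
  moreover have "real (Suc i) / 2 ^ k \<le> b" unfolding b using ij by (intro divide_right_mono) auto
  moreover have "0 < i" using 1 by (simp add: i_def)
  ultimately show ?thesis using that a by blast
qed

section \<open>Almost sure properties of the thresholds\<close>

context swfpp
begin

lemma D_eq_incr: "D a y k \<omega> = incr (w \<omega>) y (nat \<lfloor>c a * real (k\<^sup>2)\<rfloor>) (k\<^sup>2)"
  by (simp add: D_def incr_def steps_def)

lemma stat_VF_law:
  assumes a: "0 < a" "a < 1" and S: "stat a m N P B v W" and r: "r < N"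
  shows "measure P {\<omega>\<in>space P. 0 < VF B v W m r \<omega>} = a" "measure P {\<omega>\<in>space P. VF B v W m r \<omega> = 0} = 1 - a"
  using prodlaw_prob_box[OF stat_column[OF a S], of "{Col r}" "\<lambda>_. {0<..}"]
    prodlaw_prob_box[OF stat_column[OF a S], of "{Col r}" "\<lambda>_. {0}"] r a
  by (simp_all add: laws_def measure_\<pi>)

text \<open>One-site analogue of the bounds for pairs; it serves to keep the thresholds strictly
  between 0 and 1.\<close>

lemma single_bounds:
  assumes a: "0 < a" "a < 1"
  shows "a < a1 \<Longrightarrow> a1 < 1 \<Longrightarrow> \<exists>C. \<forall>k>0. measure M {\<omega>\<in>space M. 0 < D a y k \<omega>} \<le> a1 + C / (real k)\<^sup>2"
    and "0 < a1 \<Longrightarrow> a1 < a \<Longrightarrow> \<exists>C. \<forall>k>0. measure M {\<omega>\<in>space M. D a y k \<omega> = 0} \<le> 1 - a1 + C / (real k)\<^sup>2"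
proof -
  have embed: "measure M {\<omega>\<in>space M. D a y k \<omega> \<in> A} = measure P {\<omega>\<in>space P. Dn a (Suc (steps a (k\<^sup>2))) (k\<^sup>2) k (\<lambda>i j. W i j \<omega>) \<in> A}"
    if S: "stat a1 (Suc (steps a (k\<^sup>2))) (Suc (k\<^sup>2 + y)) P B v W" and k: "0 < k" and A: "A \<in> sets borel" and a1: "0 < a1" "a1 < 1"
    for a1 k A B v W and P :: "(reg \<Rightarrow> real) measure"
  proof -
    let ?m = "Suc (steps a (k\<^sup>2))" and ?N = "Suc (k\<^sup>2 + y)"
    have D: "D a y k \<omega> = Dn a ?m (k\<^sup>2) k (cells ?m ?N \<omega>)" for \<omega>
      using D_eq_Dn[of a k ?m y ?N \<omega>] k by simp
    have "(\<lambda>f. Dn a ?m (k\<^sup>2) k (\<lambda>i j. f (Cell i j))) \<in> borel_measurable (PiM (cell_set ?m ?N) (\<lambda>_. borel :: real measure))"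
      by (rule Dn_coordinate_measurable) (use k in auto)
    from measurable_sets[OF this A]
    have meas: "{f\<in>space (PiM (cell_set ?m ?N) (\<lambda>_. borel :: real measure)). Dn a ?m (k\<^sup>2) k (\<lambda>i j. f (Cell i j)) \<in> A} \<in> sets (PiM (cell_set ?m ?N) (\<lambda>_. borel))"
      by (simp add: vimage_def Int_def conj_commute)
    show ?thesis unfolding D
    proof (rule cell_transfer[OF S a1 _ _ meas])
      show "Dn a ?m (k\<^sup>2) k F \<in> A \<longleftrightarrow> Dn a ?m (k\<^sup>2) k F' \<in> A" if "\<And>i j. i < ?m \<Longrightarrow> j < ?N \<Longrightarrow> F i j = F' i j" for F F'
        using Dn_cong[of a k ?m "k\<^sup>2" F F'] that k by simp
    qed auto
  qed
  have Dm: "(\<lambda>\<omega>. Dn a (Suc (steps a (k\<^sup>2))) (k\<^sup>2) k (\<lambda>i j. W i j \<omega>)) \<in> borel_measurable P"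
    if "stat a1 (Suc (steps a (k\<^sup>2))) (Suc (k\<^sup>2 + y)) P B v W" "0 < k" for a1 k B v W and P :: "(reg \<Rightarrow> real) measure"
    by (rule Dn_measurable) (use stat_W_measurable[OF that(1)] that(2) in auto)
  show "\<exists>C. \<forall>k>0. measure M {\<omega>\<in>space M. 0 < D a y k \<omega>} \<le> a1 + C / (real k)\<^sup>2" if a1: "a < a1" "a1 < 1"
  proof -
    have a10: "0 < a1" using a a1 by simp
    from Dn_upper[OF a(1) a1, where 'w="reg \<Rightarrow> real"] obtain C where C: "\<And>(P :: (reg \<Rightarrow> real) measure) B v W m N r k. stat a1 m N P B v W \<Longrightarrow> r < N \<Longrightarrow> steps a (k\<^sup>2) \<le> m \<Longrightarrow> k\<^sup>2 \<le> r \<Longrightarrow> 0 < k \<Longrightarrow>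
       measure P {\<omega>\<in>space P. VF B v W m r \<omega> < Dn a m r k (\<lambda>i j. W i j \<omega>)} \<le> C / (real k)\<^sup>2"
      by blast
    show ?thesis
    proof (intro exI[of _ C] allI impI)
      fix k :: nat assume k: "0 < k"
      let ?m = "Suc (steps a (k\<^sup>2))" and ?N = "Suc (k\<^sup>2 + y)"
      obtain P :: "(reg \<Rightarrow> real) measure" and B v W where S: "stat a1 ?m ?N P B v W" using stat_exists[OF a10 a1(2)] by blast
      interpret P: prob_space P by (rule stat_prob_space[OF S])
      have r: "k\<^sup>2 < ?N" by simp
      note [measurable] = Dm[OF S k] stat_VF_measurable[OF S r]
      let ?V = "{\<omega>\<in>space P. 0 < VF B v W ?m (k\<^sup>2) \<omega>}"
      let ?A = "{\<omega>\<in>space P. VF B v W ?m (k\<^sup>2) \<omega> < Dn a ?m (k\<^sup>2) k (\<lambda>i j. W i j \<omega>)}"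
      have s: "?V \<in> sets P" "?A \<in> sets P" by measurable
      have "measure M {\<omega>\<in>space M. 0 < D a y k \<omega>} = measure P {\<omega>\<in>space P. Dn a ?m (k\<^sup>2) k (\<lambda>i j. W i j \<omega>) \<in> {0<..}}"
        using embed[OF S k, of "{0<..}"] a10 a1 by simp
      also have "\<dots> \<le> measure P (?V \<union> ?A)"
        by (intro P.finite_measure_mono sets.Un s) auto
      also have "\<dots> \<le> measure P ?V + measure P ?A" by (intro measure_Un_le s)
      also have "\<dots> \<le> a1 + C / (real k)\<^sup>2"
        using C[OF S r _ order_refl k] stat_VF_law(1)[OF a10 a1(2) S r] by simp
      finally show "measure M {\<omega>\<in>space M. 0 < D a y k \<omega>} \<le> a1 + C / (real k)\<^sup>2" .
    qed
  qed
  show "\<exists>C. \<forall>k>0. measure M {\<omega>\<in>space M. D a y k \<omega> = 0} \<le> 1 - a1 + C / (real k)\<^sup>2" if a1: "0 < a1" "a1 < a"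
  proof -
    have a11: "a1 < 1" using a a1 by simp
    from Dn_lower[OF a1 a(2), where 'w="reg \<Rightarrow> real"] obtain C where C: "\<And>(P :: (reg \<Rightarrow> real) measure) B v W m N r k. stat a1 m N P B v W \<Longrightarrow> r < N \<Longrightarrow> steps a (k\<^sup>2) \<le> m \<Longrightarrow> k\<^sup>2 \<le> r \<Longrightarrow> 0 < k \<Longrightarrow>
       measure P {\<omega>\<in>space P. Dn a m r k (\<lambda>i j. W i j \<omega>) < VF B v W m r \<omega>} \<le> C / (real k)\<^sup>2"
      by blast
    show ?thesis
    proof (intro exI[of _ C] allI impI)
      fix k :: nat assume k: "0 < k"
      let ?m = "Suc (steps a (k\<^sup>2))" and ?N = "Suc (k\<^sup>2 + y)"
      obtain P :: "(reg \<Rightarrow> real) measure" and B v W where S: "stat a1 ?m ?N P B v W" using stat_exists[OF a1(1) a11] by blast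
      interpret P: prob_space P by (rule stat_prob_space[OF S])
      have r: "k\<^sup>2 < ?N" by simp
      note [measurable] = Dm[OF S k] stat_VF_measurable[OF S r]
      let ?V = "{\<omega>\<in>space P. VF B v W ?m (k\<^sup>2) \<omega> = 0}"
      let ?A = "{\<omega>\<in>space P. Dn a ?m (k\<^sup>2) k (\<lambda>i j. W i j \<omega>) < VF B v W ?m (k\<^sup>2) \<omega>}"
      have s: "?V \<in> sets P" "?A \<in> sets P" by measurable
      have "measure M {\<omega>\<in>space M. D a y k \<omega> = 0} = measure P {\<omega>\<in>space P. Dn a ?m (k\<^sup>2) k (\<lambda>i j. W i j \<omega>) \<in> {0}}"
        using embed[OF S k, of "{0}"] a1 a11 by simp
      also have "\<dots> \<le> measure P (?V \<union> ?A)"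
      proof (intro P.finite_measure_mono sets.Un s subsetI)
        fix \<omega> assume "\<omega> \<in> {\<omega>\<in>space P. Dn a ?m (k\<^sup>2) k (\<lambda>i j. W i j \<omega>) \<in> {0}}"
        then show "\<omega> \<in> ?V \<union> ?A" using Vf_nonneg_Suc[of "\<lambda>k. B k \<omega>" "\<lambda>l. v l \<omega>" "\<lambda>k l. W k l \<omega>" "steps a (k\<^sup>2)" "k\<^sup>2"] by auto
      qed
      also have "\<dots> \<le> measure P ?V + measure P ?A" by (intro measure_Un_le s)
      also have "\<dots> \<le> 1 - a1 + C / (real k)\<^sup>2"
        using C[OF S r _ order_refl k] stat_VF_law(2)[OF a1(1) a11 S r] by simp
      finally show "measure M {\<omega>\<in>space M. D a y k \<omega> = 0} \<le> 1 - a1 + C / (real k)\<^sup>2" .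
    qed
  qed
qed

lemma prob_not_Z_le:
  assumes a: "0 < a" "a < a1" "a1 < 1"
  shows "measure M {\<omega>\<in>space M. \<not> Z a y \<omega>} \<le> a1"
proof -
  have "a < 1" using a by simp
  from single_bounds(1)[OF a(1) this a(2,3), of y] obtain C where C: "\<forall>k>0. measure M {\<omega>\<in>space M. 0 < D a y k \<omega>} \<le> a1 + C / (real k)\<^sup>2" by (elim exE)
  have "measure M {\<omega>\<in>space M. \<not> Z a y \<omega>} \<le> measure M (\<Union>k0. \<Inter>k\<in>{k0<..}. {\<omega>\<in>space M. 0 < D a y k \<omega>})"
  proof (rule M.finite_measure_mono)
    show "{\<omega>\<in>space M. \<not> Z a y \<omega>} \<subseteq> (\<Union>k0. \<Inter>k\<in>{k0<..}. {\<omega>\<in>space M. 0 < D a y k \<omega>})"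
    proof
      fix \<omega> assume \<omega>: "\<omega> \<in> {\<omega>\<in>space M. \<not> Z a y \<omega>}"
      then obtain k0 where "\<And>k. k > k0 \<Longrightarrow> D a y k \<omega> \<noteq> 0" by (auto simp: Z_def)
      then have "0 < D a y k \<omega>" if "k > k0" for k using that D_nonneg[of a y k \<omega>] by (simp add: less_le)
      then show "\<omega> \<in> (\<Union>k0. \<Inter>k\<in>{k0<..}. {\<omega>\<in>space M. 0 < D a y k \<omega>})" using \<omega> by blast
    qed
  qed (intro sets.countable_UN sets.countable_INT' image_subsetI, auto)
  also have "\<dots> \<le> a1" by (rule liminf_prob_le) (use C in auto)
  finally show ?thesis .
qed

lemma prob_Z_le:
  assumes a: "0 < a1" "a1 < a" "a < 1"
  shows "measure M {\<omega>\<in>space M. Z a y \<omega>} \<le> 1 - a1"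
proof -
  define a' where "a' = (a1 + a) / 2"
  have a': "a1 < a'" "a' < a" "0 < a'" "a' < 1" using a by (auto simp: a'_def)
  from single_bounds(2)[OF a'(3,4) a(1) a'(1), of y] obtain C where C: "\<forall>k>0. measure M {\<omega>\<in>space M. D a' y k \<omega> = 0} \<le> 1 - a1 + C / (real k)\<^sup>2" by (elim exE)
  have "measure M {\<omega>\<in>space M. Z a y \<omega>} \<le> measure M (\<Union>k0. \<Inter>k\<in>{k0<..}. {\<omega>\<in>space M. D a' y k \<omega> = 0})"
  proof (rule M.finite_measure_mono_AE)
    show "AE \<omega> in M. \<omega> \<in> {\<omega>\<in>space M. Z a y \<omega>} \<longrightarrow> \<omega> \<in> (\<Union>k0. \<Inter>k\<in>{k0<..}. {\<omega>\<in>space M. D a' y k \<omega> = 0})"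
      using AE_Z[OF a'(3,2) a(3), of y] by eventually_elim blast
  qed (intro sets.countable_UN sets.countable_INT' image_subsetI, auto)
  also have "\<dots> \<le> 1 - a1" by (rule liminf_prob_le) (use C in auto)
  finally show ?thesis .
qed

text \<open>\<open>Z\<close> fails at \<open>1 / 2 ^ k\<close>, and holds at
  \<open>1 - 1 / 2 ^ k\<close>, with probability at most \<open>2 / 2 ^ k\<close>; neither can
  happen for all \<open>k\<close> except on a null set.\<close>

lemma AE_ex_Z:
  shows "AE \<omega> in M. \<exists>a\<in>dyadics. Z a y \<omega>" and "AE \<omega> in M. \<exists>a\<in>dyadics. \<not> Z a y \<omega>"
proof -
  have null: "AE \<omega> in M. \<exists>k. Q k \<omega>"
    if m: "\<And>k. {\<omega>\<in>space M. \<not> Q k \<omega>} \<in> sets M" and le: "\<And>k. 2 \<le> k \<Longrightarrow> measure M {\<omega>\<in>space M. \<not> Q k \<omega>} \<le> 2 * (1 / 2) ^ k" for Q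
  proof -
    have "measure M (\<Inter>k. {\<omega>\<in>space M. \<not> Q k \<omega>}) \<le> 0"
    proof (rule LIMSEQ_le_const)
      show "(\<lambda>k. 2 * (1 / 2 :: real) ^ k) \<longlonglongrightarrow> 0" by (auto intro!: tendsto_eq_intros LIMSEQ_power_zero)
      have "measure M (\<Inter>k. {\<omega>\<in>space M. \<not> Q k \<omega>}) \<le> 2 * (1 / 2) ^ k" if "2 \<le> k" for k
      proof -
        have "measure M (\<Inter>k. {\<omega>\<in>space M. \<not> Q k \<omega>}) \<le> measure M {\<omega>\<in>space M. \<not> Q k \<omega>}"
          by (intro M.finite_measure_mono m) auto
        then show ?thesis using le[OF that] by simp
      qed
      then show "\<exists>N. \<forall>k\<ge>N. measure M (\<Inter>k. {\<omega>\<in>space M. \<not> Q k \<omega>}) \<le> 2 * (1 / 2) ^ k" by (intro exI[of _ 2]) auto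
    qed
    then have "measure M (\<Inter>k. {\<omega>\<in>space M. \<not> Q k \<omega>}) = 0" by (simp add: measure_le_0_iff)
    then have "(\<Inter>k. {\<omega>\<in>space M. \<not> Q k \<omega>}) \<in> null_sets M"
      using m by (intro null_setsI sets.countable_INT) (auto simp: M.emeasure_eq_measure)
    then show ?thesis by (rule AE_I') auto
  qed
  have p: "(1 / 2 :: real) ^ k = 1 / 2 ^ k" for k by (simp add: power_divide)
  have p2: "2 / 2 ^ k < (1 :: real)" if "2 \<le> k" for k :: nat
  proof -
    have "(2 :: real) ^ 1 < 2 ^ k" by (rule power_strict_increasing) (use that in auto)
    then show ?thesis by simp
  qed
  have "AE \<omega> in M. \<exists>k. 2 \<le> k \<and> Z (1 / 2 ^ k) y \<omega>"
  proof (rule null)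
    fix k :: nat assume k: "2 \<le> k"
    have "measure M {\<omega>\<in>space M. \<not> Z (1 / 2 ^ k) y \<omega>} \<le> 2 / 2 ^ k"
      by (rule prob_not_Z_le) (use p2[OF k] in \<open>auto simp: divide_strict_right_mono\<close>)
    then show "measure M {\<omega>\<in>space M. \<not> (2 \<le> k \<and> Z (1 / 2 ^ k) y \<omega>)} \<le> 2 * (1 / 2) ^ k" using k by (simp add: p)
  qed measurable
  then show "AE \<omega> in M. \<exists>a\<in>dyadics. Z a y \<omega>"
  proof eventually_elim
    case (elim \<omega>)
    then obtain k where k: "2 \<le> k" "Z (1 / 2 ^ k) y \<omega>" by blast
    have "1 < (2 :: nat) ^ k" using k by (intro one_less_power) auto
    then show ?case using dyadicsI[of 1 k] k by auto
  qed
  have "AE \<omega> in M. \<exists>k. 2 \<le> k \<and> \<not> Z (1 - 1 / 2 ^ k) y \<omega>"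
  proof (rule null)
    fix k :: nat assume k: "2 \<le> k"
    have "measure M {\<omega>\<in>space M. Z (1 - 1 / 2 ^ k) y \<omega>} \<le> 1 - (1 - 2 / 2 ^ k)"
      by (rule prob_Z_le) (use p2[OF k] in \<open>auto simp: divide_strict_right_mono\<close>)
    then show "measure M {\<omega>\<in>space M. \<not> (2 \<le> k \<and> \<not> Z (1 - 1 / 2 ^ k) y \<omega>)} \<le> 2 * (1 / 2) ^ k" using k by (simp add: p)
  qed measurable
  then show "AE \<omega> in M. \<exists>a\<in>dyadics. \<not> Z a y \<omega>"
  proof eventually_elim
    case (elim \<omega>)
    then obtain k where k: "2 \<le> k" "\<not> Z (1 - 1 / 2 ^ k) y \<omega>" by blast
    have k2: "1 < (2 :: nat) ^ k" using k by (intro one_less_power) auto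
    have "real (2 ^ k - 1) / 2 ^ k = 1 - 1 / 2 ^ k" using k2 by (simp add: of_nat_diff diff_divide_distrib)
    moreover have "real (2 ^ k - 1) / 2 ^ k \<in> dyadics" by (rule dyadicsI) (use k2 in auto)
    ultimately show ?case using k by auto
  qed
qed

text \<open>\<open>Z\<close> is monotone in \<open>a\<close> only almost surely.\<close>
definition "Zm a y \<omega> \<longleftrightarrow> (\<exists>b\<in>dyadics. a \<le> b \<and> Z b y \<omega>)"

lemma Zm_measurable[measurable]: "Measurable.pred M (Zm a y)"
proof -
  have "{\<omega>\<in>space M. Zm a y \<omega>} = (\<Union>b\<in>dyadics. {\<omega>\<in>space M. a \<le> b \<and> Z b y \<omega>})" by (auto simp: Zm_def)
  also have "\<dots> \<in> sets M" by (intro sets.countable_UN' countable_dyadics image_subsetI) measurable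
  finally show ?thesis by (simp add: pred_def)
qed

lemma Zm_antimono: "a \<le> b \<Longrightarrow> Zm b y \<omega> \<Longrightarrow> Zm a y \<omega>"
  unfolding Zm_def by (meson order_trans)

text \<open>Collects the almost sure facts for both sites and all dyadic parameters, so that the
  discussion of thresholds becomes deterministic.\<close>

definition "good \<omega> \<longleftrightarrow> (\<forall>y\<in>{0, 1}. (\<forall>a'\<in>dyadics. \<forall>a\<in>dyadics. a' < a \<longrightarrow>
    (Z a y \<omega> \<longrightarrow> (\<exists>k0. \<forall>l>k0. D a' y l \<omega> = 0)) \<and> (\<not> Z a' y \<omega> \<longrightarrow> (\<exists>\<delta>>0. \<exists>k0. \<forall>k>k0. \<delta> \<le> D a y k \<omega>))) \<and>
    (\<exists>a\<in>dyadics. Z a y \<omega>) \<and> (\<exists>a\<in>dyadics. \<not> Z a y \<omega>))"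

lemma AE_good: "AE \<omega> in M. good \<omega>"
proof -
  have "AE \<omega> in M. \<forall>a'\<in>dyadics. \<forall>a\<in>dyadics. a' < a \<longrightarrow>
    (Z a y \<omega> \<longrightarrow> (\<exists>k0. \<forall>l>k0. D a' y l \<omega> = 0)) \<and> (\<not> Z a' y \<omega> \<longrightarrow> (\<exists>\<delta>>0. \<exists>k0. \<forall>k>k0. \<delta> \<le> D a y k \<omega>))" for y
  proof (intro AE_ball_countable[OF countable_dyadics, THEN iffD2] ballI)
    fix a' a assume a: "a' \<in> dyadics" "a \<in> dyadics"
    show "AE \<omega> in M. a' < a \<longrightarrow>
      (Z a y \<omega> \<longrightarrow> (\<exists>k0. \<forall>l>k0. D a' y l \<omega> = 0)) \<and> (\<not> Z a' y \<omega> \<longrightarrow> (\<exists>\<delta>>0. \<exists>k0. \<forall>k>k0. \<delta> \<le> D a y k \<omega>))"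
    proof (cases "a' < a")
      case True
      show ?thesis using AE_Z[OF dyadics_bounds(1)[OF a(1)] True dyadics_bounds(2)[OF a(2)], of y] by eventually_elim simp
    qed simp
  qed
  from AE_conjI[OF this AE_conjI[OF AE_ex_Z]] have "AE \<omega> in M. \<forall>y\<in>{0, 1}. (\<forall>a'\<in>dyadics. \<forall>a\<in>dyadics. a' < a \<longrightarrow>
    (Z a y \<omega> \<longrightarrow> (\<exists>k0. \<forall>l>k0. D a' y l \<omega> = 0)) \<and> (\<not> Z a' y \<omega> \<longrightarrow> (\<exists>\<delta>>0. \<exists>k0. \<forall>k>k0. \<delta> \<le> D a y k \<omega>))) \<and>
    (\<exists>a\<in>dyadics. Z a y \<omega>) \<and> (\<exists>a\<in>dyadics. \<not> Z a y \<omega>)"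
    by (intro AE_ball_countable[THEN iffD2] ballI) auto
  then show ?thesis by (simp only: good_def)
qed

text \<open>On good outcomes a zero pattern at a larger dyadic forces zeros from some index on at
  \<open>a\<close>, so the monotone version adds nothing.\<close>

lemma Zm_iff_Z:
  assumes "good \<omega>" "y \<in> {0, 1}" "a \<in> dyadics"
  shows "Zm a y \<omega> \<longleftrightarrow> Z a y \<omega>"
proof
  assume "Zm a y \<omega>"
  then obtain b where b: "b \<in> dyadics" "a \<le> b" "Z b y \<omega>" by (auto simp: Zm_def)
  show "Z a y \<omega>"
  proof (cases "a = b")
    case False
    then have "a < b" using b by simp
    then obtain k0 where "\<forall>l>k0. D a y l \<omega> = 0" using assms b unfolding good_def by fastforce
    then have "D a y (Suc (max k0 k)) \<omega> = 0" "Suc (max k0 k) > k" for k by auto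
    then show ?thesis unfolding Z_def by blast
  qed (use b in simp)
qed (use assms in \<open>auto simp: Zm_def\<close>)

end

text \<open>As \<open>F\<close> increases and \<open>G\<close> decreases, the part of the new set
  that is already covered is just \<open>F j \<inter> G (Suc (Suc j))\<close>. Inclusion-exclusion
  therefore involves only intersections of one \<open>F\<close> with one \<open>G\<close>, whose
  probabilities are known.\<close>

lemma (in prob_space) prob_interlacing_Suc:
  assumes F: "\<And>i. F i \<in> events" "\<And>i k. i \<le> k \<Longrightarrow> F i \<subseteq> F k"
    and G: "\<And>i. G i \<in> events" "\<And>i k. i \<le> k \<Longrightarrow> G k \<subseteq> G i" and j: "0 < j"
  shows "prob (\<Union>i\<in>{1..Suc j}. F i \<inter> G (Suc i)) =
    prob (\<Union>i\<in>{1..j}. F i \<inter> G (Suc i)) + prob (F (Suc j) \<inter> G (Suc (Suc j))) - prob (F j \<inter> G (Suc (Suc j)))"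
proof -
  let ?U = "\<Union>i\<in>{1..j}. F i \<inter> G (Suc i)" and ?A = "F (Suc j) \<inter> G (Suc (Suc j))"
  have m: "?U \<in> events" "?A \<in> events" using F(1) G(1) by auto
  have "{1..Suc j} = insert (Suc j) {1..j}" by auto
  then have "(\<Union>i\<in>{1..Suc j}. F i \<inter> G (Suc i)) = ?U \<union> ?A" by auto
  moreover have "?U \<inter> ?A = F j \<inter> G (Suc (Suc j))"
  proof
    show "?U \<inter> ?A \<subseteq> F j \<inter> G (Suc (Suc j))" using F(2)[of _ j] by auto blast
    show "F j \<inter> G (Suc (Suc j)) \<subseteq> ?U \<inter> ?A" using F(2)[of j "Suc j"] G(2)[of "Suc j" "Suc (Suc j)"] j by fastforce
  qed
  ultimately show ?thesis using measure_Un3[of ?U M ?A] m by (simp add: fmeasurable_eq_sets)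
qed

section \<open>Ordering of the two thresholds\<close>

context swfpp
begin

definition "\<tau> a = c a / (1 + c a)"

lemma \<tau>_mono:
  assumes "0 < a" "a < b" "b < 1"
  shows "\<tau> a < \<tau> b"
proof -
  have "0 < c a" "c a < c b" using assms c_pos c_mono by auto
  then show ?thesis by (simp add: \<tau>_def field_simps)
qed

lemma \<tau>_cont:
  assumes "0 < a" "a < 1"
  shows "isCont \<tau> a"
proof -
  have "isCont c a" using c_cont assms by (simp add: continuous_on_eq_continuous_at)
  then show ?thesis unfolding \<tau>_def using c_pos[OF assms] by (intro continuous_intros) auto
qed

abbreviation "crit y \<omega> \<equiv> crit_angle (w \<omega>) (0, int y)"

lemma crit_ge:
  assumes g: "good \<omega>" and y: "y \<in> {0, 1}" and a: "a' \<in> dyadics" "a \<in> dyadics" "a' < a" and Zm: "Zm a y \<omega>"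
  shows "\<tau> a' \<le> crit y \<omega>" "{t. 0 < t \<and> t < 1 \<and> busemann_is (w \<omega>) t (0, int y) ((0, int y) + e2) 0} \<noteq> {}"
proof -
  obtain b where b: "b \<in> dyadics" "a \<le> b" "Z b y \<omega>" using Zm by (auto simp: Zm_def)
  have "a' < b" using a b by simp
  then obtain k0 where k0: "\<forall>l>k0. D a' y l \<omega> = 0" using g y a(1) b unfolding good_def by fastforce
  note * = crit_angle_ge[OF c_pos[OF dyadics_bounds[OF a(1)]], of k0 "w \<omega>" y]
  show "\<tau> a' \<le> crit y \<omega>" "{t. 0 < t \<and> t < 1 \<and> busemann_is (w \<omega>) t (0, int y) ((0, int y) + e2) 0} \<noteq> {}"
    unfolding \<tau>_def by (rule *, use k0 in \<open>simp add: D_eq_incr\<close>)+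
qed

lemma crit_le:
  assumes g: "good \<omega>" and y: "y \<in> {0, 1}" and a: "a' \<in> dyadics" "a \<in> dyadics" "a' < a" and Zm: "\<not> Zm a' y \<omega>"
  shows "crit y \<omega> \<le> \<tau> a"
proof -
  have "\<not> Z a' y \<omega>" using Zm a by (auto simp: Zm_def)
  then have "\<exists>\<delta>>0. \<exists>k0. \<forall>k>k0. \<delta> \<le> D a y k \<omega>" using g y a unfolding good_def by blast
  then obtain \<delta> k0 where k0: "0 < \<delta>" "\<forall>k>k0. \<delta> \<le> D a y k \<omega>" by blast
  \<comment> \<open>Another parameter, at which \<open>Z\<close> holds, guarantees that the set in
    \<open>crit_angle\<close> is nonempty.\<close>
  obtain b where b: "b \<in> dyadics" "Z b y \<omega>" using g y unfolding good_def by blast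
  obtain b' where b': "b' \<in> dyadics" "b' < b" using dyadics_dense[of 0 b] dyadics_bounds[OF b(1)] by auto
  have "Zm b y \<omega>" using b by (auto simp: Zm_def)
  note ne = crit_ge(2)[OF g y b'(1) b(1) b'(2) this]
  show ?thesis unfolding \<tau>_def
    by (rule crit_angle_le[OF c_pos[OF dyadics_bounds[OF a(2)]] k0(1) _ ne, of k0]) (use k0 in \<open>simp add: D_eq_incr\<close>)
qed

text \<open>\<theta> is the supremum of the dyadics where \<open>Zm\<close> holds. The bounds
  \<open>crit_ge\<close> and \<open>crit_le\<close> lose a little in the parameter; density of the
  dyadics and continuity of \<tau> remove the loss.\<close>

lemma crit_threshold:
  assumes g: "good \<omega>" and y: "y \<in> {0, 1}"
  obtains \<theta> where "0 < \<theta>" "\<theta> < 1" "crit y \<omega> = \<tau> \<theta>" "\<forall>a\<in>dyadics. a < \<theta> \<longrightarrow> Zm a y \<omega>" "\<forall>a\<in>dyadics. \<theta> < a \<longrightarrow> \<not> Zm a y \<omega>"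
proof -
  define A where "A = {a\<in>dyadics. Zm a y \<omega>}"
  define \<theta> where "\<theta> = Sup A"
  obtain a0 where a0: "a0 \<in> dyadics" "Z a0 y \<omega>" using g y unfolding good_def by blast
  obtain b0 where b0: "b0 \<in> dyadics" "\<not> Z b0 y \<omega>" using g y unfolding good_def by blast
  have a0A: "a0 \<in> A" using a0 by (auto simp: A_def Zm_def)
  have b0A: "a < b0" if "a \<in> A" for a
  proof (rule ccontr)
    assume "\<not> a < b0"
    then have "Zm b0 y \<omega>" using that by (auto simp: A_def intro: Zm_antimono[of b0 a])
    then show False using Zm_iff_Z[OF g y b0(1)] b0(2) by simp
  qed
  have bdd: "bdd_above A" by (rule bdd_aboveI[of _ b0]) (use b0A in \<open>auto simp: less_imp_le\<close>)
  have "a0 \<le> \<theta>" unfolding \<theta>_def using a0A bdd by (rule cSup_upper)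
  then have \<theta>0: "0 < \<theta>" using dyadics_bounds[OF a0(1)] by simp
  have "\<theta> \<le> b0" unfolding \<theta>_def using a0A b0A by (intro cSup_least) (auto simp: less_imp_le)
  then have \<theta>1: "\<theta> < 1" using dyadics_bounds[OF b0(1)] by simp
  have below: "Zm a y \<omega>" if a: "a \<in> dyadics" "a < \<theta>" for a
  proof -
    obtain a' where "a' \<in> A" "a < a'" using a(2) a0A bdd unfolding \<theta>_def by (subst (asm) less_cSup_iff) auto
    then show ?thesis by (auto simp: A_def intro: Zm_antimono[of a a'])
  qed
  have above: "\<not> Zm a y \<omega>" if a: "a \<in> dyadics" "\<theta> < a" for a
  proof
    assume "Zm a y \<omega>"
    then have "a \<le> \<theta>" unfolding \<theta>_def using a(1) bdd by (intro cSup_upper) (auto simp: A_def)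
    then show False using a(2) by simp
  qed
  have "crit y \<omega> = \<tau> \<theta>"
  proof (rule antisym)
    show "crit y \<omega> \<le> \<tau> \<theta>"
    proof (rule tendsto_lowerbound)
      show "(\<tau> \<longlongrightarrow> \<tau> \<theta>) (at_right \<theta>)"
        using \<tau>_cont[OF \<theta>0 \<theta>1] by (simp add: isCont_def filterlim_at_split)
      have "crit y \<omega> \<le> \<tau> t" if t: "\<theta> < t" "t < 1" for t
      proof -
        obtain a where a: "a \<in> dyadics" "\<theta> < a" "a < t" using dyadics_dense[of \<theta> t] \<theta>0 t by auto
        obtain a' where a': "a' \<in> dyadics" "\<theta> < a'" "a' < a" using dyadics_dense[of \<theta> a] \<theta>0 a t by auto
        have "crit y \<omega> \<le> \<tau> a" by (rule crit_le[OF g y a'(1) a(1) a'(3) above[OF a'(1,2)]])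
        also have "\<dots> \<le> \<tau> t" using \<tau>_mono[OF _ a(3) t(2)] dyadics_bounds[OF a(1)] by simp
        finally show ?thesis .
      qed
      then show "\<forall>\<^sub>F t in at_right \<theta>. crit y \<omega> \<le> \<tau> t"
        using eventually_at_right_real[OF \<theta>1] by (rule eventually_mono[rotated]) auto
    qed simp
    show "\<tau> \<theta> \<le> crit y \<omega>"
    proof (rule tendsto_upperbound)
      show "(\<tau> \<longlongrightarrow> \<tau> \<theta>) (at_left \<theta>)"
        using \<tau>_cont[OF \<theta>0 \<theta>1] by (simp add: isCont_def filterlim_at_split)
      have "\<tau> t \<le> crit y \<omega>" if t: "0 < t" "t < \<theta>" for t
      proof -
        obtain a where a: "a \<in> dyadics" "t < a" "a < \<theta>" using dyadics_dense[of t \<theta>] \<theta>1 t by auto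
        obtain a' where a': "a' \<in> dyadics" "a < a'" "a' < \<theta>" using dyadics_dense[of a \<theta>] \<theta>1 a t by auto
        have "\<tau> t \<le> \<tau> a" using \<tau>_mono[OF t(1) a(2)] dyadics_bounds[OF a(1)] by simp
        also have "\<dots> \<le> crit y \<omega>" by (rule crit_ge(1)[OF g y a(1) a'(1,2) below[OF a'(1,3)]])
        finally show ?thesis .
      qed
      then show "\<forall>\<^sub>F t in at_left \<theta>. \<tau> t \<le> crit y \<omega>"
        using eventually_at_left_real[OF \<theta>0] by (rule eventually_mono[rotated]) auto
    qed simp
  qed
  with \<theta>0 \<theta>1 show ?thesis using below above that by blast
qed

text \<open>Two distinct dyadics witness a strict inequality between the thresholds, because the
  two-site law covers only \<open>a < b\<close>.\<close>

definition "crossing y = {\<omega>\<in>space M. \<exists>a\<in>dyadics. \<exists>b\<in>dyadics. a < b \<and> \<not> Zm a y \<omega> \<and> Zm b (1 - y) \<omega>}"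

lemma crossing_iff:
  assumes g: "good \<omega>" and y: "y \<in> {0, 1}" and \<omega>: "\<omega> \<in> space M"
  shows "crit y \<omega> < crit (1 - y) \<omega> \<longleftrightarrow> \<omega> \<in> crossing y"
proof -
  obtain \<theta> where \<theta>: "0 < \<theta>" "\<theta> < 1" "crit y \<omega> = \<tau> \<theta>" "\<forall>a\<in>dyadics. a < \<theta> \<longrightarrow> Zm a y \<omega>" "\<forall>a\<in>dyadics. \<theta> < a \<longrightarrow> \<not> Zm a y \<omega>"
    by (rule crit_threshold[OF g y])
  have y': "1 - y \<in> {0, 1}" using y by auto
  obtain \<theta>' where \<theta>': "0 < \<theta>'" "\<theta>' < 1" "crit (1 - y) \<omega> = \<tau> \<theta>'" "\<forall>a\<in>dyadics. a < \<theta>' \<longrightarrow> Zm a (1 - y) \<omega>" "\<forall>a\<in>dyadics. \<theta>' < a \<longrightarrow> \<not> Zm a (1 - y) \<omega>"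
    by (rule crit_threshold[OF g y'])
  have "\<tau> \<theta> < \<tau> \<theta>' \<longleftrightarrow> \<theta> < \<theta>'"
    using \<tau>_mono[OF \<theta>(1) _ \<theta>'(2)] \<tau>_mono[OF \<theta>'(1) _ \<theta>(2)] by (cases \<theta> \<theta>' rule: linorder_cases) auto
  also have "\<theta> < \<theta>' \<longleftrightarrow> \<omega> \<in> crossing y"
  proof
    assume lt: "\<theta> < \<theta>'"
    obtain a where a: "a \<in> dyadics" "\<theta> < a" "a < \<theta>'" using dyadics_dense[of \<theta> \<theta>'] \<theta> \<theta>' lt by auto
    obtain b where b: "b \<in> dyadics" "a < b" "b < \<theta>'" using dyadics_dense[of a \<theta>'] a \<theta> \<theta>' by auto
    have "\<not> Zm a y \<omega>" "Zm b (1 - y) \<omega>" using \<theta>(5) \<theta>'(4) a(1,2) b(1,3) by blast+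
    then show "\<omega> \<in> crossing y" unfolding crossing_def using a(1) b(1,2) \<omega> by blast
  next
    assume "\<omega> \<in> crossing y"
    then obtain a b where ab: "a \<in> dyadics" "b \<in> dyadics" "a < b" "\<not> Zm a y \<omega>" "Zm b (1 - y) \<omega>" unfolding crossing_def by blast
    have "\<theta> \<le> a" using \<theta>(4) ab(1) ab(4) by (meson not_le)
    moreover have "b \<le> \<theta>'" using \<theta>'(5) ab(2) ab(5) by (meson not_le)
    ultimately show "\<theta> < \<theta>'" using ab(3) by simp
  qed
  finally show ?thesis by (simp only: \<theta>(3) \<theta>'(3))
qed

lemma prob_Zm:
  assumes y: "y \<in> {0, 1}" and ab: "a \<in> dyadics" "b \<in> dyadics" "a < b"
  shows "measure M {\<omega>\<in>space M. \<not> Zm a y \<omega> \<and> Zm b (1 - y) \<omega>} = pair_prob y a b"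
proof -
  have y': "1 - y \<in> {0, 1}" using y by auto
  have "AE \<omega> in M. \<omega> \<in> {\<omega>\<in>space M. \<not> Zm a y \<omega> \<and> Zm b (1 - y) \<omega>} \<longleftrightarrow> \<omega> \<in> {\<omega>\<in>space M. \<not> Z a y \<omega> \<and> Z b (1 - y) \<omega>}"
    using AE_good
  proof eventually_elim
    case (elim \<omega>)
    show ?case using Zm_iff_Z[OF elim y ab(1)] Zm_iff_Z[OF elim y' ab(2)] by simp
  qed
  then have "measure M {\<omega>\<in>space M. \<not> Zm a y \<omega> \<and> Zm b (1 - y) \<omega>} = measure M {\<omega>\<in>space M. \<not> Z a y \<omega> \<and> Z b (1 - y) \<omega>}"
    by (rule M.finite_measure_eq_AE) measurable
  also have "\<dots> = pair_prob y a b"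
    using prob_Z[of y a b] y ab dyadics_bounds by auto
  finally show ?thesis .
qed

definition "grid_crossing y k j = (\<Union>i\<in>{1..j}. {\<omega>\<in>space M. \<not> Zm (real i / 2 ^ k) y \<omega>} \<inter> {\<omega>\<in>space M. Zm (real (Suc i) / 2 ^ k) (1 - y) \<omega>})"

lemma grid_crossing_measurable[measurable]: "grid_crossing y k j \<in> sets M"
  unfolding grid_crossing_def by (intro sets.finite_UN sets.Int) measurable

text \<open>Each step adds an increment of \<open>pair_prob\<close> in its first argument, with the
  second argument just above it: a Riemann sum of mesh \<open>x\<close> for the diagonal derivative,
  \<open>1 - t\<close> if \<open>y = 0\<close> and \<open>(1 - t)^2\<close> if \<open>y = 1\<close>.
  The right-hand side is the exact value of this sum.\<close>

lemma prob_grid_crossing: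
  assumes y: "y \<in> {0, 1}" and j: "Suc j < 2 ^ k"
  defines "x \<equiv> 1 / 2 ^ k :: real"
  shows "measure M (grid_crossing y k j) =
    (if y = 0 then x * j - (x * j)\<^sup>2 / 2 - 3 / 2 * x * (x * j)
     else x * j - (x * j)\<^sup>2 + ((x * j) ^ 3 - x\<^sup>2 * (x * j)) / 3 - 2 * x\<^sup>2 * (x * j))"
  using j
proof (induction j)
  case 0
  show ?case by (simp add: grid_crossing_def)
next
  case (Suc j)
  let ?F = "\<lambda>i. {\<omega>\<in>space M. \<not> Zm (real i / 2 ^ k) y \<omega>}" and ?G = "\<lambda>i. {\<omega>\<in>space M. Zm (real i / 2 ^ k) (1 - y) \<omega>}"
  have x: "real i / 2 ^ k = x * real i" for i by (simp add: x_def)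
  have FG: "measure M (?F i \<inter> ?G l) = pair_prob y (x * i) (x * l)" if "0 < i" "i < l" "l < 2 ^ k" for i l
  proof -
    have "?F i \<inter> ?G l = {\<omega>\<in>space M. \<not> Zm (real i / 2 ^ k) y \<omega> \<and> Zm (real l / 2 ^ k) (1 - y) \<omega>}" by auto
    moreover have "real i / 2 ^ k < real l / 2 ^ k" using that by (intro divide_strict_right_mono) auto
    ultimately show ?thesis using prob_Zm[OF y dyadicsI[of i k] dyadicsI[of l k]] that by (simp only: x)
  qed
  have "measure M (grid_crossing y k (Suc j)) = measure M (grid_crossing y k j) + pair_prob y (x * Suc j) (x * Suc (Suc j)) - pair_prob y (x * j) (x * Suc (Suc j))"
  proof (cases "j = 0")
    \<comment> \<open>For \<open>j = 0\<close> the subtracted term is \<open>pair_prob\<close> at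
      first argument 0, hence zero, so the general formula for the increment also covers the first
      cell.\<close>
    case True
    then show ?thesis using FG[of 1 2] Suc.prems by (simp add: grid_crossing_def pair_prob_def numeral_2_eq_2)
  next
    case False
    have "measure M (grid_crossing y k (Suc j)) = measure M (grid_crossing y k j) + measure M (?F (Suc j) \<inter> ?G (Suc (Suc j))) - measure M (?F j \<inter> ?G (Suc (Suc j)))"
      unfolding grid_crossing_def
    proof (rule M.prob_interlacing_Suc)
      show "?F i \<subseteq> ?F l" "?G l \<subseteq> ?G i" if "i \<le> l" for i l
        using Zm_antimono[of "real i / 2 ^ k" "real l / 2 ^ k"] that by (auto simp: divide_right_mono)
          show "?F i \<in> sets M" "?G i \<in> sets M" for i by measurable
    qed (use False in simp)
    then show ?thesis using FG[of "Suc j" "Suc (Suc j)"] FG[of j "Suc (Suc j)"] Suc.prems False by simp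
  qed
  also have "measure M (grid_crossing y k j) =
    (if y = 0 then x * j - (x * j)\<^sup>2 / 2 - 3 / 2 * x * (x * j)
     else x * j - (x * j)\<^sup>2 + ((x * j) ^ 3 - x\<^sup>2 * (x * j)) / 3 - 2 * x\<^sup>2 * (x * j))"
    by (rule Suc.IH) (use Suc.prems in simp)
  also have "real (Suc (Suc j)) = real j + 2" by simp
  also have "real (Suc j) = real j + 1" by simp
  finally show ?case
    by (cases "y = 0") (simp_all add: pair_prob_def algebra_simps add_divide_distrib diff_divide_distrib power2_eq_square power3_eq_cube)
qed

text \<open>The left half of a grid cell is a cell of the next grid, and \<open>Zm\<close> passes
  from the right end of the cell down to its midpoint.\<close>

lemma grid_crossing_mono: "grid_crossing y k (2 ^ k - 2) \<subseteq> grid_crossing y (Suc k) (2 ^ Suc k - 2)"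
proof
  fix \<omega> assume "\<omega> \<in> grid_crossing y k (2 ^ k - 2)"
  then obtain i where i: "1 \<le> i" "i \<le> 2 ^ k - 2" "\<omega> \<in> space M" "\<not> Zm (real i / 2 ^ k) y \<omega>" "Zm (real (Suc i) / 2 ^ k) (1 - y) \<omega>"
    by (auto simp: grid_crossing_def)
  have "real (Suc (2 * i)) / 2 ^ Suc k \<le> real (Suc i) / 2 ^ k" "real (2 * i) / 2 ^ Suc k = real i / 2 ^ k" by (auto simp: field_simps)
  then have "\<not> Zm (real (2 * i) / 2 ^ Suc k) y \<omega>" "Zm (real (Suc (2 * i)) / 2 ^ Suc k) (1 - y) \<omega>"
    using i(4) Zm_antimono[OF _ i(5)] by simp_all
  moreover have "2 * i \<in> {1..2 ^ Suc k - 2}" using i(1,2) by auto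
  ultimately show "\<omega> \<in> grid_crossing y (Suc k) (2 ^ Suc k - 2)" unfolding grid_crossing_def using i(3) by blast
qed

lemma crossing_eq: "crossing y = (\<Union>k. grid_crossing y k (2 ^ k - 2))"
proof
  show "crossing y \<subseteq> (\<Union>k. grid_crossing y k (2 ^ k - 2))"
  proof
    fix \<omega> assume "\<omega> \<in> crossing y"
    then obtain a b where ab: "a \<in> dyadics" "b \<in> dyadics" "a < b" "\<omega> \<in> space M" "\<not> Zm a y \<omega>" "Zm b (1 - y) \<omega>" unfolding crossing_def by blast
    obtain i k where i: "0 < i" "Suc i < 2 ^ k" "a = real i / 2 ^ k" "real (Suc i) / 2 ^ k \<le> b" using dyadics_grid[OF ab(1,2,3)] .
    have "Zm (real (Suc i) / 2 ^ k) (1 - y) \<omega>" using i(4) ab(6) by (rule Zm_antimono)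
    moreover have "i \<in> {1..2 ^ k - 2}" using i(1,2) by auto
    ultimately have "\<omega> \<in> grid_crossing y k (2 ^ k - 2)" unfolding grid_crossing_def using ab(4,5) i(3) by blast
    then show "\<omega> \<in> (\<Union>k. grid_crossing y k (2 ^ k - 2))" by blast
  qed
  show "(\<Union>k. grid_crossing y k (2 ^ k - 2)) \<subseteq> crossing y"
  proof
    fix \<omega> assume "\<omega> \<in> (\<Union>k. grid_crossing y k (2 ^ k - 2))"
    then obtain k i where i: "1 \<le> i" "i \<le> 2 ^ k - 2" "\<omega> \<in> space M" "\<not> Zm (real i / 2 ^ k) y \<omega>" "Zm (real (Suc i) / 2 ^ k) (1 - y) \<omega>"
      by (auto simp: grid_crossing_def)
    have "Suc i < 2 ^ k" using i by auto
    then have "real i / 2 ^ k \<in> dyadics" "real (Suc i) / 2 ^ k \<in> dyadics" using i by (auto intro!: dyadicsI simp del: of_nat_Suc)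
    moreover have "real i / 2 ^ k < real (Suc i) / 2 ^ k" by (intro divide_strict_right_mono) auto
    ultimately show "\<omega> \<in> crossing y" unfolding crossing_def using i(3,4,5) by blast
  qed
qed

lemma crossing_measurable: "crossing y \<in> sets M"
  unfolding crossing_eq by (intro sets.countable_UN image_subsetI grid_crossing_measurable)

text \<open>For \<open>j = 2 ^ k - 2\<close> the product \<open>x * j\<close> is
  \<open>1 - 2 * x\<close> and tends to 1, so the closed forms tend to \<open>1 - 1 / 2\<close> and
  \<open>1 - 1 + 1 / 3\<close>.\<close>

lemma prob_crossing:
  assumes y: "y \<in> {0, 1}"
  shows "measure M (crossing y) = (if y = 0 then 1 / 2 else 1 / 3)"
proof (rule LIMSEQ_unique)
  have "incseq (\<lambda>k. grid_crossing y k (2 ^ k - 2))" by (intro incseq_SucI grid_crossing_mono)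
  then show "(\<lambda>k. measure M (grid_crossing y k (2 ^ k - 2))) \<longlonglongrightarrow> measure M (crossing y)"
    unfolding crossing_eq by (intro M.finite_Lim_measure_incseq image_subsetI grid_crossing_measurable)
  define x :: "nat \<Rightarrow> real" where "x k = (1 / 2) ^ k" for k
  have x: "x \<longlonglongrightarrow> 0" unfolding x_def by (rule LIMSEQ_power_zero) simp
  have ev: "\<forall>\<^sub>F k in sequentially. (if y = 0 then (1 - 2 * x k) - (1 - 2 * x k)\<^sup>2 / 2 - 3 / 2 * x k * (1 - 2 * x k)
     else (1 - 2 * x k) - (1 - 2 * x k)\<^sup>2 + ((1 - 2 * x k) ^ 3 - (x k)\<^sup>2 * (1 - 2 * x k)) / 3 - 2 * (x k)\<^sup>2 * (1 - 2 * x k)) =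
     measure M (grid_crossing y k (2 ^ k - 2))"
    using eventually_ge_at_top[of 1]
  proof eventually_elim
    case (elim k)
    have k2: "2 ^ 1 \<le> (2 :: nat) ^ k" by (rule power_increasing) (use elim in auto)
    then have j: "Suc (2 ^ k - 2) < 2 ^ k" by simp
    have xk: "x k = 1 / 2 ^ k" by (simp add: x_def power_divide)
    have "1 / 2 ^ k * real (2 ^ k - 2) = 1 - 2 * x k" using k2 by (simp add: xk of_nat_diff field_simps)
    then show ?case using prob_grid_crossing[OF y j] by (simp only: xk)
  qed
  show "(\<lambda>k. measure M (grid_crossing y k (2 ^ k - 2))) \<longlonglongrightarrow> (if y = 0 then 1 / 2 else 1 / 3)"
  proof (rule Lim_transform_eventually[OF _ ev])
    show "(\<lambda>k. if y = 0 then (1 - 2 * x k) - (1 - 2 * x k)\<^sup>2 / 2 - 3 / 2 * x k * (1 - 2 * x k)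
     else (1 - 2 * x k) - (1 - 2 * x k)\<^sup>2 + ((1 - 2 * x k) ^ 3 - (x k)\<^sup>2 * (1 - 2 * x k)) / 3 - 2 * (x k)\<^sup>2 * (1 - 2 * x k))
     \<longlonglongrightarrow> (if y = 0 then 1 / 2 else 1 / 3)"
      by (cases "y = 0") (auto intro!: tendsto_eq_intros x)
  qed
qed

theorem critical_angle_probabilities:
  "measure (completion M) {\<omega>\<in>space M. crit_angle (w \<omega>) 0 > crit_angle (w \<omega>) e2} = 1 / 3 \<and>
   measure (completion M) {\<omega>\<in>space M. crit_angle (w \<omega>) 0 = crit_angle (w \<omega>) e2} = 1 / 6 \<and>
   measure (completion M) {\<omega>\<in>space M. crit_angle (w \<omega>) 0 < crit_angle (w \<omega>) e2} = 1 / 2"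
proof -
  have z: "(0 :: site) = (0, int 0)" "e2 = (0, int 1)" by (simp_all add: zero_prod_def e2_def)
  obtain N where N: "N \<in> null_sets M" "{\<omega>\<in>space M. \<not> good \<omega>} \<subseteq> N"
    using AE_good unfolding eventually_ae_filter by blast
  have g: "good \<omega>" if "\<omega> \<in> space M" "\<omega> \<notin> N" for \<omega> using N that by blast
  have iff: "crit 0 \<omega> < crit 1 \<omega> \<longleftrightarrow> \<omega> \<in> crossing 0" "crit 1 \<omega> < crit 0 \<omega> \<longleftrightarrow> \<omega> \<in> crossing 1"
    if "\<omega> \<in> space M" "\<omega> \<notin> N" for \<omega>
    using crossing_iff[OF g[OF that], of 0] crossing_iff[OF g[OF that], of 1] that(1) by simp_all
  have disj: "\<omega> \<notin> crossing 0 \<or> \<omega> \<notin> crossing 1" if "\<omega> \<in> space M" "\<omega> \<notin> N" for \<omega>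
    using iff[OF that] by linarith
  \<comment> \<open>The two crossing events are known to be disjoint only off the null set, through
    their meaning as opposite strict inequalities.\<close>
  have "AE \<omega> in M. \<omega> \<notin> N" using N(1) by (rule AE_not_in)
  then have "AE \<omega> in M. \<omega> \<notin> crossing 0 \<or> \<omega> \<notin> crossing 1"
    using AE_space by eventually_elim (rule disj)
  then have "measure M (crossing 0 \<union> crossing 1) = measure M (crossing 0) + measure M (crossing 1)"
    by (intro measure_Un_AE) (simp_all add: crossing_measurable M.fmeasurable_eq_sets)
  then have U: "measure M (crossing 0 \<union> crossing 1) = 5 / 6" by (simp add: prob_crossing)
  let ?C = "space M - (crossing 0 \<union> crossing 1)"
  have C: "measure M ?C = 1 / 6"
    using M.prob_compl[of "crossing 0 \<union> crossing 1"] U crossing_measurable by simp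
  have "measure (completion M) {\<omega>\<in>space M. crit 0 \<omega> > crit 1 \<omega>} = measure M (crossing 1)"
    by (rule measure_completion_eq_AE[OF N(1) crossing_measurable]) (use iff in auto)
  moreover have "measure (completion M) {\<omega>\<in>space M. crit 0 \<omega> < crit 1 \<omega>} = measure M (crossing 0)"
    by (rule measure_completion_eq_AE[OF N(1) crossing_measurable]) (use iff in auto)
  moreover have "measure (completion M) {\<omega>\<in>space M. crit 0 \<omega> = crit 1 \<omega>} = measure M ?C"
  proof (rule measure_completion_eq_AE[OF N(1)])
    show "\<omega> \<in> {\<omega>\<in>space M. crit 0 \<omega> = crit 1 \<omega>} \<longleftrightarrow> \<omega> \<in> ?C" if "\<omega> \<in> space M" "\<omega> \<notin> N" for \<omega>
      using iff[OF that] that(1) by force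
  qed (use crossing_measurable in auto)
  ultimately show ?thesis unfolding z using C by (simp add: prob_crossing)
qed

end

section \<open>Bernoulli and exponential weights\<close>

lemma suminf_ennreal_swap:
  fixes f :: "nat \<Rightarrow> nat \<Rightarrow> ennreal"
  shows "(\<Sum>i. \<Sum>j. f i j) = (\<Sum>j. \<Sum>i. f i j)"
proof -
  have "(\<Sum>i. \<Sum>j. f i j) = (\<integral>\<^sup>+i. (\<Sum>j. f i j) \<partial>count_space UNIV)" by (simp add: nn_integral_count_space_nat)
  also have "\<dots> = (\<Sum>j. \<Sum>i. f i j)" by (subst nn_integral_suminf) (auto simp: nn_integral_count_space_nat)
  finally show ?thesis .
qed

lemma suminf_ennreal_shift:
  fixes f :: "nat \<Rightarrow> ennreal"
  assumes "\<And>i. i < k \<Longrightarrow> f i = 0"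
  shows "suminf f = (\<Sum>j. f (j + k))"
  using suminf_offset[of f k] assms by (simp add: summableI)

text \<open>The double series is split by which index is larger and rewritten in terms of the
  smaller index and the excess \<open>d\<close>; the diagonal belongs to the second part.\<close>

lemma suminf_pairs_split:
  fixes T :: "nat \<Rightarrow> nat \<Rightarrow> ennreal"
  shows "(\<Sum>i. \<Sum>j. T i j) = (\<Sum>j. \<Sum>d. T (d + Suc j) j) + (\<Sum>i. \<Sum>d. T i (d + i))"
proof -
  have "(\<Sum>i. \<Sum>j. T i j) = (\<Sum>i. \<Sum>j. (if j < i then T i j else 0) + (if i \<le> j then T i j else 0))"
    by (intro suminf_cong) auto
  also have "\<dots> = (\<Sum>i. \<Sum>j. if j < i then T i j else 0) + (\<Sum>i. \<Sum>j. if i \<le> j then T i j else 0)"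
    by (simp add: suminf_add[symmetric] summableI)
  also have "(\<Sum>i. \<Sum>j. if j < i then T i j else 0) = (\<Sum>j. \<Sum>i. if j < i then T i j else 0)" by (rule suminf_ennreal_swap)
  finally have eq: "(\<Sum>i. \<Sum>j. T i j) = (\<Sum>j. \<Sum>i. if j < i then T i j else 0) + (\<Sum>i. \<Sum>j. if i \<le> j then T i j else 0)" .
  have "(\<Sum>i. if j < i then T i j else 0) = (\<Sum>d. T (d + Suc j) j)" for j
    by (subst suminf_ennreal_shift[of "Suc j"]) auto
  moreover have "(\<Sum>j. if i \<le> j then T i j else 0) = (\<Sum>d. T i (d + i))" for i
    by (subst suminf_ennreal_shift[of i]) auto
  ultimately show ?thesis unfolding eq by simp
qed

lemma ennreal_mult_left_assoc: "0 \<le> x \<Longrightarrow> 0 \<le> y \<Longrightarrow> ennreal x * (ennreal y * h) = ennreal (x * y) * h"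
  by (simp add: ennreal_mult mult.assoc)

lemma ennreal_weights_eq:
  assumes "w * w' = x * (y * z)" "0 \<le> w" "0 \<le> w'" "0 \<le> x" "0 \<le> y" "0 \<le> z"
  shows "ennreal w * (ennreal w' * h) = ennreal x * (ennreal y * (ennreal z * h))"
  using assms by (simp add: ennreal_mult_left_assoc)

lemma summable_square_mult_power:
  fixes \<kappa> :: real
  assumes "0 < \<kappa>" "\<kappa> < 1"
  shows "summable (\<lambda>k. (real (Suc k))\<^sup>2 * \<kappa> ^ k)"
proof -
  have "(\<lambda>k. (1 + inverse (real (Suc k)))\<^sup>2 * \<kappa>) \<longlonglongrightarrow> (1 + 0)\<^sup>2 * \<kappa>"
    by (intro tendsto_intros LIMSEQ_inverse_real_of_nat)
  then have "\<forall>\<^sub>F k in sequentially. (1 + inverse (real (Suc k)))\<^sup>2 * \<kappa> < (1 + \<kappa>) / 2"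
    using assms by (intro order_tendstoD(2)) auto
  then obtain N where N: "\<And>k. k \<ge> N \<Longrightarrow> (1 + inverse (real (Suc k)))\<^sup>2 * \<kappa> < (1 + \<kappa>) / 2" by (auto simp: eventually_sequentially)
  show ?thesis
  proof (rule summable_ratio_test)
    show "(1 + \<kappa>) / 2 < 1" using assms by simp
    fix k assume k: "k \<ge> N"
    have "real (Suc (Suc k)) = (1 + inverse (real (Suc k))) * real (Suc k)" by (simp add: distrib_right)
    then have "(real (Suc (Suc k)))\<^sup>2 * \<kappa> ^ Suc k = ((1 + inverse (real (Suc k)))\<^sup>2 * \<kappa>) * ((real (Suc k))\<^sup>2 * \<kappa> ^ k)"
      by (simp only: power_mult_distrib power_Suc mult_ac)
    also have "\<dots> \<le> (1 + \<kappa>) / 2 * ((real (Suc k))\<^sup>2 * \<kappa> ^ k)"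
      using N[OF k] assms by (intro mult_right_mono) auto
    finally show "norm ((real (Suc (Suc k)))\<^sup>2 * \<kappa> ^ Suc k) \<le> (1 + \<kappa>) / 2 * norm ((real (Suc k))\<^sup>2 * \<kappa> ^ k)"
      using assms by (simp add: abs_mult del: of_nat_Suc)
  qed
qed

text \<open>Geometric on the positive integers, with probability \<open>\<kappa> ^ k\<close> of
  exceeding \<open>k\<close>.\<close>

definition geo :: "real \<Rightarrow> real measure" where
  "geo \<kappa> = distr (measure_pmf (geometric_pmf (1 - \<kappa>))) borel (\<lambda>k. real (Suc k))"

lemma prob_space_geo: "prob_space (geo \<kappa>)"
  unfolding geo_def by (intro prob_space.prob_space_distr prob_space_measure_pmf) simp

lemma sets_geo[simp, measurable_cong]: "sets (geo \<kappa>) = sets borel"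
  by (simp add: geo_def)

lemma nn_integral_geo:
  assumes "0 < \<kappa>" "\<kappa> < 1" "h \<in> borel_measurable borel"
  shows "(\<integral>\<^sup>+x. h x \<partial>geo \<kappa>) = (\<Sum>k. ennreal ((1 - \<kappa>) * \<kappa> ^ k) * h (real (Suc k)))"
  using assms by (simp add: geo_def nn_integral_distr nn_integral_measure_pmf nn_integral_count_space_nat mult.commute del: of_nat_Suc)

lemma suminf_geo_weights:
  assumes "0 < \<kappa>" "\<kappa> < (1 :: real)"
  shows "(\<Sum>k. ennreal ((1 - \<kappa>) * \<kappa> ^ k)) = 1"
proof -
  interpret prob_space "geo \<kappa>" by (rule prob_space_geo)
  show ?thesis using nn_integral_geo[OF assms, of "\<lambda>_. 1"] emeasure_space_1 by simp
qed

lemma geo_memoryless: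
  assumes k: "0 < \<kappa>" "\<kappa> < 1" and h: "h \<in> borel_measurable borel"
  shows "(\<integral>\<^sup>+x. h x \<partial>geo \<kappa>) = ennreal \<kappa> * (\<integral>\<^sup>+v. h (1 + v) \<partial>geo \<kappa>) + ennreal (1 - \<kappa>) * h 1"
proof -
  note [measurable] = h
  let ?f = "\<lambda>k. ennreal ((1 - \<kappa>) * \<kappa> ^ k) * h (real (Suc k))"
  have "suminf ?f = (\<Sum>k. ?f (k + 1)) + (\<Sum>k<1. ?f k)" by (rule suminf_offset) (simp add: summableI)
  also have "(\<lambda>k. ?f (k + 1)) = (\<lambda>k. ennreal \<kappa> * (ennreal ((1 - \<kappa>) * \<kappa> ^ k) * h (1 + real (Suc k))))"
  proof
    fix i
    have "(1 - \<kappa>) * \<kappa> ^ (i + 1) = \<kappa> * ((1 - \<kappa>) * \<kappa> ^ i)" by simp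
    then show "?f (i + 1) = ennreal \<kappa> * (ennreal ((1 - \<kappa>) * \<kappa> ^ i) * h (1 + real (Suc i)))"
      using k by (simp only:) (subst ennreal_mult_left_assoc; simp)
  qed
  also have "suminf \<dots> = ennreal \<kappa> * (\<integral>\<^sup>+v. h (1 + v) \<partial>geo \<kappa>)"
    using k by (simp add: nn_integral_geo)
  finally show ?thesis using k by (simp add: nn_integral_geo)
qed

text \<open>The minimum survives a step only if both variables do, so its ratio is
  \<open>q * v\<close>. When the first variable is strictly larger, its excess is again geometric by
  memorylessness; ties count as excess zero.\<close>

lemma geo_min_excess:
  assumes q: "0 < q" "q < 1" and v: "0 < v" "v < 1" and H[measurable]: "H \<in> borel_measurable borel"
  shows "(\<integral>\<^sup>+x. (\<integral>\<^sup>+y. (H (min x y, max 0 (x - y)) :: ennreal) \<partial>geo v) \<partial>geo q) =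
    ennreal ((1 - v) * q / (1 - q * v)) * (\<integral>\<^sup>+x. (\<integral>\<^sup>+d. H (x, d) \<partial>geo q) \<partial>geo (q * v)) +
    ennreal ((1 - q) / (1 - q * v)) * (\<integral>\<^sup>+x. H (x, 0) \<partial>geo (q * v))"
proof -
  have "q * v < 1 * 1" using q v by (intro mult_strict_mono) auto
  then have qv: "0 < q * v" "q * v < 1" using q v by simp_all
  let ?T = "\<lambda>i j. ennreal ((1 - q) * q ^ i) * (ennreal ((1 - v) * v ^ j) * H (min (real (Suc i)) (real (Suc j)), max 0 (real (Suc i) - real (Suc j))))"
  have "(\<integral>\<^sup>+x. (\<integral>\<^sup>+y. H (min x y, max 0 (x - y)) \<partial>geo v) \<partial>geo q) = (\<Sum>i. \<Sum>j. ?T i j)"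
    using q v by (simp add: nn_integral_geo)
  also have "\<dots> = (\<Sum>j. \<Sum>d. ?T (d + Suc j) j) + (\<Sum>i. \<Sum>d. ?T i (d + i))" by (rule suminf_pairs_split)
  also have "(\<Sum>j. \<Sum>d. ?T (d + Suc j) j) = ennreal ((1 - v) * q / (1 - q * v)) * (\<integral>\<^sup>+x. (\<integral>\<^sup>+d. H (x, d) \<partial>geo q) \<partial>geo (q * v))"
  proof -
    have "?T (d + Suc j) j = ennreal ((1 - v) * q / (1 - q * v)) * (ennreal ((1 - q * v) * (q * v) ^ j) * (ennreal ((1 - q) * q ^ d) * H (real (Suc j), real (Suc d))))" for j d
    proof -
      have "min (real (Suc (d + Suc j))) (real (Suc j)) = real (Suc j)" "max 0 (real (Suc (d + Suc j)) - real (Suc j)) = real (Suc d)" by auto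
      moreover have "(1 - q) * q ^ (d + Suc j) * ((1 - v) * v ^ j) = (1 - v) * q / (1 - q * v) * ((1 - q * v) * (q * v) ^ j * ((1 - q) * q ^ d))"
        using qv by (simp add: power_add power_mult_distrib)
      ultimately show ?thesis using q v qv by (simp only:) (rule ennreal_weights_eq; simp)
    qed
    then show ?thesis using q qv by (simp add: nn_integral_geo)
  qed
  also have "(\<Sum>i. \<Sum>d. ?T i (d + i)) = ennreal ((1 - q) / (1 - q * v)) * (\<integral>\<^sup>+x. H (x, 0) \<partial>geo (q * v))"
  proof -
    have "?T i (d + i) = ennreal ((1 - q) / (1 - q * v)) * (ennreal ((1 - q * v) * (q * v) ^ i) * (ennreal ((1 - v) * v ^ d) * H (real (Suc i), 0)))" for i d
    proof -
      have "min (real (Suc i)) (real (Suc (d + i))) = real (Suc i)" "max 0 (real (Suc i) - real (Suc (d + i))) = 0" by auto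
      moreover have "(1 - q) * q ^ i * ((1 - v) * v ^ (d + i)) = (1 - q) / (1 - q * v) * ((1 - q * v) * (q * v) ^ i * ((1 - v) * v ^ d))"
        using qv by (simp add: power_add power_mult_distrib)
      ultimately show ?thesis using q v qv by (simp only:) (rule ennreal_weights_eq; simp)
    qed
    then have "(\<Sum>d. ?T i (d + i)) = ennreal ((1 - q) / (1 - q * v)) * (ennreal ((1 - q * v) * (q * v) ^ i) * H (real (Suc i), 0))" for i
      by (simp add: suminf_geo_weights[OF v])
    then show ?thesis using q qv by (simp add: nn_integral_geo)
  qed
  finally show ?thesis .
qed

lemma geo_moments:
  assumes k: "0 < \<kappa>" "\<kappa> < 1"
  shows "integrable (geo \<kappa>) (\<lambda>x. x\<^sup>2)" "(\<integral>x. x \<partial>geo \<kappa>) = 1 / (1 - \<kappa>)"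
proof -
  let ?g = "geometric_pmf (1 - \<kappa>)"
  show "integrable (geo \<kappa>) (\<lambda>x. x\<^sup>2)"
  proof (rule integrableI_bounded)
    have "(\<integral>\<^sup>+x. ennreal (norm (x\<^sup>2)) \<partial>geo \<kappa>) = (\<Sum>i. ennreal ((1 - \<kappa>) * ((real (Suc i))\<^sup>2 * \<kappa> ^ i)))"
    proof -
      have "(\<lambda>i. ennreal ((1 - \<kappa>) * \<kappa> ^ i) * ennreal (norm ((real (Suc i))\<^sup>2))) = (\<lambda>i. ennreal ((1 - \<kappa>) * ((real (Suc i))\<^sup>2 * \<kappa> ^ i)))"
      proof
        fix i
        have "(1 - \<kappa>) * ((real (Suc i))\<^sup>2 * \<kappa> ^ i) = (1 - \<kappa>) * \<kappa> ^ i * norm ((real (Suc i))\<^sup>2)" by simp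
        then show "ennreal ((1 - \<kappa>) * \<kappa> ^ i) * ennreal (norm ((real (Suc i))\<^sup>2)) = ennreal ((1 - \<kappa>) * ((real (Suc i))\<^sup>2 * \<kappa> ^ i))"
          using k by (simp only: ennreal_mult[symmetric] norm_ge_zero) (simp add: ennreal_mult)
      qed
      then show ?thesis by (subst nn_integral_geo[OF k]) (auto intro!: arg_cong[where f=suminf])
    qed
    also have "\<dots> \<noteq> \<infinity>"
      unfolding infinity_ennreal_def by (rule ennreal_suminf_neq_top[OF summable_mult[OF summable_square_mult_power[OF k]]]) (use k in auto)
    finally show "(\<integral>\<^sup>+x. ennreal (norm (x\<^sup>2)) \<partial>geo \<kappa>) < \<infinity>" by (simp add: less_top)
  qed simp
  have "(\<integral>x. x \<partial>geo \<kappa>) = (\<integral>x. real x + 1 \<partial>?g)" unfolding geo_def by (subst integral_distr) (auto simp: add.commute)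
  also have "\<dots> = \<kappa> / (1 - \<kappa>) + 1"
    using k integrable_real_geometric_pmf[of "1 - \<kappa>"] expectation_geometric_pmf[of "1 - \<kappa>"] by simp
  also have "\<dots> = 1 / (1 - \<kappa>)" using k by (simp add: field_simps)
  finally show "(\<integral>x. x \<partial>geo \<kappa>) = 1 / (1 - \<kappa>)" .
qed

section \<open>Exponential laws\<close>

definition expo :: "real \<Rightarrow> real measure" where
  "expo l = density lborel (\<lambda>x. ennreal (exponential_density l x))"

lemma sets_expo[simp, measurable_cong]: "sets (expo l) = sets borel"
  by (simp add: expo_def)

lemma prob_space_expo: "0 < l \<Longrightarrow> prob_space (expo l)"
  unfolding expo_def by (rule prob_space_exponential_density)

lemma nn_integral_expo:
  "h \<in> borel_measurable borel \<Longrightarrow> (\<integral>\<^sup>+x. h x \<partial>expo l) = (\<integral>\<^sup>+x. ennreal (exponential_density l x) * h x \<partial>lborel)"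
  by (simp add: expo_def nn_integral_density)

lemma AE_expo_pos: "AE x in expo l. 0 < x"
proof -
  have "AE x in lborel. (x :: real) \<noteq> 0" by (rule AE_lborel_singleton)
  then have "AE x in lborel. 0 < ennreal (exponential_density l x) \<longrightarrow> 0 < x"
    by eventually_elim (auto simp: exponential_density_def split: if_splits)
  then show ?thesis unfolding expo_def by (subst AE_density) auto
qed

lemma expo_moments:
  assumes "0 < l"
  shows "integrable (expo l) (\<lambda>x. x\<^sup>2)" "(\<integral>x. x \<partial>expo l) = 1 / l"
proof -
  interpret prob_space "expo l" by (rule prob_space_expo[OF assms])
  have d: "distributed (expo l) lborel (\<lambda>x. x) (exponential_density l)"
    unfolding distributed_def by (auto simp: expo_def distr_id2)
  show "integrable (expo l) (\<lambda>x. x\<^sup>2)" using erlang_ith_moment_integrable[OF assms d, of 2] by simp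
  show "(\<integral>x. x \<partial>expo l) = 1 / l" using erlang_ith_moment[OF assms d, of 1] by simp
qed

lemma exponential_density_split:
  assumes l: "0 < \<sigma>" "0 < \<tau>" and v: "0 \<le> v"
  shows "exponential_density \<sigma> (y + v) * exponential_density \<tau> y =
    \<tau> / (\<sigma> + \<tau>) * (exponential_density (\<sigma> + \<tau>) y * exponential_density \<sigma> v)"
proof -
  have e: "exp (- (y + v) * \<sigma>) * exp (- y * \<tau>) = exp (- y * (\<sigma> + \<tau>)) * exp (- v * \<sigma>)"
    by (simp add: exp_add[symmetric] algebra_simps)
  show ?thesis
  proof (cases "0 \<le> y")
    case True
    have "\<sigma> * exp (- (y + v) * \<sigma>) * (\<tau> * exp (- y * \<tau>)) = \<sigma> * \<tau> * (exp (- (y + v) * \<sigma>) * exp (- y * \<tau>))" by simp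
    also have "\<dots> = \<tau> / (\<sigma> + \<tau>) * ((\<sigma> + \<tau>) * exp (- y * (\<sigma> + \<tau>)) * (\<sigma> * exp (- v * \<sigma>)))"
      unfolding e using l by simp
    finally show ?thesis using True v by (simp add: exponential_density_def)
  qed (simp add: exponential_density_def)
qed

text \<open>The quadrant is cut along the diagonal, a null set, and the larger time is written as
  the smaller one plus an excess. By \<open>exponential_density_split\<close> the density then
  factorises into minimum, winner and excess.\<close>

lemma expo_race:
  assumes l: "0 < \<sigma>" "0 < \<tau>" and H[measurable]: "H \<in> borel_measurable borel"
  shows "(\<integral>\<^sup>+x. (\<integral>\<^sup>+y. (H (x, y) :: ennreal) \<partial>expo \<tau>) \<partial>expo \<sigma>) =
    ennreal (\<tau> / (\<sigma> + \<tau>)) * (\<integral>\<^sup>+y. (\<integral>\<^sup>+v. H (y + v, y) \<partial>expo \<sigma>) \<partial>expo (\<sigma> + \<tau>)) +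
    ennreal (\<sigma> / (\<sigma> + \<tau>)) * (\<integral>\<^sup>+x. (\<integral>\<^sup>+w. H (x, x + w) \<partial>expo \<tau>) \<partial>expo (\<sigma> + \<tau>))"
proof -
  let ?f = exponential_density
  define F where "F x y = ennreal (?f \<sigma> x * ?f \<tau> y) * H (x, y)" for x y
  have F[measurable]: "(\<lambda>(x, y). F x y) \<in> borel_measurable (lborel \<Otimes>\<^sub>M lborel)" unfolding F_def by measurable
  have f0: "0 \<le> ?f r x" if "0 < r" for r x using that by (simp add: exponential_density_def)
  have both: "(\<integral>\<^sup>+x. (\<integral>\<^sup>+y. h x y \<partial>expo r) \<partial>expo r') = (\<integral>\<^sup>+x. (\<integral>\<^sup>+y. ennreal (?f r' x * ?f r y) * h x y \<partial>lborel) \<partial>lborel)"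
    if [measurable]: "(\<lambda>(x, y). h x y) \<in> borel_measurable (borel \<Otimes>\<^sub>M borel)" and r: "0 < r" "0 < r'" for h r r'
  proof -
    interpret E: prob_space "expo r" by (rule prob_space_expo[OF r(1)])
    have "(\<integral>\<^sup>+x. (\<integral>\<^sup>+y. h x y \<partial>expo r) \<partial>expo r') = (\<integral>\<^sup>+x. ennreal (?f r' x) * (\<integral>\<^sup>+y. h x y \<partial>expo r) \<partial>lborel)"
      by (rule nn_integral_expo) measurable
    also have "\<dots> = (\<integral>\<^sup>+x. ennreal (?f r' x) * (\<integral>\<^sup>+y. ennreal (?f r y) * h x y \<partial>lborel) \<partial>lborel)"
      by (subst nn_integral_expo) auto
    also have "\<dots> = (\<integral>\<^sup>+x. (\<integral>\<^sup>+y. ennreal (?f r' x) * (ennreal (?f r y) * h x y) \<partial>lborel) \<partial>lborel)"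
      by (subst nn_integral_cmult) auto
    finally show ?thesis using f0[OF r(1)] f0[OF r(2)] by (simp add: ennreal_mult mult.assoc)
  qed
  have "(\<integral>\<^sup>+x. (\<integral>\<^sup>+y. H (x, y) \<partial>expo \<tau>) \<partial>expo \<sigma>) = (\<integral>\<^sup>+x. (\<integral>\<^sup>+y. F x y \<partial>lborel) \<partial>lborel)"
    unfolding F_def by (rule both) (use l H in \<open>auto simp: borel_prod\<close>)
  also have "\<dots> = (\<integral>\<^sup>+x. (\<integral>\<^sup>+y. F x y * (if y \<le> x then 1 else 0) \<partial>lborel) + (\<integral>\<^sup>+y. F x y * (if x \<le> y then 1 else 0) \<partial>lborel) \<partial>lborel)"
  proof (rule nn_integral_cong)
    fix x
    have "(\<integral>\<^sup>+y. F x y \<partial>lborel) = (\<integral>\<^sup>+y. F x y * (if y \<le> x then 1 else 0) + F x y * (if x \<le> y then 1 else 0) \<partial>lborel)"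
      by (rule nn_integral_cong_AE, rule AE_mp[OF AE_lborel_singleton[of x]]) (rule AE_I2, auto)
    also have "\<dots> = (\<integral>\<^sup>+y. F x y * (if y \<le> x then 1 else 0) \<partial>lborel) + (\<integral>\<^sup>+y. F x y * (if x \<le> y then 1 else 0) \<partial>lborel)"
      by (rule nn_integral_add) measurable
    finally show "(\<integral>\<^sup>+y. F x y \<partial>lborel) = (\<integral>\<^sup>+y. F x y * (if y \<le> x then 1 else 0) \<partial>lborel) + (\<integral>\<^sup>+y. F x y * (if x \<le> y then 1 else 0) \<partial>lborel)" .
  qed
  also have "\<dots> = (\<integral>\<^sup>+x. (\<integral>\<^sup>+y. F x y * (if y \<le> x then 1 else 0) \<partial>lborel) \<partial>lborel) + (\<integral>\<^sup>+x. (\<integral>\<^sup>+y. F x y * (if x \<le> y then 1 else 0) \<partial>lborel) \<partial>lborel)"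
    by (rule nn_integral_add) measurable
  also have "(\<integral>\<^sup>+x. (\<integral>\<^sup>+y. F x y * (if y \<le> x then 1 else 0) \<partial>lborel) \<partial>lborel) = (\<integral>\<^sup>+y. (\<integral>\<^sup>+x. F x y * (if y \<le> x then 1 else 0) \<partial>lborel) \<partial>lborel)"
    by (rule lborel_pair.Fubini'[symmetric]) measurable
  also have "\<dots> = (\<integral>\<^sup>+y. (\<integral>\<^sup>+v. ennreal (\<tau> / (\<sigma> + \<tau>)) * (ennreal (?f (\<sigma> + \<tau>) y * ?f \<sigma> v) * H (y + v, y)) \<partial>lborel) \<partial>lborel)"
  proof (rule nn_integral_cong)
    fix y
    have w: "?f \<sigma> (y + v) * ?f \<tau> y = \<tau> / (\<sigma> + \<tau>) * (?f (\<sigma> + \<tau>) y * ?f \<sigma> v)" if "0 \<le> v" for v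
      using l that by (rule exponential_density_split)
    have z: "?f \<sigma> v = 0" if "\<not> 0 \<le> v" for v using that by (simp add: exponential_density_def)
    have "(\<integral>\<^sup>+x. F x y * (if y \<le> x then 1 else 0) \<partial>lborel) = (\<integral>\<^sup>+v. F (y + 1 * v) y * (if y \<le> y + 1 * v then 1 else 0) \<partial>lborel)"
      by (subst nn_integral_real_affine[where c=1 and t=y]) auto
    also have "\<dots> = (\<integral>\<^sup>+v. ennreal (\<tau> / (\<sigma> + \<tau>)) * (ennreal (?f (\<sigma> + \<tau>) y * ?f \<sigma> v) * H (y + v, y)) \<partial>lborel)"
    proof (rule nn_integral_cong)
      fix v
      show "F (y + 1 * v) y * (if y \<le> y + 1 * v then 1 else 0) = ennreal (\<tau> / (\<sigma> + \<tau>)) * (ennreal (?f (\<sigma> + \<tau>) y * ?f \<sigma> v) * H (y + v, y))"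
        using w[of v] z[of v] l f0 by (cases "0 \<le> v") (auto simp: F_def ennreal_mult_left_assoc)
    qed
    finally show "(\<integral>\<^sup>+x. F x y * (if y \<le> x then 1 else 0) \<partial>lborel) = (\<integral>\<^sup>+v. ennreal (\<tau> / (\<sigma> + \<tau>)) * (ennreal (?f (\<sigma> + \<tau>) y * ?f \<sigma> v) * H (y + v, y)) \<partial>lborel)" .
  qed
  also have "\<dots> = ennreal (\<tau> / (\<sigma> + \<tau>)) * (\<integral>\<^sup>+y. (\<integral>\<^sup>+v. H (y + v, y) \<partial>expo \<sigma>) \<partial>expo (\<sigma> + \<tau>))"
    using l by (subst both) (auto simp: nn_integral_cmult)
  also have "(\<integral>\<^sup>+x. (\<integral>\<^sup>+y. F x y * (if x \<le> y then 1 else 0) \<partial>lborel) \<partial>lborel) =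
    (\<integral>\<^sup>+x. (\<integral>\<^sup>+w. ennreal (\<sigma> / (\<sigma> + \<tau>)) * (ennreal (?f (\<sigma> + \<tau>) x * ?f \<tau> w) * H (x, x + w)) \<partial>lborel) \<partial>lborel)"
  proof (rule nn_integral_cong)
    fix x
    have w: "?f \<sigma> x * ?f \<tau> (x + v) = \<sigma> / (\<sigma> + \<tau>) * (?f (\<sigma> + \<tau>) x * ?f \<tau> v)" if "0 \<le> v" for v
      using exponential_density_split[OF l(2,1) that, of x] by (simp add: mult.commute add.commute)
    have z: "?f \<tau> v = 0" if "\<not> 0 \<le> v" for v using that by (simp add: exponential_density_def)
    have "(\<integral>\<^sup>+y. F x y * (if x \<le> y then 1 else 0) \<partial>lborel) = (\<integral>\<^sup>+v. F x (x + 1 * v) * (if x \<le> x + 1 * v then 1 else 0) \<partial>lborel)"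
      by (subst nn_integral_real_affine[where c=1 and t=x]) auto
    also have "\<dots> = (\<integral>\<^sup>+w. ennreal (\<sigma> / (\<sigma> + \<tau>)) * (ennreal (?f (\<sigma> + \<tau>) x * ?f \<tau> w) * H (x, x + w)) \<partial>lborel)"
    proof (rule nn_integral_cong)
      fix v
      show "F x (x + 1 * v) * (if x \<le> x + 1 * v then 1 else 0) = ennreal (\<sigma> / (\<sigma> + \<tau>)) * (ennreal (?f (\<sigma> + \<tau>) x * ?f \<tau> v) * H (x, x + v))"
        using w[of v] z[of v] l f0 by (cases "0 \<le> v") (auto simp: F_def ennreal_mult_left_assoc)
    qed
    finally show "(\<integral>\<^sup>+y. F x y * (if x \<le> y then 1 else 0) \<partial>lborel) = (\<integral>\<^sup>+w. ennreal (\<sigma> / (\<sigma> + \<tau>)) * (ennreal (?f (\<sigma> + \<tau>) x * ?f \<tau> w) * H (x, x + w)) \<partial>lborel)" .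
  qed
  also have "\<dots> = ennreal (\<sigma> / (\<sigma> + \<tau>)) * (\<integral>\<^sup>+x. (\<integral>\<^sup>+w. H (x, x + w) \<partial>expo \<tau>) \<partial>expo (\<sigma> + \<tau>))"
    using l by (subst both) (auto simp: nn_integral_cmult)
  finally show ?thesis .
qed

lemma expo_min_excess:
  assumes l: "0 < \<sigma>" "0 < \<tau>" and H[measurable]: "H \<in> borel_measurable borel"
  shows "(\<integral>\<^sup>+x. (\<integral>\<^sup>+y. (H (min x y, max 0 (x - y)) :: ennreal) \<partial>expo \<tau>) \<partial>expo \<sigma>) =
    ennreal (\<tau> / (\<sigma> + \<tau>)) * (\<integral>\<^sup>+x. (\<integral>\<^sup>+d. H (x, d) \<partial>expo \<sigma>) \<partial>expo (\<sigma> + \<tau>)) +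
    ennreal (\<sigma> / (\<sigma> + \<tau>)) * (\<integral>\<^sup>+x. H (x, 0) \<partial>expo (\<sigma> + \<tau>))"
proof -
  interpret E: prob_space "expo \<tau>" by (rule prob_space_expo[OF l(2)])
  have "(\<integral>\<^sup>+x. (\<integral>\<^sup>+y. H (min x y, max 0 (x - y)) \<partial>expo \<tau>) \<partial>expo \<sigma>) =
    ennreal (\<tau> / (\<sigma> + \<tau>)) * (\<integral>\<^sup>+y. (\<integral>\<^sup>+v. H (min (y + v) y, max 0 (y + v - y)) \<partial>expo \<sigma>) \<partial>expo (\<sigma> + \<tau>)) +
    ennreal (\<sigma> / (\<sigma> + \<tau>)) * (\<integral>\<^sup>+x. (\<integral>\<^sup>+w. H (min x (x + w), max 0 (x - (x + w))) \<partial>expo \<tau>) \<partial>expo (\<sigma> + \<tau>))"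
  proof -
    have "(\<lambda>(x, y). H (min x y, max 0 (x - y))) \<in> borel_measurable (borel \<Otimes>\<^sub>M borel)" by measurable
    then show ?thesis using expo_race[OF l, of "\<lambda>(x, y). H (min x y, max 0 (x - y))"] by (simp add: borel_prod)
  qed
  moreover have "(\<integral>\<^sup>+v. H (min (y + v) y, max 0 (y + v - y)) \<partial>expo \<sigma>) = (\<integral>\<^sup>+v. H (y, v) \<partial>expo \<sigma>)" for y
    by (rule nn_integral_cong_AE, rule AE_mp[OF AE_expo_pos]) (rule AE_I2, simp)
  moreover have "(\<integral>\<^sup>+w. H (min x (x + w), max 0 (x - (x + w))) \<partial>expo \<tau>) = (\<integral>\<^sup>+w. H (x, 0) \<partial>expo \<tau>)" for x
    by (rule nn_integral_cong_AE, rule AE_mp[OF AE_expo_pos]) (rule AE_I2, simp)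
  ultimately show ?thesis by (simp add: E.emeasure_space_1)
qed

text \<open>Horizontal increments are 0 or 1, and positive queues are geometric with ratio
  \<open>a / b\<close>; ratios multiply under minima, \<open>a / b * b = a\<close>. A positive
  service is always exactly 1, so the excess noise is 0. The slope is the quotient of the
  derivatives of \<open>a / (1 - a)\<close> and \<open>p * a / (1 - p + p * a)\<close>.\<close>

lemma queue_moments_ber:
  assumes pa: "0 < p" "p < 1"
  shows "queue_moments p (\<lambda>_. return borel 1) (\<lambda>a b. geo (a / b)) (\<lambda>_. return borel 0)
    (\<lambda>\<theta>. (1 - p + p * \<theta>)\<^sup>2 / (p * (1 - p) * (1 - \<theta>)\<^sup>2))"
proof (intro queue_moments.intro queue_moments_axioms.intro)
  have r: "prob_space (return borel (x :: real))" for x by (simp add: prob_space_return)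
  have m: "(\<lambda>y. H (x, y)) \<in> borel_measurable borel" if [measurable]: "H \<in> borel_measurable borel" for H :: "real \<times> real \<Rightarrow> ennreal" and x
    by measurable
  show Q: "queue_family p (\<lambda>_. return borel 1) (\<lambda>a b. geo (a / b)) (\<lambda>_. return borel 0)"
  proof (rule queue_family.intro)
    fix a b :: real and H :: "real \<times> real \<Rightarrow> ennreal"
    assume ab: "0 < a" "a < b" and H[measurable]: "H \<in> borel_measurable borel"
    have k: "0 < a / b" "a / b < 1" using ab by auto
    show "(\<integral>\<^sup>+s. (\<integral>\<^sup>+e. H (s, e) \<partial>return borel 1) \<partial>geo (a / b)) =
        ennreal (a / b) * (\<integral>\<^sup>+x. (\<integral>\<^sup>+v. H (x + v, x) \<partial>geo (a / b)) \<partial>return borel 1) +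
        ennreal (1 - a / b) * (\<integral>\<^sup>+x. (\<integral>\<^sup>+w. H (x, x + w) \<partial>return borel 0) \<partial>return borel 1)" if "b \<le> 1"
    proof -
      interpret E: prob_space "geo (a / b)" by (rule prob_space_geo)
      show ?thesis using geo_memoryless[OF k, of "\<lambda>x. H (x, 1)"] by (simp add: nn_integral_return)
    qed
    show "(\<integral>\<^sup>+q. (\<integral>\<^sup>+v. H (min q v, max 0 (q - v)) \<partial>geo (b / 1)) \<partial>geo (a / b)) =
        ennreal (a * (1 - b) / (b * (1 - a))) * (\<integral>\<^sup>+x. (\<integral>\<^sup>+d. H (x, d) \<partial>geo (a / b)) \<partial>geo (a / 1)) +
        ennreal (1 - a * (1 - b) / (b * (1 - a))) * (\<integral>\<^sup>+x. H (x, 0) \<partial>geo (a / 1))" if b1: "b < 1"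
    proof -
      have 1: "a / b * (b / 1) = a / 1" using ab by simp
      have 2: "(1 - b / 1) * (a / b) / (1 - a / 1) = a * (1 - b) / (b * (1 - a))" by simp
      have 3: "(1 - a / b) / (1 - a / 1) = 1 - a * (1 - b) / (b * (1 - a))" using ab b1 by (simp add: field_simps)
      have "0 < b / 1" "b / 1 < 1" using ab b1 by auto
      from geo_min_excess[OF k this H, unfolded 1 2 3] show ?thesis .
    qed
  next
    show "AE x in geo (a / b). 0 < x" for a b unfolding geo_def by (subst AE_distr_iff) auto
    show "AE x in return borel 1. (0 :: real) < x" "AE x in return borel 0. (0 :: real) \<le> x" by (auto simp: AE_return)
  qed (simp_all add: pa less_imp_le r prob_space_geo)
  let ?c = "\<lambda>\<theta>. (1 - p + p * \<theta>)\<^sup>2 / (p * (1 - p) * (1 - \<theta>)\<^sup>2)"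
  have d: "0 < 1 - p + p * a" if "0 < a" for a using that pa by (intro add_pos_pos) auto
  show "integrable (return borel 1) (\<lambda>x :: real. x\<^sup>2)"
  proof -
    interpret R: prob_space "return borel (1 :: real)" by (rule r)
    show ?thesis by (rule R.integrable_const_bound[where B=1]) (auto simp: AE_return)
  qed
  show "continuous_on {0<..<1} ?c" using pa by (intro continuous_intros) auto
  fix a :: real assume a: "0 < a"
  show "?c a < ?c b" if b: "a < b" "b < 1" for b
  proof (rule frac_less)
    show "(1 - p + p * a)\<^sup>2 < (1 - p + p * b)\<^sup>2" using d[OF a] b pa by (intro power_strict_mono) auto
    have "(1 - b)\<^sup>2 \<le> (1 - a)\<^sup>2" using b by (intro power_mono) auto
    then show "p * (1 - p) * (1 - b)\<^sup>2 \<le> p * (1 - p) * (1 - a)\<^sup>2" using pa by (intro mult_left_mono) auto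
    show "0 < p * (1 - p) * (1 - b)\<^sup>2" "0 \<le> (1 - p + p * a)\<^sup>2" using pa b by auto
  qed
  assume a1: "a < 1"
  show "integrable (geo (a / 1)) (\<lambda>x. x\<^sup>2)" using geo_moments(1)[of a] a a1 by simp
  show "0 < ?c a" using d[OF a] a1 pa by simp
  interpret queue_family p "\<lambda>_. return borel 1" "\<lambda>a b. geo (a / b)" "\<lambda>_. return borel 0" by (rule Q)
  let ?g' = "p * (1 - p) / (1 - p + p * a)\<^sup>2"
  have "((\<lambda>a. u a * (\<integral>x. x \<partial>return borel 1)) has_real_derivative ?g') (at a)"
  proof -
    have "((\<lambda>a. p * a / (1 - p + p * a)) has_real_derivative ?g') (at a)"
      using d[OF a] by (auto intro!: derivative_eq_intros simp: power2_eq_square algebra_simps)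
    then show ?thesis by (simp add: u_def integral_return)
  qed
  moreover have "((\<lambda>a. a * (\<integral>x. x \<partial>geo (a / 1))) has_real_derivative ?c a * ?g') (at a)"
  proof -
    have "((\<lambda>a. a / (1 - a)) has_real_derivative ?c a * ?g') (at a)"
      using d[OF a] a1 pa by (auto intro!: derivative_eq_intros simp: power2_eq_square)
    moreover have "a \<in> {0<..<1}" using a a1 by simp
    ultimately show ?thesis
      by (rule has_field_derivative_transform_within_open[OF _ open_greaterThanLessThan]) (simp add: geo_moments)
  qed
  ultimately show "\<exists>g'>0. ((\<lambda>a. u a * (\<integral>x. x \<partial>return borel 1)) has_real_derivative g') (at a) \<and>
    ((\<lambda>a. a * (\<integral>x. x \<partial>geo (a / 1))) has_real_derivative ?c a * g') (at a)"
    using d[OF a] pa by (intro exI[of _ ?g']) auto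
qed

text \<open>The slope is a product of the strictly increasing factors
  \<open>(2 - a) / (1 - a)^2\<close> and \<open>(q + p * a)^2 / (2 * q + p * a)\<close>, up to the
  constant \<open>1 / p\<close>.\<close>

lemma exp_speed_mono:
  fixes q p a b :: real
  assumes "0 \<le> q" "0 < p" "0 < a" "a < b" "b < 1"
  shows "(2 - a) * (q + p * a)\<^sup>2 / ((1 - a)\<^sup>2 * p * (2 * q + p * a)) < (2 - b) * (q + p * b)\<^sup>2 / ((1 - b)\<^sup>2 * p * (2 * q + p * b))"
proof -
  have 1: "(q + p * a)\<^sup>2 / (2 * q + p * a) < (q + p * b)\<^sup>2 / (2 * q + p * b)"
  proof -
    have "p * a < p * b" "0 < p * a" using assms by auto
    moreover define x y where "x = p * a" and "y = p * b"
    ultimately have xy: "x < y" "0 < x" by simp_all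
    have "(q + y)\<^sup>2 * (2 * q + x) - (q + x)\<^sup>2 * (2 * q + y) = (y - x) * (3 * q\<^sup>2 + 2 * q * (x + y) + x * y)"
      by (simp add: power2_eq_square algebra_simps)
    also have "0 < \<dots>" using xy assms by (intro mult_pos_pos add_nonneg_pos) auto
    finally have "(q + x)\<^sup>2 * (2 * q + y) < (q + y)\<^sup>2 * (2 * q + x)" by simp
    then show ?thesis using xy assms unfolding x_def[symmetric] y_def[symmetric] by (simp add: divide_less_eq less_divide_eq mult.commute frac_less_eq)
  qed
  have 2: "(2 - a) / (1 - a)\<^sup>2 < (2 - b) / (1 - b)\<^sup>2"
  proof -
    have e: "(2 - x) / (1 - x)\<^sup>2 = 1 / (1 - x) + 1 / (1 - x)\<^sup>2" if "x < 1" for x :: real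
    proof -
      have "(2 - x) / (1 - x)\<^sup>2 = ((1 - x) + 1) / (1 - x)\<^sup>2" by simp
      also have "\<dots> = (1 - x) / (1 - x)\<^sup>2 + 1 / (1 - x)\<^sup>2" by (rule add_divide_distrib)
      finally show ?thesis using that by (simp add: power2_eq_square)
    qed
    have "1 / (1 - a) < 1 / (1 - b)" using assms by (intro divide_strict_left_mono) auto
    moreover have "1 / (1 - a)\<^sup>2 \<le> 1 / (1 - b)\<^sup>2" using assms by (intro divide_left_mono power_mono) auto
    ultimately show ?thesis using assms by (simp add: e)
  qed
  have "(2 - a) / (1 - a)\<^sup>2 * ((q + p * a)\<^sup>2 / (2 * q + p * a)) < (2 - b) / (1 - b)\<^sup>2 * ((q + p * b)\<^sup>2 / (2 * q + p * b))"
    using 1 2 assms by (intro mult_strict_mono) auto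
  then have "(2 - a) / (1 - a)\<^sup>2 * ((q + p * a)\<^sup>2 / (2 * q + p * a)) / p < (2 - b) / (1 - b)\<^sup>2 * ((q + p * b)\<^sup>2 / (2 * q + p * b)) / p"
    using assms by (intro divide_strict_right_mono)
  then show ?thesis by (simp add: mult_ac)
qed

text \<open>Rates add when clocks race: a queue clock of rate
  \<open>\<alpha> / a - \<alpha> / b\<close> against a service clock of rate
  \<open>\<alpha> / b\<close> gives total rate \<open>\<alpha> / a\<close>. The excess of a service
  is exponential with its own rate. The slope is the quotient of the derivatives of the means
  \<open>a^2 / (\<alpha> * (1 - a))\<close> and \<open>u a * a / \<alpha>\<close>.\<close>

lemma queue_moments_exp:
  assumes p: "0 < p" "p \<le> 1" and \<alpha>: "0 < \<alpha>"
  shows "queue_moments p (\<lambda>a. expo (\<alpha> / a)) (\<lambda>a b. expo (\<alpha> / a - \<alpha> / b)) (\<lambda>b. expo (\<alpha> / b))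
    (\<lambda>\<theta>. (2 - \<theta>) * (1 - p + p * \<theta>)\<^sup>2 / ((1 - \<theta>)\<^sup>2 * p * (2 * (1 - p) + p * \<theta>)))"
proof (intro queue_moments.intro queue_moments_axioms.intro)
  have pos: "0 < \<alpha> / a - \<alpha> / b" if "0 < a" "a < b" for a b
    using that \<alpha> by (simp add: divide_strict_left_mono)
  show Q: "queue_family p (\<lambda>a. expo (\<alpha> / a)) (\<lambda>a b. expo (\<alpha> / a - \<alpha> / b)) (\<lambda>b. expo (\<alpha> / b))"
  proof (rule queue_family.intro)
    fix a b :: real and H :: "real \<times> real \<Rightarrow> ennreal"
    assume ab: "0 < a" "a < b" and H[measurable]: "H \<in> borel_measurable borel"
    show "(\<integral>\<^sup>+s. (\<integral>\<^sup>+e. H (s, e) \<partial>expo (\<alpha> / b)) \<partial>expo (\<alpha> / a - \<alpha> / b)) =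
        ennreal (a / b) * (\<integral>\<^sup>+x. (\<integral>\<^sup>+v. H (x + v, x) \<partial>expo (\<alpha> / a - \<alpha> / b)) \<partial>expo (\<alpha> / a)) +
        ennreal (1 - a / b) * (\<integral>\<^sup>+x. (\<integral>\<^sup>+w. H (x, x + w) \<partial>expo (\<alpha> / b)) \<partial>expo (\<alpha> / a))" if "b \<le> 1"
    proof -
      have 1: "\<alpha> / a - \<alpha> / b + \<alpha> / b = \<alpha> / a" by simp
      have 2: "\<alpha> / b / (\<alpha> / a) = a / b" "(\<alpha> / a - \<alpha> / b) / (\<alpha> / a) = 1 - a / b" using ab \<alpha> by (simp_all add: field_simps)
      have "0 < \<alpha> / b" using ab \<alpha> by simp
      from expo_race[OF pos[OF ab] this H, unfolded 1 2] show ?thesis .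
    qed
    show "(\<integral>\<^sup>+q. (\<integral>\<^sup>+v. H (min q v, max 0 (q - v)) \<partial>expo (\<alpha> / b - \<alpha> / 1)) \<partial>expo (\<alpha> / a - \<alpha> / b)) =
        ennreal (a * (1 - b) / (b * (1 - a))) * (\<integral>\<^sup>+x. (\<integral>\<^sup>+d. H (x, d) \<partial>expo (\<alpha> / a - \<alpha> / b)) \<partial>expo (\<alpha> / a - \<alpha> / 1)) +
        ennreal (1 - a * (1 - b) / (b * (1 - a))) * (\<integral>\<^sup>+x. H (x, 0) \<partial>expo (\<alpha> / a - \<alpha> / 1))" if b1: "b < 1"
    proof -
      have 1: "\<alpha> / a - \<alpha> / b + (\<alpha> / b - \<alpha> / 1) = \<alpha> / a - \<alpha> / 1" by simp
      have f: "\<alpha> / x - \<alpha> / 1 = \<alpha> * (1 - x) / x" if "0 < x" for x using that by (simp add: field_simps)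
      have f2: "\<alpha> / a - \<alpha> / b = \<alpha> * (b - a) / (a * b)" using ab by (simp add: field_simps)
      have "b \<noteq> 0" "1 - a \<noteq> 0" "a \<noteq> 0" "\<alpha> \<noteq> 0" using ab b1 \<alpha> by auto
      then have 2: "(\<alpha> / b - \<alpha> / 1) / (\<alpha> / a - \<alpha> / 1) = a * (1 - b) / (b * (1 - a))"
        "(\<alpha> / a - \<alpha> / b) / (\<alpha> / a - \<alpha> / 1) = 1 - a * (1 - b) / (b * (1 - a))"
        using ab unfolding f2 by (simp_all only: f less_trans[OF ab]) (simp_all add: divide_simps, simp add: algebra_simps)
      show ?thesis by (rule expo_min_excess[OF pos[OF ab] pos[OF less_trans[OF ab] b1] H, unfolded 1 2])
    qed
  next
    show "AE x in expo (\<alpha> / b). 0 \<le> x" for b using AE_expo_pos[of "\<alpha> / b"] by eventually_elim simp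
    show "prob_space (expo (\<alpha> / a - \<alpha> / b))" if "0 < a" "a < b" "b \<le> 1" for a b by (rule prob_space_expo[OF pos[OF that(1,2)]])
  qed (simp_all add: p \<alpha> prob_space_expo AE_expo_pos)
  let ?c = "\<lambda>\<theta>. (2 - \<theta>) * (1 - p + p * \<theta>)\<^sup>2 / ((1 - \<theta>)\<^sup>2 * p * (2 * (1 - p) + p * \<theta>))"
  have d: "0 < 1 - p + p * a" "0 < 2 * (1 - p) + p * a" if "0 < a" for a using that p by (auto intro!: add_nonneg_pos)
  show "continuous_on {0<..<1} ?c"
  proof (intro continuous_intros ballI)
    show "(1 - x)\<^sup>2 * p * (2 * (1 - p) + p * x) \<noteq> 0" if "x \<in> {0<..<1}" for x using d[of x] that p by simp
  qed
  fix a :: real assume a: "0 < a"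
  show "?c a < ?c b" if b: "a < b" "b < 1" for b
    by (rule exp_speed_mono) (use p a b in auto)
  assume a1: "a < 1"
  show "integrable (expo (\<alpha> / a)) (\<lambda>x. x\<^sup>2)" using a \<alpha> by (intro expo_moments) simp
  show "integrable (expo (\<alpha> / a - \<alpha> / 1)) (\<lambda>x. x\<^sup>2)" using pos[OF a a1] by (rule expo_moments)
  show "0 < ?c a" using d[OF a] a1 p by simp
  interpret queue_family p "\<lambda>a. expo (\<alpha> / a)" "\<lambda>a b. expo (\<alpha> / a - \<alpha> / b)" "\<lambda>b. expo (\<alpha> / b)" by (rule Q)
  let ?g' = "p * a * (2 * (1 - p) + p * a) / (\<alpha> * (1 - p + p * a)\<^sup>2)"
  have I: "a \<in> {0<..<1}" using a a1 by simp
  have "((\<lambda>a. u a * (\<integral>x. x \<partial>expo (\<alpha> / a))) has_real_derivative ?g') (at a)"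
  proof (rule has_field_derivative_transform_within_open[OF _ open_greaterThanLessThan I])
    show "((\<lambda>a. p * a / (1 - p + p * a) * (a / \<alpha>)) has_real_derivative ?g') (at a)"
    proof -
      define X where "X = 1 - p + p * a"
      have X: "X \<noteq> 0" using d(1)[OF a] by (simp add: X_def)
      have "((\<lambda>a. p * a / (1 - p + p * a)) has_real_derivative p * (1 - p) / X\<^sup>2) (at a)"
        using d[OF a] unfolding X_def by (auto intro!: derivative_eq_intros simp: power2_eq_square algebra_simps)
      then have "((\<lambda>a. p * a / (1 - p + p * a) * (a / \<alpha>)) has_real_derivative p * (1 - p) / X\<^sup>2 * (a / \<alpha>) + 1 / \<alpha> * (p * a / X)) (at a)"
        unfolding X_def by (rule DERIV_mult) (rule DERIV_cdivide[OF DERIV_ident])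
      also have "p * (1 - p) / X\<^sup>2 * (a / \<alpha>) + 1 / \<alpha> * (p * a / X) = p * a * ((1 - p) + X) / (\<alpha> * X\<^sup>2)"
        using X \<alpha> by (simp add: field_simps power2_eq_square)
      also have "(1 - p) + X = 2 * (1 - p) + p * a" by (simp add: X_def)
      finally show ?thesis by (simp only: X_def)
    qed
    show "p * x / (1 - p + p * x) * (x / \<alpha>) = u x * (\<integral>y. y \<partial>expo (\<alpha> / x))" if "x \<in> {0<..<1}" for x
      using that \<alpha> by (simp add: u_def expo_moments)
  qed
  moreover have "((\<lambda>a. a * (\<integral>x. x \<partial>expo (\<alpha> / a - \<alpha> / 1))) has_real_derivative ?c a * ?g') (at a)"
  proof (rule has_field_derivative_transform_within_open[OF _ open_greaterThanLessThan I])
    have "?c a * ?g' = a * (2 - a) / (\<alpha> * (1 - a)\<^sup>2)" using d[OF a] a1 p \<alpha> by simp (simp only: mult.commute)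
    moreover have "((\<lambda>a. a * (a / (\<alpha> * (1 - a)))) has_real_derivative a * (2 - a) / (\<alpha> * (1 - a)\<^sup>2)) (at a)"
    proof -
      have "((\<lambda>a. a * a / (1 - a)) has_real_derivative a * (2 - a) / (1 - a)\<^sup>2) (at a)"
        using a1 by (auto intro!: derivative_eq_intros simp: power2_eq_square algebra_simps)
      from DERIV_cdivide[OF this, of \<alpha>] show ?thesis by (simp add: mult.commute[of \<alpha>])
    qed
    ultimately show "((\<lambda>a. a * (a / (\<alpha> * (1 - a)))) has_real_derivative ?c a * ?g') (at a)" by simp
    show "x * (x / (\<alpha> * (1 - x))) = x * (\<integral>y. y \<partial>expo (\<alpha> / x - \<alpha> / 1))" if "x \<in> {0<..<1}" for x
    proof -
      have x: "0 < x" "x < 1" using that by auto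
      have "1 / (\<alpha> / x - \<alpha> / 1) = x / (\<alpha> * (1 - x))" using x \<alpha> by (simp add: field_simps)
      then show ?thesis using expo_moments(2)[OF pos[OF x]] by simp
    qed
  qed
  ultimately show "\<exists>g'>0. ((\<lambda>a. u a * (\<integral>x. x \<partial>expo (\<alpha> / a))) has_real_derivative g') (at a) \<and>
    ((\<lambda>a. a * (\<integral>x. x \<partial>expo (\<alpha> / a - \<alpha> / 1))) has_real_derivative ?c a * g') (at a)"
    using d[OF a] p a \<alpha> by (intro exI[of _ ?g']) auto
qed

lemma mix_return: "mix p (return borel 1) = ber_law p"
proof -
  let ?B = "measure_pmf (bernoulli_pmf p)"
  interpret R: prob_space "return borel (1 :: real)" by (simp add: prob_space_return)
  show ?thesis
  proof (rule measure_eqI)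
    fix A assume "A \<in> sets (mix p (return borel 1))"
    then have [measurable]: "A \<in> sets borel" by simp
    have [measurable]: "Measurable.pred ?B (\<lambda>b. b)" by simp
    have "emeasure (mix p (return borel 1)) A = (\<integral>\<^sup>+x. indicator A x \<partial>mix p (return borel 1))" by simp
    also have "\<dots> = (\<integral>\<^sup>+z. indicator A (case z of (b, x) \<Rightarrow> (if b then 1 else 0) * x) \<partial>(?B \<Otimes>\<^sub>M return borel 1))"
      unfolding mix_def by (rule nn_integral_distr) auto
    also have "\<dots> = (\<integral>\<^sup>+b. (\<integral>\<^sup>+x. indicator A ((if b then 1 else 0) * x) \<partial>return borel 1) \<partial>?B)"
      by (subst R.nn_integral_fst[symmetric]) (use mix_measurable in auto)
    also have "\<dots> = (\<integral>\<^sup>+b. indicator A (if b then 1 else 0) \<partial>?B)"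
      by (subst nn_integral_return) auto
    also have "\<dots> = (\<integral>\<^sup>+x. indicator A x \<partial>ber_law p)"
      unfolding ber_law_def by (subst nn_integral_distr) auto
    also have "\<dots> = emeasure (ber_law p) A" by (rule nn_integral_indicator) (simp add: ber_law_def)
    finally show "emeasure (mix p (return borel 1)) A = emeasure (ber_law p) A" .
  qed (simp add: ber_law_def)
qed

theorem theorem2p12:
  fixes M :: "'a measure" and w :: "'a \<Rightarrow> site \<Rightarrow> real" and \<mu> :: "real measure"
    and p \<alpha> :: real
  assumes "prob_space M"
    and "\<And>z. (\<lambda>\<omega>. w \<omega> z) \<in> borel_measurable M"
    and "prob_space.indep_vars M (\<lambda>_. borel) (\<lambda>z \<omega>. w \<omega> z) UNIV"
    and "\<And>z. distr M borel (\<lambda>\<omega>. w \<omega> z) = \<mu>"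
    and "(0 < p \<and> p \<le> 1 \<and> 0 < \<alpha> \<and> \<mu> = ber_exp_law p \<alpha>) \<or> (0 < p \<and> p < 1 \<and> \<mu> = ber_law p)"
  shows "measure (completion M) {\<omega> \<in> space M. crit_angle (w \<omega>) 0 > crit_angle (w \<omega>) e2} = 1/3 \<and>
         measure (completion M) {\<omega> \<in> space M. crit_angle (w \<omega>) 0 = crit_angle (w \<omega>) e2} = 1/6 \<and>
         measure (completion M) {\<omega> \<in> space M. crit_angle (w \<omega>) 0 < crit_angle (w \<omega>) e2} = 1/2"
  using assms(5)
proof (elim disjE conjE)
  assume pa: "0 < p" "p \<le> 1" "0 < \<alpha>" and \<mu>: "\<mu> = ber_exp_law p \<alpha>"
  interpret queue_moments p "\<lambda>a. expo (\<alpha> / a)" "\<lambda>a b. expo (\<alpha> / a - \<alpha> / b)" "\<lambda>b. expo (\<alpha> / b)"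
    "\<lambda>\<theta>. (2 - \<theta>) * (1 - p + p * \<theta>)\<^sup>2 / ((1 - \<theta>)\<^sup>2 * p * (2 * (1 - p) + p * \<theta>))"
    by (rule queue_moments_exp[OF pa])
  \<comment> \<open>At parameter 1 the stationary horizontal law is the weight law itself, since
    \<open>u 1 = p\<close> and the rate is \<alpha>.\<close>
  have "\<nu> 1 = \<mu>" unfolding \<nu>_def u_1 \<mu> by (simp add: mix_def expo_def ber_exp_law_def)
  then interpret swfpp p "\<lambda>a. expo (\<alpha> / a)" "\<lambda>a b. expo (\<alpha> / a - \<alpha> / b)" "\<lambda>b. expo (\<alpha> / b)"
    "\<lambda>\<theta>. (2 - \<theta>) * (1 - p + p * \<theta>)\<^sup>2 / ((1 - \<theta>)\<^sup>2 * p * (2 * (1 - p) + p * \<theta>))" M w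
    by (intro swfpp.intro[OF queue_moments_exp[OF pa]] swfpp_axioms.intro assms(1,3)) (simp only: assms(4) \<open>\<nu> 1 = \<mu>\<close>)
  show ?thesis by (rule critical_angle_probabilities)
next
  assume pa: "0 < p" "p < 1" and \<mu>: "\<mu> = ber_law p"
  interpret queue_moments p "\<lambda>_. return borel 1" "\<lambda>a b. geo (a / b)" "\<lambda>_. return borel 0"
    "\<lambda>\<theta>. (1 - p + p * \<theta>)\<^sup>2 / (p * (1 - p) * (1 - \<theta>)\<^sup>2)"
    by (rule queue_moments_ber[OF pa])
  have "\<nu> 1 = \<mu>" unfolding \<nu>_def u_1 \<mu> by (rule mix_return)
  then interpret swfpp p "\<lambda>_. return borel 1" "\<lambda>a b. geo (a / b)" "\<lambda>_. return borel 0"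
    "\<lambda>\<theta>. (1 - p + p * \<theta>)\<^sup>2 / (p * (1 - p) * (1 - \<theta>)\<^sup>2)" M w
    by (intro swfpp.intro[OF queue_moments_ber[OF pa]] swfpp_axioms.intro assms(1,3)) (simp only: assms(4) \<open>\<nu> 1 = \<mu>\<close>)
  show ?thesis by (rule critical_angle_probabilities)
qed

end
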